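(* Let $a,b,c\in\mathbb{R}$ and $1\le p<r\le q<\infty$. Then $W^{1,(q,p)}_{\{a,b\}}(\mathbb{R}^N_* )$ is continuously embedded into $L^r(\mathbb{R}^N;|x|^cdx)$ (and hence into $W^{1,(r,p)}_{\{c,b\}}(\mathbb{R}^N_* )$) in each of the following cases: (i) $a$ and $b-p$ are on the same side of $-N$ (including $-N$), $\frac{a+N}q\ne\frac{b-p+N}p$, $c$ lies in the open interval with endpoints $c^0$ and $c^1$, and $\theta_c\left(\frac1p-\frac1N-\frac1q\right)\le\frac1r-\frac1q$; (ii) $a$ and $b-p$ are strictly on opposite sides of $-N$, $c$ lies in the open interval with endpoints $c^0$ and $-N$, and $\theta_c\left(\frac1p-\frac1N-\frac1q\right)\le\frac1r-\frac1q$; (iii) $r=q$ and $c=a$; (iv) $r\le p^*$, either ($a\le-N$ and $b-p<-N$) or ($a\ge-N$ and $b-p>-N$), and $c=c^1$; (v) $\frac{a+N}q=\frac{b-p+N}p\ne0$ and $c=c^1$.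
   Context: $N\ge1$, $\mathbb{R}^N_*:=\mathbb{R}^N\setminus\{0\}$. For $d\in\mathbb{R}$, $0<s<\infty$, $\|u\|_{d,s}:=(\int_{\mathbb{R}^N}|x|^d|u|^s dx)^{1/s}$ ($\{0\}$ of measure $0$; Euclidean norm for vector-valued $u$), $L^s(\mathbb{R}^N;|x|^ddx)$ the measurable $u$ with $\|u\|_{d,s}<\infty$. $W^{1,(q,p)}_{\{a,b\}}(\mathbb{R}^N_* )$ is the set of $u\in L^1_{loc}(\mathbb{R}^N_* )$ with $\|u\|_{a,q},\|\nabla u\|_{b,p}<\infty$ (distributional gradient on $\mathbb{R}^N_*$), normed by $\|u\|_{a,q}+\|\nabla u\|_{b,p}$. $p^*:=\infty$ if $p\ge N$, $Np/(N-p)$ if $p<N$. $c^0:=\frac{r(a+N)}{q}-N$, $c^1:=\frac{r(b-p+N)}{p}-N$, $\theta_c:=\frac{c-c^0}{c^1-c^0}$ when $c^0\ne c^1$. *)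

theory Defs
  imports "HOL-Analysis.Analysis"
begin

fun Ck :: "nat \<Rightarrow> ('a::euclidean_space \<Rightarrow> real) set" where
  "Ck 0 = {f. continuous_on UNIV f}"
| "Ck (Suc k) = {f. (\<forall>x. f differentiable (at x)) \<and>
                    (\<forall>v. (\<lambda>x. frechet_derivative f (at x) v) \<in> Ck k)}"

definition smooth_fun :: "('a::euclidean_space \<Rightarrow> real) \<Rightarrow> bool" where
  "smooth_fun f \<longleftrightarrow> (\<forall>k. f \<in> Ck k)"

definition tsupport :: "('a::euclidean_space \<Rightarrow> real) \<Rightarrow> 'a set" where
  "tsupport f = closure {x. f x \<noteq> 0}"

definition test_fun :: "('a::euclidean_space \<Rightarrow> real) \<Rightarrow> bool" where
  "test_fun \<phi> \<longleftrightarrow> smooth_fun \<phi> \<and> compact (tsupport \<phi>) \<and> 0 \<notin> tsupport \<phi>"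

definition loc_int_punct :: "('a::euclidean_space \<Rightarrow> 'b::euclidean_space) \<Rightarrow> bool" where
  "loc_int_punct u \<longleftrightarrow> u \<in> borel_measurable lebesgue \<and>
     (\<forall>K. compact K \<and> 0 \<notin> K \<longrightarrow> set_integrable lebesgue K u)"

definition weak_grad :: "('a::euclidean_space \<Rightarrow> real) \<Rightarrow> ('a \<Rightarrow> 'a) \<Rightarrow> bool" where
  "weak_grad u g \<longleftrightarrow> loc_int_punct u \<and> loc_int_punct g \<and>
     (\<forall>\<phi>. test_fun \<phi> \<longrightarrow> (\<forall>i\<in>Basis.
        (\<integral>x. u x * frechet_derivative \<phi> (at x) i \<partial>lebesgue)
          = - (\<integral>x. (g x \<bullet> i) * \<phi> x \<partial>lebesgue)))"

definition wint :: "real \<Rightarrow> real \<Rightarrow> ('a::euclidean_space \<Rightarrow> 'b::real_normed_vector) \<Rightarrow> ennreal" where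
  "wint d s f = (\<integral>\<^sup>+ x. ennreal (norm x powr d * norm (f x) powr s) \<partial>lebesgue)"

definition wnorm :: "real \<Rightarrow> real \<Rightarrow> ('a::euclidean_space \<Rightarrow> 'b::real_normed_vector) \<Rightarrow> real" where
  "wnorm d s f = enn2real (wint d s f) powr (1 / s)"

definition in_W :: "real \<Rightarrow> real \<Rightarrow> real \<Rightarrow> real \<Rightarrow> ('a::euclidean_space \<Rightarrow> real) \<Rightarrow> ('a \<Rightarrow> 'a) \<Rightarrow> bool" where
  "in_W a b q p u g \<longleftrightarrow> loc_int_punct u \<and> weak_grad u g \<and>
     wint a q u < \<infinity> \<and> wint b p g < \<infinity>"

end

theory Submission
  imports Defs "HOL-Probability.Probability"
begin

text \<open>Write \<open>A = (a + N) / q\<close>, \<open>B = (b - p + N) / p\<close> and \<open>G = (c + N) / r\<close>, and cover the punctured space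
by boxes \<open>Q k\<close> of size comparable to \<open>2 powr k\<close> at distance comparable to \<open>2 powr k\<close> from the origin, one family for each
of the directions \<open>\<plusminus>i\<close> with \<open>i\<close> a basis vector. On a box, the Loomis--Whitney inequality gives a scale-invariant
Sobolev--Poincare inequality, and Hoelder interpolation between \<open>L\<^sup>q\<close> and an \<open>L\<^sup>s\<close> with \<open>1 / p - 1 / s \<le> 1 / N\<close> bounds
the \<open>L\<^sup>r\<close> norm of \<open>u\<close> minus its mean. The means of neighbouring boxes differ by at most the local gradient
norm. Weak derivatives enter only through mollification at a positive distance from the origin.

What remains concerns sequences indexed by the integers: the local norms \<open>\<alpha> k\<close> of \<open>u\<close>, \<open>\<beta> k\<close> of its gradient and
\<open>\<gamma> k\<close> of \<open>u\<close> in the target space, and the means \<open>m k\<close>, where \<open>\<Sum>k. \<alpha> k powr q \<le> 1\<close> and \<open>\<Sum>k. \<beta> k powr p \<le> 1\<close>.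
By reflection one may assume \<open>G < A\<close>, or \<open>G = B\<close> with \<open>B < 0\<close>. For \<open>k \<ge> 0\<close> Hoelder bounds \<open>\<gamma> k\<close> by
\<open>2 powr (k * (G - A)) * \<alpha> k\<close>, a geometric decay. For \<open>k < 0\<close> the oscillation is at most
\<open>\<alpha> k powr (1 - \<theta>') * \<beta> k powr \<theta>'\<close>, whose \<open>r\<close>-th powers are summable once
\<open>\<theta>' \<ge> (1 / r - 1 / q) / (1 / p - 1 / q)\<close>; since \<open>\<theta>\<close> itself may be smaller, it is first raised to this value. The mean
contributes \<open>2 powr (k * G) * m k\<close>, which decays geometrically as \<open>m\<close> grows at most like \<open>2 powr (- k * B)\<close>. If
\<open>G = B\<close> there is no decay, but \<open>M k = 2 powr (k * B) * m k\<close> satisfies the contractive recursion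
\<open>M (k + 1) \<le> 2 powr B * M k + K * \<beta> k\<close>, so \<open>M\<close> inherits summability from \<open>\<beta>\<close>.\<close>

section \<open>Inequalities for two-sided sequences\<close>

text \<open>Two obstacles shape the argument. A larger \<open>\<theta>\<close> restores summability
  over the scales, but it moves the interpolated exponent from \<open>G\<close> towards
  \<open>B\<close>. The resulting factor \<open>2 powr (k * (G - G'))\<close> is harmless only on
  one side of \<open>k = 0\<close>. The second obstacle is that constants have no gradient, so the
  means must be controlled through the \<open>L^q\<close> norm; this is the origin of the conditions
  relative to \<open>-N\<close>. Up to reflection, if \<open>A <= 0\<close> that norm forces the
  means to tend to 0 towards the origin, and they are then bounded by the gradient alone. If
  \<open>G > 0\<close>, constants are integrable near the origin with weight \<open>|x|^c\<close>,
  and comparison with the mean at scale one is enough. Hence \<open>-N\<close> replaces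
  \<open>c1\<close> as an endpoint in case (ii). Boxes are used instead of annuli because
  Loomis--Whitney needs a product measure, the Poincare argument needs convexity, and the punctured
  line is disconnected, so scales can be linked only within one direction.\<close>

lemma powr_add_le:
  fixes x y r :: real
  assumes "0 \<le> x" "0 \<le> y" "0 \<le> r"
  shows "(x + y) powr r \<le> 2 powr r * (x powr r + y powr r)"
proof -
  have "(x + y) powr r \<le> (2 * max x y) powr r"
    using assms by (intro powr_mono2) auto
  also have "\<dots> = 2 powr r * max x y powr r"
    using assms by (simp add: powr_mult)
  also have "\<dots> \<le> 2 powr r * (x powr r + y powr r)"
    by (intro mult_left_mono) (auto simp: max_def)
  finally show ?thesis .
qed

lemma sum_powr2_nonneg_le:
  fixes x :: real and F :: "int set"
  assumes "x < 0" "finite F" "F \<subseteq> {0..}"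
  shows "(\<Sum>k\<in>F. 2 powr (of_int k * x)) \<le> 1 / (1 - 2 powr x)"
proof -
  have y: "0 \<le> 2 powr x" "2 powr x < 1"
    using assms(1) powr_less_mono[of x 0 2] by auto
  have inj: "inj_on nat F" using assms(3) by (intro inj_onI) (metis atLeast_iff nat_eq_iff subsetD int_nat_eq)
  have "(\<Sum>k\<in>F. 2 powr (of_int k * x)) = (\<Sum>i\<in>nat ` F. (2 powr x) ^ i)"
    unfolding sum.reindex[OF inj]
  proof (intro sum.cong refl)
    fix k assume "k \<in> F"
    then have "k \<ge> 0" using assms(3) by auto
    then have "real (nat k) = of_int k" by simp
    then show "2 powr (real_of_int k * x) = ((^) (2 powr x) \<circ> nat) k"
      by (simp add: powr_power mult.commute)
  qed
  also have "\<dots> \<le> (\<Sum>i. (2 powr x) ^ i)"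
    using y assms(2) by (intro sum_le_suminf summable_geometric) auto
  also have "\<dots> = 1 / (1 - 2 powr x)"
    using y by (intro suminf_geometric) auto
  finally show ?thesis .
qed

lemma sum_powr2_nonpos_le:
  fixes x :: real and F :: "int set"
  assumes "x > 0" "finite F" "F \<subseteq> {..0}"
  shows "(\<Sum>k\<in>F. 2 powr (of_int k * x)) \<le> 1 / (1 - 2 powr (-x))"
proof -
  have "(\<Sum>k\<in>F. 2 powr (of_int k * x)) = (\<Sum>k\<in>uminus ` F. 2 powr (of_int k * (-x)))"
    by (subst sum.reindex) (auto simp: o_def)
  also have "\<dots> \<le> 1 / (1 - 2 powr (-x))"
    using assms by (intro sum_powr2_nonneg_le) auto
  finally show ?thesis .
qed

text \<open>With \<open>a = \<alpha> powr q\<close> and \<open>b = \<beta> powr p\<close> the left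
  side is \<open>a powr l * b powr n\<close> where \<open>l + n >= 1\<close>. Both bases are at most
  1, so it is at most \<open>max a b\<close>. Thus the products are summable as soon as
  \<open>a\<close> and \<open>b\<close> are, without Hoelder's inequality for sums.\<close>

lemma powr_interp_le_add:
  fixes \<alpha> \<beta> :: real
  assumes "0 < \<alpha>" "\<alpha> \<le> 1" "0 < \<beta>" "\<beta> \<le> 1" "0 < p" "0 < q" "0 \<le> \<theta>" "\<theta> \<le> 1" "0 < r"
    and le: "1 / r \<le> (1 - \<theta>) / q + \<theta> / p"
  shows "(\<alpha> powr (1 - \<theta>) * \<beta> powr \<theta>) powr r \<le> \<alpha> powr q + \<beta> powr p"
proof -
  define a b where "a = \<alpha> powr q" and "b = \<beta> powr p"
  define l n where "l = r * (1 - \<theta>) / q" and "n = r * \<theta> / p"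
  have ln: "0 \<le> l" "0 \<le> n" using assms by (auto simp: l_def n_def)
  have "1 = r * (1 / r)" using assms by simp
  also have "\<dots> \<le> r * ((1 - \<theta>) / q + \<theta> / p)" using assms by (intro mult_left_mono) auto
  finally have sum: "1 \<le> l + n" by (simp add: l_def n_def algebra_simps)
  have ab: "0 < a" "a \<le> 1" "0 < b" "b \<le> 1"
    using assms by (auto simp: a_def b_def powr_le1)
  have "(\<alpha> powr (1 - \<theta>) * \<beta> powr \<theta>) powr r = a powr l * b powr n"
    using assms by (simp add: a_def b_def l_def n_def powr_mult powr_powr mult.commute)
  also have "\<dots> \<le> max a b powr l * max a b powr n"
    using ab ln by (intro mult_mono powr_mono2) auto
  also have "\<dots> = max a b powr (l + n)" by (simp add: powr_add)
  also have "\<dots> \<le> max a b powr 1" using ab sum by (intro powr_mono') auto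
  also have "\<dots> \<le> a + b" using ab by auto
  finally show ?thesis by (simp add: a_def b_def)
qed

text \<open>\<^term>\<open>\<delta>\<close> is separate from \<^term>\<open>\<beta>\<close> because the reflection \<open>k \<mapsto> - k\<close> shifts it by one index.\<close>

definition dyadic_data ::
  "real \<Rightarrow> real \<Rightarrow> real \<Rightarrow> real \<Rightarrow> real \<Rightarrow> (int \<Rightarrow> real) \<Rightarrow> (int \<Rightarrow> real) \<Rightarrow> (int \<Rightarrow> real) \<Rightarrow> (int \<Rightarrow> real) \<Rightarrow> bool" where
  "dyadic_data p q A B C \<alpha> \<beta> \<delta> m \<longleftrightarrow>
     (\<forall>k. 0 < \<alpha> k) \<and> (\<forall>k. 0 < \<beta> k) \<and> (\<forall>k. 0 \<le> \<delta> k) \<and> (\<forall>k. 0 \<le> m k) \<and>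
     (\<forall>F. finite F \<longrightarrow> (\<Sum>k\<in>F. \<alpha> k powr q) \<le> 1) \<and>
     (\<forall>F. finite F \<longrightarrow> (\<Sum>k\<in>F. \<beta> k powr p) \<le> 1) \<and>
     (\<forall>F. finite F \<longrightarrow> (\<Sum>k\<in>F. \<delta> k powr p) \<le> 1) \<and>
     (\<forall>k. \<bar>m (k + 1) - m k\<bar> \<le> C * 2 powr (- (of_int k * B)) * \<delta> k) \<and>
     (\<forall>k. 2 powr (of_int k * A) * m k \<le> C * \<alpha> k)"

lemma le1_of_sum_powr:
  fixes \<alpha> :: "int \<Rightarrow> real"
  assumes "\<forall>F. finite F \<longrightarrow> (\<Sum>k\<in>F. \<alpha> k powr q) \<le> 1" "0 < q" "0 \<le> \<alpha> k"
  shows "\<alpha> k \<le> 1"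
proof (rule ccontr)
  assume "\<not> ?thesis"
  then have "1 < \<alpha> k powr q" using assms powr_less_mono2[of q 1 "\<alpha> k"] by simp
  moreover have "\<alpha> k powr q \<le> 1" using assms(1)[rule_format, of "{k}"] by simp
  ultimately show False by simp
qed

lemma tendsto0_of_sum_powr:
  fixes \<alpha> :: "int \<Rightarrow> real"
  assumes "\<forall>F. finite F \<longrightarrow> (\<Sum>k\<in>F. \<alpha> k powr q) \<le> 1" "0 < q" "\<And>k. 0 \<le> \<alpha> k"
  shows "(\<lambda>n. \<alpha> (k - int n)) \<longlonglongrightarrow> 0"
proof -
  have "summable (\<lambda>n. \<alpha> (k - int n) powr q)"
  proof (rule summableI_nonneg_bounded)
    fix n
    have "(\<Sum>i<n. \<alpha> (k - int i) powr q) = (\<Sum>j\<in>(\<lambda>i. k - int i) ` {..<n}. \<alpha> j powr q)"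
      by (subst sum.reindex) (auto simp: inj_on_def)
    also have "\<dots> \<le> 1" using assms(1) by auto
    finally show "(\<Sum>i<n. \<alpha> (k - int i) powr q) \<le> 1" .
  qed auto
  then have "(\<lambda>n. \<alpha> (k - int n) powr q) \<longlonglongrightarrow> 0" by (rule summable_LIMSEQ_zero)
  then have "(\<lambda>n. (\<alpha> (k - int n) powr q) powr (1 / q)) \<longlonglongrightarrow> 0 powr (1 / q)"
    using assms(2) by (intro tendsto_powr') auto
  then show ?thesis using assms by (simp add: powr_powr)
qed

text \<open>The limit of \<^term>\<open>m\<close> at \<open>-\<infinity>\<close> vanishes because \<^prop>\<open>A \<le> 0\<close>, so \<^term>\<open>m k\<close> is bounded by the
  total variation to the left of \<^term>\<open>k\<close>.\<close>

lemma dyadic_mean_decay: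
  assumes H: "dyadic_data p q A B C \<alpha> \<beta> \<delta> m" and "0 < p" "0 < q" "A \<le> 0" "B < 0" "0 \<le> C"
  shows "m k \<le> C / (2 powr (-B) - 1) * 2 powr (- (of_int k * B))"
proof -
  \<comment> \<open>Chosen so that \<open>C * 2 powr (- (j * B))\<close> is \<open>K\<close> times
    the difference of the powers at \<open>j + 1\<close> and at \<open>j\<close>; the increments of
    \<open>m\<close> then telescope.\<close>
  define K where "K = C / (2 powr (-B) - 1)"
  have "2 powr (-B) > 1" using assms by simp
  then have K: "K * (2 powr (-B) - 1) = C" "0 \<le> K"
    using assms unfolding K_def by (simp, intro divide_nonneg_nonneg) (auto intro!: ge_one_powr_ge_zero)
  have pos: "0 \<le> \<delta> k" "0 < \<alpha> k" "0 \<le> m k" for k using H by (auto simp: dyadic_data_def)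
  have d1: "\<delta> k \<le> 1" for k
    using H assms by (intro le1_of_sum_powr[of \<delta> p]) (auto simp: dyadic_data_def)
  have step: "m (j + 1) \<le> m j + K * (2 powr (- (of_int (j+1) * B)) - 2 powr (- (of_int j * B)))" for j
  proof -
    have "m (j + 1) - m j \<le> C * 2 powr (- (of_int j * B)) * \<delta> j"
      using H by (auto simp: dyadic_data_def abs_le_iff)
    also have "\<dots> \<le> C * 2 powr (- (of_int j * B)) * 1"
      using assms d1 by (intro mult_left_mono) auto
    also have "\<dots> = K * (2 powr (-B) - 1) * 2 powr (- (of_int j * B))" using K by simp
    also have "\<dots> = K * (2 powr (- (of_int (j+1) * B)) - 2 powr (- (of_int j * B)))"
      by (simp add: algebra_simps flip: powr_add)
    finally show ?thesis by simp
  qed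
  have tele: "m k \<le> m (k - int n) + K * (2 powr (- (of_int k * B)) - 2 powr (- (of_int (k - int n) * B)))" for n
  proof (induction n)
    case (Suc n)
    have "k - int n = (k - int (Suc n)) + 1" by simp
    then have "m (k - int n) \<le> m (k - int (Suc n)) + K * (2 powr (- (of_int (k - int n) * B)) - 2 powr (- (of_int (k - int (Suc n)) * B)))"
      using step[of "k - int (Suc n)"] by simp
    then show ?case using Suc by (simp add: right_diff_distrib)
  qed simp
  have le: "m k \<le> C * \<alpha> (k - int n) + K * 2 powr (- (of_int k * B))" if "int n \<ge> k" for n
  proof -
    let ?j = "k - int n"
    have "of_int ?j * A \<ge> 0" using that assms by (intro mult_nonpos_nonpos) auto
    then have "1 \<le> 2 powr (of_int ?j * A)" by (intro ge_one_powr_ge_zero) auto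
    then have "m ?j \<le> 2 powr (of_int ?j * A) * m ?j"
      using pos(3)[of ?j] mult_right_mono[of 1 _ "m ?j"] by simp
    also have "\<dots> \<le> C * \<alpha> ?j" using H unfolding dyadic_data_def by blast
    finally have "m ?j \<le> C * \<alpha> ?j" .
    moreover have "K * (2 powr (- (of_int k * B)) - 2 powr (- (of_int ?j * B))) \<le> K * 2 powr (- (of_int k * B))"
      using K by (intro mult_left_mono) auto
    ultimately show ?thesis using tele[of n] by linarith
  qed
  have "(\<lambda>n. \<alpha> (k - int n)) \<longlonglongrightarrow> 0"
    using H assms pos by (intro tendsto0_of_sum_powr[of \<alpha> q]) (auto simp: dyadic_data_def less_imp_le)
  then have "(\<lambda>n. C * \<alpha> (k - int n) + K * 2 powr (- (of_int k * B))) \<longlonglongrightarrow> C * 0 + K * 2 powr (- (of_int k * B))"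
    by (intro tendsto_intros)
  moreover have "eventually (\<lambda>n. m k \<le> C * \<alpha> (k - int n) + K * 2 powr (- (of_int k * B))) sequentially"
    using le by (intro eventually_sequentiallyI[of "nat k"]) auto
  ultimately have "m k \<le> C * 0 + K * 2 powr (- (of_int k * B))"
    by (intro tendsto_lowerbound[of _ _ sequentially "m k"]) auto
  then show ?thesis by (simp add: K_def)
qed

text \<open>If \<open>A > 0\<close>, the means need not vanish at \<open>-\<infinity>\<close>, so
  they are compared with \<open>m 0\<close>, which is at most \<open>C\<close>. Going left from 0
  the increments grow at most like \<open>2 powr (n * B')\<close>; a positive \<open>B' >= B\<close>
  makes their sum geometric, hence comparable to its last term.\<close>

lemma dyadic_mean_growth:
  assumes H: "dyadic_data p q A B C \<alpha> \<beta> \<delta> m" and "0 < p" "0 < q" "0 < B'" "B \<le> B'" "0 \<le> C"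
  shows "m (- int n) \<le> C * (1 + 1 / (1 - 2 powr (-B'))) * 2 powr (real n * B')"
proof -
  define K where "K = C * (1 + 1 / (1 - 2 powr (-B')))"
  have B1: "2 powr (-B') < 1" using assms powr_less_mono[of "-B'" 0 2] by simp
  have K: "C \<le> K" "C \<le> K * (1 - 2 powr (-B'))" "0 \<le> K"
  proof -
    define y where "y = 2 powr (-B')"
    have y: "0 < y" "y < 1" using B1 by (auto simp: y_def)
    have K': "K = C + C / (1 - y)" by (simp add: K_def y_def distrib_left)
    have c: "0 \<le> C / (1 - y)" using y assms by (intro divide_nonneg_nonneg) auto
    show "C \<le> K" "0 \<le> K" using K' c assms by auto
    have "K * (1 - y) = C * (1 - y) + C" using y by (simp add: K' distrib_right)
    moreover have "0 \<le> C * (1 - y)" using y assms by auto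
    ultimately show "C \<le> K * (1 - 2 powr (-B'))" by (simp add: y_def)
  qed
  have pos: "0 \<le> \<delta> k" "0 < \<alpha> k" "0 \<le> m k" for k using H by (auto simp: dyadic_data_def)
  have d1: "\<delta> k \<le> 1" "\<alpha> k \<le> 1" for k
    using H assms pos
    by (auto intro!: le1_of_sum_powr[of \<delta> p] le1_of_sum_powr[of \<alpha> q] simp: dyadic_data_def less_imp_le)
  have "m (- int n) \<le> K * 2 powr (real n * B')"
  proof (induction n)
    case 0
    have "m 0 \<le> C * \<alpha> 0" using H unfolding dyadic_data_def by (metis mult_zero_left of_int_0 powr_zero_eq_one mult_1 zero_neq_numeral)
    also have "\<dots> \<le> C * 1" using d1 assms by (intro mult_left_mono) auto
    finally show ?case using K by simp
  next
    case (Suc n)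
    let ?j = "- int (Suc n)"
    have "\<bar>m (?j + 1) - m ?j\<bar> \<le> C * 2 powr (- (of_int ?j * B)) * \<delta> ?j"
      using H unfolding dyadic_data_def by blast
    then have "m ?j \<le> m (- int n) + C * 2 powr (- (of_int ?j * B)) * \<delta> ?j"
      by (simp add: abs_le_iff)
    also have "C * 2 powr (- (of_int ?j * B)) * \<delta> ?j \<le> C * 2 powr (real (Suc n) * B') * 1"
    proof (intro mult_mono powr_mono)
      have "- (of_int ?j * B) = real (Suc n) * B" by (simp add: algebra_simps)
      also have "\<dots> \<le> real (Suc n) * B'" using assms by (intro mult_left_mono) auto
      finally show "- (of_int ?j * B) \<le> real (Suc n) * B'" .
    qed (use assms d1 pos in auto)
    also have "\<dots> \<le> K * (1 - 2 powr (-B')) * 2 powr (real (Suc n) * B')"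
      using K by (simp add: mult_right_mono)
    also have "\<dots> = K * 2 powr (real (Suc n) * B') - K * 2 powr (real n * B')"
      by (simp add: algebra_simps flip: powr_add)
    finally show ?case using Suc by simp
  qed
  then show ?thesis by (simp add: K_def)
qed

text \<open>\<open>B'\<close> is a growth exponent of the means for negative indices. It is kept
  separate from \<open>B\<close> because the two ways of controlling the means supply different
  exponents. The quantifier order matters: \<open>S\<close> depends on the parameters alone and
  becomes the embedding constant.\<close>

lemma dyadic_sum_split:
  assumes "0 < p" "0 < q" "0 < r" "0 \<le> \<theta>" "\<theta> \<le> 1" "1 / r \<le> (1 - \<theta>) / q + \<theta> / p" "0 \<le> C" "0 \<le> K"
    and "G < A" "B' < G" "G' \<le> G"
  shows "\<exists>S. \<forall>\<alpha> \<beta> \<delta> m \<gamma>. dyadic_data p q A B C \<alpha> \<beta> \<delta> m \<longrightarrow>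
     (\<forall>k. 0 \<le> \<gamma> k) \<longrightarrow>
     (\<forall>k. \<gamma> k \<le> C * (2 powr (of_int k * (G - G')) * (\<alpha> k powr (1 - \<theta>) * \<beta> k powr \<theta>) + 2 powr (of_int k * G) * m k)) \<longrightarrow>
     (\<forall>k. \<gamma> k \<le> C * 2 powr (of_int k * (G - A)) * \<alpha> k) \<longrightarrow>
     (\<forall>k\<le>0. m k \<le> K * 2 powr (- (of_int k * B'))) \<longrightarrow>
     (\<forall>F. finite F \<longrightarrow> (\<Sum>k\<in>F. \<gamma> k powr r) \<le> S)"
proof -
  define S1 where "S1 = C powr r * (1 / (1 - 2 powr (r * (G - A))))"
  \<comment> \<open>The inner \<open>2\<close> bounds the sums of \<open>\<alpha> k powr q\<close>
    and \<open>\<beta> k powr p\<close>, each at most 1; the outer \<open>2 powr r\<close> is the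
    price of separating oscillation and mean.\<close>
  define S2 where "S2 = 2 powr r * (C powr r * 2 + (C * K) powr r * (1 / (1 - 2 powr (- (r * (G - B'))))))"
  show ?thesis
  proof (intro exI[of _ "S1 + S2"] allI impI)
    fix \<alpha> \<beta> \<delta> m \<gamma> and F :: "int set"
    assume H: "dyadic_data p q A B C \<alpha> \<beta> \<delta> m" and g0: "\<forall>k. 0 \<le> \<gamma> k"
      and h1: "\<forall>k. \<gamma> k \<le> C * (2 powr (of_int k * (G - G')) * (\<alpha> k powr (1 - \<theta>) * \<beta> k powr \<theta>) + 2 powr (of_int k * G) * m k)"
      and h4: "\<forall>k. \<gamma> k \<le> C * 2 powr (of_int k * (G - A)) * \<alpha> k"
      and hm: "\<forall>k\<le>0. m k \<le> K * 2 powr (- (of_int k * B'))" and F: "finite F"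
    have pos: "0 < \<alpha> k" "0 < \<beta> k" "0 \<le> m k" for k using H by (auto simp: dyadic_data_def)
    have a1: "\<alpha> k \<le> 1" "\<beta> k \<le> 1" for k
      using H assms pos
      by (auto intro!: le1_of_sum_powr[of \<beta> p] le1_of_sum_powr[of \<alpha> q] simp: dyadic_data_def less_imp_le)
    have 1: "(\<Sum>k\<in>F \<inter> {0..}. \<gamma> k powr r) \<le> S1"
    proof -
      have "(\<Sum>k\<in>F \<inter> {0..}. \<gamma> k powr r) \<le> (\<Sum>k\<in>F \<inter> {0..}. C powr r * 2 powr (of_int k * (r * (G - A))))"
      proof (intro sum_mono)
        fix k
        have "\<gamma> k \<le> C * 2 powr (of_int k * (G - A)) * 1"
          using h4 a1 assms by (meson mult_left_mono order_trans mult_nonneg_nonneg powr_ge_zero)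
        then have "\<gamma> k powr r \<le> (C * 2 powr (of_int k * (G - A))) powr r"
          using g0 assms by (intro powr_mono2) auto
        also have "\<dots> = C powr r * 2 powr (of_int k * (r * (G - A)))"
          using assms by (simp add: powr_mult powr_powr algebra_simps)
        finally show "\<gamma> k powr r \<le> C powr r * 2 powr (of_int k * (r * (G - A)))" .
      qed
      also have "\<dots> \<le> S1" unfolding S1_def sum_distrib_left[symmetric]
        using assms F by (intro mult_left_mono sum_powr2_nonneg_le) (auto simp: mult_pos_neg)
      finally show ?thesis .
    qed
    have 2: "(\<Sum>k\<in>F \<inter> {..<0}. \<gamma> k powr r) \<le> S2"
    proof -
      have "(\<Sum>k\<in>F \<inter> {..<0}. \<gamma> k powr r) \<le> (\<Sum>k\<in>F \<inter> {..<0}.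
         2 powr r * (C powr r * (\<alpha> k powr q + \<beta> k powr p) + (C * K) powr r * 2 powr (of_int k * (r * (G - B')))))"
      proof (intro sum_mono)
        fix k assume k: "k \<in> F \<inter> {..<0}"
        let ?x = "\<alpha> k powr (1 - \<theta>) * \<beta> k powr \<theta>"
        have "of_int k * (G - G') \<le> 0" using k assms by (intro mult_nonpos_nonneg) auto
        then have "2 powr (of_int k * (G - G')) \<le> 2 powr 0" by (intro powr_mono) auto
        then have t1: "2 powr (of_int k * (G - G')) * ?x \<le> 1 * ?x" by (intro mult_right_mono) auto
        have "2 powr (of_int k * G) * m k \<le> 2 powr (of_int k * G) * (K * 2 powr (- (of_int k * B')))"
          using hm k by (intro mult_left_mono) auto
        also have "\<dots> = K * 2 powr (of_int k * (G - B'))"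
          by (simp add: right_diff_distrib powr_diff powr_minus_divide)
        finally have t2: "2 powr (of_int k * G) * m k \<le> K * 2 powr (of_int k * (G - B'))" .
        have "\<gamma> k \<le> C * (2 powr (of_int k * (G - G')) * ?x + 2 powr (of_int k * G) * m k)"
          using h1 by blast
        also have "\<dots> \<le> C * (?x + K * 2 powr (of_int k * (G - B')))"
          using t1 t2 assms by (intro mult_left_mono) auto
        finally have "\<gamma> k powr r \<le> (C * ?x + C * K * 2 powr (of_int k * (G - B'))) powr r"
          using g0 assms by (intro powr_mono2) (auto simp: algebra_simps)
        also have "\<dots> \<le> 2 powr r * ((C * ?x) powr r + (C * K * 2 powr (of_int k * (G - B'))) powr r)"
          using assms by (intro powr_add_le) auto
        also have "(C * ?x) powr r \<le> C powr r * (\<alpha> k powr q + \<beta> k powr p)"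
          using powr_interp_le_add[of "\<alpha> k" "\<beta> k" p q \<theta> r] pos a1 assms
          by (subst powr_mult) (auto intro!: mult_left_mono)
        also have "(C * K * 2 powr (of_int k * (G - B'))) powr r = (C * K) powr r * 2 powr (of_int k * (r * (G - B')))"
          using assms by (simp add: powr_mult powr_powr algebra_simps)
        finally show "\<gamma> k powr r \<le> 2 powr r * (C powr r * (\<alpha> k powr q + \<beta> k powr p) + (C * K) powr r * 2 powr (of_int k * (r * (G - B'))))"
          by simp
      qed
      also have "\<dots> = 2 powr r * (C powr r * ((\<Sum>k\<in>F \<inter> {..<0}. \<alpha> k powr q) + (\<Sum>k\<in>F \<inter> {..<0}. \<beta> k powr p))
           + (C * K) powr r * (\<Sum>k\<in>F \<inter> {..<0}. 2 powr (of_int k * (r * (G - B')))))"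
        by (simp add: sum_distrib_left sum.distrib algebra_simps)
      also have "\<dots> \<le> S2" unfolding S2_def
      proof (intro mult_left_mono add_mono)
        have "(\<Sum>k\<in>F \<inter> {..<0}. \<alpha> k powr q) \<le> 1" "(\<Sum>k\<in>F \<inter> {..<0}. \<beta> k powr p) \<le> 1"
          using H F by (auto simp: dyadic_data_def)
        then show "(\<Sum>k\<in>F \<inter> {..<0}. \<alpha> k powr q) + (\<Sum>k\<in>F \<inter> {..<0}. \<beta> k powr p) \<le> 2" by simp
        show "(\<Sum>k\<in>F \<inter> {..<0}. 2 powr (of_int k * (r * (G - B')))) \<le> 1 / (1 - 2 powr (- (r * (G - B'))))"
          using assms F by (intro sum_powr2_nonpos_le) auto
      qed auto
      finally show ?thesis .
    qed
    have "(\<Sum>k\<in>F. \<gamma> k powr r) = (\<Sum>k\<in>F \<inter> {0..}. \<gamma> k powr r) + (\<Sum>k\<in>F \<inter> {..<0}. \<gamma> k powr r)"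
      using F by (subst sum.union_disjoint[symmetric]) (auto intro!: sum.cong)
    with 1 2 show "(\<Sum>k\<in>F. \<gamma> k powr r) \<le> S1 + S2" by linarith
  qed
qed

text \<open>Convexity is applied at positive points only; if one argument vanishes, the claim
  reduces to \<open>t powr r <= t\<close> for \<open>0 < t < 1\<close>.\<close>

lemma powr_convex_comb:
  fixes x y l r :: real
  assumes "0 \<le> x" "0 \<le> y" "0 < l" "l < 1" "1 \<le> r"
  shows "(l * x + (1 - l) * y) powr r \<le> l * x powr r + (1 - l) * y powr r"
proof -
  have *: "(t * z) powr r \<le> t * z powr r" if "0 < t" "t < 1" "0 \<le> z" for t z
  proof -
    have "t powr r \<le> t powr 1" using that assms by (intro powr_mono') auto
    then show ?thesis using that by (simp add: powr_mult mult_right_mono)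
  qed
  consider "x = 0" | "y = 0" | "0 < x" "0 < y" using assms by linarith
  then show ?thesis
  proof cases
    case 3
    then show ?thesis
      using convex_onD[OF powr_convex[of r], of "1 - l" x y] assms by (simp add: algebra_simps)
  qed (use *[of l x] *[of "1 - l" y] assms in auto)
qed

text \<open>The right side of the recursion is the convex combination of \<open>M k\<close> and
  \<open>C / (1 - l) * \<delta> k\<close> with weights \<open>l\<close> and \<open>1 - l\<close>.
  Convexity therefore keeps the contraction factor \<open>l\<close> for the \<open>r\<close>-th
  powers, and \<open>\<delta> k powr r <= \<delta> k powr p\<close> since
  \<open>\<delta> k <= 1\<close>. Summing over a finite window gives
  \<open>T <= K powr r + l * T + D\<close>, and \<open>l * T\<close> is absorbed because
  \<open>T\<close> is finite.\<close>

lemma dyadic_recursion_sum: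
  fixes M \<delta> :: "int \<Rightarrow> real"
  assumes "0 < l" "l < 1" "1 \<le> p" "p < r" "0 \<le> C" "0 \<le> K"
    and M: "\<And>k. 0 \<le> M k" "\<And>k. M k \<le> K" and \<delta>: "\<And>k. 0 \<le> \<delta> k"
    and rec: "\<And>k. M (k + 1) \<le> l * M k + C * \<delta> k"
    and sum: "\<forall>F. finite F \<longrightarrow> (\<Sum>k\<in>F. \<delta> k powr p) \<le> 1"
    and F: "finite F"
  shows "(\<Sum>k\<in>F. M k powr r) \<le> (K powr r + (1 - l) * (C / (1 - l)) powr r) / (1 - l)"
proof -
  define D where "D = (1 - l) * (C / (1 - l)) powr r"
  have D0: "0 \<le> D" using assms by (auto simp: D_def)
  have d1: "\<delta> k \<le> 1" for k using sum assms by (intro le1_of_sum_powr[of \<delta> p]) auto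
  have cv: "M (k + 1) powr r \<le> l * M k powr r + D * \<delta> k powr p" for k
  proof -
    have "M (k + 1) powr r \<le> (l * M k + (1 - l) * (C / (1 - l) * \<delta> k)) powr r"
      using rec[of k] M assms by (intro powr_mono2) auto
    also have "\<dots> \<le> l * M k powr r + (1 - l) * (C / (1 - l) * \<delta> k) powr r"
      using M \<delta> assms by (intro powr_convex_comb) auto
    also have "(1 - l) * (C / (1 - l) * \<delta> k) powr r = D * \<delta> k powr r"
      using \<delta>[of k] assms(1,2,5) unfolding D_def by (subst powr_mult) auto
    also have "\<dots> \<le> D * \<delta> k powr p"
      using d1[of k] \<delta>[of k] assms D0
      by (intro mult_left_mono powr_mono') auto
    finally show ?thesis by simp
  qed
  obtain n where n: "F \<subseteq> {- int n .. int n}"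
  proof -
    define n where "n = nat (Max (insert 0 (abs ` F)))"
    have "\<bar>k\<bar> \<le> int n" if "k \<in> F" for k
    proof -
      have "\<bar>k\<bar> \<le> Max (insert 0 (abs ` F))" using that F by (intro Max_ge) auto
      moreover have "0 \<le> Max (insert 0 (abs ` F))" using F by (intro Max_ge) auto
      ultimately show ?thesis by (simp add: n_def)
    qed
    then have "F \<subseteq> {- int n .. int n}" by (force simp: abs_le_iff)
    then show ?thesis using that by blast
  qed
  let ?I = "{- int n .. int n}"
  \<comment> \<open>The window without its first index is \<open>?J\<close> shifted by one. The
    first term has no predecessor in the window and is bounded by \<open>K powr r\<close>.\<close>
  let ?J = "{- int n .. int n - 1}"
  define T where "T = (\<Sum>k\<in>?I. M k powr r)"
  have "T = M (- int n) powr r + (\<Sum>k\<in>{- int n + 1 .. int n}. M k powr r)"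
    unfolding T_def by (subst sum.remove[of _ "- int n"]) (auto intro!: sum.cong)
  also have "(\<Sum>k\<in>{- int n + 1 .. int n}. M k powr r) = (\<Sum>k\<in>?J. M (k + 1) powr r)"
    by (rule sum.reindex_bij_witness[of _ "\<lambda>k. k + 1" "\<lambda>k. k - 1"]) auto
  also have "\<dots> \<le> (\<Sum>k\<in>?J. l * M k powr r + D * \<delta> k powr p)" by (intro sum_mono cv)
  also have "\<dots> = l * (\<Sum>k\<in>?J. M k powr r) + D * (\<Sum>k\<in>?J. \<delta> k powr p)"
    by (simp add: sum.distrib sum_distrib_left)
  also have "\<dots> \<le> l * T + D * 1"
    unfolding T_def using assms D0 sum by (intro add_mono mult_left_mono sum_mono2) auto
  also have "M (- int n) powr r \<le> K powr r" using M assms by (intro powr_mono2) auto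
  finally have "(1 - l) * T \<le> K powr r + D" by (simp add: algebra_simps)
  then have "T \<le> (K powr r + D) / (1 - l)" using assms by (simp add: field_simps)
  moreover have "(\<Sum>k\<in>F. M k powr r) \<le> T" unfolding T_def using n by (intro sum_mono2) auto
  ultimately show ?thesis by (simp add: D_def)
qed

text \<open>With \<open>G = G' = B\<close> the interpolation term carries no power of 2 and can be
  summed over all indices at once. The decay estimate for the means yields only that the normalised
  means are bounded; this suffices for the leftmost term of the recursion, and the recursion itself
  provides the summability.\<close>

lemma dyadic_sum_critical:
  assumes "1 \<le> p" "p < r" "r \<le> q" "0 \<le> \<theta>" "\<theta> \<le> 1" "1 / r \<le> (1 - \<theta>) / q + \<theta> / p" "0 \<le> C"
    and "A \<le> 0" "B < 0"
  shows "\<exists>S. \<forall>\<alpha> \<beta> \<delta> m \<gamma>. dyadic_data p q A B C \<alpha> \<beta> \<delta> m \<longrightarrow>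
     (\<forall>k. 0 \<le> \<gamma> k) \<longrightarrow>
     (\<forall>k. \<gamma> k \<le> C * ((\<alpha> k powr (1 - \<theta>) * \<beta> k powr \<theta>) + 2 powr (of_int k * B) * m k)) \<longrightarrow>
     (\<forall>F. finite F \<longrightarrow> (\<Sum>k\<in>F. \<gamma> k powr r) \<le> S)"
proof -
  define l where "l = 2 powr B"
  define K where "K = C / (2 powr (-B) - 1)"
  define S1 where "S1 = (K powr r + (1 - l) * (C * l / (1 - l)) powr r) / (1 - l)"
  have l: "0 < l" "l < 1" using assms powr_less_mono[of B 0 2] by (auto simp: l_def)
  have "2 powr (-B) > 1" using assms by simp
  then have K: "0 \<le> K"
    using assms unfolding K_def by (intro divide_nonneg_nonneg) (auto intro!: ge_one_powr_ge_zero)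
  show ?thesis
  proof (intro exI[of _ "2 powr r * (C powr r * 2 + C powr r * S1)"] allI impI)
    fix \<alpha> \<beta> \<delta> m \<gamma> and F :: "int set"
    assume H: "dyadic_data p q A B C \<alpha> \<beta> \<delta> m" and g0: "\<forall>k. 0 \<le> \<gamma> k"
      and h1: "\<forall>k. \<gamma> k \<le> C * ((\<alpha> k powr (1 - \<theta>) * \<beta> k powr \<theta>) + 2 powr (of_int k * B) * m k)"
      and F: "finite F"
    define M where "M k = 2 powr (of_int k * B) * m k" for k
    have pos: "0 < \<alpha> k" "0 < \<beta> k" "0 \<le> m k" "0 \<le> \<delta> k" for k using H by (auto simp: dyadic_data_def)
    have a1: "\<alpha> k \<le> 1" "\<beta> k \<le> 1" for k
      using H assms pos
      by (auto intro!: le1_of_sum_powr[of \<beta> p] le1_of_sum_powr[of \<alpha> q] simp: dyadic_data_def less_imp_le)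
    have M0: "0 \<le> M k" for k using pos by (simp add: M_def)
    have MK: "M k \<le> K" for k
    proof -
      have "M k \<le> 2 powr (of_int k * B) * (K * 2 powr (- (of_int k * B)))"
        unfolding M_def K_def using assms by (intro mult_left_mono dyadic_mean_decay[OF H]) auto
      then show ?thesis by (simp add: powr_minus_divide)
    qed
    have rec: "M (k + 1) \<le> l * M k + (C * l) * \<delta> k" for k
    proof -
      have "\<bar>m (k + 1) - m k\<bar> \<le> C * 2 powr (- (of_int k * B)) * \<delta> k"
        using H unfolding dyadic_data_def by blast
      then have "m (k + 1) \<le> m k + C * 2 powr (- (of_int k * B)) * \<delta> k" by (simp add: abs_le_iff)
      then have "M (k + 1) \<le> 2 powr (of_int (k + 1) * B) * (m k + C * 2 powr (- (of_int k * B)) * \<delta> k)"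
        unfolding M_def by (intro mult_left_mono) auto
      also have "2 powr (of_int (k + 1) * B) = l * 2 powr (of_int k * B)"
        by (simp add: l_def distrib_right powr_add)
      finally show ?thesis by (simp add: M_def algebra_simps powr_minus_divide)
    qed
    have SM: "(\<Sum>k\<in>F. M k powr r) \<le> S1"
      unfolding S1_def using M0 MK rec l K assms F pos H
      by (intro dyadic_recursion_sum[of l p r "C * l" K M \<delta> F]) (auto simp: dyadic_data_def)
    have "(\<Sum>k\<in>F. \<gamma> k powr r) \<le> (\<Sum>k\<in>F. 2 powr r * (C powr r * (\<alpha> k powr q + \<beta> k powr p) + C powr r * M k powr r))"
    proof (intro sum_mono)
      fix k
      let ?x = "\<alpha> k powr (1 - \<theta>) * \<beta> k powr \<theta>"
      have "\<gamma> k powr r \<le> (C * ?x + C * M k) powr r"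
        using g0 h1 assms by (intro powr_mono2) (auto simp: algebra_simps M_def)
      also have "\<dots> \<le> 2 powr r * ((C * ?x) powr r + (C * M k) powr r)"
        using assms M0 by (intro powr_add_le) auto
      also have "(C * ?x) powr r \<le> C powr r * (\<alpha> k powr q + \<beta> k powr p)"
        using powr_interp_le_add[of "\<alpha> k" "\<beta> k" p q \<theta> r] pos a1 assms
        by (subst powr_mult) (auto intro!: mult_left_mono)
      also have "(C * M k) powr r = C powr r * M k powr r"
        using assms M0 by (simp add: powr_mult)
      finally show "\<gamma> k powr r \<le> 2 powr r * (C powr r * (\<alpha> k powr q + \<beta> k powr p) + C powr r * M k powr r)"
        by simp
    qed
    also have "\<dots> = 2 powr r * (C powr r * ((\<Sum>k\<in>F. \<alpha> k powr q) + (\<Sum>k\<in>F. \<beta> k powr p)) + C powr r * (\<Sum>k\<in>F. M k powr r))"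
      by (simp add: sum_distrib_left sum.distrib algebra_simps)
    also have "\<dots> \<le> 2 powr r * (C powr r * 2 + C powr r * S1)"
    proof (intro mult_left_mono add_mono)
      have "(\<Sum>k\<in>F. \<alpha> k powr q) \<le> 1" "(\<Sum>k\<in>F. \<beta> k powr p) \<le> 1"
        using H F by (auto simp: dyadic_data_def)
      then show "(\<Sum>k\<in>F. \<alpha> k powr q) + (\<Sum>k\<in>F. \<beta> k powr p) \<le> 2" by simp
    qed (use SM in auto)
    finally show "(\<Sum>k\<in>F. \<gamma> k powr r) \<le> 2 powr r * (C powr r * 2 + C powr r * S1)" .
  qed
qed

text \<open>The two bounds on \<open>\<gamma>\<close> are alternatives, to be chosen index by index:
  oscillation plus mean, or Hoelder's inequality alone.\<close>

definition dyadic_ok where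
  "dyadic_ok p q A B G G' \<theta> C \<alpha> \<beta> \<delta> m \<gamma> \<longleftrightarrow> dyadic_data p q A B C \<alpha> \<beta> \<delta> m \<and> (\<forall>k. 0 \<le> \<gamma> k) \<and>
     (\<forall>k. \<gamma> k \<le> C * (2 powr (of_int k * (G - G')) * (\<alpha> k powr (1 - \<theta>) * \<beta> k powr \<theta>) + 2 powr (of_int k * G) * m k)) \<and>
     (\<forall>k. \<gamma> k \<le> C * 2 powr (of_int k * (G - A)) * \<alpha> k)"

text \<open>In the noncritical case the disjunction \<open>0 < G \<or> A \<le> 0\<close> separates
  the two ways of controlling the means on negative indices: comparison with \<open>m 0\<close>, or
  their vanishing at \<open>-\<infinity>\<close>.\<close>

lemma dyadic_sum_one_sided:
  assumes "1 \<le> p" "p < r" "r \<le> q" "0 \<le> \<theta>" "\<theta> \<le> 1" "1 / r \<le> (1 - \<theta>) / q + \<theta> / p" "0 \<le> C"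
    and cases: "(G < A \<and> B < G \<and> (0 < G \<or> A \<le> 0) \<and> G' \<le> G) \<or> (G = B \<and> G' = B \<and> A \<le> 0 \<and> B < 0)"
  shows "\<exists>S. \<forall>\<alpha> \<beta> \<delta> m \<gamma>. dyadic_ok p q A B G G' \<theta> C \<alpha> \<beta> \<delta> m \<gamma> \<longrightarrow>
     (\<forall>F. finite F \<longrightarrow> (\<Sum>k\<in>F. \<gamma> k powr r) \<le> S)"
proof -
  consider (pos) "G < A" "B < G" "0 < G" "G' \<le> G" | (neg) "G < A" "B < G" "A \<le> 0" "G' \<le> G"
    | (crit) "G = B" "G' = B" "A \<le> 0" "B < 0"
    using cases by blast
  moreover have pq: "0 < p" "0 < q" "0 < r" using assms by auto
  ultimately show ?thesis
  proof cases
    case pos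
    \<comment> \<open>A value strictly between \<open>max B 0\<close> and \<open>G\<close>: at least
      \<open>B\<close> and positive, so that the growth estimate applies, and below
      \<open>G\<close>, so that \<open>2 powr (k * (G - B'))\<close> can be summed over
      \<open>k < 0\<close>.\<close>
    define B' where "B' = (max B 0 + G) / 2"
    have B': "B \<le> B'" "0 < B'" "B' < G" using pos by (auto simp: B'_def)
    define K where "K = C * (1 + 1 / (1 - 2 powr (-B')))"
    have "2 powr (-B') < 1" using B' powr_less_mono[of "-B'" 0 2] by simp
    then have K: "0 \<le> K" using assms by (auto simp: K_def)
    have mK: "\<forall>k\<le>0. m k \<le> K * 2 powr (- (of_int k * B'))"
      if "dyadic_data p q A B C \<alpha> \<beta> \<delta> m" for \<alpha> \<beta> \<delta> m
    proof (intro allI impI)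
      fix k :: int assume "k \<le> 0"
      then have k: "k = - int (nat (-k))" by simp
      have "m (- int (nat (-k))) \<le> K * 2 powr (real (nat (-k)) * B')"
        unfolding K_def using assms B' by (intro dyadic_mean_growth[OF that]) auto
      then show "m k \<le> K * 2 powr (- (of_int k * B'))" using k \<open>k \<le> 0\<close> by simp
    qed
    obtain S where S: "\<forall>\<alpha> \<beta> \<delta> m \<gamma>. dyadic_data p q A B C \<alpha> \<beta> \<delta> m \<longrightarrow>
     (\<forall>k. 0 \<le> \<gamma> k) \<longrightarrow>
     (\<forall>k. \<gamma> k \<le> C * (2 powr (of_int k * (G - G')) * (\<alpha> k powr (1 - \<theta>) * \<beta> k powr \<theta>) + 2 powr (of_int k * G) * m k)) \<longrightarrow>
     (\<forall>k. \<gamma> k \<le> C * 2 powr (of_int k * (G - A)) * \<alpha> k) \<longrightarrow>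
     (\<forall>k\<le>0. m k \<le> K * 2 powr (- (of_int k * B'))) \<longrightarrow>
     (\<forall>F. finite F \<longrightarrow> (\<Sum>k\<in>F. \<gamma> k powr r) \<le> S)"
      using dyadic_sum_split[OF pq assms(4-7) K pos(1) B'(3) pos(4), of B] by blast
    show ?thesis
    proof (intro exI[of _ S] allI impI)
      fix \<alpha> \<beta> \<delta> m \<gamma> and F :: "int set"
      assume ok: "dyadic_ok p q A B G G' \<theta> C \<alpha> \<beta> \<delta> m \<gamma>" and F: "finite F"
      then have "dyadic_data p q A B C \<alpha> \<beta> \<delta> m" unfolding dyadic_ok_def by blast
      from mK[OF this] ok F S show "(\<Sum>k\<in>F. \<gamma> k powr r) \<le> S" unfolding dyadic_ok_def by blast
    qed
  next
    case neg
    define K where "K = C / (2 powr (-B) - 1)"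
    have K: "0 \<le> K"
      using assms neg unfolding K_def by (intro divide_nonneg_nonneg) (auto intro!: ge_one_powr_ge_zero)
    have mK: "\<forall>k\<le>0. m k \<le> K * 2 powr (- (of_int k * B))"
      if "dyadic_data p q A B C \<alpha> \<beta> \<delta> m" for \<alpha> \<beta> \<delta> m
      unfolding K_def using assms neg by (intro allI impI dyadic_mean_decay[OF that]) auto
    obtain S where S: "\<forall>\<alpha> \<beta> \<delta> m \<gamma>. dyadic_data p q A B C \<alpha> \<beta> \<delta> m \<longrightarrow>
     (\<forall>k. 0 \<le> \<gamma> k) \<longrightarrow>
     (\<forall>k. \<gamma> k \<le> C * (2 powr (of_int k * (G - G')) * (\<alpha> k powr (1 - \<theta>) * \<beta> k powr \<theta>) + 2 powr (of_int k * G) * m k)) \<longrightarrow>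
     (\<forall>k. \<gamma> k \<le> C * 2 powr (of_int k * (G - A)) * \<alpha> k) \<longrightarrow>
     (\<forall>k\<le>0. m k \<le> K * 2 powr (- (of_int k * B))) \<longrightarrow>
     (\<forall>F. finite F \<longrightarrow> (\<Sum>k\<in>F. \<gamma> k powr r) \<le> S)"
      using dyadic_sum_split[OF pq assms(4-7) K neg(1,2,4), of B] by blast
    show ?thesis
    proof (intro exI[of _ S] allI impI)
      fix \<alpha> \<beta> \<delta> m \<gamma> and F :: "int set"
      assume ok: "dyadic_ok p q A B G G' \<theta> C \<alpha> \<beta> \<delta> m \<gamma>" and F: "finite F"
      then have "dyadic_data p q A B C \<alpha> \<beta> \<delta> m" unfolding dyadic_ok_def by blast
      from mK[OF this] ok F S show "(\<Sum>k\<in>F. \<gamma> k powr r) \<le> S" unfolding dyadic_ok_def by blast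
    qed
  next
    case crit
    obtain S where S: "\<forall>\<alpha> \<beta> \<delta> m \<gamma>. dyadic_data p q A B C \<alpha> \<beta> \<delta> m \<longrightarrow>
     (\<forall>k. 0 \<le> \<gamma> k) \<longrightarrow>
     (\<forall>k. \<gamma> k \<le> C * ((\<alpha> k powr (1 - \<theta>) * \<beta> k powr \<theta>) + 2 powr (of_int k * B) * m k)) \<longrightarrow>
     (\<forall>F. finite F \<longrightarrow> (\<Sum>k\<in>F. \<gamma> k powr r) \<le> S)"
      using dyadic_sum_critical[OF assms(1-7) crit(3,4)] by blast
    show ?thesis
    proof (intro exI[of _ S] allI impI)
      fix \<alpha> \<beta> \<delta> m \<gamma> and F :: "int set"
      assume ok: "dyadic_ok p q A B G G' \<theta> C \<alpha> \<beta> \<delta> m \<gamma>" and F: "finite F"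
      then have "\<forall>k. \<gamma> k \<le> C * ((\<alpha> k powr (1 - \<theta>) * \<beta> k powr \<theta>) + 2 powr (of_int k * B) * m k)"
        unfolding dyadic_ok_def crit by simp
      with ok F S show "(\<Sum>k\<in>F. \<gamma> k powr r) \<le> S" unfolding dyadic_ok_def by blast
    qed
  qed
qed

section \<open>Reflection of the scale index\<close>

lemma sum_reflect_le:
  fixes f :: "int \<Rightarrow> real"
  assumes "\<forall>F. finite F \<longrightarrow> (\<Sum>k\<in>F. f k) \<le> S" "finite F"
  shows "(\<Sum>k\<in>F. f (c - k)) \<le> S"
proof -
  have "(\<Sum>k\<in>F. f (c - k)) = (\<Sum>k\<in>(\<lambda>k. c - k) ` F. f k)"
    by (subst sum.reindex) (auto simp: inj_on_def)
  also have "\<dots> \<le> S" using assms by auto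
  finally show ?thesis .
qed

text \<open>Inversion of the scale changes the sign of every exponent. The step from
  \<open>k\<close> to \<open>k + 1\<close> becomes the step from \<open>- 1 - k\<close> to
  \<open>- k\<close>, which accounts for \<open>\<delta> (-1 - k)\<close>. Writing its power of 2 in
  terms of \<open>k\<close> costs a factor \<open>2 powr B\<close>, hence the enlarged
  constant.\<close>

lemma dyadic_ok_reflect:
  assumes "dyadic_ok p q A B G G' \<theta> C \<alpha> \<beta> \<delta> m \<gamma>" "0 \<le> C"
  shows "dyadic_ok p q (-A) (-B) (-G) (-G') \<theta> (C * max 1 (2 powr B))
           (\<lambda>k. \<alpha> (-k)) (\<lambda>k. \<beta> (-k)) (\<lambda>k. \<delta> (-1 - k)) (\<lambda>k. m (-k)) (\<lambda>k. \<gamma> (-k))"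
proof -
  let ?C = "C * max 1 (2 powr B)"
  have H0: "\<forall>k. 0 < \<alpha> k" "\<forall>k. 0 < \<beta> k" "\<forall>k. 0 \<le> \<delta> k" "\<forall>k. 0 \<le> m k" "\<forall>k. 0 \<le> \<gamma> k"
    "\<forall>F. finite F \<longrightarrow> (\<Sum>k\<in>F. \<alpha> k powr q) \<le> 1"
    "\<forall>F. finite F \<longrightarrow> (\<Sum>k\<in>F. \<beta> k powr p) \<le> 1"
    "\<forall>F. finite F \<longrightarrow> (\<Sum>k\<in>F. \<delta> k powr p) \<le> 1"
    "\<forall>k. \<bar>m (k + 1) - m k\<bar> \<le> C * 2 powr (- (of_int k * B)) * \<delta> k"
    "\<forall>k. 2 powr (of_int k * A) * m k \<le> C * \<alpha> k"
    "\<forall>k. \<gamma> k \<le> C * (2 powr (of_int k * (G - G')) * (\<alpha> k powr (1 - \<theta>) * \<beta> k powr \<theta>) + 2 powr (of_int k * G) * m k)"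
    "\<forall>k. \<gamma> k \<le> C * 2 powr (of_int k * (G - A)) * \<alpha> k"
    by (insert assms(1)[unfolded dyadic_ok_def dyadic_data_def], (elim conjE, assumption)+)
  note H = H0(1-5)[rule_format] H0(6-8) H0(9-12)[rule_format]
  have CC: "C \<le> ?C" "C * 2 powr B \<le> ?C"
    using mult_left_mono[of 1 "max 1 (2 powr B)" C] mult_left_mono[of "2 powr B" "max 1 (2 powr B)" C] assms(2)
    by simp_all
  have neg: "of_int k * (- x) = of_int (- k) * x" for k :: int and x :: real by simp
  have r1: "\<bar>m (- (k + 1)) - m (- k)\<bar> \<le> ?C * 2 powr (- (of_int k * - B)) * \<delta> (- 1 - k)" for k
  proof -
    have e: "- (k + 1) = - 1 - k" "- k = (- 1 - k) + 1" by simp_all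
    have "\<bar>m (- (k + 1)) - m (- k)\<bar> = \<bar>m ((- 1 - k) + 1) - m (- 1 - k)\<bar>"
      unfolding e(1) by (subst e(2)) (rule abs_minus_commute)
    also have "\<dots> \<le> C * 2 powr (- (of_int (- 1 - k) * B)) * \<delta> (- 1 - k)" by (rule H(9))
    also have "- (of_int (- 1 - k) * B) = B + - (of_int k * - B)" by (simp add: algebra_simps)
    also have "C * 2 powr (B + - (of_int k * - B)) * \<delta> (- 1 - k) = (C * 2 powr B) * (2 powr (- (of_int k * - B)) * \<delta> (- 1 - k))"
      unfolding powr_add by simp
    also have "\<dots> \<le> ?C * (2 powr (- (of_int k * - B)) * \<delta> (- 1 - k))"
      using CC H by (intro mult_right_mono) auto
    finally show ?thesis by simp
  qed
  have r2: "2 powr (of_int k * - A) * m (- k) \<le> ?C * \<alpha> (- k)" for k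
    using order_trans[OF H(10)[of "-k"] mult_right_mono[OF CC(1) less_imp_le[OF H(1)[of "-k"]]]]
    unfolding neg .
  have r3: "\<gamma> (- k) \<le> ?C * (2 powr (of_int k * (- G - - G')) * (\<alpha> (- k) powr (1 - \<theta>) * \<beta> (- k) powr \<theta>) + 2 powr (of_int k * - G) * m (- k))" for k
  proof -
    have e: "of_int k * (- G - - G') = of_int (- k) * (G - G')" by (simp add: algebra_simps)
    show ?thesis unfolding neg e
      using H(4)[of "-k"] by (intro order_trans[OF H(11)] mult_right_mono CC) auto
  qed
  have r4: "\<gamma> (- k) \<le> ?C * 2 powr (of_int k * (- G - - A)) * \<alpha> (- k)" for k
  proof -
    have e: "of_int k * (- G - - A) = of_int (- k) * (G - A)" by (simp add: algebra_simps)
    show ?thesis unfolding e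
      using H(1)[of "-k"] by (intro order_trans[OF H(12)] mult_right_mono CC) auto
  qed
  have r5: "(\<Sum>k\<in>F. \<alpha> (- k) powr q) \<le> 1" "(\<Sum>k\<in>F. \<beta> (- k) powr p) \<le> 1"
    "(\<Sum>k\<in>F. \<delta> (- 1 - k) powr p) \<le> 1" if "finite F" for F
    using sum_reflect_le[OF H(6) that, of 0] sum_reflect_le[OF H(7) that, of 0]
      sum_reflect_le[OF H(8) that, of "-1"] by simp_all
  show ?thesis unfolding dyadic_ok_def dyadic_data_def
    by (intro conjI allI impI) (rule H r1 r2 r3 r4 r5 | assumption)+
qed

text \<open>The last two alternatives are the first two for \<open>- A\<close>, \<open>- B\<close>,
  \<open>- G\<close> and \<open>- G'\<close>.\<close>

lemma dyadic_sum:
  assumes "1 \<le> p" "p < r" "r \<le> q" "0 \<le> \<theta>" "\<theta> \<le> 1" "1 / r \<le> (1 - \<theta>) / q + \<theta> / p" "0 \<le> C"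
    and cases: "(G < A \<and> B < G \<and> (0 < G \<or> A \<le> 0) \<and> G' \<le> G) \<or> (G = B \<and> G' = B \<and> A \<le> 0 \<and> B < 0)
      \<or> (A < G \<and> G < B \<and> (G < 0 \<or> 0 \<le> A) \<and> G \<le> G') \<or> (G = B \<and> G' = B \<and> 0 \<le> A \<and> 0 < B)"
  shows "\<exists>S. \<forall>\<alpha> \<beta> m \<gamma>. dyadic_ok p q A B G G' \<theta> C \<alpha> \<beta> \<beta> m \<gamma> \<longrightarrow>
     (\<forall>F. finite F \<longrightarrow> (\<Sum>k\<in>F. \<gamma> k powr r) \<le> S)"
proof (cases "(G < A \<and> B < G \<and> (0 < G \<or> A \<le> 0) \<and> G' \<le> G) \<or> (G = B \<and> G' = B \<and> A \<le> 0 \<and> B < 0)")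
  case True
  from dyadic_sum_one_sided[OF assms(1-7) this] obtain S where
    "\<forall>\<alpha> \<beta> \<delta> m \<gamma>. dyadic_ok p q A B G G' \<theta> C \<alpha> \<beta> \<delta> m \<gamma> \<longrightarrow>
     (\<forall>F. finite F \<longrightarrow> (\<Sum>k\<in>F. \<gamma> k powr r) \<le> S)" ..
  then show ?thesis by (intro exI[of _ S]) simp
next
  case False
  then have neg: "(- G < - A \<and> - B < - G \<and> (0 < - G \<or> - A \<le> 0) \<and> - G' \<le> - G) \<or> (- G = - B \<and> - G' = - B \<and> - A \<le> 0 \<and> - B < 0)"
    using cases by linarith
  have C: "0 \<le> C * max 1 (2 powr B)" using assms by simp
  from dyadic_sum_one_sided[OF assms(1-6) C neg] obtain S where
    S: "\<forall>\<alpha> \<beta> \<delta> m \<gamma>. dyadic_ok p q (-A) (-B) (-G) (-G') \<theta> (C * max 1 (2 powr B)) \<alpha> \<beta> \<delta> m \<gamma> \<longrightarrow>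
     (\<forall>F. finite F \<longrightarrow> (\<Sum>k\<in>F. \<gamma> k powr r) \<le> S)" ..
  show ?thesis
  proof (intro exI[of _ S] allI impI)
    fix \<alpha> \<beta> m \<gamma> and F :: "int set"
    assume ok: "dyadic_ok p q A B G G' \<theta> C \<alpha> \<beta> \<beta> m \<gamma>" and F: "finite F"
    have "\<forall>F. finite F \<longrightarrow> (\<Sum>k\<in>F. \<gamma> (- k) powr r) \<le> S"
      using S[rule_format, OF dyadic_ok_reflect[OF ok assms(7)]] by (intro allI impI)
    from sum_reflect_le[OF this F, of 0] show "(\<Sum>k\<in>F. \<gamma> k powr r) \<le> S" by simp
  qed
qed

section \<open>The Loomis--Whitney inequality\<close>

text \<open>The missing weight \<open>1 - sum e I\<close> is placed on the value 1. Dividing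
  everything by the product \<open>T\<close> makes the weighted logarithms add up to 0, and
  \<open>ln y <= y - 1\<close> turns this into the claim.\<close>

lemma weighted_amgm:
  fixes x e :: "'i \<Rightarrow> real"
  assumes "finite I" and e: "\<And>i. i \<in> I \<Longrightarrow> 0 \<le> e i" "sum e I \<le> 1" and x: "\<And>i. i \<in> I \<Longrightarrow> 0 \<le> x i"
  shows "(\<Prod>i\<in>I. x i powr e i) \<le> (\<Sum>i\<in>I. e i * x i) + (1 - sum e I)"
proof (cases "\<exists>i\<in>I. x i = 0")
  case True
  \<comment> \<open>A zero base annihilates the product even if its exponent is 0, since
    \<open>0 powr 0 = 0\<close>.\<close>
  then have "(\<Prod>i\<in>I. x i powr e i) = 0" using assms by auto
  then show ?thesis using e x by (auto intro!: add_nonneg_nonneg sum_nonneg)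
next
  case False
  then have pos: "0 < x i" if "i \<in> I" for i using that x by (metis less_eq_real_def)
  define T where "T = (\<Prod>i\<in>I. x i powr e i)"
  have ne: "x i \<noteq> 0" if "i \<in> I" for i using pos[OF that] by simp
  have T: "0 < T" unfolding T_def using ne by (intro prod_pos) auto
  have lnT: "ln T = (\<Sum>i\<in>I. e i * ln (x i))"
    unfolding T_def using ne assms(1)
    by (subst ln_prod) (auto intro!: sum.cong simp: ln_powr)
  have "0 = (\<Sum>i\<in>I. e i * ln (x i / T)) + (1 - sum e I) * ln (1 / T)"
  proof -
    have "(\<Sum>i\<in>I. e i * ln (x i / T)) = (\<Sum>i\<in>I. e i * ln (x i) - e i * ln T)"
      using ne T by (intro sum.cong refl) (simp add: ln_div right_diff_distrib)
    also have "\<dots> = ln T - sum e I * ln T" by (simp add: sum_subtractf lnT sum_distrib_right)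
    finally show ?thesis using T by (simp add: ln_div left_diff_distrib)
  qed
  also have "\<dots> \<le> (\<Sum>i\<in>I. e i * (x i / T - 1)) + (1 - sum e I) * (1 / T - 1)"
    using pos T e by (intro add_mono sum_mono mult_left_mono ln_le_minus_one) auto
  also have "\<dots> = ((\<Sum>i\<in>I. e i * x i) + (1 - sum e I)) / T - 1"
    by (simp add: right_diff_distrib sum_subtractf left_diff_distrib sum_divide_distrib add_divide_distrib diff_divide_distrib)
  finally show ?thesis using T unfolding T_def[symmetric] by (simp add: field_simps)
qed

lemma (in prob_space) integrable_prod_powr:
  fixes G :: "'i \<Rightarrow> 'a \<Rightarrow> real"
  assumes "finite I" and e: "\<And>i. i \<in> I \<Longrightarrow> 0 \<le> e i" "sum e I \<le> 1"
    and G: "\<And>i. i \<in> I \<Longrightarrow> integrable M (G i)" "\<And>i x. i \<in> I \<Longrightarrow> 0 \<le> G i x"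
  shows "integrable M (\<lambda>x. \<Prod>i\<in>I. G i x powr e i)"
proof (rule Bochner_Integration.integrable_bound)
  show "integrable M (\<lambda>x. (\<Sum>i\<in>I. e i * G i x) + (1 - sum e I))" using G by auto
  show "(\<lambda>x. \<Prod>i\<in>I. G i x powr e i) \<in> borel_measurable M"
    using G by (intro borel_measurable_prod) auto
  show "AE x in M. norm (\<Prod>i\<in>I. G i x powr e i) \<le> norm ((\<Sum>i\<in>I. e i * G i x) + (1 - sum e I))"
  proof (rule AE_I2)
    fix x
    have "norm (\<Prod>i\<in>I. G i x powr e i) = (\<Prod>i\<in>I. G i x powr e i)" by (simp add: abs_prod)
    also have "\<dots> \<le> (\<Sum>i\<in>I. e i * G i x) + (1 - sum e I)"
      using assms by (intro weighted_amgm) auto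
    finally show "norm (\<Prod>i\<in>I. G i x powr e i) \<le> norm ((\<Sum>i\<in>I. e i * G i x) + (1 - sum e I))" by simp
  qed
qed

text \<open>Hoelder's inequality for several factors; exponents with sum below 1 are admissible
  because the total mass is 1. After normalising every factor to mean 1 it is the integrated
  arithmetic-geometric mean inequality. A factor of mean 0 vanishes almost everywhere and is treated
  separately.\<close>

lemma (in prob_space) expectation_prod_powr_le:
  fixes G :: "'i \<Rightarrow> 'a \<Rightarrow> real"
  assumes "finite I" and e: "\<And>i. i \<in> I \<Longrightarrow> 0 \<le> e i" "sum e I \<le> 1"
    and G: "\<And>i. i \<in> I \<Longrightarrow> integrable M (G i)" "\<And>i x. i \<in> I \<Longrightarrow> 0 \<le> G i x"
  shows "expectation (\<lambda>x. \<Prod>i\<in>I. G i x powr e i) \<le> (\<Prod>i\<in>I. expectation (G i) powr e i)"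
proof (cases "\<exists>i\<in>I. expectation (G i) = 0")
  case True
  then obtain i where i: "i \<in> I" "expectation (G i) = 0" by auto
  then have "AE x in M. G i x = 0"
    using integral_nonneg_eq_0_iff_AE[OF G(1)[OF i(1)]] G(2) by auto
  then have "AE x in M. (\<Prod>i\<in>I. G i x powr e i) = 0"
    using i(1) assms(1) by (auto elim!: eventually_mono)
  then have "expectation (\<lambda>x. \<Prod>i\<in>I. G i x powr e i) = 0" by (rule integral_eq_zero_AE)
  then show ?thesis by (simp add: prod_nonneg)
next
  case False
  define m where "m i = expectation (G i)" for i
  have m: "0 < m i" if "i \<in> I" for i
    using False that G(2) Bochner_Integration.integral_nonneg[of M "G i"] by (force simp: m_def less_le)
  have "expectation (\<lambda>x. \<Prod>i\<in>I. (G i x / m i) powr e i) \<le> expectation (\<lambda>x. (\<Sum>i\<in>I. e i * (G i x / m i)) + (1 - sum e I))"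
  proof (rule integral_mono)
    show "integrable M (\<lambda>x. \<Prod>i\<in>I. (G i x / m i) powr e i)"
      using assms m by (intro integrable_prod_powr) (auto simp: less_imp_le)
    show "integrable M (\<lambda>x. (\<Sum>i\<in>I. e i * (G i x / m i)) + (1 - sum e I))" using G by auto
    show "(\<Prod>i\<in>I. (G i x / m i) powr e i) \<le> (\<Sum>i\<in>I. e i * (G i x / m i)) + (1 - sum e I)" for x
      using assms m by (intro weighted_amgm) (auto simp: less_imp_le)
  qed
  also have "\<dots> = (\<Sum>i\<in>I. e i * (m i / m i)) + (1 - sum e I)"
    using G by (subst Bochner_Integration.integral_add) (auto simp: m_def prob_space simp del: divide_self_if)
  also have "(\<Sum>i\<in>I. e i * (m i / m i)) = sum e I"
    using m[THEN less_imp_neq] by (intro sum.cong) auto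
  finally have le1: "expectation (\<lambda>x. \<Prod>i\<in>I. (G i x / m i) powr e i) \<le> 1" by simp
  have "expectation (\<lambda>x. \<Prod>i\<in>I. G i x powr e i)
      = expectation (\<lambda>x. (\<Prod>i\<in>I. m i powr e i) * (\<Prod>i\<in>I. (G i x / m i) powr e i))"
  proof (rule Bochner_Integration.integral_cong[OF refl])
    fix x
    show "(\<Prod>i\<in>I. G i x powr e i) = (\<Prod>i\<in>I. m i powr e i) * (\<Prod>i\<in>I. (G i x / m i) powr e i)"
      unfolding prod.distrib[symmetric]
    proof (intro prod.cong refl)
      fix i assume "i \<in> I"
      then show "G i x powr e i = m i powr e i * (G i x / m i) powr e i"
        using m[of i] G(2)[of i x] by (simp flip: powr_mult)
    qed
  qed
  also have "\<dots> = (\<Prod>i\<in>I. m i powr e i) * expectation (\<lambda>x. \<Prod>i\<in>I. (G i x / m i) powr e i)" by simp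
  also have "\<dots> \<le> (\<Prod>i\<in>I. m i powr e i) * 1"
    using le1 by (intro mult_left_mono prod_nonneg) auto
  finally show ?thesis by (simp add: m_def)
qed

lemma (in prob_space) integral_between:
  fixes f :: "'a \<Rightarrow> real"
  assumes "f \<in> borel_measurable M" "\<And>x. x \<in> space M \<Longrightarrow> a \<le> f x" "\<And>x. x \<in> space M \<Longrightarrow> f x \<le> b" 
  shows "integrable M f" "a \<le> expectation f" "expectation f \<le> b"
proof -
  have bd: "\<bar>f x\<bar> \<le> \<bar>a\<bar> + \<bar>b\<bar>" if "x \<in> space M" for x using assms(2,3)[OF that] by linarith
  show i: "integrable M f"
    using assms(1) bd by (intro integrable_const_bound[of _ "\<bar>a\<bar> + \<bar>b\<bar>"]) auto
  have "expectation (\<lambda>_. a) \<le> expectation f" using i assms by (intro integral_mono) auto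
  then show "a \<le> expectation f" by (simp add: prob_space)
  have "expectation f \<le> expectation (\<lambda>_. b)" using i assms by (intro integral_mono) auto
  then show "expectation f \<le> b" by (simp add: prob_space)
qed

text \<open>The factor \<open>f powr e\<close> is there to make the induction over the coordinates
  close. Integrate over coordinate \<open>j\<close> first. The average of \<open>f\<close> over
  \<open>j\<close>, called \<open>h\<close>, does not depend on that coordinate and leaves the
  integral as \<open>h powr s\<close>. The remaining factors have total exponent
  \<open>e + (card I - 1) * s <= 1\<close>, so Hoelder's inequality replaces each by its average,
  and \<open>f powr e\<close> becomes \<open>h powr e\<close>. What is left is the same expression
  for \<open>h\<close> on the other coordinates with \<open>e + s\<close> in place of
  \<open>e\<close>. The bounds \<open>d <= f <= K\<close> settle all integrability questions. For
  \<open>e = 0\<close> and \<open>s = 1 / (card I - 1)\<close> this is the inequality behind the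
  Gagliardo-Nirenberg proof of Sobolev's theorem.\<close>

lemma loomis_whitney:
  fixes M :: "'i \<Rightarrow> 'a measure" and f :: "('i \<Rightarrow> 'a) \<Rightarrow> real"
  assumes P: "\<And>i. prob_space (M i)" and "finite I" "0 < d" "0 \<le> s"
    and "f \<in> borel_measurable (PiM I M)" "\<And>x. x \<in> space (PiM I M) \<Longrightarrow> d \<le> f x"
      "\<And>x. x \<in> space (PiM I M) \<Longrightarrow> f x \<le> K"
    and "0 \<le> e" "e + (real (card I) - 1) * s \<le> 1"
  shows "(\<integral>x. f x powr e * (\<Prod>i\<in>I. (\<integral>t. f (x(i := t)) \<partial>M i) powr s) \<partial>PiM I M)
     \<le> (\<integral>x. f x \<partial>PiM I M) powr (e + real (card I) * s)"
  using assms(2,5-)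
proof (induction I arbitrary: f e rule: finite_induct)
  case empty
  show ?case by (simp add: PiM_empty lebesgue_integral_count_space_finite)
next
  case (insert j J)
  interpret psf: product_sigma_finite M by (unfold_locales) (use P prob_space_imp_sigma_finite in \<open>blast intro: sigma_finite_measure.sigma_finite_countable\<close>)
  have PI: "prob_space (PiM A M)" for A by (intro prob_space_PiM P)
  interpret I: prob_space "PiM (insert j J) M" by (rule PI)
  interpret J: prob_space "PiM J M" by (rule PI)
  interpret j: prob_space "M j" by (rule P)
  note f[measurable] = insert.prems(1)
  define h where "h x = (\<integral>t. f (x(j := t)) \<partial>M j)" for x
  have upd: "x(j := t) \<in> space (PiM (insert j J) M)" if "x \<in> space (PiM J M)" "t \<in> space (M j)" for x t
    using that by (auto simp: space_PiM PiE_iff extensional_def)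
  have upd2: "x(i := t) \<in> space (PiM A M)" if "x \<in> space (PiM A M)" "t \<in> space (M i)" "i \<in> A" for x t i A
    using that by (auto simp: space_PiM PiE_iff extensional_def)
  have mupd[measurable]: "(\<lambda>(x, t). x(i := t)) \<in> measurable (PiM A M \<Otimes>\<^sub>M M i) (PiM A M)" if "i \<in> A" for i A
    using that by (auto intro!: measurable_fun_upd[of _ A i, where f=fst and h=snd, simplified] simp: split_beta' insert_absorb)
  have madd[measurable]: "(\<lambda>(x, t). x(j := t)) \<in> measurable (PiM J M \<Otimes>\<^sub>M M j) (PiM (insert j J) M)"
    by (rule measurable_add_dim)
  have mc: "(\<lambda>t. x(j := t)) \<in> measurable (M j) (PiM (insert j J) M)" if "x \<in> space (PiM J M)" for x
    using measurable_component_update[OF that insert(2)] .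
  have fj: "(\<lambda>t. f (x(j := t))) \<in> borel_measurable (M j)" if "x \<in> space (PiM J M)" for x
    using measurable_compose[OF mc[OF that] f] .
  have hb: "d \<le> h x" "h x \<le> K" if "x \<in> space (PiM J M)" for x
    unfolding h_def using j.integral_between[OF fj[OF that], of d K] insert.prems(2,3) upd[OF that] by blast+
  have hm[measurable]: "h \<in> borel_measurable (PiM J M)"
  proof -
    have "(\<lambda>(x, t). f (x(j := t))) \<in> borel_measurable (PiM J M \<Otimes>\<^sub>M M j)"
      using measurable_compose[OF madd f] by (simp add: split_beta')
    then show ?thesis unfolding h_def by (rule sigma_finite_measure.borel_measurable_lebesgue_integral[OF prob_space_imp_sigma_finite[OF P]])
  qed
  define F where "F i x = (\<integral>t. f (x(i := t)) \<partial>M i)" for i x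
  have Fm: "F i \<in> borel_measurable (PiM (insert j J) M)" if "i \<in> insert j J" for i
  proof -
    interpret i: prob_space "M i" by (rule P)
    have "(\<lambda>(x, t). f (x(i := t))) \<in> borel_measurable (PiM (insert j J) M \<Otimes>\<^sub>M M i)"
      using measurable_compose[OF mupd[OF that] f] by (simp add: split_beta' fun_upd_def)
    then show ?thesis unfolding F_def by (rule sigma_finite_measure.borel_measurable_lebesgue_integral[OF prob_space_imp_sigma_finite[OF P]])
  qed
  have Fb: "d \<le> F i x" "F i x \<le> K" if "i \<in> insert j J" "x \<in> space (PiM (insert j J) M)" for i x
  proof -
    interpret i: prob_space "M i" by (rule P)
    have "(\<lambda>t. x(i := t)) \<in> measurable (M i) (PiM (insert j J) M)"
      using that by (intro measurable_fun_upd[of _ "insert j J" i]) (auto simp: insert_absorb)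
    from measurable_compose[OF this f] show "d \<le> F i x" "F i x \<le> K"
      unfolding F_def using i.integral_between[of "\<lambda>t. f (x(i := t))" d K] insert.prems(2,3) upd2[OF that(2) _ that(1)] by blast+
  qed
  define \<Phi> where "\<Phi> x = f x powr e * (\<Prod>i\<in>insert j J. F i x powr s)" for x
  have \<Phi>m: "\<Phi> \<in> borel_measurable (PiM (insert j J) M)"
    unfolding \<Phi>_def using Fm by (intro borel_measurable_times borel_measurable_prod) auto
  have K: "d \<le> K" "0 < K"
  proof -
    obtain x where "x \<in> space (PiM (insert j J) M)" using I.not_empty by blast
    then show "d \<le> K" using insert.prems(2,3) by force
    then show "0 < K" using assms by simp
  qed
  have \<Phi>0: "0 \<le> \<Phi> x" for x unfolding \<Phi>_def by (intro mult_nonneg_nonneg prod_nonneg) auto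
  have \<Phi>K: "\<Phi> x \<le> K powr e * (\<Prod>i\<in>insert j J. K powr s)" if x: "x \<in> space (PiM (insert j J) M)" for x
  proof -
    have fx: "0 \<le> f x" using insert.prems(2)[OF x] assms(3) by linarith
    have Fx: "0 \<le> F i x" if "i \<in> insert j J" for i using Fb(1)[OF that x] assms(3) by linarith
    show ?thesis
      unfolding \<Phi>_def using insert.prems(3)[OF x] insert.prems(4) Fb(2)[OF _ x] fx Fx assms
      by (intro mult_mono prod_mono powr_mono2 prod_nonneg) (auto intro!: powr_mono2)
  qed
  have \<Phi>i: "integrable (PiM (insert j J) M) \<Phi>"
    by (rule I.integral_between(1)[OF \<Phi>m \<Phi>0 \<Phi>K])
  have eq1: "(\<integral>x. \<Phi> x \<partial>PiM (insert j J) M) = (\<integral>x. (\<integral>t. \<Phi> (x(j := t)) \<partial>M j) \<partial>PiM J M)"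
    by (rule psf.product_integral_insert[OF insert(1,2) \<Phi>i])
  define \<Psi> where "\<Psi> x = h x powr (e + s) * (\<Prod>i\<in>J. (\<integral>t. h (x(i := t)) \<partial>M i) powr s)" for x
  have inner: "(\<integral>t. \<Phi> (x(j := t)) \<partial>M j) \<le> \<Psi> x" if x: "x \<in> space (PiM J M)" for x
  proof -
    define G where "G i t = (if i = j then f (x(j := t)) else F i (x(j := t)))" for i t
    define E where "E i = (if i = j then e else s)" for i
    have Gm: "G i \<in> borel_measurable (M j)" if "i \<in> insert j J" for i
      unfolding G_def using fj[OF x] measurable_compose[OF mc[OF x] Fm[OF that]] by (cases "i = j") auto
    have Gb: "d \<le> G i t" "G i t \<le> K" if "i \<in> insert j J" "t \<in> space (M j)" for i t
      unfolding G_def using insert.prems(2,3) Fb[OF that(1) upd[OF x that(2)]] upd[OF x that(2)] by auto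
    have Gi: "integrable (M j) (G i)" if "i \<in> insert j J" for i
      using j.integral_between(1)[OF Gm[OF that]] Gb[OF that] by blast
    \<comment> \<open>Nonnegative for every argument, as Hoelder's inequality is stated here, and
      equal to \<open>G\<close> on the space of the measure.\<close>
    define G' where "G' i t = max 0 (G i t)" for i t
    have GG': "G' i t = G i t" if "i \<in> insert j J" "t \<in> space (M j)" for i t
      using Gb(1)[OF that] assms by (simp add: G'_def)
    have sE: "sum E (insert j J) = e + real (card J) * s"
    proof -
      have "sum E J = (\<Sum>i\<in>J. s)" using insert(2) by (intro sum.cong) (auto simp: E_def)
      then show ?thesis using insert(1,2) by (simp add: E_def)
    qed
    \<comment> \<open>This factor is already averaged over \<open>j\<close>, hence constant in
      \<open>t\<close>.\<close>
    have Fj: "F j (x(j := t)) = h x" for t by (simp add: F_def h_def)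
    have "\<Phi> (x(j := t)) = h x powr s * (\<Prod>i\<in>insert j J. G' i t powr E i)" if "t \<in> space (M j)" for t
    proof -
      have "(\<Prod>i\<in>insert j J. G' i t powr E i) = (\<Prod>i\<in>insert j J. G i t powr E i)"
        using GG' that by (intro prod.cong) auto
      also have "\<dots> = f (x(j := t)) powr e * (\<Prod>i\<in>J. F i (x(j := t)) powr s)"
      proof -
        have "(\<Prod>i\<in>J. G i t powr E i) = (\<Prod>i\<in>J. F i (x(j := t)) powr s)"
          using insert(2) by (intro prod.cong) (auto simp: E_def G_def)
        then show ?thesis using insert(1,2) by (simp add: E_def G_def)
      qed
      finally show ?thesis unfolding \<Phi>_def using insert(1,2) Fj by simp
    qed
    then have "(\<integral>t. \<Phi> (x(j := t)) \<partial>M j) = h x powr s * (\<integral>t. (\<Prod>i\<in>insert j J. G' i t powr E i) \<partial>M j)"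
      by (simp cong: Bochner_Integration.integral_cong)
    also have "\<dots> \<le> h x powr s * (\<Prod>i\<in>insert j J. (\<integral>t. G' i t \<partial>M j) powr E i)"
    proof (intro mult_left_mono j.expectation_prod_powr_le)
      show "sum E (insert j J) \<le> 1" using insert.prems(5) insert(1,2) sE by simp
      show "0 \<le> E i" for i using assms insert.prems by (simp add: E_def)
      show "integrable (M j) (G' i)" if "i \<in> insert j J" for i
        unfolding G'_def using Gi[OF that] by auto
    qed (use insert(1) in \<open>auto simp: G'_def\<close>)
    also have "(\<Prod>i\<in>insert j J. (\<integral>t. G' i t \<partial>M j) powr E i) = (\<Prod>i\<in>insert j J. (\<integral>t. G i t \<partial>M j) powr E i)"
      by (intro prod.cong refl arg_cong2[where f="(powr)"] Bochner_Integration.integral_cong GG') auto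
    also have "\<dots> = h x powr e * (\<Prod>i\<in>J. (\<integral>t. F i (x(j := t)) \<partial>M j) powr s)"
    proof -
      have "(\<Prod>i\<in>J. (\<integral>t. G i t \<partial>M j) powr E i) = (\<Prod>i\<in>J. (\<integral>t. F i (x(j := t)) \<partial>M j) powr s)"
        using insert(2) by (intro prod.cong) (auto simp: E_def G_def)
      then show ?thesis using insert(1,2) by (simp add: E_def G_def h_def)
    qed
    \<comment> \<open>Fubini interchanges the averages over \<open>i\<close> and \<open>j\<close>,
      so that \<open>f\<close> is seen only through \<open>h\<close>.\<close>
    also have "(\<Prod>i\<in>J. (\<integral>t. F i (x(j := t)) \<partial>M j) powr s) = (\<Prod>i\<in>J. (\<integral>t. h (x(i := t)) \<partial>M i) powr s)"
    proof (intro prod.cong refl arg_cong2[where f="(powr)"])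
      fix i assume i: "i \<in> J"
      then have ij: "i \<noteq> j" using insert(2) by auto
      interpret i: prob_space "M i" by (rule P)
      interpret p: pair_prob_space "M j" "M i" ..
      have m2: "(\<lambda>(t, t'). x(j := t, i := t')) \<in> measurable (M j \<Otimes>\<^sub>M M i) (PiM (insert j J) M)"
      proof -
        have "(\<lambda>p. (x(j := fst p))(i := snd p)) \<in> measurable (M j \<Otimes>\<^sub>M M i) (PiM (insert j J) M)"
          by (rule measurable_fun_upd[of _ "insert j J" i])
            (use i measurable_compose[OF measurable_fst mc[OF x]] in \<open>auto simp: insert_absorb\<close>)
        then show ?thesis by (simp add: split_beta')
      qed
      have m3: "(\<lambda>(t, t'). f (x(j := t, i := t'))) \<in> borel_measurable (M j \<Otimes>\<^sub>M M i)"
        using measurable_compose[OF m2 f] by (simp add: split_beta' fun_upd_def)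
      have "integrable (M j \<Otimes>\<^sub>M M i) (\<lambda>(t, t'). f (x(j := t, i := t')))"
      proof (rule p.integral_between(1)[OF m3, of d K])
        fix z assume "z \<in> space (M j \<Otimes>\<^sub>M M i)"
        then have "x(j := fst z, i := snd z) \<in> space (PiM (insert j J) M)"
          using upd[OF x] i by (intro upd2[of "x(j := fst z)"]) (auto simp: space_pair_measure)
        then show "d \<le> (case z of (t, t') \<Rightarrow> f (x(j := t, i := t')))" "(case z of (t, t') \<Rightarrow> f (x(j := t, i := t'))) \<le> K"
          using insert.prems(2,3) by (auto simp: split_beta')
      qed
      from p.Fubini_integral[OF this]
      show "(\<integral>t. F i (x(j := t)) \<partial>M j) = (\<integral>t. h (x(i := t)) \<partial>M i)"
        unfolding F_def h_def using ij by (simp add: fun_upd_twist)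
    qed
    also have "h x powr s * (h x powr e * (\<Prod>i\<in>J. (\<integral>t. h (x(i := t)) \<partial>M i) powr s)) = \<Psi> x"
      unfolding \<Psi>_def by (simp add: powr_add)
    finally show ?thesis .
  qed
  have hFm: "(\<lambda>x. \<integral>t. h (x(i := t)) \<partial>M i) \<in> borel_measurable (PiM J M)" if "i \<in> J" for i
  proof -
    interpret i: prob_space "M i" by (rule P)
    have "(\<lambda>(x, t). h (x(i := t))) \<in> borel_measurable (PiM J M \<Otimes>\<^sub>M M i)"
      using measurable_compose[OF mupd[OF that] hm] by (simp add: split_beta' fun_upd_def)
    then show ?thesis by (rule sigma_finite_measure.borel_measurable_lebesgue_integral[OF prob_space_imp_sigma_finite[OF P]])
  qed
  have hFb: "d \<le> (\<integral>t. h (x(i := t)) \<partial>M i)" "(\<integral>t. h (x(i := t)) \<partial>M i) \<le> K" if "i \<in> J" "x \<in> space (PiM J M)" for i x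
  proof -
    interpret i: prob_space "M i" by (rule P)
    have "(\<lambda>t. x(i := t)) \<in> measurable (M i) (PiM J M)"
      using that by (intro measurable_fun_upd[of _ J i]) (auto simp: insert_absorb)
    from measurable_compose[OF this hm] show "d \<le> (\<integral>t. h (x(i := t)) \<partial>M i)" "(\<integral>t. h (x(i := t)) \<partial>M i) \<le> K"
      using i.integral_between[of "\<lambda>t. h (x(i := t))" d K] hb upd2[OF that(2) _ that(1)] by blast+
  qed
  have \<Psi>i: "integrable (PiM J M) \<Psi>"
  proof (rule J.integral_between(1)[of _ 0 "K powr (e + s) * (\<Prod>i\<in>J. K powr s)"])
    show "\<Psi> \<in> borel_measurable (PiM J M)"
      unfolding \<Psi>_def using hFm by (intro borel_measurable_times borel_measurable_prod) auto
    fix x assume x: "x \<in> space (PiM J M)"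
    show "0 \<le> \<Psi> x" unfolding \<Psi>_def by (intro mult_nonneg_nonneg prod_nonneg) auto
    have fx: "0 \<le> h x" using hb[OF x] assms by simp
    have Fx: "0 \<le> (\<integral>t. h (x(i := t)) \<partial>M i)" if "i \<in> J" for i using hFb(1)[OF that x] assms by simp
    show "\<Psi> x \<le> K powr (e + s) * (\<Prod>i\<in>J. K powr s)"
      unfolding \<Psi>_def using hb[OF x] insert.prems(4) hFb(2)[OF _ x] fx Fx assms
      by (intro mult_mono prod_mono powr_mono2 prod_nonneg) (auto intro!: powr_mono2)
  qed
  have hint: "(\<integral>x. h x \<partial>PiM J M) = (\<integral>x. f x \<partial>PiM (insert j J) M)"
    unfolding h_def
    using I.integral_between(1)[OF f insert.prems(2,3)] by (intro psf.product_integral_insert[symmetric] insert(1,2))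
  have "(\<integral>x. \<Phi> x \<partial>PiM (insert j J) M) \<le> (\<integral>x. \<Psi> x \<partial>PiM J M)"
    unfolding eq1
  proof (rule integral_mono)
    interpret pj: pair_prob_space "PiM J M" "M j" ..
    have "integrable (PiM J M \<Otimes>\<^sub>M M j) (\<lambda>(x,t). \<Phi> (x(j := t)))"
    proof -
      show ?thesis
      proof (rule pj.integral_between(1)[of _ 0 "K powr e * (\<Prod>i\<in>insert j J. K powr s)"])
        show "(\<lambda>(x, t). \<Phi> (x(j := t))) \<in> borel_measurable (PiM J M \<Otimes>\<^sub>M M j)"
          using measurable_compose[OF madd \<Phi>m] by (simp add: split_beta')
        fix z assume z: "z \<in> space (PiM J M \<Otimes>\<^sub>M M j)"
        let ?x = "(fst z)(j := snd z)"
        have x: "?x \<in> space (PiM (insert j J) M)" using z upd by (auto simp: space_pair_measure)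
        show "0 \<le> (case z of (x, t) \<Rightarrow> \<Phi> (x(j := t)))" unfolding split_beta' by (rule \<Phi>0)
        show "(case z of (x, t) \<Rightarrow> \<Phi> (x(j := t))) \<le> K powr e * (\<Prod>i\<in>insert j J. K powr s)"
          unfolding split_beta' by (rule \<Phi>K[OF x])
      qed
    qed
    from pj.integrable_fst'[OF this] show "integrable (PiM J M) (\<lambda>x. \<integral>t. \<Phi> (x(j := t)) \<partial>M j)" by simp
  qed (use \<Psi>i inner in auto)
  also have "\<dots> \<le> (\<integral>x. h x \<partial>PiM J M) powr (e + s + real (card J) * s)"
    unfolding \<Psi>_def
  proof (rule insert.IH[OF hm hb])
    show "e + s + (real (card J) - 1) * s \<le> 1" using insert.prems(5) insert(1,2) by (simp add: algebra_simps)
  qed (use insert.prems assms in auto)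
  also have "e + s + real (card J) * s = e + real (card (insert j J)) * s"
    using insert(1,2) by (simp add: algebra_simps)
  finally show ?case unfolding hint \<Phi>_def F_def .
qed

text \<open>Averages are used in place of integrals: the local inequalities become scale invariant,
  and Hoelder exponents may add up to less than 1.\<close>

abbreviation unif :: "'a::euclidean_space \<Rightarrow> 'a \<Rightarrow> 'a measure" where
  "unif l u \<equiv> uniform_measure lborel (cbox l u)"

context
  fixes l u :: "'a::euclidean_space"
  assumes lu: "\<And>b. b \<in> Basis \<Longrightarrow> l \<bullet> b < u \<bullet> b"
begin

lemma emeasure_box_pos: "emeasure lborel (cbox l u) \<noteq> 0" "emeasure lborel (cbox l u) \<noteq> \<infinity>"
proof -
  have pos: "0 < (\<Prod>b\<in>Basis. (u - l) \<bullet> b)" using lu by (intro prod_pos) (auto simp: inner_diff_left)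
  have eq: "emeasure lborel (cbox l u) = ennreal (\<Prod>b\<in>Basis. (u - l) \<bullet> b)"
    using lu by (subst emeasure_lborel_cbox) (auto simp: less_imp_le)
  show "emeasure lborel (cbox l u) \<noteq> 0" unfolding eq ennreal_eq_0_iff using pos by linarith
qed (simp add: emeasure_lborel_cbox_eq)

lemma prob_space_unif: "prob_space (unif l u)"
  by (intro prob_space_uniform_measure emeasure_box_pos)

lemma AE_unif: "AE x in unif l u. x \<in> cbox l u"
  by (intro AE_uniform_measureI) auto

lemma integrable_unif_bounded:
  fixes f :: "'a \<Rightarrow> real"
  assumes "f \<in> borel_measurable borel" "\<And>x. x \<in> cbox l u \<Longrightarrow> \<bar>f x\<bar> \<le> K"
  shows "integrable (unif l u) f"
proof -
  interpret prob_space "unif l u" by (rule prob_space_unif)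
  have "AE x in unif l u. norm (f x) \<le> K" using AE_unif assms(2) by (auto elim!: eventually_mono)
  then show ?thesis using assms(1) by (intro integrable_const_bound[of _ K]) auto
qed

lemma integrable_unif_continuous:
  fixes f :: "'a \<Rightarrow> real"
  assumes "continuous_on UNIV f"
  shows "integrable (unif l u) f"
proof -
  have "bounded (f ` cbox l u)"
    using assms by (intro compact_imp_bounded compact_continuous_image) (auto intro: continuous_on_subset)
  then obtain K where "\<And>x. x \<in> cbox l u \<Longrightarrow> \<bar>f x\<bar> \<le> K" by (auto simp: bounded_iff)
  then show ?thesis using assms by (intro integrable_unif_bounded) (auto simp: borel_measurable_continuous_onI)
qed

text \<open>The normalised indicator of a box factors over the coordinates, so both measures agree
  on rectangles. This carries the product inequality over to Euclidean space.\<close>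

lemma unif_eq_distr_PiM:
  "unif l u = distr (PiM Basis (\<lambda>b. unif (l \<bullet> b) (u \<bullet> b))) borel (\<lambda>f. \<Sum>b\<in>Basis. f b *\<^sub>R b)"
proof -
  let ?P = "PiM Basis (\<lambda>b::'a. lborel :: real measure)"
  let ?T = "\<lambda>f::'a \<Rightarrow> real. \<Sum>b\<in>Basis. f b *\<^sub>R b"
  let ?g = "\<lambda>x::'a. indicator (cbox l u) x / emeasure lborel (cbox l u)"
  have T[measurable]: "?T \<in> measurable ?P borel" by measurable
  interpret L: product_sigma_finite "\<lambda>b::'a. lborel :: real measure" ..
  have pr: "prob_space (unif (l \<bullet> b) (u \<bullet> b))" if "b \<in> Basis" for b
    using lu[OF that] by (intro prob_space_uniform_measure) auto
  define M where "M b = (if b \<in> Basis then unif (l \<bullet> b) (u \<bullet> b) else lborel)" for b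
  interpret M: product_sigma_finite M
    by (intro product_sigma_finite.intro)
      (use pr prob_space_imp_sigma_finite lborel.sigma_finite_measure_axioms in \<open>auto simp: M_def\<close>)
  have PM: "PiM Basis (\<lambda>b. unif (l \<bullet> b) (u \<bullet> b)) = PiM Basis M"
    by (intro PiM_cong) (auto simp: M_def)
  have g: "?g (?T f) = (\<Prod>b\<in>Basis. indicator {l \<bullet> b..u \<bullet> b} (f b) / ennreal (u \<bullet> b - l \<bullet> b))" for f
  proof -
    have "(\<Prod>b\<in>Basis. indicator {l \<bullet> b..u \<bullet> b} (f b) / ennreal (u \<bullet> b - l \<bullet> b)) =
      (\<Prod>b\<in>Basis. ennreal (indicator {l \<bullet> b..u \<bullet> b} (f b) / (u \<bullet> b - l \<bullet> b)))"
      using lu by (intro prod.cong refl) (auto simp: indicator_def divide_ennreal[symmetric])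
    also have "\<dots> = ennreal (\<Prod>b\<in>Basis. indicator {l \<bullet> b..u \<bullet> b} (f b) / (u \<bullet> b - l \<bullet> b))"
      using lu by (intro prod_ennreal) (auto simp: less_imp_le)
    also have "\<dots> = ennreal ((\<Prod>b\<in>Basis. indicator {l \<bullet> b..u \<bullet> b} (f b)) / (\<Prod>b\<in>Basis. (u - l) \<bullet> b))"
      by (simp add: prod_dividef inner_diff_left)
    also have "(\<Prod>b\<in>Basis. indicator {l \<bullet> b..u \<bullet> b} (f b)) = (indicator (cbox l u) (?T f) :: real)"
      by (auto simp: cbox_def indicator_def)
    also have "ennreal (indicator (cbox l u) (?T f) / (\<Prod>b\<in>Basis. (u - l) \<bullet> b)) = ?g (?T f)"
    proof -
      have "0 < (\<Prod>b\<in>Basis. (u - l) \<bullet> b)" using lu by (intro prod_pos) (auto simp: inner_diff_left)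
      then show ?thesis using lu
        by (subst emeasure_lborel_cbox) (auto simp: less_imp_le indicator_def divide_ennreal[symmetric])
    qed
    finally show ?thesis by simp
  qed
  have dens: "density ?P (\<lambda>f. ?g (?T f)) = PiM Basis M"
  proof (rule M.PiM_eqI)
    show "sets (density ?P (\<lambda>f. ?g (?T f))) = sets (PiM Basis M)"
      by (simp, intro sets_PiM_cong) (auto simp: M_def)
    fix A assume A: "\<And>i. i \<in> Basis \<Longrightarrow> A i \<in> sets (M i)"
    then have A': "\<And>i. i \<in> Basis \<Longrightarrow> A i \<in> sets borel" by (auto simp: M_def)
    have "emeasure (density ?P (\<lambda>f. ?g (?T f))) (Pi\<^sub>E Basis A) = (\<integral>\<^sup>+f. ?g (?T f) * indicator (Pi\<^sub>E Basis A) f \<partial>?P)"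
      using A' by (intro emeasure_density sets_PiM_I_finite) auto
    also have "\<dots> = (\<integral>\<^sup>+f. (\<Prod>b\<in>Basis. indicator {l \<bullet> b..u \<bullet> b} (f b) / ennreal (u \<bullet> b - l \<bullet> b) * indicator (A b) (f b)) \<partial>?P)"
    proof (intro nn_integral_cong)
      fix f assume f: "f \<in> space ?P"
      have "indicator (Pi\<^sub>E Basis A) f = (\<Prod>b\<in>Basis. indicator (A b) (f b) :: ennreal)"
        using f by (auto simp: indicator_def PiE_iff space_PiM)
      then show "?g (?T f) * indicator (Pi\<^sub>E Basis A) f = (\<Prod>b\<in>Basis. indicator {l \<bullet> b..u \<bullet> b} (f b) / ennreal (u \<bullet> b - l \<bullet> b) * indicator (A b) (f b))"
        unfolding g by (simp add: prod.distrib)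
    qed
    also have "\<dots> = (\<Prod>b\<in>Basis. (\<integral>\<^sup>+t. indicator {l \<bullet> b..u \<bullet> b} t / ennreal (u \<bullet> b - l \<bullet> b) * indicator (A b) t \<partial>lborel))"
      using A' by (intro L.product_nn_integral_prod) auto
    also have "\<dots> = (\<Prod>b\<in>Basis. emeasure (M b) (A b))"
    proof (intro prod.cong refl)
      fix b :: 'a assume b: "b \<in> Basis"
      show "(\<integral>\<^sup>+t. indicator {l \<bullet> b..u \<bullet> b} t / ennreal (u \<bullet> b - l \<bullet> b) * indicator (A b) t \<partial>lborel) = emeasure (M b) (A b)"
        using lu[OF b] A'[OF b] b by (auto simp: M_def uniform_measure_def emeasure_density)
    qed
    finally show "emeasure (density ?P (\<lambda>f. ?g (?T f))) (Pi\<^sub>E Basis A) = (\<Prod>b\<in>Basis. emeasure (M b) (A b))" .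
  qed simp
  have "unif l u = density (distr ?P borel ?T) ?g"
    unfolding uniform_measure_def by (subst lborel_eq) simp
  also have "\<dots> = distr (density ?P (\<lambda>f. ?g (?T f))) borel ?T"
    by (rule density_distr) auto
  finally show ?thesis unfolding dens PM .
qed

text \<open>That \<open>w\<close> is bounded by the average of \<open>f\<close> along every
  coordinate line is what the fundamental theorem of calculus provides. Taking the power
  \<open>\<kappa> / N\<close> of each of the \<open>N\<close> line bounds and multiplying gives
  \<open>\<bar>w\<bar> powr \<kappa>\<close>, to which the product inequality applies with
  \<open>e = 0\<close>. The last hypothesis is the limit exponent \<open>N / (N - 1)\<close>,
  written without division so that it also makes sense for \<open>N = 1\<close>.\<close>

lemma loomis_whitney_box:
  fixes w f :: "'a \<Rightarrow> real"
  assumes w: "w \<in> borel_measurable borel" and f: "f \<in> borel_measurable borel"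
    and "0 < d" "\<And>x. d \<le> f x" "\<And>x. f x \<le> K"
    and le: "\<And>x b. x \<in> cbox l u \<Longrightarrow> b \<in> Basis \<Longrightarrow> \<bar>w x\<bar> \<le> (\<integral>t. f (x + (t - x \<bullet> b) *\<^sub>R b) \<partial>unif (l \<bullet> b) (u \<bullet> b))"
    and "0 < \<kappa>" "(real DIM('a) - 1) * (\<kappa> / DIM('a)) \<le> 1"
  shows "(\<integral>x. \<bar>w x\<bar> powr \<kappa> \<partial>unif l u) \<le> (\<integral>x. f x \<partial>unif l u) powr \<kappa>"
proof -
  \<comment> \<open>A point mass off the basis, so that every factor of the family is a probability
    measure.\<close>
  define M where "M b = (if b \<in> Basis then unif (l \<bullet> b) (u \<bullet> b) else return lborel 0)" for b :: 'a
  let ?T = "\<lambda>f::'a \<Rightarrow> real. \<Sum>b\<in>Basis. f b *\<^sub>R b"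
  have P: "prob_space (M b)" for b
    using lu[of b] by (auto simp: M_def emeasure_lborel_Icc_eq intro!: prob_space_uniform_measure prob_space_return)
  have Mb: "sets (M b) = sets borel" for b by (simp add: M_def)
  have U: "unif l u = distr (PiM Basis M) borel ?T"
  proof -
    have "PiM Basis (\<lambda>b. unif (l \<bullet> b) (u \<bullet> b)) = PiM Basis M"
      by (intro PiM_cong) (auto simp: M_def)
    then show ?thesis by (simp add: unif_eq_distr_PiM)
  qed
  have comp: "(\<lambda>x. x b) \<in> measurable (PiM Basis M) borel" if "b \<in> Basis" for b
    using measurable_component_singleton[OF that, of M] measurable_cong_sets[OF refl Mb[of b]] by blast
  have T: "?T \<in> measurable (PiM Basis M) borel"
    using comp by (intro borel_measurable_sum borel_measurable_scaleR) auto
  interpret U: prob_space "unif l u" by (rule prob_space_unif)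
  interpret P: prob_space "PiM Basis M" by (intro prob_space_PiM P)
  define s where "s = \<kappa> / DIM('a)"
  have s: "0 \<le> s" "0 < s" using assms by (auto simp: s_def)
  have fT: "(\<lambda>x. f (?T x)) \<in> borel_measurable (PiM Basis M)" using measurable_compose[OF T f] .
  define F where "F b x = (\<integral>t. f (?T (x(b := t))) \<partial>M b)" for b x
  have updT: "?T (x(b := t)) = ?T x + (t - ?T x \<bullet> b) *\<^sub>R b" if "b \<in> Basis" for x b t
  proof -
    have "?T (x(b := t)) = (\<Sum>c\<in>Basis. x c *\<^sub>R c + (if c = b then (t - x b) *\<^sub>R b else 0))"
      by (intro sum.cong refl) (auto simp: algebra_simps)
    also have "\<dots> = ?T x + (t - x b) *\<^sub>R b" using that by (simp add: sum.distrib)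
    finally show ?thesis using that by (simp add: inner_sum_left inner_Basis if_distrib sum.delta cong: if_cong)
  qed
  have lw: "(\<integral>x. f (?T x) powr 0 * (\<Prod>b\<in>Basis. (\<integral>t. f (?T (x(b := t))) \<partial>M b) powr s) \<partial>PiM Basis M)
     \<le> (\<integral>x. f (?T x) \<partial>PiM Basis M) powr (0 + real (card (Basis::'a set)) * s)"
    by (rule loomis_whitney[where d=d and K=K, OF P]) (use assms s fT in \<open>auto simp: s_def\<close>)
  \<comment> \<open>Needed for \<open>f powr 0 = 1\<close>, which fails at zeros of
    \<open>f\<close>.\<close>
  have fK: "f (?T x) \<noteq> 0" for x using assms(3) assms(4)[of "?T x"] by auto
  have "(\<integral>x. \<bar>w x\<bar> powr \<kappa> \<partial>unif l u) = (\<integral>x. \<bar>w (?T x)\<bar> powr \<kappa> \<partial>PiM Basis M)"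
    unfolding U using T w by (intro integral_distr) auto
  also have "\<dots> \<le> (\<integral>x. f (?T x) powr 0 * (\<Prod>b\<in>Basis. (\<integral>t. f (?T (x(b := t))) \<partial>M b) powr s) \<partial>PiM Basis M)"
  proof (rule integral_mono_AE)
    have AEQ: "AE x in PiM Basis M. ?T x \<in> cbox l u"
      using AE_unif unfolding U using T by (subst (asm) AE_distr_iff) auto
    have Fb: "d \<le> F b x" "F b x \<le> K" if "b \<in> Basis" "x \<in> space (PiM Basis M)" for b x
    proof -
      interpret b: prob_space "M b" by (rule P)
      have "(\<lambda>t. x(b := t)) \<in> measurable (M b) (PiM Basis M)"
        using that by (intro measurable_fun_upd[of _ Basis b]) (auto simp: insert_absorb)
      from measurable_compose[OF this fT] show "d \<le> F b x" "F b x \<le> K"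
        unfolding F_def using b.integral_between[of "\<lambda>t. f (?T (x(b := t)))" d K] assms by auto
    qed
    have Fm: "F b \<in> borel_measurable (PiM Basis M)" if "b \<in> Basis" for b
    proof -
      have "(\<lambda>z. (fst z)(b := snd z)) \<in> measurable (PiM Basis M \<Otimes>\<^sub>M M b) (PiM Basis M)"
        using that by (intro measurable_fun_upd[of _ Basis b]) (auto simp: insert_absorb)
      from measurable_compose[OF this fT]
      show ?thesis unfolding F_def
        by (intro sigma_finite_measure.borel_measurable_lebesgue_integral[OF prob_space_imp_sigma_finite[OF P]])
          (simp add: split_beta')
    qed
    have AEle: "AE x in PiM Basis M. \<bar>w (?T x)\<bar> powr \<kappa> \<le> f (?T x) powr 0 * (\<Prod>b\<in>Basis. F b x powr s)"
      using AEQ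
    proof eventually_elim
      case (elim x)
      have "\<bar>w (?T x)\<bar> powr \<kappa> = (\<Prod>b\<in>(Basis::'a set). \<bar>w (?T x)\<bar> powr s)"
      proof (cases "w (?T x) = 0")
        case False
        then show ?thesis by (simp add: s_def powr_power)
      qed (simp add: s_def)
      also have "\<dots> \<le> (\<Prod>b\<in>Basis. F b x powr s)"
      proof (intro prod_mono conjI powr_mono2)
        fix b :: 'a assume b: "b \<in> Basis"
        have "\<bar>w (?T x)\<bar> \<le> (\<integral>t. f (?T x + (t - ?T x \<bullet> b) *\<^sub>R b) \<partial>unif (l \<bullet> b) (u \<bullet> b))"
          by (rule le[OF elim b])
        also have "\<dots> = F b x" unfolding F_def updT[OF b] using b by (simp add: M_def)
        finally show "\<bar>w (?T x)\<bar> \<le> F b x" .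
      qed (use s in auto)
      finally show ?case using fK[of x] by simp
    qed
    then show "AE x in PiM Basis M. \<bar>w (?T x)\<bar> powr \<kappa> \<le> f (?T x) powr 0 * (\<Prod>b\<in>Basis. (\<integral>t. f (?T (x(b := t))) \<partial>M b) powr s)"
      by (simp add: F_def)
    show I: "integrable (PiM Basis M) (\<lambda>x. f (?T x) powr 0 * (\<Prod>b\<in>Basis. (\<integral>t. f (?T (x(b := t))) \<partial>M b) powr s))"
      unfolding F_def[symmetric]
    proof (rule P.integral_between(1)[of _ 0 "\<Prod>b\<in>(Basis::'a set). K powr s"])
      show "(\<lambda>x. f (?T x) powr 0 * (\<Prod>b\<in>Basis. F b x powr s)) \<in> borel_measurable (PiM Basis M)"
        using Fm fT by (intro borel_measurable_times borel_measurable_prod) auto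
      fix x assume x: "x \<in> space (PiM Basis M)"
      show "0 \<le> f (?T x) powr 0 * (\<Prod>b\<in>Basis. F b x powr s)" by (intro mult_nonneg_nonneg prod_nonneg) auto
      have "(\<Prod>b\<in>Basis. F b x powr s) \<le> (\<Prod>b\<in>(Basis::'a set). K powr s)"
        using Fb[OF _ x] s assms(3) by (intro prod_mono conjI powr_mono2) (auto intro: order_trans[OF less_imp_le])
      then show "f (?T x) powr 0 * (\<Prod>b\<in>Basis. F b x powr s) \<le> (\<Prod>b\<in>(Basis::'a set). K powr s)"
        using fK[of x] by simp
    qed
    show "integrable (PiM Basis M) (\<lambda>x. \<bar>w (?T x)\<bar> powr \<kappa>)"
      using AEle measurable_compose[OF T w]
      by (intro Bochner_Integration.integrable_bound[OF I[folded F_def]]) (auto elim!: eventually_mono)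
  qed
  also have "\<dots> \<le> (\<integral>x. f (?T x) \<partial>PiM Basis M) powr (0 + real (card (Basis::'a set)) * s)" by (rule lw)
  also have "\<dots> = (\<integral>x. f x \<partial>unif l u) powr \<kappa>"
    unfolding U using T f by (subst integral_distr) (auto simp: s_def)
  finally show ?thesis .
qed

end

lemma (in prob_space) holder2:
  fixes f g :: "'a \<Rightarrow> real"
  assumes "integrable M f" "integrable M g" "\<And>x. 0 \<le> f x" "\<And>x. 0 \<le> g x" "0 \<le> e1" "0 \<le> e2" "e1 + e2 \<le> 1"
  shows "integrable M (\<lambda>x. f x powr e1 * g x powr e2)"
    "expectation (\<lambda>x. f x powr e1 * g x powr e2) \<le> expectation f powr e1 * expectation g powr e2"
proof -
  let ?G = "\<lambda>i x. if i then f x else g x"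
  let ?e = "\<lambda>i. if i then e1 else e2"
  have G: "integrable M (?G i)" for i using assms by (cases i) auto
  have "integrable M (\<lambda>x. \<Prod>i\<in>UNIV. ?G i x powr ?e i)"
    using assms G by (intro integrable_prod_powr) (auto simp: UNIV_bool)
  then show "integrable M (\<lambda>x. f x powr e1 * g x powr e2)" by (simp add: UNIV_bool mult.commute)
  have "expectation (\<lambda>x. \<Prod>i\<in>UNIV. ?G i x powr ?e i) \<le> (\<Prod>i\<in>UNIV. expectation (?G i) powr ?e i)"
    using assms G by (intro expectation_prod_powr_le) (auto simp: UNIV_bool)
  then show "expectation (\<lambda>x. f x powr e1 * g x powr e2) \<le> expectation f powr e1 * expectation g powr e2"
    by (simp add: UNIV_bool mult.commute)
qed

section \<open>Sobolev and Poincare inequalities on boxes\<close>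

text \<open>Only derivatives along lines are ever integrated. They are required on \<open>K\<close>
  alone, because the gradient identity for mollified functions holds only away from the
  origin.\<close>

definition dir_deriv_on :: "'a::euclidean_space set \<Rightarrow> ('a \<Rightarrow> real) \<Rightarrow> ('a \<Rightarrow> 'a) \<Rightarrow> bool" where
  "dir_deriv_on K v G \<longleftrightarrow> continuous_on UNIV v \<and> continuous_on UNIV G \<and>
     (\<forall>z\<in>K. \<forall>h. ((\<lambda>t. v (z + t *\<^sub>R h)) has_real_derivative G z \<bullet> h) (at 0))"

lemma dir_deriv_onD:
  assumes "dir_deriv_on K v G" "x + t *\<^sub>R h \<in> K"
  shows "((\<lambda>t. v (x + t *\<^sub>R h)) has_real_derivative G (x + t *\<^sub>R h) \<bullet> h) (at t)"
proof -
  have "((\<lambda>s. v ((x + t *\<^sub>R h) + s *\<^sub>R h)) has_real_derivative G (x + t *\<^sub>R h) \<bullet> h) (at 0)"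
    using assms unfolding dir_deriv_on_def by blast
  then have "((\<lambda>s. v (x + (s + t) *\<^sub>R h)) has_real_derivative G (x + t *\<^sub>R h) \<bullet> h) (at 0)"
    by (simp add: scaleR_add_left add_ac)
  then show ?thesis using DERIV_shift[of "\<lambda>s. v (x + s *\<^sub>R h)" _ 0 t] by simp
qed

text \<open>Applying the mean value theorem to \<open>w - \<Phi>\<close> and
  \<open>w + \<Phi>\<close>, with \<open>\<Phi>\<close> a primitive of \<open>\<phi>\<close>, avoids
  integrating \<open>D\<close>, of which only the pointwise bound is known.\<close>

lemma line_bound:
  fixes w \<phi> :: "real \<Rightarrow> real"
  assumes D: "\<And>t. t \<in> {a..b} \<Longrightarrow> (w has_real_derivative D t) (at t within {a..b})"
    and bd: "\<And>t. t \<in> {a..b} \<Longrightarrow> \<bar>D t\<bar> \<le> \<phi> t" and \<phi>: "continuous_on {a..b} \<phi>"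
    and st: "s \<in> {a..b}" "t \<in> {a..b}"
  shows "\<bar>w s - w t\<bar> \<le> integral {a..b} \<phi>"
proof -
  define \<Phi> where "\<Phi> t = integral {a..t} \<phi>" for t
  have \<Phi>': "(\<Phi> has_real_derivative \<phi> t) (at t within {a..b})" if "t \<in> {a..b}" for t
    unfolding \<Phi>_def using integral_has_real_derivative[OF \<phi> that] .
  have \<phi>0: "0 \<le> \<phi> t" if "t \<in> {a..b}" for t using bd[OF that] by linarith
  have \<phi>i: "\<phi> integrable_on {a..b}" using \<phi> by (rule integrable_continuous_real)
  have mono: "\<Phi> y - \<Phi> x \<le> integral {a..b} \<phi>" if "a \<le> x" "x \<le> y" "y \<le> b" for x y
  proof -
    have i: "\<phi> integrable_on {a..x}" "\<phi> integrable_on {a..y}"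
      using that by (auto intro!: integrable_on_subinterval[OF \<phi>i])
    have "\<Phi> y \<le> integral {a..b} \<phi>"
      unfolding \<Phi>_def using that \<phi>0 \<phi>i i by (intro integral_subset_le) auto
    moreover have "0 \<le> \<Phi> x"
      unfolding \<Phi>_def using that \<phi>0 i by (intro integral_nonneg) auto
    ultimately show ?thesis by linarith
  qed
  have key: "\<bar>w y - w x\<bar> \<le> \<Phi> y - \<Phi> x" if xy: "a \<le> x" "x < y" "y \<le> b" for x y
  proof -
    have sub: "{x..y} \<subseteq> {a..b}" using xy by auto
    have d1: "((\<lambda>t. w t - \<Phi> t) has_derivative times (D t - \<phi> t)) (at t within {x..y})" if "x \<le> t" "t \<le> y" for t
      using DERIV_subset[OF DERIV_diff[OF D \<Phi>'] sub, of t] that xy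
      by (auto simp: has_field_derivative_def)
    obtain t where t: "t \<in> {x<..<y}" "(w y - \<Phi> y) - (w x - \<Phi> x) = (D t - \<phi> t) * (y - x)"
      using mvt_simple[OF xy(2) d1] by blast
    have "D t - \<phi> t \<le> 0" using bd[of t] t xy by auto
    then have 1: "(w y - \<Phi> y) - (w x - \<Phi> x) \<le> 0" unfolding t(2) using xy by (intro mult_nonpos_nonneg) auto
    have d2: "((\<lambda>t. w t + \<Phi> t) has_derivative times (D t + \<phi> t)) (at t within {x..y})" if "x \<le> t" "t \<le> y" for t
      using DERIV_subset[OF DERIV_add[OF D \<Phi>'] sub, of t] that xy
      by (auto simp: has_field_derivative_def)
    obtain t where t: "t \<in> {x<..<y}" "(w y + \<Phi> y) - (w x + \<Phi> x) = (D t + \<phi> t) * (y - x)"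
      using mvt_simple[OF xy(2) d2] by blast
    have "0 \<le> D t + \<phi> t" using bd[of t] t xy by auto
    then have 2: "0 \<le> (w y + \<Phi> y) - (w x + \<Phi> x)" unfolding t(2) using xy by (intro mult_nonneg_nonneg) auto
    from 1 2 show ?thesis by linarith
  qed
  consider "s = t" | "s < t" | "t < s" by linarith
  then show ?thesis
  proof cases
    case 1
    then show ?thesis using \<phi>0 by (auto intro!: integral_nonneg \<phi>i)
  next
    case 2
    then show ?thesis using key[of s t] mono[of s t] st by auto
  next
    case 3
    then show ?thesis using key[of t s] mono[of t s] st by auto
  qed
qed

lemma integral_unif:
  fixes f :: "'a::euclidean_space \<Rightarrow> real"
  assumes "f \<in> borel_measurable borel" "\<And>b. b \<in> Basis \<Longrightarrow> l \<bullet> b < u \<bullet> b"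
  shows "(\<integral>x. f x \<partial>unif l u) = (LINT x:cbox l u|lborel. f x) / measure lborel (cbox l u)"
proof -
  let ?m = "measure lborel (cbox l u)"
  have m: "emeasure lborel (cbox l u) = ennreal ?m"
    using emeasure_box_pos[of l u] assms(2) by (intro emeasure_eq_ennreal_measure) auto
  have m0: "0 < ?m" using emeasure_box_pos(1)[of l u] assms(2) unfolding m by (auto simp: zero_less_measure_iff m)
  have "unif l u = density lborel (\<lambda>x. ennreal (indicator (cbox l u) x / ?m))"
    unfolding uniform_measure_def m using m0
    by (intro density_cong) (auto simp: indicator_def divide_ennreal[symmetric])
  then have "(\<integral>x. f x \<partial>unif l u) = (\<integral>x. (indicator (cbox l u) x / ?m) *\<^sub>R f x \<partial>lborel)"
    using assms m0 by (simp add: integral_density)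
  also have "\<dots> = (LINT x:cbox l u|lborel. f x) / ?m"
    by (simp add: set_lebesgue_integral_def flip: Bochner_Integration.integral_divide_zero)
  finally show ?thesis .
qed

lemma integral_unif_real:
  fixes f :: "real \<Rightarrow> real"
  assumes "continuous_on UNIV f" "a < b"
  shows "integral {a..b} f = (b - a) * (\<integral>x. f x \<partial>unif a b)"
proof -
  have "set_integrable lborel {a..b} f"
    using assms by (intro borel_integrable_atLeastAtMost') (auto intro: continuous_on_subset)
  from set_borel_integral_eq_integral(2)[OF this] show ?thesis
    using assms by (subst integral_unif) (auto simp: borel_measurable_continuous_onI)
qed

text \<open>Loomis--Whitney is applied to \<open>w = V powr \<gamma>\<close>, which on every line is
  at most the average of \<open>w + L * \<gamma> * V powr (\<gamma> - 1) * g\<close>. Since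
  \<open>\<gamma> - 1 = s * (1 - 1 / p)\<close>, Hoelder's inequality extracts the same power
  \<open>1 - 1 / p\<close> of the integral \<open>X\<close> of \<open>V powr s\<close> from both
  terms. With \<open>\<kappa> = s / \<gamma>\<close> the left side is
  \<open>X powr (1 / \<kappa>)\<close>, where \<open>1 / \<kappa> = 1 - 1 / p + 1 / s\<close>, so
  division by the common power leaves \<open>X powr (1 / s)\<close>. The condition on
  \<open>s\<close> says exactly that \<open>\<kappa>\<close> is admissible. The lower bound
  \<open>d\<close> makes the powers of \<open>V\<close> differentiable and the division
  legitimate.\<close>

lemma sobolev_box:
  fixes V g :: "'a::euclidean_space \<Rightarrow> real"
  assumes lu: "\<And>b. b \<in> Basis \<Longrightarrow> l \<bullet> b < u \<bullet> b" and L: "\<And>b. b \<in> Basis \<Longrightarrow> u \<bullet> b - l \<bullet> b \<le> L"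
    and V: "continuous_on UNIV V" "0 < d" "\<And>x. d \<le> V x"
    and g: "continuous_on UNIV g" "\<And>x. 0 \<le> g x"
    and D: "\<And>x b t. x \<in> cbox l u \<Longrightarrow> b \<in> Basis \<Longrightarrow> t \<in> {l \<bullet> b..u \<bullet> b} \<Longrightarrow>
      \<exists>D. ((\<lambda>t. V (x + (t - x \<bullet> b) *\<^sub>R b)) has_real_derivative D) (at t within {l \<bullet> b..u \<bullet> b})
        \<and> \<bar>D\<bar> \<le> g (x + (t - x \<bullet> b) *\<^sub>R b)"
    and p: "1 \<le> p" and s: "p \<le> s" "1 / p - 1 / s \<le> 1 / DIM('a)"
  shows "(\<integral>x. V x powr s \<partial>unif l u) powr (1 / s) \<le>
    (\<integral>x. V x powr p \<partial>unif l u) powr (1 / p) + (1 + s * (1 - 1 / p)) * L * (\<integral>x. g x powr p \<partial>unif l u) powr (1 / p)"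
proof -
  interpret prob_space "unif l u" using lu by (rule prob_space_unif)
  define \<gamma> where "\<gamma> = 1 + s * (1 - 1 / p)"
  define \<kappa> where "\<kappa> = s / \<gamma>"
  have s0: "0 < s" using p s by linarith
  have \<gamma>: "1 \<le> \<gamma>" using p s0 by (simp add: \<gamma>_def)
  have \<kappa>: "0 < \<kappa>" using s0 \<gamma> by (simp add: \<kappa>_def)
  have i\<kappa>: "1 / \<kappa> = 1 - 1 / p + 1 / s"
    using s0 p \<gamma> by (simp add: \<kappa>_def \<gamma>_def field_simps)
  have \<kappa>N: "(real DIM('a) - 1) * (\<kappa> / DIM('a)) \<le> 1"
  proof -
    have "1 - 1 / DIM('a) \<le> 1 / \<kappa>" using s(2) i\<kappa> by linarith
    then have "(1 - 1 / DIM('a)) * \<kappa> \<le> 1" using \<kappa> by (simp add: field_simps)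
    then show ?thesis by (simp add: field_simps)
  qed
  have L0: "0 < L"
  proof -
    obtain b :: 'a where "b \<in> Basis" using nonempty_Basis by blast
    then show ?thesis using lu[of b] L[of b] by linarith
  qed
  have V0: "0 < V x" "V x \<noteq> 0" for x using V(2) V(3)[of x] by auto
  define w where "w x = V x powr \<gamma>" for x
  define \<phi> where "\<phi> x = \<gamma> * (V x powr (\<gamma> - 1) * g x)" for x
  define f where "f x = w x + L * \<phi> x" for x
  have cw: "continuous_on UNIV w" unfolding w_def using V V0 by (intro continuous_intros) auto
  have c\<phi>: "continuous_on UNIV \<phi>" unfolding \<phi>_def using V V0 g by (intro continuous_intros) auto
  have cf: "continuous_on UNIV f" unfolding f_def by (intro continuous_intros cw c\<phi>)
  have \<phi>0: "0 \<le> \<phi> x" for x using \<gamma> g by (simp add: \<phi>_def)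
  have f_ge: "d powr \<gamma> \<le> f x" for x
  proof -
    have "d powr \<gamma> \<le> w x" unfolding w_def using V(2,3) \<gamma> by (intro powr_mono2) auto
    then show ?thesis unfolding f_def using L0 \<phi>0[of x] by (smt (verit) mult_nonneg_nonneg)
  qed
  have "bounded (f ` cbox l u)"
    using cf by (intro compact_imp_bounded compact_continuous_image) (auto intro: continuous_on_subset)
  then obtain K where K: "\<And>x. x \<in> cbox l u \<Longrightarrow> \<bar>f x\<bar> \<le> K" by (auto simp: bounded_iff)
  \<comment> \<open>Loomis--Whitney asks for global bounds. The truncation changes \<open>f\<close>
    only outside the box and keeps the lower bound \<open>d powr \<gamma>\<close>.\<close>
  define f1 where "f1 x = min (f x) (max K (d powr \<gamma>))" for x
  have f1: "f1 x = f x" if "x \<in> cbox l u" for x using K[OF that] by (auto simp: f1_def)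
  have f1m: "f1 \<in> borel_measurable borel"
    unfolding f1_def using cf by (intro borel_measurable_min) (auto simp: borel_measurable_continuous_onI)
  have "(\<integral>x. \<bar>w x\<bar> powr \<kappa> \<partial>unif l u) \<le> (\<integral>x. f1 x \<partial>unif l u) powr \<kappa>"
  proof (rule loomis_whitney_box[OF lu _ f1m _ _ _ _ \<kappa> \<kappa>N])
    show "w \<in> borel_measurable borel" using cw by (auto simp: borel_measurable_continuous_onI)
    show "0 < d powr \<gamma>" using V by simp
    show "d powr \<gamma> \<le> f1 x" "f1 x \<le> max K (d powr \<gamma>)" for x using f_ge[of x] by (auto simp: f1_def)
    fix x b :: 'a assume x: "x \<in> cbox l u" and b: "b \<in> Basis"
    let ?l = "\<lambda>t. x + (t - x \<bullet> b) *\<^sub>R b"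
    let ?I = "{l \<bullet> b..u \<bullet> b}"
    define BB where "BB = unif (l \<bullet> b) (u \<bullet> b)"
    have B1: "\<And>c. c \<in> Basis \<Longrightarrow> (l \<bullet> b) \<bullet> c < (u \<bullet> b) \<bullet> c" using lu[OF b] by simp
    interpret B: prob_space BB unfolding BB_def using B1 by (rule prob_space_unif)
    have cl: "continuous_on UNIV (\<lambda>t. h (?l t))" if "continuous_on UNIV h" for h :: "'a \<Rightarrow> real"
      by (rule continuous_on_compose2[OF that]) (auto intro!: continuous_intros)
    have int: "integrable BB (\<lambda>t. h (?l t))" if "continuous_on UNIV h" for h :: "'a \<Rightarrow> real"
      unfolding BB_def by (rule integrable_unif_continuous[OF B1 cl[OF that]])
    have AEB: "AE t in BB. t \<in> ?I" unfolding BB_def using AE_unif[OF B1] by (simp only: cbox_interval)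
    have xb: "x \<bullet> b \<in> ?I" using x b by (auto simp: cbox_def)
    have lQ: "?l t \<in> cbox l u" if "t \<in> ?I" for t
      using x b that by (auto simp: cbox_def inner_add_left inner_Basis)
    have "\<forall>t\<in>?I. \<exists>D. ((\<lambda>t. V (?l t)) has_real_derivative D) (at t within ?I) \<and> \<bar>D\<bar> \<le> g (?l t)"
      using D[OF x b] by blast
    then obtain DD where DD: "\<And>t. t \<in> ?I \<Longrightarrow> ((\<lambda>t. V (?l t)) has_real_derivative DD t) (at t within ?I)"
      "\<And>t. t \<in> ?I \<Longrightarrow> \<bar>DD t\<bar> \<le> g (?l t)" by metis
    define c where "c = integral ?I (\<lambda>t. \<phi> (?l t))"
    have c_eq: "c = (u \<bullet> b - l \<bullet> b) * (\<integral>t. \<phi> (?l t) \<partial>BB)"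
      unfolding c_def BB_def using lu[OF b] by (intro integral_unif_real cl c\<phi>) auto
    have c_le: "c \<le> L * (\<integral>t. \<phi> (?l t) \<partial>BB)"
      unfolding c_eq using L[OF b] \<phi>0 by (intro mult_right_mono Bochner_Integration.integral_nonneg) auto
    have wle: "w x \<le> w (?l t) + c" if t: "t \<in> ?I" for t
    proof -
      have "\<bar>w (?l (x \<bullet> b)) - w (?l t)\<bar> \<le> c" unfolding c_def
      proof (rule line_bound[where w="\<lambda>t. w (?l t)" and \<phi>="\<lambda>t. \<phi> (?l t)" and D="\<lambda>t. \<gamma> * V (?l t) powr (\<gamma> - 1) * DD t"])
        fix t assume t: "t \<in> ?I"
        show "((\<lambda>t. w (?l t)) has_real_derivative \<gamma> * V (?l t) powr (\<gamma> - 1) * DD t) (at t within ?I)"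
          unfolding w_def by (rule DERIV_chain2[OF has_real_derivative_powr[OF V0(1)] DD(1)[OF t]])
        show "\<bar>\<gamma> * V (?l t) powr (\<gamma> - 1) * DD t\<bar> \<le> \<phi> (?l t)"
          unfolding \<phi>_def using \<gamma> DD(2)[OF t] by (simp add: abs_mult mult.assoc mult_left_mono)
      qed (use c\<phi> xb t in \<open>auto intro: continuous_on_subset cl\<close>)
      then show ?thesis by auto
    qed
    have "w x = (\<integral>t. w x \<partial>BB)" by (simp add: B.prob_space)
    also have "\<dots> \<le> (\<integral>t. w (?l t) + c \<partial>BB)"
    proof (rule integral_mono_AE)
      show "AE t in BB. w x \<le> w (?l t) + c" using AEB by eventually_elim (rule wle)
    qed (use int[OF cw] in auto)
    also have "\<dots> = (\<integral>t. w (?l t) \<partial>BB) + c" using int[OF cw] by (simp add: B.prob_space)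
    also have "\<dots> \<le> (\<integral>t. w (?l t) \<partial>BB) + L * (\<integral>t. \<phi> (?l t) \<partial>BB)" using c_le by simp
    also have "\<dots> = (\<integral>t. f (?l t) \<partial>BB)" unfolding f_def using int[OF cw] int[OF c\<phi>] by simp
    also have "\<dots> = (\<integral>t. f1 (?l t) \<partial>BB)"
    proof (rule integral_cong_AE)
      show "(\<lambda>t. f (?l t)) \<in> borel_measurable BB" using int[OF cf] by auto
      show "(\<lambda>t. f1 (?l t)) \<in> borel_measurable BB"
        by (rule measurable_compose[OF _ f1m]) (simp add: BB_def)
      show "AE t in BB. f (?l t) = f1 (?l t)" using AEB by eventually_elim (simp add: f1 lQ)
    qed
    finally show "\<bar>w x\<bar> \<le> (\<integral>t. f1 (?l t) \<partial>unif (l \<bullet> b) (u \<bullet> b))"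
      unfolding BB_def by (simp add: w_def)
  qed
  also have "(\<integral>x. f1 x \<partial>unif l u) = (\<integral>x. f x \<partial>unif l u)"
    using AE_unif[OF lu] f1m borel_measurable_continuous_onI[OF cf]
    by (intro integral_cong_AE) (auto elim!: eventually_mono simp: f1)
  finally have LW: "(\<integral>x. \<bar>w x\<bar> powr \<kappa> \<partial>unif l u) \<le> (\<integral>x. f x \<partial>unif l u) powr \<kappa>" .
  define X where "X = (\<integral>x. V x powr s \<partial>unif l u)"
  have cVs: "continuous_on UNIV (\<lambda>x. V x powr a)" for a using V V0 by (intro continuous_intros) auto
  have ig: "integrable (unif l u) h" if "continuous_on UNIV h" for h :: "'a \<Rightarrow> real"
    by (rule integrable_unif_continuous[OF lu that])
  have cgp: "continuous_on UNIV (\<lambda>x. g x powr p)" using g p by (intro continuous_on_powr') (auto intro!: continuous_intros)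
  have X: "0 < X"
  proof -
    have "(\<integral>x. d powr s \<partial>unif l u) \<le> X"
      unfolding X_def using V(2,3) s0 by (intro integral_mono ig cVs) (auto intro!: powr_mono2)
    moreover have "0 < d powr s" using V by simp
    moreover have "(\<integral>x. d powr s \<partial>unif l u) = d powr s" using prob_space by simp
    ultimately show ?thesis by linarith
  qed
  have XL: "X = (\<integral>x. \<bar>w x\<bar> powr \<kappa> \<partial>unif l u)"
    unfolding X_def w_def using s0 \<gamma> by (simp add: powr_powr \<kappa>_def)
  have f0: "0 \<le> (\<integral>x. f x \<partial>unif l u)" using order_trans[OF powr_ge_zero f_ge] by (intro Bochner_Integration.integral_nonneg) auto
  have "X powr (1 / \<kappa>) \<le> ((\<integral>x. f x \<partial>unif l u) powr \<kappa>) powr (1 / \<kappa>)"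
    using LW X \<kappa> unfolding XL[symmetric] by (intro powr_mono2) auto
  also have "\<dots> = (\<integral>x. f x \<partial>unif l u)" using f0 \<kappa> by (simp add: powr_powr)
  also have "\<dots> = (\<integral>x. w x \<partial>unif l u) + L * (\<gamma> * (\<integral>x. V x powr (\<gamma> - 1) * g x \<partial>unif l u))"
  proof -
    have "(\<integral>x. f x \<partial>unif l u) = (\<integral>x. w x \<partial>unif l u) + L * (\<integral>x. \<phi> x \<partial>unif l u)"
      unfolding f_def using ig[OF cw] ig[OF c\<phi>] by simp
    then show ?thesis by (simp add: \<phi>_def)
  qed
  also have "\<dots> \<le> X powr (1 - 1 / p) * (\<integral>x. V x powr p \<partial>unif l u) powr (1 / p)
      + L * (\<gamma> * (X powr (1 - 1 / p) * (\<integral>x. g x powr p \<partial>unif l u) powr (1 / p)))"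
  proof (intro add_mono mult_left_mono)
    have "(\<integral>x. w x \<partial>unif l u) = (\<integral>x. (V x powr s) powr (1 - 1 / p) * (V x powr p) powr (1 / p) \<partial>unif l u)"
    proof (rule Bochner_Integration.integral_cong[OF refl])
      fix x
      have "\<gamma> = s * (1 - 1 / p) + p * (1 / p)" using p by (simp add: \<gamma>_def)
      then show "w x = (V x powr s) powr (1 - 1 / p) * (V x powr p) powr (1 / p)"
        unfolding w_def powr_powr by (simp only: powr_add)
    qed
    also have "\<dots> \<le> X powr (1 - 1 / p) * (\<integral>x. V x powr p \<partial>unif l u) powr (1 / p)"
      unfolding X_def using p by (intro holder2 ig cVs) auto
    finally show "(\<integral>x. w x \<partial>unif l u) \<le> X powr (1 - 1 / p) * (\<integral>x. V x powr p \<partial>unif l u) powr (1 / p)" .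
    have "(\<integral>x. V x powr (\<gamma> - 1) * g x \<partial>unif l u) = (\<integral>x. (V x powr s) powr (1 - 1 / p) * (g x powr p) powr (1 / p) \<partial>unif l u)"
      using p g by (intro Bochner_Integration.integral_cong refl) (simp add: powr_powr \<gamma>_def)
    also have "\<dots> \<le> X powr (1 - 1 / p) * (\<integral>x. g x powr p \<partial>unif l u) powr (1 / p)"
      unfolding X_def using p by (intro holder2 ig cVs cgp) auto
    finally show "(\<integral>x. V x powr (\<gamma> - 1) * g x \<partial>unif l u) \<le> X powr (1 - 1 / p) * (\<integral>x. g x powr p \<partial>unif l u) powr (1 / p)" .
  qed (use L0 \<gamma> in auto)
  also have "\<dots> = X powr (1 - 1 / p) * ((\<integral>x. V x powr p \<partial>unif l u) powr (1 / p) + \<gamma> * L * (\<integral>x. g x powr p \<partial>unif l u) powr (1 / p))"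
    by (simp add: algebra_simps)
  finally have "X powr (1 - 1 / p) * X powr (1 / s) \<le> X powr (1 - 1 / p) * ((\<integral>x. V x powr p \<partial>unif l u) powr (1 / p) + \<gamma> * L * (\<integral>x. g x powr p \<partial>unif l u) powr (1 / p))"
    unfolding i\<kappa> powr_add .
  then show ?thesis using X unfolding X_def[symmetric] \<gamma>_def[symmetric] by simp
qed

section \<open>Jensen's inequality and the Poincare inequality on convex sets\<close>

lemma (in prob_space) jensen_powr:
  fixes f :: "'a \<Rightarrow> real"
  assumes "integrable M (\<lambda>x. f x powr p)" "\<And>x. 0 \<le> f x" "1 \<le> p"
  shows "expectation f powr p \<le> expectation (\<lambda>x. f x powr p)"
proof -
  have "expectation (\<lambda>x. (f x powr p) powr (1 / p) * 1 powr 0) \<le> expectation (\<lambda>x. f x powr p) powr (1 / p) * expectation (\<lambda>x. 1) powr 0"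
    using assms by (intro holder2) auto
  then have "expectation f \<le> expectation (\<lambda>x. f x powr p) powr (1 / p)"
    using assms by (simp add: powr_powr prob_space)
  then have "expectation f powr p \<le> (expectation (\<lambda>x. f x powr p) powr (1 / p)) powr p"
    using assms by (intro powr_mono2 Bochner_Integration.integral_nonneg) auto
  also have "\<dots> = expectation (\<lambda>x. f x powr p)"
    using assms by (simp add: powr_powr Bochner_Integration.integral_nonneg)
  finally show ?thesis .
qed

lemma nn_integral_affine:
  fixes f :: "'a::euclidean_space \<Rightarrow> ennreal"
  assumes [measurable]: "f \<in> borel_measurable borel" and "0 < c"
  shows "(\<integral>\<^sup>+y. f (x + c *\<^sub>R y) \<partial>lborel) = ennreal (1 / c ^ DIM('a)) * (\<integral>\<^sup>+y. f y \<partial>lborel)"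
proof -
  have "(\<integral>\<^sup>+y. f y \<partial>lborel) = ennreal (c ^ DIM('a)) * (\<integral>\<^sup>+y. f (x + c *\<^sub>R y) \<partial>lborel)"
    using assms(2) by (subst lborel_affine[of c x]) (auto simp: nn_integral_density nn_integral_distr nn_integral_cmult)
  then have "ennreal (1 / c ^ DIM('a)) * (\<integral>\<^sup>+y. f y \<partial>lborel) = (ennreal (1 / c ^ DIM('a)) * ennreal (c ^ DIM('a))) * (\<integral>\<^sup>+y. f (x + c *\<^sub>R y) \<partial>lborel)"
    by (simp add: mult.assoc)
  also have "ennreal (1 / c ^ DIM('a)) * ennreal (c ^ DIM('a)) = 1"
    using assms(2) by (subst ennreal_mult[symmetric]) auto
  finally show ?thesis by simp
qed

lemma segment_bound:
  fixes v :: "'a::euclidean_space \<Rightarrow> real"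
  assumes v: "dir_deriv_on K v G" and K: "convex K" "x \<in> K" "y \<in> K" and D: "dist x y \<le> D" and p: "1 \<le> p"
  shows "ennreal (\<bar>v x - v y\<bar> powr p) \<le> ennreal (D powr p) * (\<integral>\<^sup>+t\<in>{0..1}. ennreal (norm (G ((1 - t) *\<^sub>R x + t *\<^sub>R y)) powr p) \<partial>lborel)"
proof -
  define h where "h t = norm (G ((1 - t) *\<^sub>R x + t *\<^sub>R y))" for t
  have cG: "continuous_on UNIV G" using v by (simp add: dir_deriv_on_def)
  have ch: "continuous_on UNIV h"
    unfolding h_def by (intro continuous_on_norm continuous_on_compose2[OF cG]) (auto intro!: continuous_intros)
  have chp: "continuous_on UNIV (\<lambda>t. h t powr p)"
    using ch p by (intro continuous_on_powr') (auto intro!: continuous_intros simp: h_def)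
  have seg: "(1 - t) *\<^sub>R x + t *\<^sub>R y = x + t *\<^sub>R (y - x)" for t by (simp add: algebra_simps)
  have "\<bar>(\<lambda>t. v (x + t *\<^sub>R (y - x))) 0 - (\<lambda>t. v (x + t *\<^sub>R (y - x))) 1\<bar> \<le> integral {0..1} (\<lambda>t. D * h t)"
  proof (rule line_bound[where w="\<lambda>t. v (x + t *\<^sub>R (y - x))" and D="\<lambda>t. G (x + t *\<^sub>R (y - x)) \<bullet> (y - x)"])
    fix t :: real assume t: "t \<in> {0..1}"
    have "x + t *\<^sub>R (y - x) \<in> K" using convexD_alt[OF K, of t] t by (simp add: seg)
    from dir_deriv_onD[OF v this]
    show "((\<lambda>t. v (x + t *\<^sub>R (y - x))) has_real_derivative G (x + t *\<^sub>R (y - x)) \<bullet> (y - x)) (at t within {0..1})"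
      by (rule has_field_derivative_at_within)
    have "\<bar>G (x + t *\<^sub>R (y - x)) \<bullet> (y - x)\<bar> \<le> norm (G (x + t *\<^sub>R (y - x))) * norm (y - x)"
      by (rule Cauchy_Schwarz_ineq2)
    also have "\<dots> \<le> norm (G (x + t *\<^sub>R (y - x))) * D"
      using D by (intro mult_left_mono) (auto simp: dist_norm norm_minus_commute)
    finally show "\<bar>G (x + t *\<^sub>R (y - x)) \<bullet> (y - x)\<bar> \<le> D * h t" by (simp add: h_def seg mult.commute)
  qed (use ch in \<open>auto intro!: continuous_intros intro: continuous_on_subset\<close>)
  also have "\<dots> = D * (\<integral>t. h t \<partial>unif 0 1)"
    using integral_unif_real[OF ch, of 0 1] by simp
  finally have 1: "\<bar>v x - v y\<bar> \<le> D * (\<integral>t. h t \<partial>unif 0 1)" by simp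
  interpret U: prob_space "unif 0 (1::real)" by (rule prob_space_unif) auto
  have ip: "integrable (unif 0 (1::real)) (\<lambda>t. h t powr p)" by (rule integrable_unif_continuous[OF _ chp]) auto
  have "\<bar>v x - v y\<bar> powr p \<le> (D * (\<integral>t. h t \<partial>unif 0 1)) powr p" using 1 p by (intro powr_mono2) auto
  also have "\<dots> = D powr p * (\<integral>t. h t \<partial>unif 0 1) powr p"
    by (rule powr_mult)
  also have "\<dots> \<le> D powr p * (\<integral>t. h t powr p \<partial>unif 0 1)"
    using p ip by (intro mult_left_mono U.jensen_powr) (auto simp: h_def)
  finally have "ennreal (\<bar>v x - v y\<bar> powr p) \<le> ennreal (D powr p) * ennreal (\<integral>t. h t powr p \<partial>unif 0 1)"
    by (simp add: ennreal_leI flip: ennreal_mult')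
  also have "ennreal (\<integral>t. h t powr p \<partial>unif 0 1) = (\<integral>\<^sup>+t. ennreal (h t powr p) \<partial>unif 0 1)"
    using ip by (intro nn_integral_eq_integral[symmetric]) auto
  also have "\<dots> = (\<integral>\<^sup>+t\<in>{0..1}. ennreal (h t powr p) \<partial>lborel)"
    using borel_measurable_continuous_onI[OF chp] by (subst nn_integral_uniform_measure) (auto simp: divide_ennreal_def)
  finally show ?thesis by (simp add: h_def)
qed

text \<open>The bound along segments is integrated over both endpoints. At parameter
  \<open>t >= 1 / 2\<close> the intermediate point is substituted for \<open>y\<close>, otherwise
  for \<open>x\<close>; in either case the Jacobian contributes at most \<open>2 ^ N\<close>, and
  the other endpoint contributes the volume of \<open>K\<close>.\<close>

lemma poincare_pair:
  fixes v :: "'a::euclidean_space \<Rightarrow> real"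
  assumes v: "dir_deriv_on K v G" and K: "convex K" "compact K" and D: "\<And>x y. x \<in> K \<Longrightarrow> y \<in> K \<Longrightarrow> dist x y \<le> D" and p: "1 \<le> p"
  shows "(\<integral>\<^sup>+x\<in>K. (\<integral>\<^sup>+y\<in>K. ennreal (\<bar>v x - v y\<bar> powr p) \<partial>lborel) \<partial>lborel)
    \<le> ennreal (D powr p * 2 ^ DIM('a)) * emeasure lborel K * (\<integral>\<^sup>+x\<in>K. ennreal (norm (G x) powr p) \<partial>lborel)"
proof -
  have cG: "continuous_on UNIV G" using v by (simp add: dir_deriv_on_def)
  have [measurable]: "G \<in> borel_measurable borel" using cG by (rule borel_measurable_continuous_onI)
  have [measurable]: "K \<in> sets borel" using K by (simp add: compact_imp_closed)
  \<comment> \<open>Convexity keeps the segments in \<open>K\<close>, so cutting off there loses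
    nothing and allows substitution over the whole space.\<close>
  define H where "H z = ennreal (norm (G z) powr p) * indicator K z" for z
  have [measurable]: "H \<in> borel_measurable borel" unfolding H_def by measurable
  define J where "J = (\<integral>\<^sup>+x. H x \<partial>lborel)"
  define c where "c t x y = H ((1 - t) *\<^sub>R x + t *\<^sub>R y) * indicator K x * indicator K y * indicator {0..1} t" for t :: real and x y
  have cm[measurable]: "(\<lambda>(t, x, y). c t x y) \<in> borel_measurable (lborel \<Otimes>\<^sub>M lborel \<Otimes>\<^sub>M lborel)"
    unfolding c_def by measurable
  have "pair_sigma_finite (lborel::'a measure) (lborel::real measure)" "pair_sigma_finite (lborel::'a measure) (lborel::'a measure)"
    by (intro pair_sigma_finite.intro lborel.sigma_finite_measure_axioms)+
  note XT_Fubini = pair_sigma_finite.Fubini'[OF this(1)] and XX_Fubini = pair_sigma_finite.Fubini'[OF this(2)]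
  have scale: "(\<integral>\<^sup>+y. H (x + t *\<^sub>R y) \<partial>lborel) \<le> 2 ^ DIM('a) * J" if "1 / 2 \<le> t" for x t
  proof -
    have "1 / t ^ DIM('a) = (1 / t) ^ DIM('a)" by (simp add: power_one_over)
    also have "\<dots> \<le> 2 ^ DIM('a)" using that by (intro power_mono) (auto simp: field_simps)
    finally have "ennreal (1 / t ^ DIM('a)) \<le> 2 ^ DIM('a)"
      by (metis ennreal_leI ennreal_numeral ennreal_power zero_le_numeral)
    then show ?thesis using that by (subst nn_integral_affine) (auto simp: J_def intro!: mult_right_mono)
  qed
  have inner: "(\<integral>\<^sup>+x. (\<integral>\<^sup>+y. c t x y \<partial>lborel) \<partial>lborel) \<le> (2 ^ DIM('a) * J * emeasure lborel K) * indicator {0..1} t" for t :: real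
  proof (cases "t \<in> {0..1}")
    case True
    show ?thesis
    proof (cases "1 / 2 \<le> t")
      case True
      have "(\<integral>\<^sup>+x. (\<integral>\<^sup>+y. c t x y \<partial>lborel) \<partial>lborel) \<le> (\<integral>\<^sup>+x. (2 ^ DIM('a) * J) * indicator K x \<partial>lborel)"
      proof (intro nn_integral_mono)
        fix x :: 'a
        have "(\<integral>\<^sup>+y. c t x y \<partial>lborel) \<le> (\<integral>\<^sup>+y. H ((1 - t) *\<^sub>R x + t *\<^sub>R y) * indicator K x \<partial>lborel)"
          unfolding c_def by (intro nn_integral_mono) (auto simp: indicator_def)
        also have "\<dots> = (\<integral>\<^sup>+y. H ((1 - t) *\<^sub>R x + t *\<^sub>R y) \<partial>lborel) * indicator K x"
          by (rule nn_integral_multc) measurable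
        also have "\<dots> \<le> (2 ^ DIM('a) * J) * indicator K x" using scale[OF True] by (intro mult_right_mono) auto
        finally show "(\<integral>\<^sup>+y. c t x y \<partial>lborel) \<le> (2 ^ DIM('a) * J) * indicator K x" .
      qed
      also have "\<dots> = 2 ^ DIM('a) * J * emeasure lborel K" by (rule nn_integral_cmult_indicator) measurable
      finally show ?thesis using \<open>t \<in> {0..1}\<close> by simp
    next
      case False
      have "(\<integral>\<^sup>+x. (\<integral>\<^sup>+y. c t x y \<partial>lborel) \<partial>lborel) = (\<integral>\<^sup>+y. (\<integral>\<^sup>+x. c t x y \<partial>lborel) \<partial>lborel)"
        by (intro XX_Fubini[symmetric]) (unfold c_def, measurable)
      also have "\<dots> \<le> (\<integral>\<^sup>+y. (2 ^ DIM('a) * J) * indicator K y \<partial>lborel)"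
      proof (intro nn_integral_mono)
        fix y :: 'a
        have "(\<integral>\<^sup>+x. c t x y \<partial>lborel) \<le> (\<integral>\<^sup>+x. H (t *\<^sub>R y + (1 - t) *\<^sub>R x) * indicator K y \<partial>lborel)"
          unfolding c_def by (intro nn_integral_mono) (auto simp: indicator_def add.commute)
        also have "\<dots> = (\<integral>\<^sup>+x. H (t *\<^sub>R y + (1 - t) *\<^sub>R x) \<partial>lborel) * indicator K y"
          by (rule nn_integral_multc) measurable
        also have "\<dots> \<le> (2 ^ DIM('a) * J) * indicator K y" using scale[of "1 - t"] False by (intro mult_right_mono) auto
        finally show "(\<integral>\<^sup>+x. c t x y \<partial>lborel) \<le> (2 ^ DIM('a) * J) * indicator K y" .
      qed
      also have "\<dots> = 2 ^ DIM('a) * J * emeasure lborel K" by (rule nn_integral_cmult_indicator) measurable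
      finally show ?thesis using \<open>t \<in> {0..1}\<close> by simp
    qed
  qed (simp add: c_def)
  have "(\<integral>\<^sup>+x. (\<integral>\<^sup>+y. (\<integral>\<^sup>+t. c t x y \<partial>lborel) \<partial>lborel) \<partial>lborel) = (\<integral>\<^sup>+x. (\<integral>\<^sup>+t. (\<integral>\<^sup>+y. c t x y \<partial>lborel) \<partial>lborel) \<partial>lborel)"
    by (intro nn_integral_cong XT_Fubini[symmetric] XT_Fubini) (unfold c_def, measurable)
  also have "\<dots> = (\<integral>\<^sup>+t. (\<integral>\<^sup>+x. (\<integral>\<^sup>+y. c t x y \<partial>lborel) \<partial>lborel) \<partial>lborel)"
    by (intro XT_Fubini[symmetric]) (unfold c_def, measurable)
  also have "\<dots> \<le> (\<integral>\<^sup>+t. (2 ^ DIM('a) * J * emeasure lborel K) * indicator {0..1::real} t \<partial>lborel)"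
    by (rule nn_integral_mono) (rule inner)
  also have "\<dots> = 2 ^ DIM('a) * J * emeasure lborel K"
    by (subst nn_integral_cmult_indicator) auto
  finally have chain: "(\<integral>\<^sup>+x. (\<integral>\<^sup>+y. (\<integral>\<^sup>+t. c t x y \<partial>lborel) \<partial>lborel) \<partial>lborel) \<le> 2 ^ DIM('a) * J * emeasure lborel K" .
  have "(\<integral>\<^sup>+x\<in>K. (\<integral>\<^sup>+y\<in>K. ennreal (\<bar>v x - v y\<bar> powr p) \<partial>lborel) \<partial>lborel)
     \<le> (\<integral>\<^sup>+x. (\<integral>\<^sup>+y. ennreal (D powr p) * (\<integral>\<^sup>+t. c t x y \<partial>lborel) \<partial>lborel) \<partial>lborel)"
  proof (rule nn_integral_mono)
    fix x
    show "(\<integral>\<^sup>+y\<in>K. ennreal (\<bar>v x - v y\<bar> powr p) \<partial>lborel) * indicator K x \<le> (\<integral>\<^sup>+y. ennreal (D powr p) * (\<integral>\<^sup>+t. c t x y \<partial>lborel) \<partial>lborel)"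
    proof (cases "x \<in> K")
      case x: True
      have "(\<integral>\<^sup>+y\<in>K. ennreal (\<bar>v x - v y\<bar> powr p) \<partial>lborel) \<le> (\<integral>\<^sup>+y. ennreal (D powr p) * (\<integral>\<^sup>+t. c t x y \<partial>lborel) \<partial>lborel)"
      proof (rule nn_integral_mono)
        fix y
        show "ennreal (\<bar>v x - v y\<bar> powr p) * indicator K y \<le> ennreal (D powr p) * (\<integral>\<^sup>+t. c t x y \<partial>lborel)"
        proof (cases "y \<in> K")
          case y: True
          have "ennreal (\<bar>v x - v y\<bar> powr p) \<le> ennreal (D powr p) * (\<integral>\<^sup>+t\<in>{0..1}. ennreal (norm (G ((1 - t) *\<^sub>R x + t *\<^sub>R y)) powr p) \<partial>lborel)"
            by (rule segment_bound[OF v K(1) x y D[OF x y] p])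
          also have "(\<integral>\<^sup>+t\<in>{0..1}. ennreal (norm (G ((1 - t) *\<^sub>R x + t *\<^sub>R y)) powr p) \<partial>lborel) = (\<integral>\<^sup>+t. c t x y \<partial>lborel)"
          proof (rule nn_integral_cong)
            fix t :: real
            show "ennreal (norm (G ((1 - t) *\<^sub>R x + t *\<^sub>R y)) powr p) * indicator {0..1} t = c t x y"
              using convexD_alt[OF K(1) x y, of t] x y by (auto simp: c_def H_def indicator_def)
          qed
          finally show ?thesis using y by simp
        qed simp
      qed
      then show ?thesis using x by simp
    qed simp
  qed
  also have "\<dots> = ennreal (D powr p) * (\<integral>\<^sup>+x. (\<integral>\<^sup>+y. (\<integral>\<^sup>+t. c t x y \<partial>lborel) \<partial>lborel) \<partial>lborel)"
  proof -
    have "(\<integral>\<^sup>+y. ennreal (D powr p) * (\<integral>\<^sup>+t. c t x y \<partial>lborel) \<partial>lborel) = ennreal (D powr p) * (\<integral>\<^sup>+y. (\<integral>\<^sup>+t. c t x y \<partial>lborel) \<partial>lborel)" for x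
      by (intro nn_integral_cmult) (unfold c_def, measurable)
    then show ?thesis by (simp add: nn_integral_cmult c_def)
  qed
  also have "\<dots> \<le> ennreal (D powr p) * (2 ^ DIM('a) * J * emeasure lborel K)"
    by (rule mult_left_mono[OF chain]) simp
  finally show ?thesis
    unfolding J_def H_def by (simp add: ennreal_mult' mult_ac flip: ennreal_power)
qed

lemma ennreal_integral_le:
  fixes f :: "'a \<Rightarrow> real"
  assumes "f \<in> borel_measurable M" "\<And>x. 0 \<le> f x"
  shows "ennreal (\<integral>x. f x \<partial>M) \<le> (\<integral>\<^sup>+x. ennreal (f x) \<partial>M)"
  using assms by (subst integral_eq_nn_integral) (auto simp: ennreal_enn2real_if)

lemma measure_box:
  assumes "\<And>b. b \<in> Basis \<Longrightarrow> l \<bullet> b < u \<bullet> b"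
  shows "0 < measure lborel (cbox l u)" "emeasure lborel (cbox l u) = ennreal (measure lborel (cbox l u))"
proof -
  show m: "emeasure lborel (cbox l u) = ennreal (measure lborel (cbox l u))"
    using emeasure_box_pos[of l u] assms by (intro emeasure_eq_ennreal_measure) auto
  show "0 < measure lborel (cbox l u)"
    using emeasure_box_pos(1)[of l u] assms unfolding m by (auto simp: zero_less_measure_iff m)
qed

lemma nn_integral_unif:
  fixes f :: "'a::euclidean_space \<Rightarrow> ennreal"
  assumes "\<And>b. b \<in> Basis \<Longrightarrow> l \<bullet> b < u \<bullet> b" "f \<in> borel_measurable borel"
  shows "(\<integral>\<^sup>+x. f x \<partial>unif l u) = ennreal (1 / measure lborel (cbox l u)) * (\<integral>\<^sup>+x\<in>cbox l u. f x \<partial>lborel)"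
  using assms(2) measure_box[OF assms(1)]
  by (subst nn_integral_uniform_measure) (auto simp: divide_ennreal_def inverse_ennreal mult.commute inverse_eq_divide)

lemma continuous_on_powr_const:
  fixes h :: "'a::topological_space \<Rightarrow> real"
  assumes "continuous_on S h" "\<And>x. 0 \<le> h x" "0 < a"
  shows "continuous_on S (\<lambda>x. h x powr a)"
  using assms by (intro continuous_on_powr') (auto intro!: continuous_intros)

text \<open>The form with two boxes and a 1-Lipschitz \<open>\<phi>\<close> serves two purposes.
  Equal boxes and the identity give the Poincare inequality; two neighbouring boxes and
  \<open>\<phi> = abs\<close> compare the means of \<open>\<bar>v\<bar>\<close>.\<close>

lemma mean_oscillation:
  fixes v :: "'a::euclidean_space \<Rightarrow> real" and \<phi> :: "real \<Rightarrow> real"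
  assumes v: "dir_deriv_on K v G" and K: "convex K" "compact K" and D: "\<And>x y. x \<in> K \<Longrightarrow> y \<in> K \<Longrightarrow> dist x y \<le> D" and p: "1 \<le> p"
    and b1: "\<And>b. b \<in> Basis \<Longrightarrow> l1 \<bullet> b < u1 \<bullet> b" and b2: "\<And>b. b \<in> Basis \<Longrightarrow> l2 \<bullet> b < u2 \<bullet> b"
    and sub: "cbox l1 u1 \<subseteq> K" "cbox l2 u2 \<subseteq> K"
    and I: "(\<integral>\<^sup>+x\<in>K. ennreal (norm (G x) powr p) \<partial>lborel) \<le> ennreal I" "0 \<le> I"
    and \<phi>: "\<And>a b. \<bar>\<phi> a - \<phi> b\<bar> \<le> \<bar>a - b\<bar>" "continuous_on UNIV \<phi>"
  shows "(\<integral>x. \<bar>\<phi> (v x) - (\<integral>y. \<phi> (v y) \<partial>unif l2 u2)\<bar> powr p \<partial>unif l1 u1)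
     \<le> D powr p * 2 ^ DIM('a) * measure lborel K / (measure lborel (cbox l1 u1) * measure lborel (cbox l2 u2)) * I"
proof -
  let ?U1 = "unif l1 u1" and ?U2 = "unif l2 u2"
  let ?m1 = "measure lborel (cbox l1 u1)" and ?m2 = "measure lborel (cbox l2 u2)"
  interpret U1: prob_space ?U1 using b1 by (rule prob_space_unif)
  interpret U2: prob_space ?U2 using b2 by (rule prob_space_unif)
  have cv: "continuous_on UNIV v" using v by (simp add: dir_deriv_on_def)
  have [measurable]: "v \<in> borel_measurable borel" using cv by (rule borel_measurable_continuous_onI)
  have [measurable]: "\<phi> \<in> borel_measurable borel" using \<phi>(2) by (rule borel_measurable_continuous_onI)
  have [measurable]: "K \<in> sets borel" using K by (simp add: compact_imp_closed)
  define c where "c = (\<integral>y. \<phi> (v y) \<partial>?U2)"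
  have c\<phi>: "continuous_on UNIV (\<lambda>x. \<phi> (v x))" by (rule continuous_on_compose2[OF \<phi>(2) cv]) auto
  have i\<phi>: "integrable ?U2 (\<lambda>x. \<phi> (v x))" by (rule integrable_unif_continuous[OF b2 c\<phi>])
  have iv: "integrable ?U2 (\<lambda>y. \<bar>v x - v y\<bar> powr a)" if "0 < a" for x a
    using that by (intro integrable_unif_continuous b2 continuous_on_powr_const continuous_intros cv) auto
  have pt: "ennreal (\<bar>\<phi> (v x) - c\<bar> powr p) \<le> (\<integral>\<^sup>+y. ennreal (\<bar>v x - v y\<bar> powr p) \<partial>?U2)" for x
  proof -
    have "\<phi> (v x) - c = (\<integral>y. \<phi> (v x) - \<phi> (v y) \<partial>?U2)"
      using i\<phi> U2.prob_space by (simp add: c_def)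
    also have "\<bar>\<dots>\<bar> \<le> (\<integral>y. \<bar>\<phi> (v x) - \<phi> (v y)\<bar> \<partial>?U2)" by (rule integral_abs_bound)
    also have "\<dots> \<le> (\<integral>y. \<bar>v x - v y\<bar> \<partial>?U2)"
      using i\<phi> iv[of 1 x] \<phi>(1) by (intro integral_mono) auto
    finally have "\<bar>\<phi> (v x) - c\<bar> powr p \<le> (\<integral>y. \<bar>v x - v y\<bar> \<partial>?U2) powr p" using p by (intro powr_mono2) auto
    also have "\<dots> \<le> (\<integral>y. \<bar>v x - v y\<bar> powr p \<partial>?U2)" using p iv[of p x] by (intro U2.jensen_powr) auto
    finally have "ennreal (\<bar>\<phi> (v x) - c\<bar> powr p) \<le> ennreal (\<integral>y. \<bar>v x - v y\<bar> powr p \<partial>?U2)" by (rule ennreal_leI)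
    also have "\<dots> \<le> (\<integral>\<^sup>+y. ennreal (\<bar>v x - v y\<bar> powr p) \<partial>?U2)" by (rule ennreal_integral_le) auto
    finally show ?thesis .
  qed
  have "ennreal (\<integral>x. \<bar>\<phi> (v x) - c\<bar> powr p \<partial>?U1) \<le> (\<integral>\<^sup>+x. ennreal (\<bar>\<phi> (v x) - c\<bar> powr p) \<partial>?U1)"
    by (rule ennreal_integral_le) auto
  also have "\<dots> \<le> (\<integral>\<^sup>+x. (\<integral>\<^sup>+y. ennreal (\<bar>v x - v y\<bar> powr p) \<partial>?U2) \<partial>?U1)"
    by (rule nn_integral_mono) (rule pt)
  also have "\<dots> = (\<integral>\<^sup>+x. ennreal (1 / ?m2) * (\<integral>\<^sup>+y\<in>cbox l2 u2. ennreal (\<bar>v x - v y\<bar> powr p) \<partial>lborel) \<partial>?U1)"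
    using b2 by (intro nn_integral_cong nn_integral_unif) auto
  also have "\<dots> = ennreal (1 / ?m1) * (\<integral>\<^sup>+x\<in>cbox l1 u1. ennreal (1 / ?m2) * (\<integral>\<^sup>+y\<in>cbox l2 u2. ennreal (\<bar>v x - v y\<bar> powr p) \<partial>lborel) \<partial>lborel)"
    using b1 by (intro nn_integral_unif) auto
  also have "\<dots> = ennreal (1 / ?m1) * (ennreal (1 / ?m2) * (\<integral>\<^sup>+x\<in>cbox l1 u1. (\<integral>\<^sup>+y\<in>cbox l2 u2. ennreal (\<bar>v x - v y\<bar> powr p) \<partial>lborel) \<partial>lborel))"
    by (subst nn_integral_cmult[symmetric]) (auto simp: mult.assoc)
  also have "\<dots> \<le> ennreal (1 / ?m1) * (ennreal (1 / ?m2) * (\<integral>\<^sup>+x\<in>K. (\<integral>\<^sup>+y\<in>K. ennreal (\<bar>v x - v y\<bar> powr p) \<partial>lborel) \<partial>lborel))"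
    using sub by (intro mult_left_mono nn_integral_mono mult_mono) (auto simp: indicator_def intro!: nn_integral_mono)
  also have "\<dots> \<le> ennreal (1 / ?m1) * (ennreal (1 / ?m2) * (ennreal (D powr p * 2 ^ DIM('a)) * emeasure lborel K * ennreal I))"
    by (intro mult_left_mono order_trans[OF poincare_pair[OF v K D p]] I) auto
  also have "emeasure lborel K = ennreal (measure lborel K)"
    using emeasure_bounded_finite[OF compact_imp_bounded[OF K(2)]] by (intro emeasure_eq_ennreal_measure) auto
  also have "ennreal (1 / ?m1) * (ennreal (1 / ?m2) * (ennreal (D powr p * 2 ^ DIM('a)) * ennreal (measure lborel K) * ennreal I))
     = ennreal (D powr p * 2 ^ DIM('a) * measure lborel K / (?m1 * ?m2) * I)"
    using I by (simp add: ennreal_mult'[symmetric] ennreal_mult''[symmetric])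
  finally show ?thesis
    using I measure_box[OF b1] measure_box[OF b2] unfolding c_def by (subst (asm) ennreal_le_iff) auto
qed

text \<open>\<open>X\<close> bounds the \<open>L^q\<close> norm of \<open>v\<close> and
  \<open>Y\<close> bounds \<open>D\<close> times the \<open>L^p\<close> norm of the gradient, both
  with respect to the normalised measure. The deviation \<open>d\<close> from the mean is at most a
  multiple of \<open>X\<close> in \<open>L^q\<close> and, by Poincare and Sobolev, of
  \<open>Y\<close> in \<open>L^s\<close>. Hoelder's inequality between these two gives the
  \<open>L^r\<close> bound, and the mean is added back at the end.\<close>

lemma local_interp:
  fixes v :: "'a::euclidean_space \<Rightarrow> real"
  assumes lu: "\<And>b. b \<in> Basis \<Longrightarrow> l \<bullet> b < u \<bullet> b" and v: "dir_deriv_on (cbox l u) v G"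
    and D: "\<And>x y. x \<in> cbox l u \<Longrightarrow> y \<in> cbox l u \<Longrightarrow> dist x y \<le> D"
    and p: "1 \<le> p" and s: "p \<le> s" "1 / p - 1 / s \<le> 1 / DIM('a)"
    and r: "0 < r" and q: "1 \<le> q" and \<theta>: "0 \<le> \<theta>" "\<theta> \<le> 1" "(1 - \<theta>) / q + \<theta> / s \<le> 1 / r"
    and X: "0 < X" "(\<integral>x. \<bar>v x\<bar> powr q \<partial>unif l u) \<le> X powr q"
    and Y: "0 < Y" "D powr p * (\<integral>x. norm (G x) powr p \<partial>unif l u) \<le> Y powr p"
  shows "(\<integral>x. \<bar>v x\<bar> powr r \<partial>unif l u) \<le> 2 powr r * (
     ((2 powr (q + 1)) powr (r * (1 - \<theta>) / q) * (2 * (2 ^ DIM('a) + 1) powr (1 / p) + (1 + s * (1 - 1 / p))) powr (r * \<theta>)) * (X powr (1 - \<theta>) * Y powr \<theta>) powr r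
     + (\<integral>x. \<bar>v x\<bar> \<partial>unif l u) powr r)"
proof -
  interpret prob_space "unif l u" using lu by (rule prob_space_unif)
  have cv: "continuous_on UNIV v" and cG: "continuous_on UNIV G" using v by (auto simp: dir_deriv_on_def)
  have ig: "integrable (unif l u) h" if "continuous_on UNIV h" for h :: "'a \<Rightarrow> real"
    by (rule integrable_unif_continuous[OF lu that])
  have cpw: "continuous_on UNIV (\<lambda>x. h x powr a)" if "continuous_on UNIV h" "\<And>x. 0 \<le> h x" "0 < a" for h :: "'a \<Rightarrow> real" and a
    using that by (rule continuous_on_powr_const)
  have s0: "0 < s" "0 < p" "0 < q" using p s q by linarith+
  define c where "c = (\<integral>y. v y \<partial>unif l u)"
  define d where "d x = v x - c" for x
  have cd: "continuous_on UNIV d" unfolding d_def by (intro continuous_intros cv)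
  have cad: "continuous_on UNIV (\<lambda>x. \<bar>d x\<bar>)" by (intro continuous_intros cd)
  have cav: "continuous_on UNIV (\<lambda>x. \<bar>v x\<bar>)" by (intro continuous_intros cv)
  have cng: "continuous_on UNIV (\<lambda>x. norm (G x))" by (intro continuous_intros cG)
  define I where "I = (\<integral>x. norm (G x) powr p \<partial>unif l u)"
  have I0: "0 \<le> I" unfolding I_def by (intro Bochner_Integration.integral_nonneg) auto
  have ends: "l \<in> cbox l u" "u \<in> cbox l u" unfolding mem_box using lu by (auto intro: less_imp_le)
  have D0: "0 < D"
  proof -
    obtain b :: 'a where b: "b \<in> Basis" using nonempty_Basis by blast
    have "l \<noteq> u" using lu[OF b] by auto
    then have "0 < dist l u" by simp
    then show ?thesis using D[OF ends] by linarith
  qed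
  have side: "u \<bullet> b - l \<bullet> b \<le> D" if b: "b \<in> Basis" for b
  proof -
    have "u \<bullet> b - l \<bullet> b \<le> \<bar>(u - l) \<bullet> b\<bar>" by (simp add: inner_diff_left)
    also have "\<dots> \<le> dist u l" unfolding dist_norm using b by (rule Basis_le_norm)
    also have "\<dots> \<le> D" by (rule D[OF ends(2,1)])
    finally show ?thesis .
  qed
  let ?m = "measure lborel (cbox l u)"
  note m = measure_box[OF lu]
  \<comment> \<open>Here \<open>K\<close> and the two boxes coincide and the gradient integral over
    the box is \<open>?m * I\<close>, so that all volumes cancel.\<close>
  have "(\<integral>x. \<bar>v x - (\<integral>y. v y \<partial>unif l u)\<bar> powr p \<partial>unif l u) \<le> D powr p * 2 ^ DIM('a) * ?m / (?m * ?m) * (?m * I)"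
  proof (rule mean_oscillation[OF v convex_box(1) compact_cbox D p lu lu, where \<phi>="\<lambda>x. x"])
    have "ennreal I = (\<integral>\<^sup>+x. ennreal (norm (G x) powr p) \<partial>unif l u)"
      unfolding I_def using s0 by (intro nn_integral_eq_integral[symmetric] ig cpw cng) auto
    also have "\<dots> = ennreal (1 / ?m) * (\<integral>\<^sup>+x\<in>cbox l u. ennreal (norm (G x) powr p) \<partial>lborel)"
      using lu s0 cG by (intro nn_integral_unif) (auto intro!: borel_measurable_continuous_onI cpw cng)
    finally have "ennreal (?m * I) = (ennreal ?m * ennreal (1 / ?m)) * (\<integral>\<^sup>+x\<in>cbox l u. ennreal (norm (G x) powr p) \<partial>lborel)"
      using m I0 by (simp add: ennreal_mult mult.assoc)
    also have "ennreal ?m * ennreal (1 / ?m) = 1" using m by (subst ennreal_mult[symmetric]) auto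
    finally show "(\<integral>\<^sup>+x\<in>cbox l u. ennreal (norm (G x) powr p) \<partial>lborel) \<le> ennreal (?m * I)" by simp
  qed (use m I0 in auto)
  also have "D powr p * 2 ^ DIM('a) * ?m / (?m * ?m) * (?m * I) = 2 ^ DIM('a) * (D powr p * I)"
    using m(1) by simp
  finally have "(\<integral>x. \<bar>d x\<bar> powr p \<partial>unif l u) \<le> 2 ^ DIM('a) * (D powr p * I)"
    unfolding d_def c_def .
  also have "\<dots> \<le> 2 ^ DIM('a) * Y powr p" using Y by (intro mult_left_mono) (auto simp: I_def)
  finally have dp: "(\<integral>x. \<bar>d x\<bar> powr p \<partial>unif l u) \<le> 2 ^ DIM('a) * Y powr p" .
  \<comment> \<open>A differentiable substitute for \<open>\<bar>d\<bar>\<close>, bounded below by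
    \<open>Y\<close> and with a derivative no larger than that of \<open>d\<close>. The scale
    \<open>Y\<close> is chosen because the \<open>L^p\<close> norm of \<open>d\<close> is itself
    bounded by a multiple of \<open>Y\<close>.\<close>
  define V where "V x = sqrt ((d x)\<^sup>2 + Y\<^sup>2)" for x
  have V_pos: "0 < (d x)\<^sup>2 + Y\<^sup>2" for x using Y(1) by (intro add_nonneg_pos) auto
  have cV: "continuous_on UNIV V" unfolding V_def by (intro continuous_intros cd)
  have VY: "Y \<le> V x" and dV: "\<bar>d x\<bar> \<le> V x" and Vle: "V x \<le> \<bar>d x\<bar> + Y" for x
    unfolding V_def using Y(1) sqrt_sum_squares_le_sum_abs[of "d x" Y]
    by (auto intro!: real_le_rsqrt)
  have V0: "0 < V x" for x using VY[of x] Y(1) by linarith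
  \<comment> \<open>The summands bound the two terms of the Sobolev inequality for \<open>V\<close>:
    in the first, \<open>2 ^ N\<close> stems from Poincare, \<open>1\<close> from the regularisation
    by \<open>Y\<close>, and the leading \<open>2\<close> from splitting a \<open>p\<close>-th
    power.\<close>
  define C1 where "C1 = 2 * (2 ^ DIM('a) + 1) powr (1 / p) + (1 + s * (1 - 1 / p))"
  have "(2::real) ^ DIM('a) + 1 \<noteq> 0" by (smt (verit) zero_less_power)
  then have C1: "0 < C1" unfolding C1_def using p s0 by (intro add_pos_nonneg mult_pos_pos add_nonneg_nonneg) auto
  have "(\<integral>x. V x powr s \<partial>unif l u) powr (1 / s) \<le>
    (\<integral>x. V x powr p \<partial>unif l u) powr (1 / p) + (1 + s * (1 - 1 / p)) * D * (\<integral>x. norm (G x) powr p \<partial>unif l u) powr (1 / p)"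
  proof (rule sobolev_box[OF lu side cV Y(1) VY cng _ _ p s])
    fix x b t assume x: "x \<in> cbox l u" and b: "b \<in> Basis" and t: "t \<in> {l \<bullet> b..u \<bullet> b}"
    have lQ: "x + (t - x \<bullet> b) *\<^sub>R b \<in> cbox l u" using x b t by (auto simp: cbox_def inner_add_left inner_Basis)
    let ?x = "x - (x \<bullet> b) *\<^sub>R b"
    have e: "x + (\<tau> - x \<bullet> b) *\<^sub>R b = ?x + \<tau> *\<^sub>R b" for \<tau> by (simp add: algebra_simps)
    let ?D = "G (?x + t *\<^sub>R b) \<bullet> b"
    have d': "((\<lambda>t. d (?x + t *\<^sub>R b)) has_real_derivative ?D) (at t within {l \<bullet> b..u \<bullet> b})"
      unfolding d_def
      using has_field_derivative_at_within[OF DERIV_diff[OF dir_deriv_onD[OF v lQ[unfolded e]] DERIV_const[of c]]] by simp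
    define z where "z = ?x + t *\<^sub>R b"
    have sq: "((\<lambda>t. (d (?x + t *\<^sub>R b))\<^sup>2 + Y\<^sup>2) has_real_derivative 2 * d z * ?D) (at t within {l \<bullet> b..u \<bullet> b})"
      using DERIV_add[OF DERIV_power[OF d', of 2] DERIV_const[of "Y\<^sup>2"]] unfolding z_def[symmetric] by (simp add: mult_ac)
    have ds: "(sqrt has_real_derivative inverse (sqrt ((d z)\<^sup>2 + Y\<^sup>2)) / 2) (at ((d z)\<^sup>2 + Y\<^sup>2))"
      by (rule DERIV_real_sqrt) (rule V_pos)
    have alg: "inverse w / 2 * (2 * a * c) = a / w * c" for w a c :: real by (simp add: inverse_eq_divide)
    define k where "k \<tau> = (d (?x + \<tau> *\<^sub>R b))\<^sup>2 + Y\<^sup>2" for \<tau>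
    have kz: "(d z)\<^sup>2 + Y\<^sup>2 = k t" by (simp only: k_def z_def)
    have kd: "(k has_real_derivative 2 * d z * ?D) (at t within {l \<bullet> b..u \<bullet> b})"
      unfolding k_def by (rule sq)
    have "((\<lambda>\<tau>. sqrt (k \<tau>)) has_real_derivative (inverse (sqrt ((d z)\<^sup>2 + Y\<^sup>2)) / 2) * (2 * d z * ?D)) (at t within {l \<bullet> b..u \<bullet> b})"
      using DERIV_chain2[OF ds[unfolded kz] kd] unfolding kz .
    then have "((\<lambda>t. V (?x + t *\<^sub>R b)) has_real_derivative (inverse (sqrt ((d z)\<^sup>2 + Y\<^sup>2)) / 2) * (2 * d z * ?D)) (at t within {l \<bullet> b..u \<bullet> b})"
      by (simp only: V_def k_def)
    moreover have "\<bar>(inverse (sqrt ((d z)\<^sup>2 + Y\<^sup>2)) / 2) * (2 * d z * ?D)\<bar> \<le> norm (G z)"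
    proof -
      have "(inverse (sqrt ((d z)\<^sup>2 + Y\<^sup>2)) / 2) * (2 * d z * ?D) = (d z / V z) * ?D"
        unfolding V_def by (rule alg)
      then have "\<bar>(inverse (sqrt ((d z)\<^sup>2 + Y\<^sup>2)) / 2) * (2 * d z * ?D)\<bar> = (\<bar>d z\<bar> / V z) * \<bar>?D\<bar>"
        using V0[of z] by (simp only: abs_mult abs_divide abs_of_pos)
      also have "\<dots> \<le> 1 * \<bar>?D\<bar>" using dV[of z] V0[of z] by (intro mult_right_mono) auto
      also have "\<dots> \<le> norm (G z)" using Basis_le_norm[OF b, of "G z"] by (simp add: z_def)
      finally show ?thesis .
    qed
    ultimately have "\<exists>D. ((\<lambda>t. V (?x + t *\<^sub>R b)) has_real_derivative D) (at t within {l \<bullet> b..u \<bullet> b}) \<and> \<bar>D\<bar> \<le> norm (G (?x + t *\<^sub>R b))"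
      unfolding z_def by (intro exI conjI)
    then show "\<exists>D. ((\<lambda>t. V (x + (t - x \<bullet> b) *\<^sub>R b)) has_real_derivative D) (at t within {l \<bullet> b..u \<bullet> b}) \<and> \<bar>D\<bar> \<le> norm (G (x + (t - x \<bullet> b) *\<^sub>R b))"
      by (simp only: e)
  qed simp_all
  also have "\<dots> \<le> 2 * (2 ^ DIM('a) + 1) powr (1 / p) * Y + (1 + s * (1 - 1 / p)) * Y"
  proof (rule add_mono)
    have "(\<integral>x. V x powr p \<partial>unif l u) \<le> (\<integral>x. 2 powr p * (\<bar>d x\<bar> powr p + Y powr p) \<partial>unif l u)"
    proof (rule integral_mono)
      show "integrable (unif l u) (\<lambda>x. V x powr p)" using V0 s0 by (intro ig cpw cV) (auto simp: less_imp_le)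
      show "integrable (unif l u) (\<lambda>x. 2 powr p * (\<bar>d x\<bar> powr p + Y powr p))"
        using s0 by (intro ig continuous_intros cpw cad) auto
      fix x
      have "V x powr p \<le> (\<bar>d x\<bar> + Y) powr p" using V0[of x] Vle[of x] s0 by (intro powr_mono2) auto
      also have "\<dots> \<le> 2 powr p * (\<bar>d x\<bar> powr p + Y powr p)" using Y s0 by (intro powr_add_le) auto
      finally show "V x powr p \<le> 2 powr p * (\<bar>d x\<bar> powr p + Y powr p)" .
    qed
    also have "\<dots> = 2 powr p * ((\<integral>x. \<bar>d x\<bar> powr p \<partial>unif l u) + Y powr p)"
      using ig[OF cpw[OF cad _ s0(2)]] prob_space by simp
    also have "\<dots> \<le> 2 powr p * (2 ^ DIM('a) * Y powr p + Y powr p)" using dp by simp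
    also have "\<dots> = 2 powr p * ((2 ^ DIM('a) + 1) * Y powr p)" by (simp add: algebra_simps)
    finally have "(\<integral>x. V x powr p \<partial>unif l u) powr (1 / p) \<le> (2 powr p * ((2 ^ DIM('a) + 1) * Y powr p)) powr (1 / p)"
      using s0 by (intro powr_mono2 Bochner_Integration.integral_nonneg) auto
    also have "\<dots> = 2 * (2 ^ DIM('a) + 1) powr (1 / p) * Y"
      using s0 Y by (simp add: powr_mult powr_powr)
    finally show "(\<integral>x. V x powr p \<partial>unif l u) powr (1 / p) \<le> 2 * (2 ^ DIM('a) + 1) powr (1 / p) * Y" .
    have "D * I powr (1 / p) = (D powr p * I) powr (1 / p)"
      using D0 s0 by (simp add: powr_mult powr_powr)
    also have "\<dots> \<le> (Y powr p) powr (1 / p)" using Y I0 s0 unfolding I_def[symmetric] by (intro powr_mono2) auto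
    also have "\<dots> = Y" using Y s0 by (simp add: powr_powr)
    finally have "D * I powr (1 / p) \<le> Y" .
    moreover have "0 \<le> 1 + s * (1 - 1 / p)" using s0 p by (intro add_nonneg_nonneg mult_nonneg_nonneg) auto
    ultimately have "(1 + s * (1 - 1 / p)) * (D * I powr (1 / p)) \<le> (1 + s * (1 - 1 / p)) * Y" by (rule mult_left_mono)
    then show "(1 + s * (1 - 1 / p)) * D * (\<integral>x. norm (G x) powr p \<partial>unif l u) powr (1 / p) \<le> (1 + s * (1 - 1 / p)) * Y"
      by (simp add: I_def mult.assoc)
  qed
  also have "\<dots> = C1 * Y" by (simp add: C1_def algebra_simps)
  finally have "((\<integral>x. V x powr s \<partial>unif l u) powr (1 / s)) powr s \<le> (C1 * Y) powr s"
    using s0 by (intro powr_mono2) auto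
  then have Vs: "(\<integral>x. V x powr s \<partial>unif l u) \<le> (C1 * Y) powr s"
    using s0 by (simp add: powr_powr Bochner_Integration.integral_nonneg)
  have "(\<integral>x. \<bar>d x\<bar> powr s \<partial>unif l u) \<le> (\<integral>x. V x powr s \<partial>unif l u)"
    using s0 dV V0 by (intro integral_mono ig cpw cad cV powr_mono2) (auto simp: less_imp_le)
  with Vs have ds: "(\<integral>x. \<bar>d x\<bar> powr s \<partial>unif l u) \<le> (C1 * Y) powr s" by linarith
  have c_q: "\<bar>c\<bar> powr q \<le> X powr q"
  proof -
    have "\<bar>c\<bar> \<le> (\<integral>x. \<bar>v x\<bar> \<partial>unif l u)" unfolding c_def by (rule integral_abs_bound)
    then have "\<bar>c\<bar> powr q \<le> (\<integral>x. \<bar>v x\<bar> \<partial>unif l u) powr q" using s0 by (intro powr_mono2) auto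
    also have "\<dots> \<le> (\<integral>x. \<bar>v x\<bar> powr q \<partial>unif l u)" using s0 q by (intro jensen_powr ig cpw cav) auto
    finally show ?thesis using X by linarith
  qed
  \<comment> \<open>The exponent is \<open>q + 1\<close> because both \<open>v\<close> and its mean
    contribute \<open>X powr q\<close>.\<close>
  have dq: "(\<integral>x. \<bar>d x\<bar> powr q \<partial>unif l u) \<le> 2 powr (q + 1) * X powr q"
  proof -
    have "(\<integral>x. \<bar>d x\<bar> powr q \<partial>unif l u) \<le> (\<integral>x. 2 powr q * (\<bar>v x\<bar> powr q + \<bar>c\<bar> powr q) \<partial>unif l u)"
    proof (rule integral_mono)
      show "integrable (unif l u) (\<lambda>x. \<bar>d x\<bar> powr q)" using s0 by (intro ig cpw cad) auto
      show "integrable (unif l u) (\<lambda>x. 2 powr q * (\<bar>v x\<bar> powr q + \<bar>c\<bar> powr q))"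
        using s0 by (intro ig continuous_intros cpw cav) auto
      fix x
      have "\<bar>d x\<bar> powr q \<le> (\<bar>v x\<bar> + \<bar>c\<bar>) powr q" using s0 by (intro powr_mono2) (auto simp: d_def)
      also have "\<dots> \<le> 2 powr q * (\<bar>v x\<bar> powr q + \<bar>c\<bar> powr q)" using s0 by (intro powr_add_le) auto
      finally show "\<bar>d x\<bar> powr q \<le> 2 powr q * (\<bar>v x\<bar> powr q + \<bar>c\<bar> powr q)" .
    qed
    also have "\<dots> = 2 powr q * ((\<integral>x. \<bar>v x\<bar> powr q \<partial>unif l u) + \<bar>c\<bar> powr q)"
      using ig[OF cpw[OF cav _ s0(3)]] prob_space by simp
    also have "\<dots> \<le> 2 powr q * (X powr q + X powr q)" using X c_q by (intro mult_left_mono) auto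
    also have "\<dots> = 2 powr (q + 1) * X powr q" by (simp add: powr_add)
    finally show ?thesis .
  qed
  define e1 e2 where "e1 = r * (1 - \<theta>) / q" and "e2 = r * \<theta> / s"
  have e12: "0 \<le> e1" "0 \<le> e2" using r \<theta> s0 by (auto simp: e1_def e2_def)
  have e_sum: "e1 + e2 \<le> 1"
  proof -
    have "e1 + e2 = r * ((1 - \<theta>) / q + \<theta> / s)" by (simp add: e1_def e2_def distrib_left)
    also have "\<dots> \<le> r * (1 / r)" using \<theta> r by (intro mult_left_mono) auto
    finally show ?thesis using r by simp
  qed
  have dr: "(\<integral>x. \<bar>d x\<bar> powr r \<partial>unif l u) \<le> ((2 powr (q + 1)) powr e1 * C1 powr (r * \<theta>)) * (X powr (1 - \<theta>) * Y powr \<theta>) powr r"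
  proof -
    have "(\<integral>x. \<bar>d x\<bar> powr r \<partial>unif l u) = (\<integral>x. (\<bar>d x\<bar> powr q) powr e1 * (\<bar>d x\<bar> powr s) powr e2 \<partial>unif l u)"
    proof (rule Bochner_Integration.integral_cong[OF refl])
      fix x
      have "q * e1 = r * (1 - \<theta>)" "s * e2 = r * \<theta>" using s0 by (simp_all add: e1_def e2_def)
      then have "r = q * e1 + s * e2" by (simp add: right_diff_distrib)
      then show "\<bar>d x\<bar> powr r = (\<bar>d x\<bar> powr q) powr e1 * (\<bar>d x\<bar> powr s) powr e2"
        unfolding powr_powr by (simp only: powr_add)
    qed
    also have "\<dots> \<le> (\<integral>x. \<bar>d x\<bar> powr q \<partial>unif l u) powr e1 * (\<integral>x. \<bar>d x\<bar> powr s \<partial>unif l u) powr e2"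
      using s0 e12 e_sum by (intro holder2 ig cpw cad) auto
    also have "\<dots> \<le> (2 powr (q + 1) * X powr q) powr e1 * ((C1 * Y) powr s) powr e2"
      using dq ds e12 by (intro mult_mono powr_mono2 Bochner_Integration.integral_nonneg) auto
    also have "\<dots> = ((2 powr (q + 1)) powr e1 * C1 powr (r * \<theta>)) * (X powr (1 - \<theta>) * Y powr \<theta>) powr r"
      using s0 C1 X(1) Y(1) by (simp add: powr_mult powr_powr e1_def e2_def mult_ac)
    finally show ?thesis .
  qed
  have "(\<integral>x. \<bar>v x\<bar> powr r \<partial>unif l u) \<le> (\<integral>x. 2 powr r * (\<bar>d x\<bar> powr r + \<bar>c\<bar> powr r) \<partial>unif l u)"
  proof (rule integral_mono)
    show "integrable (unif l u) (\<lambda>x. \<bar>v x\<bar> powr r)" using r by (intro ig cpw cav) auto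
    show "integrable (unif l u) (\<lambda>x. 2 powr r * (\<bar>d x\<bar> powr r + \<bar>c\<bar> powr r))"
      using r by (intro ig continuous_intros cpw cad) auto
    fix x
    have "\<bar>v x\<bar> powr r \<le> (\<bar>d x\<bar> + \<bar>c\<bar>) powr r" using r by (intro powr_mono2) (auto simp: d_def)
    also have "\<dots> \<le> 2 powr r * (\<bar>d x\<bar> powr r + \<bar>c\<bar> powr r)" using r by (intro powr_add_le) auto
    finally show "\<bar>v x\<bar> powr r \<le> 2 powr r * (\<bar>d x\<bar> powr r + \<bar>c\<bar> powr r)" .
  qed
  also have "\<dots> = 2 powr r * ((\<integral>x. \<bar>d x\<bar> powr r \<partial>unif l u) + \<bar>c\<bar> powr r)"
    using ig[OF cpw[OF cad _ r]] prob_space by simp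
  also have "\<dots> \<le> 2 powr r * (((2 powr (q + 1)) powr e1 * C1 powr (r * \<theta>)) * (X powr (1 - \<theta>) * Y powr \<theta>) powr r + (\<integral>x. \<bar>v x\<bar> \<partial>unif l u) powr r)"
    using dr r integral_abs_bound[of "unif l u" v] by (intro mult_left_mono add_mono powr_mono2) (auto simp: c_def)
  finally show ?thesis unfolding e1_def C1_def .
qed

section \<open>Mollification\<close>

text \<open>The negative powers of \<open>s\<close> are included because the family is then closed
  under differentiation up to linear combinations.\<close>

definition flat_exp :: "nat \<Rightarrow> real \<Rightarrow> real" where
  "flat_exp m s = (if s > 0 then exp (- 1 / s) / s ^ m else 0)"

lemma flat_exp_nonneg: "0 \<le> flat_exp m s"
  by (simp add: flat_exp_def)

lemma power_over_fact_le_exp: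
  fixes x :: real
  assumes "0 \<le> x"
  shows "x ^ n / fact n \<le> exp x"
proof -
  have s: "(\<lambda>n. x ^ n / fact n) sums exp x" using exp_converges[of x] by (simp add: divide_inverse mult.commute)
  have "(\<Sum>i\<in>{n}. x ^ i / fact i) \<le> (\<Sum>i. x ^ i / fact i)"
    using assms s by (intro sum_le_suminf) (auto simp: sums_iff)
  then show ?thesis using s by (simp add: sums_iff)
qed

text \<open>A single term of the exponential series at \<open>1 / s\<close> is enough. The quadratic
  order makes the difference quotient at 0 tend to 0.\<close>

lemma flat_exp_le_square: "flat_exp m s \<le> fact (m + 2) * s\<^sup>2"
proof (cases "s > 0")
  case True
  have "(1 / s) ^ (m + 2) / fact (m + 2) \<le> exp (1 / s)"
    using True by (intro power_over_fact_le_exp) auto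
  then have "1 \<le> exp (1 / s) * (fact (m + 2) * s ^ (m + 2))"
    using True by (simp add: power_one_over field_simps del: fact_Suc)
  then have "exp (- 1 / s) \<le> fact (m + 2) * s ^ (m + 2)"
    using True by (simp add: exp_minus field_simps del: fact_Suc)
  then show ?thesis using True
    by (simp add: flat_exp_def field_simps power_add power2_eq_square del: fact_Suc)
qed (simp add: flat_exp_def del: fact_Suc)

lemma flat_exp_deriv:
  "(flat_exp m has_real_derivative (- real m * flat_exp (m + 1) s + flat_exp (m + 2) s)) (at s)"
proof -
  consider "s > 0" | "s < 0" | "s = 0" by linarith
  then show ?thesis
  proof cases
    case 1
    have "((\<lambda>s. exp (- 1 / s) / s ^ m) has_real_derivative
       ((exp (- 1 / s) * (1 / s\<^sup>2)) * s ^ m - exp (- 1 / s) * (real m * s ^ (m - 1))) / (s ^ m * s ^ m)) (at s)"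
      using 1 by (auto intro!: derivative_eq_intros simp: power2_eq_square)
    moreover have "((exp (- 1 / s) * (1 / s\<^sup>2)) * s ^ m - exp (- 1 / s) * (real m * s ^ (m - 1))) / (s ^ m * s ^ m)
       = - real m * flat_exp (m + 1) s + flat_exp (m + 2) s"
      using 1 by (cases m) (auto simp: flat_exp_def field_simps power2_eq_square)
    ultimately have "((\<lambda>s. exp (- 1 / s) / s ^ m) has_real_derivative - real m * flat_exp (m + 1) s + flat_exp (m + 2) s) (at s)"
      by simp
    moreover have "\<forall>\<^sub>F x in nhds s. flat_exp m x = exp (- 1 / x) / x ^ m"
      using eventually_nhds_in_open[of "{0<..}" s] 1
      by (auto elim!: eventually_mono simp: flat_exp_def)
    ultimately show ?thesis by (subst DERIV_cong_ev[OF refl _ refl])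
  next
    case 2
    have "\<forall>\<^sub>F x in nhds s. flat_exp m x = 0"
      using eventually_nhds_in_open[of "{..<0}" s] 2
      by (auto elim!: eventually_mono simp: flat_exp_def)
    then have "(flat_exp m has_real_derivative 0) (at s)"
      using DERIV_cong_ev[OF refl _ refl, of "flat_exp m" "\<lambda>_. 0" s 0] by simp
    then show ?thesis using 2 by (simp add: flat_exp_def)
  next
    case 3
    have "((\<lambda>h. (flat_exp m (0 + h) - flat_exp m 0) / h) \<longlongrightarrow> 0) (at 0)"
    proof (rule Lim_null_comparison[where g="\<lambda>h. fact (m + 2) * \<bar>h\<bar>"])
      show "\<forall>\<^sub>F h in at 0. norm ((flat_exp m (0 + h) - flat_exp m 0) / h) \<le> fact (m + 2) * \<bar>h\<bar>"
      proof (intro always_eventually allI)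
        fix h :: real
        show "norm ((flat_exp m (0 + h) - flat_exp m 0) / h) \<le> fact (m + 2) * \<bar>h\<bar>"
        proof (cases "h = 0")
          case False
          have "flat_exp m h \<le> (fact (m + 2) * \<bar>h\<bar>) * \<bar>h\<bar>"
            using flat_exp_le_square[of m h] by (simp add: power2_eq_square mult.assoc del: fact_Suc)
          then have "flat_exp m h / \<bar>h\<bar> \<le> fact (m + 2) * \<bar>h\<bar>"
            using False by (simp add: field_simps del: fact_Suc)
          then show ?thesis using flat_exp_nonneg[of m h] by (simp add: flat_exp_def[of m 0] del: fact_Suc)
        qed (simp del: fact_Suc)
      qed
      show "((\<lambda>h. fact (m + 2) * \<bar>h\<bar>) \<longlongrightarrow> 0) (at (0::real))"
        by (auto intro!: tendsto_eq_intros simp del: fact_Suc)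
    qed
    then have "(flat_exp m has_real_derivative 0) (at 0)" by (simp add: DERIV_def)
    then show ?thesis using 3 by (simp add: flat_exp_def)
  qed
qed

text \<open>A class of functions closed under directional derivatives; this yields smoothness of
  the bump function without computing higher derivatives.\<close>

inductive_set bump_class :: "'a::euclidean_space \<Rightarrow> real \<Rightarrow> ('a \<Rightarrow> real) set" for z \<rho> where
  base: "(\<lambda>x. flat_exp m (\<rho> - (x - z) \<bullet> (x - z))) \<in> bump_class z \<rho>"
| add: "f \<in> bump_class z \<rho> \<Longrightarrow> g \<in> bump_class z \<rho> \<Longrightarrow> (\<lambda>x. f x + g x) \<in> bump_class z \<rho>"
| scale: "f \<in> bump_class z \<rho> \<Longrightarrow> (\<lambda>x. c * f x) \<in> bump_class z \<rho>"
| inner: "f \<in> bump_class z \<rho> \<Longrightarrow> (\<lambda>x. ((x - z) \<bullet> w) * f x) \<in> bump_class z \<rho>"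

lemma flat_exp_ball_deriv:
  "((\<lambda>x. flat_exp m (\<rho> - (x - z) \<bullet> (x - z))) has_derivative
    (\<lambda>v. (- real m * flat_exp (m + 1) (\<rho> - (x - z) \<bullet> (x - z)) + flat_exp (m + 2) (\<rho> - (x - z) \<bullet> (x - z))) * (- 2 * ((x - z) \<bullet> v)))) (at x)"
proof -
  have "((\<lambda>x. \<rho> - (x - z) \<bullet> (x - z)) has_derivative (\<lambda>v. - 2 * ((x - z) \<bullet> v))) (at x)"
    by (auto intro!: derivative_eq_intros simp: inner_commute)
  from has_derivative_compose[OF this flat_exp_deriv[of m, unfolded has_field_derivative_def]]
  show ?thesis .
qed

lemma bump_class_deriv:
  "f \<in> bump_class z \<rho> \<Longrightarrow> \<exists>f'. (\<forall>x. (f has_derivative f' x) (at x)) \<and> (\<forall>v. (\<lambda>x. f' x v) \<in> bump_class z \<rho>)"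
proof (induction rule: bump_class.induct)
  case (base m)
  let ?s = "\<lambda>x. \<rho> - (x - z) \<bullet> (x - z)"
  let ?f' = "\<lambda>x v. (- real m * flat_exp (m + 1) (?s x) + flat_exp (m + 2) (?s x)) * (- 2 * ((x - z) \<bullet> v))"
  have "(\<lambda>x. ?f' x v) = (\<lambda>x. - 2 * (((x - z) \<bullet> v) * (- real m * flat_exp (m + 1) (?s x) + flat_exp (m + 2) (?s x))))" for v
    by (simp add: algebra_simps)
  moreover have "(\<lambda>x. - 2 * (((x - z) \<bullet> v) * (- real m * flat_exp (m + 1) (?s x) + flat_exp (m + 2) (?s x)))) \<in> bump_class z \<rho>" for v
    by (intro bump_class.intros)
  ultimately have "(\<lambda>x. ?f' x v) \<in> bump_class z \<rho>" for v by simp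
  then show ?case using flat_exp_ball_deriv[of m \<rho> z] by (intro exI[of _ ?f']) auto
next
  case (add f g)
  then obtain f' g' where "\<forall>x. (f has_derivative f' x) (at x)" "\<forall>v. (\<lambda>x. f' x v) \<in> bump_class z \<rho>"
    "\<forall>x. (g has_derivative g' x) (at x)" "\<forall>v. (\<lambda>x. g' x v) \<in> bump_class z \<rho>" by blast
  then show ?case
    by (intro exI[of _ "\<lambda>x v. f' x v + g' x v"]) (auto intro!: has_derivative_add bump_class.add)
next
  case (scale f c)
  then obtain f' where "\<forall>x. (f has_derivative f' x) (at x)" "\<forall>v. (\<lambda>x. f' x v) \<in> bump_class z \<rho>" by blast
  then show ?case
    by (intro exI[of _ "\<lambda>x v. c * f' x v"]) (auto intro!: has_derivative_mult_right bump_class.scale)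
next
  case (inner f w)
  then obtain f' where f': "\<forall>x. (f has_derivative f' x) (at x)" "\<forall>v. (\<lambda>x. f' x v) \<in> bump_class z \<rho>" by blast
  have "((\<lambda>x. ((x - z) \<bullet> w) * f x) has_derivative (\<lambda>v. ((x - z) \<bullet> w) * f' x v + (v \<bullet> w) * f x)) (at x)" for x
    using f'(1) by (intro has_derivative_mult) (auto intro!: derivative_eq_intros)
  moreover have "(\<lambda>x. ((x - z) \<bullet> w) * f' x v + (v \<bullet> w) * f x) \<in> bump_class z \<rho>" for v
    using f'(2) inner(1) by (intro bump_class.add bump_class.inner bump_class.scale) auto
  ultimately show ?case by (intro exI[of _ "\<lambda>x v. ((x - z) \<bullet> w) * f' x v + (v \<bullet> w) * f x"]) auto
qed

lemma bump_class_smooth: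
  assumes "f \<in> bump_class z \<rho>"
  shows "smooth_fun f"
proof -
  have "\<forall>f\<in>bump_class z \<rho>. f \<in> Ck k" for k
  proof (induction k)
    case 0
    show ?case
    proof
      fix f assume "f \<in> bump_class z \<rho>"
      then obtain f' where "\<forall>x. (f has_derivative f' x) (at x)" using bump_class_deriv by blast
      then show "f \<in> Ck 0" by (auto intro!: continuous_at_imp_continuous_on has_derivative_continuous)
    qed
  next
    case (Suc k)
    show ?case
    proof
      fix f assume f: "f \<in> bump_class z \<rho>"
      then obtain f' where f': "\<forall>x. (f has_derivative f' x) (at x)" "\<forall>v. (\<lambda>x. f' x v) \<in> bump_class z \<rho>"
        using bump_class_deriv by blast
      then have "frechet_derivative f (at x) = f' x" for x using frechet_derivative_at by metis
      then show "f \<in> Ck (Suc k)" using f' Suc by (auto simp: differentiable_def)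
    qed
  qed
  then show ?thesis using assms by (auto simp: smooth_fun_def)
qed

text \<open>The standard mollifier \<open>exp (- 1 / (\<epsilon>^2 - |w|^2))\<close> on the ball of
  radius \<open>\<epsilon>\<close>, before normalisation; the squared norm keeps it smooth at the
  centre.\<close>

definition bump :: "real \<Rightarrow> 'a::euclidean_space \<Rightarrow> real" where
  "bump \<epsilon> w = flat_exp 0 (\<epsilon>\<^sup>2 - w \<bullet> w)"

lemma bump_nonneg: "0 \<le> bump \<epsilon> w" by (simp add: bump_def flat_exp_nonneg)

lemma bump_le_1: "bump \<epsilon> w \<le> 1" by (simp add: bump_def flat_exp_def)

lemma bump_outside: "0 < \<epsilon> \<Longrightarrow> \<epsilon> \<le> norm w \<Longrightarrow> bump \<epsilon> w = 0"
  using power_mono[of \<epsilon> "norm w" 2] by (auto simp: not_less bump_def flat_exp_def dot_square_norm)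

lemma bump_inside: "norm w < \<epsilon> \<Longrightarrow> 0 < bump \<epsilon> w"
  using power_strict_mono[of "norm w" \<epsilon> 2] by (simp add: bump_def flat_exp_def dot_square_norm)

lemma bump_uminus: "bump \<epsilon> (- w) = bump \<epsilon> w" by (simp add: bump_def)

lemma bump_diff_commute: "bump \<epsilon> (x - y) = bump \<epsilon> (y - x)"
  using bump_uminus[of \<epsilon> "y - x"] by simp

definition bump' :: "real \<Rightarrow> 'a::euclidean_space \<Rightarrow> 'a \<Rightarrow> real" where
  "bump' \<epsilon> w v = flat_exp 2 (\<epsilon>\<^sup>2 - w \<bullet> w) * (- 2 * (w \<bullet> v))"

lemma bump_deriv: "(bump \<epsilon> has_derivative bump' \<epsilon> w) (at w)"
  using flat_exp_ball_deriv[of 0 "\<epsilon>\<^sup>2" 0 w] unfolding bump_def bump'_def by (simp add: numeral_2_eq_2)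

lemma continuous_bump: "continuous_on UNIV (bump \<epsilon>)"
  using bump_deriv by (auto intro!: continuous_at_imp_continuous_on has_derivative_continuous)

lemma test_fun_bump:
  assumes "0 < \<epsilon>" "\<epsilon> < norm z"
  shows "test_fun (\<lambda>y. bump \<epsilon> (y - z))"
proof -
  have "{x. bump \<epsilon> (x - z) \<noteq> 0} \<subseteq> cball z \<epsilon>"
    using bump_outside[OF assms(1)] by (force simp: dist_norm norm_minus_commute)
  then have t: "tsupport (\<lambda>y. bump \<epsilon> (y - z)) \<subseteq> cball z \<epsilon>"
    unfolding tsupport_def by (intro closure_minimal) auto
  have "compact (tsupport (\<lambda>y. bump \<epsilon> (y - z)))"
    using t unfolding tsupport_def by (meson bounded_cball bounded_subset closed_closure compact_eq_bounded_closed)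
  moreover have "0 \<notin> tsupport (\<lambda>y. bump \<epsilon> (y - z))" using t assms by (auto simp: dist_norm)
  moreover have "smooth_fun (\<lambda>y. bump \<epsilon> (y - z))"
    unfolding bump_def by (rule bump_class_smooth[OF bump_class.base])
  ultimately show ?thesis by (simp add: test_fun_def)
qed

lemma frechet_derivative_bump:
  "frechet_derivative (\<lambda>y. bump \<epsilon> (y - z)) (at y) v = bump' \<epsilon> (y - z) v"
proof -
  have "((\<lambda>y. bump \<epsilon> (y - z)) has_derivative bump' \<epsilon> (y - z)) (at y)"
    using flat_exp_ball_deriv[of 0 "\<epsilon>\<^sup>2" z y] unfolding bump_def bump'_def by (simp add: numeral_2_eq_2)
  then show ?thesis using frechet_derivative_at by metis
qed

lemma bump'_uminus: "bump' \<epsilon> (- w) v = - bump' \<epsilon> w v" by (simp add: bump'_def)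

lemma bump'_bounded:
  assumes "0 < \<epsilon>"
  obtains B where "0 \<le> B" "\<And>w v::'a::euclidean_space. \<bar>bump' \<epsilon> w v\<bar> \<le> B * norm v"
proof -
  have c: "continuous_on UNIV (\<lambda>w::'a. flat_exp 2 (\<epsilon>\<^sup>2 - w \<bullet> w))"
    using flat_exp_ball_deriv[of 2 "\<epsilon>\<^sup>2" 0]
    by (auto intro!: continuous_at_imp_continuous_on has_derivative_continuous)
  have "bounded ((\<lambda>w::'a. flat_exp 2 (\<epsilon>\<^sup>2 - w \<bullet> w)) ` cball 0 \<epsilon>)"
    using c by (intro compact_imp_bounded compact_continuous_image) (auto intro: continuous_on_subset)
  then obtain M where M: "\<And>w::'a. w \<in> cball 0 \<epsilon> \<Longrightarrow> \<bar>flat_exp 2 (\<epsilon>\<^sup>2 - w \<bullet> w)\<bar> \<le> M" unfolding bounded_iff by fastforce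
  have M0: "0 \<le> M" using M[of 0] assms by auto
  have "\<bar>bump' \<epsilon> w v\<bar> \<le> (M * 2 * \<epsilon>) * norm v" for w v :: 'a
  proof (cases "w \<in> cball 0 \<epsilon>")
    case True
    have "\<bar>bump' \<epsilon> w v\<bar> = \<bar>flat_exp 2 (\<epsilon>\<^sup>2 - w \<bullet> w)\<bar> * (2 * \<bar>w \<bullet> v\<bar>)" by (simp add: bump'_def abs_mult)
    also have "\<dots> \<le> M * (2 * (norm w * norm v))"
      using M[OF True] M0 Cauchy_Schwarz_ineq2[of w v] by (intro mult_mono) auto
    also have "\<dots> \<le> M * (2 * (\<epsilon> * norm v))" using True M0 by (intro mult_left_mono mult_right_mono) auto
    finally show ?thesis by (simp add: mult_ac)
  next
    case False
    then have "\<epsilon>\<^sup>2 \<le> w \<bullet> w" using power_mono[of \<epsilon> "norm w" 2] assms by (simp add: dot_square_norm)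
    then have "bump' \<epsilon> w v = 0" by (simp add: bump'_def flat_exp_def)
    then show ?thesis using M0 assms by simp
  qed
  then show ?thesis using that[of "M * 2 * \<epsilon>"] M0 assms by auto
qed

lemma bump_lipschitz:
  assumes "0 < \<epsilon>"
  obtains B where "0 \<le> B" "\<And>w w'::'a::euclidean_space. \<bar>bump \<epsilon> w - bump \<epsilon> w'\<bar> \<le> B * norm (w - w')"
proof -
  obtain B where B: "0 \<le> B" "\<And>w v::'a. \<bar>bump' \<epsilon> w v\<bar> \<le> B * norm v" using bump'_bounded[OF assms] by blast
  have "norm (bump \<epsilon> w - bump \<epsilon> w') \<le> B * norm (w - w')" for w w' :: 'a
  proof (rule differentiable_bound[of UNIV])
    show "(bump \<epsilon> has_derivative bump' \<epsilon> x) (at x within UNIV)" for x :: 'a by (simp add: bump_deriv)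
    show "onorm (bump' \<epsilon> x) \<le> B" for x :: 'a using B by (intro onorm_bound) auto
  qed auto
  then show ?thesis using B(1) that by auto
qed

section \<open>Convolution with the normalised bump\<close>

definition eta :: "real \<Rightarrow> 'a::euclidean_space \<Rightarrow> real" where
  "eta \<epsilon> w = bump \<epsilon> w / (\<integral>w. bump \<epsilon> (w::'a) \<partial>lborel)"

definition conv :: "real \<Rightarrow> ('a::euclidean_space \<Rightarrow> 'b::euclidean_space) \<Rightarrow> 'a \<Rightarrow> 'b" where
  "conv \<epsilon> f x = (\<integral>y. eta \<epsilon> (x - y) *\<^sub>R f y \<partial>lborel)"

lemma borel_measurable_bump [measurable]: "bump \<epsilon> \<in> borel_measurable borel"
  by (rule borel_measurable_continuous_onI[OF continuous_bump])

lemma borel_measurable_eta [measurable]: "eta \<epsilon> \<in> borel_measurable borel"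
  unfolding eta_def by measurable

lemma integrable_bump:
  assumes "0 < \<epsilon>" shows "integrable lborel (bump \<epsilon> :: 'a::euclidean_space \<Rightarrow> real)"
proof -
  have "integrable lborel (\<lambda>w::'a. indicator (cball 0 \<epsilon>) w *\<^sub>R bump \<epsilon> w)"
    by (intro borel_integrable_compact compact_cball continuous_on_subset[OF continuous_bump]) auto
  moreover have "(\<lambda>w::'a. indicator (cball 0 \<epsilon>) w *\<^sub>R bump \<epsilon> w) = bump \<epsilon>"
  proof
    fix w :: 'a
    show "indicator (cball 0 \<epsilon>) w *\<^sub>R bump \<epsilon> w = bump \<epsilon> w"
      using bump_outside[OF assms, of w] by (cases "norm w \<le> \<epsilon>") (auto simp: indicator_def)
  qed
  ultimately show ?thesis by simp
qed

lemma bump_mass_pos: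
  assumes "0 < \<epsilon>" shows "0 < (\<integral>w. bump \<epsilon> (w::'a::euclidean_space) \<partial>lborel)"
proof -
  have "(\<integral>w. bump \<epsilon> (w::'a) \<partial>lborel) \<noteq> 0"
  proof
    assume "(\<integral>w. bump \<epsilon> (w::'a) \<partial>lborel) = 0"
    then have "AE w::'a in lborel. bump \<epsilon> w = 0"
      using integral_nonneg_eq_0_iff_AE[OF integrable_bump[OF assms, where 'a='a]] by (simp add: bump_nonneg)
    then have "AE w::'a in lborel. w \<notin> ball 0 \<epsilon>"
    proof (rule AE_mp, intro AE_I2 impI)
      fix w :: 'a assume "bump \<epsilon> w = 0"
      then show "w \<notin> ball 0 \<epsilon>" using bump_inside[of w \<epsilon>] by auto
    qed
    then have "emeasure lborel (ball (0::'a) \<epsilon>) = 0"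
      by (subst (asm) AE_iff_measurable[OF _ refl]) (auto simp: ball_def)
    then have "emeasure lebesgue (ball (0::'a) \<epsilon>) = 0" by (simp add: emeasure_completion main_part)
    moreover have "\<not> negligible (ball (0::'a) \<epsilon>)"
      using assms open_not_negligible[of "ball (0::'a) \<epsilon>"] by auto
    ultimately show False by (simp add: negligible_iff_null_sets null_sets_def)
  qed
  moreover have "0 \<le> (\<integral>w. bump \<epsilon> (w::'a) \<partial>lborel)" by (intro Bochner_Integration.integral_nonneg bump_nonneg)
  ultimately show ?thesis by linarith
qed

lemma eta_nonneg: "0 < \<epsilon> \<Longrightarrow> 0 \<le> eta \<epsilon> w"
  using bump_mass_pos[of \<epsilon>, where 'a='a] by (simp add: eta_def bump_nonneg less_imp_le)

lemma eta_outside: "0 < \<epsilon> \<Longrightarrow> \<epsilon> \<le> norm w \<Longrightarrow> eta \<epsilon> w = 0"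
  by (simp add: eta_def bump_outside)

lemma eta_diff_commute: "eta \<epsilon> (x - y) = eta \<epsilon> (y - x)"
  by (simp add: eta_def bump_diff_commute)

lemma nn_integral_eta:
  fixes x :: "'a::euclidean_space"
  assumes "0 < \<epsilon>" shows "(\<integral>\<^sup>+y. ennreal (eta \<epsilon> (y - x)) \<partial>lborel) = 1"
proof -
  have i: "integrable lborel (eta \<epsilon> :: 'a \<Rightarrow> real)"
    unfolding eta_def using integrable_bump[OF assms] by auto
  have "(\<integral>\<^sup>+y. ennreal (eta \<epsilon> (y - x)) \<partial>lborel) = (\<integral>\<^sup>+y. ennreal (eta \<epsilon> ((- x) + 1 *\<^sub>R y)) \<partial>lborel)" by simp
  also have "\<dots> = (\<integral>\<^sup>+y. ennreal (eta \<epsilon> (y::'a)) \<partial>lborel)" by (subst nn_integral_affine) auto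
  also have "\<dots> = ennreal (\<integral>y. eta \<epsilon> (y::'a) \<partial>lborel)"
    using i assms by (intro nn_integral_eq_integral) (auto simp: eta_nonneg)
  also have "(\<integral>y. eta \<epsilon> (y::'a) \<partial>lborel) = 1"
    unfolding eta_def using bump_mass_pos[OF assms, where 'a='a] by simp
  finally show ?thesis by simp
qed

lemma eta_bounded:
  assumes "0 < \<epsilon>" obtains M where "0 \<le> M" "\<And>w::'a::euclidean_space. eta \<epsilon> w \<le> M"
proof
  show "0 \<le> 1 / (\<integral>w. bump \<epsilon> (w::'a) \<partial>lborel)" using bump_mass_pos[OF assms, where 'a='a] by simp
  show "eta \<epsilon> w \<le> 1 / (\<integral>w. bump \<epsilon> (w::'a) \<partial>lborel)" for w :: 'a
    unfolding eta_def using bump_mass_pos[OF assms, where 'a='a] bump_le_1[of \<epsilon> w] by (intro divide_right_mono) auto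
qed

lemma eta_lipschitz:
  assumes "0 < \<epsilon>" obtains B where "0 \<le> B" "\<And>w w'::'a::euclidean_space. \<bar>eta \<epsilon> w - eta \<epsilon> w'\<bar> \<le> B * norm (w - w')"
proof -
  let ?m = "\<integral>w. bump \<epsilon> (w::'a) \<partial>lborel"
  have m: "0 < ?m" by (rule bump_mass_pos[OF assms])
  obtain B where B: "0 \<le> B" "\<And>w w'::'a. \<bar>bump \<epsilon> w - bump \<epsilon> w'\<bar> \<le> B * norm (w - w')"
    using bump_lipschitz[OF assms] by blast
  show ?thesis
  proof
    show "0 \<le> B / ?m" using B m by simp
    show "\<bar>eta \<epsilon> w - eta \<epsilon> w'\<bar> \<le> B / ?m * norm (w - w')" for w w' :: 'a
    proof -
      have "\<bar>eta \<epsilon> w - eta \<epsilon> w'\<bar> = \<bar>bump \<epsilon> w - bump \<epsilon> w'\<bar> / ?m"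
        unfolding eta_def using m by (simp add: abs_divide flip: diff_divide_distrib)
      also have "\<dots> \<le> (B * norm (w - w')) / ?m" using B m by (intro divide_right_mono) auto
      finally show ?thesis by simp
    qed
  qed
qed

lemma integrable_conv_integrand:
  fixes f :: "'a::euclidean_space \<Rightarrow> 'b::euclidean_space"
  assumes "0 < \<epsilon>" "integrable lborel f"
  shows "integrable lborel (\<lambda>y. eta \<epsilon> (x - y) *\<^sub>R f y)"
proof -
  obtain M where M: "0 \<le> M" "\<And>w::'a. eta \<epsilon> w \<le> M" using eta_bounded[OF assms(1)] by blast
  show ?thesis
  proof (rule Bochner_Integration.integrable_bound[of _ "\<lambda>y. M * norm (f y)"])
    show "(\<lambda>y. eta \<epsilon> (x - y) *\<^sub>R f y) \<in> borel_measurable lborel" using assms(2) by measurable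
    show "AE y in lborel. norm (eta \<epsilon> (x - y) *\<^sub>R f y) \<le> norm (M * norm (f y))"
      using M eta_nonneg[OF assms(1), where 'a='a] by (intro AE_I2) (auto simp: abs_mult abs_of_nonneg intro!: mult_right_mono)
  qed (use assms in auto)
qed

lemma continuous_conv:
  fixes f :: "'a::euclidean_space \<Rightarrow> 'b::euclidean_space"
  assumes "0 < \<epsilon>" "integrable lborel f"
  shows "continuous_on UNIV (conv \<epsilon> f)"
  unfolding continuous_on_sequentially
proof (intro allI ballI impI)
  fix X and x :: 'a assume X: "(\<forall>n. X n \<in> UNIV) \<and> X \<longlonglongrightarrow> x"
  obtain M where M: "0 \<le> M" "\<And>w::'a. eta \<epsilon> w \<le> M" using eta_bounded[OF assms(1)] by blast
  have ce: "continuous_on UNIV (eta \<epsilon> :: 'a \<Rightarrow> real)" unfolding eta_def by (intro continuous_intros continuous_bump) (use bump_mass_pos[OF assms(1), where 'a='a] in auto)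
  have "(\<lambda>n. \<integral>y. eta \<epsilon> (X n - y) *\<^sub>R f y \<partial>lborel) \<longlonglongrightarrow> (\<integral>y. eta \<epsilon> (x - y) *\<^sub>R f y \<partial>lborel)"
  proof (rule integral_dominated_convergence[where w="\<lambda>y. M * norm (f y)"])
    show "AE y in lborel. (\<lambda>n. eta \<epsilon> (X n - y) *\<^sub>R f y) \<longlonglongrightarrow> eta \<epsilon> (x - y) *\<^sub>R f y"
      using X ce by (intro AE_I2 tendsto_intros) (auto intro!: isCont_tendsto_compose[of _ "eta \<epsilon>"] tendsto_intros simp: continuous_on_eq_continuous_at)
    show "AE y in lborel. norm (eta \<epsilon> (X n - y) *\<^sub>R f y) \<le> M * norm (f y)" for n
      using M eta_nonneg[OF assms(1), where 'a='a] by (intro AE_I2) (auto simp: abs_mult abs_of_nonneg intro!: mult_right_mono)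
    show "(\<lambda>y. eta \<epsilon> (x - y) *\<^sub>R f y) \<in> borel_measurable lborel" using assms(2) by measurable
    show "(\<lambda>y. eta \<epsilon> (X n - y) *\<^sub>R f y) \<in> borel_measurable lborel" for n using assms(2) by measurable
  qed (use assms in auto)
  then show "(conv \<epsilon> f \<circ> X) \<longlonglongrightarrow> conv \<epsilon> f x" by (simp add: conv_def o_def)
qed

text \<open>For fixed \<open>x\<close> the mollified value is an average of \<open>f\<close> with
  probability density \<open>eta \<epsilon> (y - x)\<close>, so Jensen's inequality moves the power
  inside. Fubini then leaves the mass of the kernel in the other variable, which is 1 because the
  kernel is even.\<close>

lemma conv_young:
  fixes f :: "'a::euclidean_space \<Rightarrow> 'b::euclidean_space"
  assumes "0 < \<epsilon>" "integrable lborel f" "1 \<le> p"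
  shows "(\<integral>\<^sup>+x. ennreal (norm (conv \<epsilon> f x) powr p) \<partial>lborel) \<le> (\<integral>\<^sup>+x. ennreal (norm (f x) powr p) \<partial>lborel)"
proof (cases "(\<integral>\<^sup>+x. ennreal (norm (f x) powr p) \<partial>lborel) = \<infinity>")
  case False
  have [measurable]: "f \<in> borel_measurable borel" using assms(2) by auto
  have fp: "integrable lborel (\<lambda>x. norm (f x) powr p)"
    using False by (intro integrableI_nonneg) (auto simp: less_top)
  have pt: "ennreal (norm (conv \<epsilon> f x) powr p) \<le> (\<integral>\<^sup>+y. ennreal (norm (f y) powr p) * ennreal (eta \<epsilon> (y - x)) \<partial>lborel)" for x
  proof -
    let ?M = "density lborel (\<lambda>y. ennreal (eta \<epsilon> (y - x)))"
    interpret P: prob_space ?M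
      using nn_integral_eta[OF assms(1), of x] by (intro prob_spaceI) (simp add: emeasure_density)
    have e: "eta \<epsilon> (x - y) = eta \<epsilon> (y - x)" for y by (rule eta_diff_commute)
    have ip: "integrable ?M (\<lambda>y. norm (f y) powr p)"
      using integrable_conv_integrand[OF assms(1) fp, of x] eta_nonneg[OF assms(1), where 'a='a]
      by (subst integrable_density) (auto simp: e)
    have "norm (conv \<epsilon> f x) \<le> (\<integral>y. norm (eta \<epsilon> (x - y) *\<^sub>R f y) \<partial>lborel)"
      unfolding conv_def by (rule integral_norm_bound)
    also have "\<dots> = (\<integral>y. norm (f y) \<partial>?M)"
      using eta_nonneg[OF assms(1), where 'a='a] by (subst integral_density) (auto simp: e abs_of_nonneg)
    finally have "norm (conv \<epsilon> f x) powr p \<le> (\<integral>y. norm (f y) \<partial>?M) powr p" using assms by (intro powr_mono2) auto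
    also have "\<dots> \<le> (\<integral>y. norm (f y) powr p \<partial>?M)" using ip assms by (intro P.jensen_powr) auto
    finally have "ennreal (norm (conv \<epsilon> f x) powr p) \<le> ennreal (\<integral>y. norm (f y) powr p \<partial>?M)" by (rule ennreal_leI)
    also have "\<dots> \<le> (\<integral>\<^sup>+y. ennreal (norm (f y) powr p) \<partial>?M)" by (rule ennreal_integral_le) auto
    also have "\<dots> = (\<integral>\<^sup>+y. ennreal (norm (f y) powr p) * ennreal (eta \<epsilon> (y - x)) \<partial>lborel)"
      by (subst nn_integral_density) (auto simp: mult.commute)
    finally show ?thesis .
  qed
  have "pair_sigma_finite (lborel::'a measure) (lborel::'a measure)"
    by (intro pair_sigma_finite.intro lborel.sigma_finite_measure_axioms)
  note Fub = pair_sigma_finite.Fubini'[OF this]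
  have "(\<integral>\<^sup>+x. ennreal (norm (conv \<epsilon> f x) powr p) \<partial>lborel) \<le> (\<integral>\<^sup>+x. (\<integral>\<^sup>+y. ennreal (norm (f y) powr p) * ennreal (eta \<epsilon> (y - x)) \<partial>lborel) \<partial>lborel)"
    by (rule nn_integral_mono) (rule pt)
  also have "\<dots> = (\<integral>\<^sup>+y. (\<integral>\<^sup>+x. ennreal (norm (f y) powr p) * ennreal (eta \<epsilon> (y - x)) \<partial>lborel) \<partial>lborel)"
    by (rule Fub[symmetric]) measurable
  also have "\<dots> = (\<integral>\<^sup>+y. ennreal (norm (f y) powr p) * (\<integral>\<^sup>+x. ennreal (eta \<epsilon> (y - x)) \<partial>lborel) \<partial>lborel)"
    by (intro nn_integral_cong nn_integral_cmult) measurable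
  also have "\<dots> = (\<integral>\<^sup>+y. ennreal (norm (f y) powr p) \<partial>lborel)"
  proof (intro nn_integral_cong)
    fix y :: 'a
    have "(\<integral>\<^sup>+x. ennreal (eta \<epsilon> (y - x)) \<partial>lborel) = (\<integral>\<^sup>+x. ennreal (eta \<epsilon> (x - y)) \<partial>lborel)"
      by (simp only: eta_diff_commute[of \<epsilon> y])
    then show "ennreal (norm (f y) powr p) * (\<integral>\<^sup>+x. ennreal (eta \<epsilon> (y - x)) \<partial>lborel) = ennreal (norm (f y) powr p)"
      using nn_integral_eta[OF assms(1), of y] by simp
  qed
  finally show ?thesis .
qed simp

lemma integrable_conv:
  fixes f :: "'a::euclidean_space \<Rightarrow> 'b::euclidean_space"
  assumes "0 < \<epsilon>" "integrable lborel f"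
  shows "integrable lborel (conv \<epsilon> f)" "(\<integral>x. norm (conv \<epsilon> f x) \<partial>lborel) \<le> (\<integral>x. norm (f x) \<partial>lborel)"
proof -
  have m: "conv \<epsilon> f \<in> borel_measurable lborel"
    using borel_measurable_continuous_onI[OF continuous_conv[OF assms]] by simp
  have le: "(\<integral>\<^sup>+x. ennreal (norm (conv \<epsilon> f x)) \<partial>lborel) \<le> (\<integral>\<^sup>+x. ennreal (norm (f x)) \<partial>lborel)"
    using conv_young[OF assms, of 1] by simp
  also have f: "(\<integral>\<^sup>+x. ennreal (norm (f x)) \<partial>lborel) = ennreal (\<integral>x. norm (f x) \<partial>lborel)"
    using assms(2) by (intro nn_integral_eq_integral) auto
  finally show i: "integrable lborel (conv \<epsilon> f)"
    using m by (intro integrableI_bounded) (auto intro: le_less_trans)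
  have "ennreal (\<integral>x. norm (conv \<epsilon> f x) \<partial>lborel) = (\<integral>\<^sup>+x. ennreal (norm (conv \<epsilon> f x)) \<partial>lborel)"
    using i by (intro nn_integral_eq_integral[symmetric]) auto
  also have "\<dots> \<le> ennreal (\<integral>x. norm (f x) \<partial>lborel)" using le f by simp
  finally show "(\<integral>x. norm (conv \<epsilon> f x) \<partial>lborel) \<le> (\<integral>x. norm (f x) \<partial>lborel)"
    by (subst (asm) ennreal_le_iff) (auto intro!: Bochner_Integration.integral_nonneg)
qed

lemma conv_add:
  fixes f g :: "'a::euclidean_space \<Rightarrow> 'b::euclidean_space"
  assumes "0 < \<epsilon>" "integrable lborel f" "integrable lborel g"
  shows "conv \<epsilon> (\<lambda>x. f x + g x) x = conv \<epsilon> f x + conv \<epsilon> g x"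
  unfolding conv_def scaleR_add_right
  by (intro Bochner_Integration.integral_add integrable_conv_integrand assms)

lemma conv_diff:
  fixes f g :: "'a::euclidean_space \<Rightarrow> 'b::euclidean_space"
  assumes "0 < \<epsilon>" "integrable lborel f" "integrable lborel g"
  shows "conv \<epsilon> (\<lambda>x. f x - g x) x = conv \<epsilon> f x - conv \<epsilon> g x"
  unfolding conv_def scaleR_diff_right
  by (intro Bochner_Integration.integral_diff integrable_conv_integrand assms)

section \<open>Convergence of mollifications in \<open>L^1\<close>\<close>

abbreviation conv_error :: "real \<Rightarrow> ('a::euclidean_space \<Rightarrow> real) \<Rightarrow> real" where
  "conv_error \<epsilon> f \<equiv> (\<integral>x. \<bar>conv \<epsilon> f x - f x\<bar> \<partial>lborel)"

text \<open>Mollification is a contraction of \<open>L^1\<close>, so \<open>f - g\<close> and its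
  mollification each contribute the distance of \<open>f\<close> and \<open>g\<close>. This makes
  the functions with vanishing error a closed set in \<open>L^1\<close>.\<close>

lemma conv_error_le:
  fixes f g :: "'a::euclidean_space \<Rightarrow> real"
  assumes \<epsilon>: "0 < \<epsilon>" and f: "integrable lborel f" and g: "integrable lborel g"
  shows "conv_error \<epsilon> f \<le> conv_error \<epsilon> g + 2 * (\<integral>x. \<bar>f x - g x\<bar> \<partial>lborel)"
proof -
  let ?h = "\<lambda>x. f x - g x"
  have h: "integrable lborel ?h" using f g by auto
  note cf = integrable_conv(1)[OF \<epsilon> f] and cg = integrable_conv(1)[OF \<epsilon> g] and ch = integrable_conv[OF \<epsilon> h]
  have "conv_error \<epsilon> f \<le> (\<integral>x. \<bar>conv \<epsilon> g x - g x\<bar> + (\<bar>conv \<epsilon> ?h x\<bar> + \<bar>?h x\<bar>) \<partial>lborel)"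
    using cf cg ch f g by (intro integral_mono) (auto simp: conv_diff[OF \<epsilon> f g])
  also have "\<dots> = conv_error \<epsilon> g + ((\<integral>x. \<bar>conv \<epsilon> ?h x\<bar> \<partial>lborel) + (\<integral>x. \<bar>?h x\<bar> \<partial>lborel))"
    using cf cg ch f g by simp
  finally show ?thesis using ch(2) by simp
qed

text \<open>Both sides have the same integral, so the \<open>L\<^sup>1\<close> error is twice the integral of the
  positive part, which is dominated by the indicator and vanishes pointwise.\<close>

lemma conv_error_open:
  fixes T :: "'a::euclidean_space set"
  assumes T: "open T" "emeasure lborel T < \<infinity>" and e: "\<And>n. 0 < e n" "e \<longlonglongrightarrow> 0"
  shows "(\<lambda>n. conv_error (e n) (indicator T)) \<longlonglongrightarrow> 0"
proof -
  have iT: "integrable lborel (indicator T :: 'a \<Rightarrow> real)" using T by (intro integrable_real_indicator) auto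
  let ?c = "\<lambda>n. conv (e n) (indicator T :: 'a \<Rightarrow> real)"
  have ic: "integrable lborel (?c n)" for n by (rule integrable_conv(1)[OF e(1) iT])
  have [measurable]: "?c n \<in> borel_measurable borel" "T \<in> sets borel" for n using ic[of n] T by auto
  have c0: "0 \<le> ?c n x" for n x
    unfolding conv_def using eta_nonneg[OF e(1), where 'a='a] by (intro Bochner_Integration.integral_nonneg) (auto intro!: mult_nonneg_nonneg)
  have ieta: "integrable lborel (\<lambda>y. eta (e n) (x - y))" and eta1: "(\<integral>y. eta (e n) (x - y) \<partial>lborel) = 1" for n and x :: 'a
  proof -
    have "(\<integral>\<^sup>+y. ennreal (eta (e n) (x - y)) \<partial>lborel) = ennreal 1"
      using nn_integral_eta[OF e(1), of n x] by (simp only: eta_diff_commute[of _ x]) simp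
    from nn_integral_eq_integrable[THEN iffD1, OF _ _ _ this]
    show "integrable lborel (\<lambda>y. eta (e n) (x - y))" "(\<integral>y. eta (e n) (x - y) \<partial>lborel) = 1"
      using eta_nonneg[OF e(1), where 'a='a] by auto
  qed
  have c1: "?c n x \<le> 1" for n x
  proof -
    have "?c n x \<le> (\<integral>y. eta (e n) (x - y) \<partial>lborel)"
      unfolding conv_def using integrable_conv_integrand[OF e(1) iT, of n x] ieta eta_nonneg[OF e(1), where 'a='a]
      by (intro integral_mono) (auto simp: indicator_def)
    then show ?thesis using eta1 by simp
  qed
  have mass: "(\<integral>x. ?c n x \<partial>lborel) \<le> (\<integral>x. indicator T x \<partial>lborel)" for n
    using integrable_conv(2)[OF e(1) iT, of n] c0 by (simp add: abs_of_nonneg)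
  have err: "conv_error (e n) (indicator T) \<le> 2 * (\<integral>x. indicator T x * (1 - ?c n x) \<partial>lborel)" for n
  proof -
    have iTc: "integrable lborel (\<lambda>x. indicator T x * (1 - ?c n x))"
    proof (rule Bochner_Integration.integrable_bound[OF iT])
      show "AE x in lborel. norm (indicator T x * (1 - ?c n x)) \<le> norm (indicator T x :: real)"
        using c0 c1 by (intro AE_I2) (auto simp: indicator_def)
    qed measurable
    have "\<bar>?c n x - indicator T x\<bar> = ?c n x - indicator T x + 2 * (indicator T x * (1 - ?c n x))" for x
      using c0[of n x] c1[of n x] by (auto simp: indicator_def)
    then have "conv_error (e n) (indicator T) = (\<integral>x. ?c n x \<partial>lborel) - (\<integral>x. indicator T x \<partial>lborel) + 2 * (\<integral>x. indicator T x * (1 - ?c n x) \<partial>lborel)"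
      using ic[of n] iT iTc by simp
    then show ?thesis using mass[of n] by linarith
  qed
  have "(\<lambda>n. \<integral>x. indicator T x * (1 - ?c n x) \<partial>lborel) \<longlonglongrightarrow> (\<integral>x. 0 \<partial>(lborel :: 'a measure))"
  proof (rule integral_dominated_convergence[where w="indicator T :: 'a \<Rightarrow> real"])
    show "(\<lambda>x. indicator T x * (1 - ?c n x)) \<in> borel_measurable lborel" for n by measurable
    show "AE x in lborel. norm (indicator T x * (1 - ?c n x)) \<le> indicator T x" for n
      using c0 c1 by (intro AE_I2) (auto simp: indicator_def)
    show "AE x in lborel. (\<lambda>n. indicator T x * (1 - ?c n x)) \<longlonglongrightarrow> 0"
    proof (intro AE_I2)
      fix x :: 'a
      show "(\<lambda>n. indicator T x * (1 - ?c n x)) \<longlonglongrightarrow> 0"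
      proof (cases "x \<in> T")
        case True
        then obtain \<delta> where \<delta>: "0 < \<delta>" "ball x \<delta> \<subseteq> T" using T(1) openE by blast
        have "\<forall>\<^sub>F n in sequentially. e n < \<delta>" using order_tendstoD(2)[OF e(2) \<delta>(1)] .
        then have "\<forall>\<^sub>F n in sequentially. indicator T x * (1 - ?c n x) = 0"
        proof eventually_elim
          case (elim n)
          have "eta (e n) (x - y) *\<^sub>R indicator T y = eta (e n) (x - y)" for y
          proof (cases "e n \<le> norm (x - y)")
            case True
            then show ?thesis by (simp add: eta_outside[OF e(1)])
          next
            case False
            then have "y \<in> T" using \<delta>(2) elim by (auto simp: dist_norm)
            then show ?thesis by simp
          qed
          then have "?c n x = 1" unfolding conv_def by (simp only: eta1)
          then show ?case by simp
        qed
        then show ?thesis by (rule tendsto_eventually)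
      qed simp
    qed
  qed (use iT in auto)
  then have "(\<lambda>n. 2 * (\<integral>x. indicator T x * (1 - ?c n x) \<partial>lborel)) \<longlonglongrightarrow> 2 * 0"
    unfolding Bochner_Integration.integral_zero by (rule tendsto_mult_left)
  then have lim0: "(\<lambda>n. 2 * (\<integral>x. indicator T x * (1 - ?c n x) \<partial>lborel)) \<longlonglongrightarrow> 0"
    unfolding mult_zero_right .
  show ?thesis
  proof (rule tendsto_sandwich[OF _ _ tendsto_const lim0])
    show "\<forall>\<^sub>F n in sequentially. conv_error (e n) (indicator T) \<le> 2 * (\<integral>x. indicator T x * (1 - ?c n x) \<partial>lborel)"
      by (rule always_eventually) (rule allI, rule err)
    show "\<forall>\<^sub>F n in sequentially. 0 \<le> conv_error (e n) (indicator T)"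
      by (rule always_eventually) (rule allI, rule Bochner_Integration.integral_nonneg, rule abs_ge_zero)
  qed
qed

lemma conv_error_approx:
  fixes f :: "'a::euclidean_space \<Rightarrow> real"
  assumes e: "\<And>n. 0 < e n" and f: "integrable lborel f"
    and appr: "\<And>d. 0 < d \<Longrightarrow> \<exists>g. integrable lborel g \<and> (\<lambda>n. conv_error (e n) g) \<longlonglongrightarrow> 0 \<and> (\<integral>x. \<bar>f x - g x\<bar> \<partial>lborel) \<le> d"
  shows "(\<lambda>n. conv_error (e n) f) \<longlonglongrightarrow> 0"
proof (rule LIMSEQ_I)
  fix r :: real assume r: "0 < r"
  obtain g where g: "integrable lborel g" "(\<lambda>n. conv_error (e n) g) \<longlonglongrightarrow> 0" "(\<integral>x. \<bar>f x - g x\<bar> \<partial>lborel) \<le> r / 4"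
    using appr[of "r / 4"] r by auto
  obtain n0 where n0: "\<And>n. n \<ge> n0 \<Longrightarrow> norm (conv_error (e n) g - 0) < r / 2"
    using LIMSEQ_D[OF g(2), of "r / 2"] r by auto
  show "\<exists>no. \<forall>n\<ge>no. norm (conv_error (e n) f - 0) < r"
  proof (intro exI allI impI)
    fix n assume "n0 \<le> n"
    then have "conv_error (e n) g < r / 2" using n0[of n] by simp
    moreover have "0 \<le> conv_error (e n) f" by (intro Bochner_Integration.integral_nonneg) auto
    ultimately show "norm (conv_error (e n) f - 0) < r"
      using conv_error_le[OF e f g(1), of n] g(3) by simp
  qed
qed

text \<open>Outer regularity approximates a Borel set of finite measure by an open one, for which
  convergence is elementary. Sums follow from the triangle inequality and dominated limits from
  closedness in \<open>L^1\<close>.\<close>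

lemma conv_error_tendsto:
  fixes f :: "'a::euclidean_space \<Rightarrow> real"
  assumes e: "\<And>n. 0 < e n" "e \<longlonglongrightarrow> 0" and f: "integrable lborel f"
  shows "(\<lambda>n. conv_error (e n) f) \<longlonglongrightarrow> 0"
  using f
proof (induction rule: integrable_induct)
  case (base A c)
  have iA: "integrable lborel (indicator A :: 'a \<Rightarrow> real)" using base by (intro integrable_real_indicator) auto
  have "(\<lambda>n. conv_error (e n) (indicator A)) \<longlonglongrightarrow> 0"
  proof (rule conv_error_approx[OF e(1) iA])
    fix d :: real assume d: "0 < d"
    have "A \<in> sets lebesgue" using base by auto
    from sets_lebesgue_outer_open[OF this d]
    obtain T where T: "open T" "A \<subseteq> T" "T - A \<in> lmeasurable" "emeasure lebesgue (T - A) < ennreal d" by blast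
    have b: "T - A \<in> sets borel" "T \<in> sets borel" using T(1) base by auto
    have TA: "emeasure lborel (T - A) < ennreal d" using T(4) b by (simp add: emeasure_completion main_part_sets)
    have "emeasure lborel T = emeasure lborel (A \<union> (T - A))" using T(2) by (intro arg_cong2[where f=emeasure]) auto
    also have "\<dots> \<le> emeasure lborel A + emeasure lborel (T - A)"
      using base b by (intro emeasure_subadditive) auto
    also have "\<dots> < \<infinity>"
      using base(2) order.strict_trans[OF TA ennreal_less_top] by (simp add: ennreal_add_less_top)
    finally have fT: "emeasure lborel T < \<infinity>" .
    have iT: "integrable lborel (indicator T :: 'a \<Rightarrow> real)" using fT b by (intro integrable_real_indicator) auto
    have "(\<integral>x. \<bar>indicator A x - indicator T x :: real\<bar> \<partial>lborel) = (\<integral>x. indicator (T - A) x \<partial>(lborel :: 'a measure))"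
      using T(2) by (intro Bochner_Integration.integral_cong) (auto simp: indicator_def)
    also have "\<dots> = measure lborel (T - A)" using b by simp
    also have "\<dots> \<le> d" using TA d by (simp add: measure_def enn2real_leI)
    finally show "\<exists>g. integrable lborel g \<and> (\<lambda>n. conv_error (e n) g) \<longlonglongrightarrow> 0 \<and> (\<integral>x. \<bar>indicator A x - g x\<bar> \<partial>(lborel :: 'a measure)) \<le> d"
      using iT conv_error_open[OF T(1) fT e] by (intro exI[of _ "indicator T"]) simp
  qed
  then have "(\<lambda>n. \<bar>c\<bar> * conv_error (e n) (indicator A)) \<longlonglongrightarrow> \<bar>c\<bar> * 0" by (intro tendsto_intros)
  moreover have "conv_error (e n) (\<lambda>x. indicator A x *\<^sub>R c) = \<bar>c\<bar> * conv_error (e n) (indicator A)" for n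
  proof -
    have "conv (e n) (\<lambda>x. indicator A x *\<^sub>R c) x = c * conv (e n) (indicator A) x" for x
      unfolding conv_def by (subst Bochner_Integration.integral_mult_right_zero[symmetric]) (simp add: mult_ac)
    then have "\<bar>conv (e n) (\<lambda>x. indicator A x *\<^sub>R c) x - indicator A x *\<^sub>R c\<bar> = \<bar>c\<bar> * \<bar>conv (e n) (indicator A) x - indicator A x\<bar>" for x
      by (simp add: abs_mult[symmetric] algebra_simps)
    then show ?thesis by simp
  qed
  ultimately show ?case by simp
next
  case (add f g)
  have fg: "integrable lborel f" "integrable lborel g" by fact+
  have "conv_error (e n) (\<lambda>x. f x + g x) \<le> conv_error (e n) f + conv_error (e n) g" for n
  proof -
    have cf: "integrable lborel (\<lambda>x. \<bar>conv (e n) f x - f x\<bar>)" and cg: "integrable lborel (\<lambda>x. \<bar>conv (e n) g x - g x\<bar>)"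
      using integrable_conv(1)[OF e(1)[of n] fg(1)] integrable_conv(1)[OF e(1)[of n] fg(2)] fg by auto
    have "conv_error (e n) (\<lambda>x. f x + g x) \<le> (\<integral>x. \<bar>conv (e n) f x - f x\<bar> + \<bar>conv (e n) g x - g x\<bar> \<partial>lborel)"
    proof (rule integral_mono)
      have "integrable lborel (conv (e n) (\<lambda>x. f x + g x))" using fg by (intro integrable_conv(1) e(1)) auto
      then show "integrable lborel (\<lambda>x. \<bar>conv (e n) (\<lambda>x. f x + g x) x - (f x + g x)\<bar>)" using fg by auto
      show "\<bar>conv (e n) (\<lambda>x. f x + g x) x - (f x + g x)\<bar> \<le> \<bar>conv (e n) f x - f x\<bar> + \<bar>conv (e n) g x - g x\<bar>" for x
        unfolding conv_add[OF e(1) fg] by linarith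
    qed (use cf cg in auto)
    also have "\<dots> = conv_error (e n) f + conv_error (e n) g" using cf cg by (rule Bochner_Integration.integral_add)
    finally show ?thesis .
  qed
  note le = this
  have lim0: "(\<lambda>n. conv_error (e n) f + conv_error (e n) g) \<longlonglongrightarrow> 0"
    using tendsto_add[OF add.IH] unfolding add_0_right .
  show ?case
  proof (rule tendsto_sandwich[OF _ _ tendsto_const lim0])
    show "\<forall>\<^sub>F n in sequentially. conv_error (e n) (\<lambda>x. f x + g x) \<le> conv_error (e n) f + conv_error (e n) g"
      by (rule always_eventually) (rule allI, rule le)
    show "\<forall>\<^sub>F n in sequentially. 0 \<le> conv_error (e n) (\<lambda>x. f x + g x)"
      by (rule always_eventually) (rule allI, rule Bochner_Integration.integral_nonneg, rule abs_ge_zero)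
  qed
next
  case (lim f s)
  have si: "integrable lborel (s i)" and f: "integrable lborel f" and err: "(\<lambda>n. conv_error (e n) (s i)) \<longlonglongrightarrow> 0"
    and sf: "(\<lambda>i. s i x) \<longlonglongrightarrow> f x" and bd: "norm (s i x) \<le> 2 * norm (f x)" for i x
    by (rule lim; simp)+
  show ?case
  proof (rule conv_error_approx[OF e(1) f])
    fix d :: real assume d: "0 < d"
    have "(\<lambda>i. \<integral>x. \<bar>f x - s i x\<bar> \<partial>lborel) \<longlonglongrightarrow> (\<integral>x. 0 \<partial>(lborel :: 'a measure))"
    proof (rule integral_dominated_convergence[where w="\<lambda>x. 3 * \<bar>f x\<bar>"])
      show "AE x in lborel. (\<lambda>i. \<bar>f x - s i x\<bar>) \<longlonglongrightarrow> 0"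
      proof (intro AE_I2)
        fix x :: 'a
        have "(\<lambda>i. \<bar>f x - s i x\<bar>) \<longlonglongrightarrow> \<bar>f x - f x\<bar>" using sf[of x] by (intro tendsto_intros) auto
        then show "(\<lambda>i. \<bar>f x - s i x\<bar>) \<longlonglongrightarrow> 0" by simp
      qed
      show "AE x in lborel. norm \<bar>f x - s i x\<bar> \<le> 3 * \<bar>f x\<bar>" for i
      proof (intro AE_I2)
        fix x :: 'a show "norm \<bar>f x - s i x\<bar> \<le> 3 * \<bar>f x\<bar>" using bd[of i x] by simp
      qed
    qed (use si f in auto)
    from LIMSEQ_D[OF this d] obtain i where
      i: "\<forall>n\<ge>i. norm ((\<integral>x. \<bar>f x - s n x\<bar> \<partial>lborel) - (\<integral>x. 0 \<partial>(lborel :: 'a measure))) < d" by (rule exE)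
    have "norm ((\<integral>x. \<bar>f x - s i x\<bar> \<partial>lborel) - (\<integral>x. 0 \<partial>(lborel :: 'a measure))) < d"
      by (rule i[rule_format, OF order_refl])
    then have d': "(\<integral>x. \<bar>f x - s i x\<bar> \<partial>lborel) \<le> d"
      unfolding Bochner_Integration.integral_zero diff_0_right real_norm_def by linarith
    show "\<exists>g. integrable lborel g \<and> (\<lambda>n. conv_error (e n) g) \<longlonglongrightarrow> 0 \<and> (\<integral>x. \<bar>f x - g x\<bar> \<partial>lborel) \<le> d"
      by (rule exI[of _ "s i"], rule conjI, rule si, rule conjI, rule err, rule d')
  qed
qed

section \<open>Weak gradients on the punctured space\<close>

text \<open>The same notion for Borel functions and \<open>lborel\<close>: product measurability and
  Fubini are applied to Borel functions, whereas \<open>weak_grad\<close> allows Lebesgue measurable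
  ones.\<close>

definition borel_weak_grad :: "('a::euclidean_space \<Rightarrow> real) \<Rightarrow> ('a \<Rightarrow> 'a) \<Rightarrow> bool" where
  "borel_weak_grad u g \<longleftrightarrow> u \<in> borel_measurable borel \<and> g \<in> borel_measurable borel \<and>
     (\<forall>K. compact K \<and> 0 \<notin> K \<longrightarrow> set_integrable lborel K u \<and> set_integrable lborel K g) \<and>
     (\<forall>\<phi>. test_fun \<phi> \<longrightarrow> (\<forall>i\<in>Basis.
        (\<integral>x. u x * frechet_derivative \<phi> (at x) i \<partial>lborel) = - (\<integral>x. (g x \<bullet> i) * \<phi> x \<partial>lborel)))"

lemma borel_version:
  fixes g :: "'a::euclidean_space \<Rightarrow> 'b::euclidean_space"
  assumes "g \<in> borel_measurable lebesgue"
  shows "\<exists>g'\<in>borel_measurable borel. AE x in lborel. g x = g' x"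
proof -
  have "\<exists>h\<in>borel_measurable lborel. AE x in lborel. g x \<bullet> i = h x" for i
    using assms by (intro completion_ex_borel_measurable_real) auto
  then obtain h where h: "\<And>i. h i \<in> borel_measurable lborel" "\<And>i. AE x in lborel. g x \<bullet> i = h i x" by metis
  have "AE x in lborel. \<forall>i\<in>Basis. g x \<bullet> i = h i x" using h(2) by (intro AE_finite_allI) auto
  then have "AE x in lborel. g x = (\<Sum>i\<in>Basis. h i x *\<^sub>R i)"
  proof eventually_elim
    case (elim x)
    have "g x = (\<Sum>i\<in>Basis. (g x \<bullet> i) *\<^sub>R i)" by (simp add: euclidean_representation)
    also have "\<dots> = (\<Sum>i\<in>Basis. h i x *\<^sub>R i)" using elim by (intro sum.cong) auto
    finally show ?case .
  qed
  moreover have "(\<lambda>x. \<Sum>i\<in>Basis. h i x *\<^sub>R i) \<in> borel_measurable borel"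
    using h(1) by (intro borel_measurable_sum borel_measurable_scaleR) auto
  ultimately show ?thesis by (rule bexI)
qed

lemma test_fun_continuous:
  assumes "test_fun \<phi>"
  shows "continuous_on UNIV \<phi>" "continuous_on UNIV (\<lambda>x. frechet_derivative \<phi> (at x) v)"
proof -
  have "\<phi> \<in> Ck 0" "\<phi> \<in> Ck (Suc 0)" using assms unfolding test_fun_def smooth_fun_def by blast+
  then show "continuous_on UNIV \<phi>" "continuous_on UNIV (\<lambda>x. frechet_derivative \<phi> (at x) v)" by auto
qed

lemma borel_measurable_lebesgueI: "f \<in> borel_measurable borel \<Longrightarrow> f \<in> borel_measurable lebesgue"
  by (rule measurable_completion) simp

lemma integral_lebesgue_borel:
  fixes f f' :: "'a::euclidean_space \<Rightarrow> 'b::euclidean_space"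
  assumes "f \<in> borel_measurable lebesgue" "f' \<in> borel_measurable borel" "AE x in lborel. f x = f' x"
  shows "(\<integral>x. f x \<partial>lebesgue) = (\<integral>x. f' x \<partial>lborel)"
    "integrable lebesgue f \<Longrightarrow> integrable lborel f'"
proof -
  have ae: "AE x in lebesgue. f x = f' x" using assms(3) by (rule AE_completion)
  have f': "f' \<in> borel_measurable lebesgue" using assms(2) by (rule borel_measurable_lebesgueI)
  have "(\<integral>x. f x \<partial>lebesgue) = (\<integral>x. f' x \<partial>lebesgue)" by (rule integral_cong_AE[OF assms(1) f' ae])
  also have "\<dots> = (\<integral>x. f' x \<partial>lborel)" using assms(2) by (intro integral_completion) auto
  finally show "(\<integral>x. f x \<partial>lebesgue) = (\<integral>x. f' x \<partial>lborel)" .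
  assume "integrable lebesgue f"
  then have "integrable lebesgue f'" using integrable_cong_AE[OF assms(1) f' ae] by simp
  then show "integrable lborel f'" using assms(2) by (subst (asm) integrable_completion) auto
qed

lemma weak_grad_borel:
  fixes u :: "'a::euclidean_space \<Rightarrow> real"
  assumes "weak_grad u g"
  shows "\<exists>u' g'. borel_weak_grad u' g' \<and> (AE x in lborel. u x = u' x) \<and> (AE x in lborel. g x = g' x)"
proof -
  have um: "u \<in> borel_measurable lebesgue" and gm: "g \<in> borel_measurable lebesgue"
    and ui: "\<And>K. compact K \<Longrightarrow> 0 \<notin> K \<Longrightarrow> set_integrable lebesgue K u"
    and gi: "\<And>K. compact K \<Longrightarrow> 0 \<notin> K \<Longrightarrow> set_integrable lebesgue K g"
    and W: "\<And>\<phi> i. test_fun \<phi> \<Longrightarrow> i \<in> Basis \<Longrightarrow>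
      (\<integral>x. u x * frechet_derivative \<phi> (at x) i \<partial>lebesgue) = - (\<integral>x. (g x \<bullet> i) * \<phi> x \<partial>lebesgue)"
    using assms unfolding weak_grad_def loc_int_punct_def by auto
  obtain u' where u': "u' \<in> borel_measurable borel" "AE x in lborel. u x = u' x" using borel_version[OF um] by blast
  obtain g' where g': "g' \<in> borel_measurable borel" "AE x in lborel. g x = g' x" using borel_version[OF gm] by blast
  have "borel_weak_grad u' g'"
    unfolding borel_weak_grad_def
  proof (intro conjI allI impI ballI u'(1) g'(1))
    fix K :: "'a set" assume K: "compact K \<and> 0 \<notin> K"
    then have [measurable]: "K \<in> sets borel" by (simp add: compact_imp_closed)
    show "set_integrable lborel K u'"
      unfolding set_integrable_def
    proof (rule integral_lebesgue_borel(2))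
      show "integrable lebesgue (\<lambda>x. indicat_real K x *\<^sub>R u x)" using ui K unfolding set_integrable_def by blast
      then show "(\<lambda>x. indicat_real K x *\<^sub>R u x) \<in> borel_measurable lebesgue" by auto
      show "(\<lambda>x. indicat_real K x *\<^sub>R u' x) \<in> borel_measurable borel" using u'(1) by measurable
      show "AE x in lborel. indicat_real K x *\<^sub>R u x = indicat_real K x *\<^sub>R u' x" using u'(2) by eventually_elim simp
    qed
    show "set_integrable lborel K g'"
      unfolding set_integrable_def
    proof (rule integral_lebesgue_borel(2))
      show "integrable lebesgue (\<lambda>x. indicat_real K x *\<^sub>R g x)" using gi K unfolding set_integrable_def by blast
      then show "(\<lambda>x. indicat_real K x *\<^sub>R g x) \<in> borel_measurable lebesgue" by auto
      show "(\<lambda>x. indicat_real K x *\<^sub>R g' x) \<in> borel_measurable borel" using g'(1) by measurable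
      show "AE x in lborel. indicat_real K x *\<^sub>R g x = indicat_real K x *\<^sub>R g' x" using g'(2) by eventually_elim simp
    qed
  next
    fix \<phi> :: "'a \<Rightarrow> real" and i :: 'a assume \<phi>: "test_fun \<phi>" and i: "i \<in> Basis"
    have m1: "\<phi> \<in> borel_measurable borel" and m2: "(\<lambda>x. frechet_derivative \<phi> (at x) i) \<in> borel_measurable borel"
      using test_fun_continuous[OF \<phi>] by (auto intro: borel_measurable_continuous_onI)
    note m1l = borel_measurable_lebesgueI[OF m1] and m2l = borel_measurable_lebesgueI[OF m2]
    have "(\<integral>x. u x * frechet_derivative \<phi> (at x) i \<partial>lebesgue) = (\<integral>x. u' x * frechet_derivative \<phi> (at x) i \<partial>lborel)"
    proof (rule integral_lebesgue_borel(1))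
      show "(\<lambda>x. u x * frechet_derivative \<phi> (at x) i) \<in> borel_measurable lebesgue" using um m2l by (rule borel_measurable_times)
      show "(\<lambda>x. u' x * frechet_derivative \<phi> (at x) i) \<in> borel_measurable borel" using u'(1) m2 by (rule borel_measurable_times)
      show "AE x in lborel. u x * frechet_derivative \<phi> (at x) i = u' x * frechet_derivative \<phi> (at x) i" using u'(2) by eventually_elim simp
    qed
    moreover have "(\<integral>x. (g x \<bullet> i) * \<phi> x \<partial>lebesgue) = (\<integral>x. (g' x \<bullet> i) * \<phi> x \<partial>lborel)"
    proof (rule integral_lebesgue_borel(1))
      show "(\<lambda>x. (g x \<bullet> i) * \<phi> x) \<in> borel_measurable lebesgue" using gm m1l by (intro borel_measurable_times borel_measurable_inner) auto
      show "(\<lambda>x. (g' x \<bullet> i) * \<phi> x) \<in> borel_measurable borel" using g'(1) m1 by (intro borel_measurable_times borel_measurable_inner) auto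
      show "AE x in lborel. (g x \<bullet> i) * \<phi> x = (g' x \<bullet> i) * \<phi> x" using g'(2) by eventually_elim simp
    qed
    ultimately show "(\<integral>x. u' x * frechet_derivative \<phi> (at x) i \<partial>lborel) = - (\<integral>x. (g' x \<bullet> i) * \<phi> x \<partial>lborel)"
      using W[OF \<phi> i] by simp
  qed
  then show ?thesis using u' g' by blast
qed

section \<open>The gradient of a mollification\<close>

lemma bump'_outside:
  assumes "0 < \<epsilon>" "\<epsilon> \<le> norm w" shows "bump' \<epsilon> w v = 0"
proof -
  have "\<epsilon>\<^sup>2 \<le> w \<bullet> w" using power_mono[of \<epsilon> "norm w" 2] assms by (simp add: dot_square_norm)
  then show ?thesis by (simp add: bump'_def flat_exp_def)
qed

lemma borel_measurable_bump' [measurable]: "(\<lambda>w. bump' \<epsilon> w v) \<in> borel_measurable borel"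
proof -
  have "continuous_on UNIV (\<lambda>w. flat_exp 2 (\<epsilon>\<^sup>2 - w \<bullet> w))"
    using flat_exp_ball_deriv[of 2 "\<epsilon>\<^sup>2" 0]
    by (auto intro!: continuous_at_imp_continuous_on has_derivative_continuous)
  then have [measurable]: "(\<lambda>w. flat_exp 2 (\<epsilon>\<^sup>2 - w \<bullet> w)) \<in> borel_measurable borel" by (rule borel_measurable_continuous_onI)
  show ?thesis unfolding bump'_def by measurable
qed

lemma bump_dir_deriv: "((\<lambda>t. bump \<epsilon> (w + t *\<^sub>R h)) has_real_derivative bump' \<epsilon> w h) (at 0)"
proof -
  have "((\<lambda>t::real. w + t *\<^sub>R h) has_derivative (\<lambda>t. t *\<^sub>R h)) (at 0)"
    by (auto intro!: derivative_eq_intros)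
  from has_derivative_compose[OF this, of "bump \<epsilon>" "bump' \<epsilon> w"]
  have "((\<lambda>t. bump \<epsilon> (w + t *\<^sub>R h)) has_derivative (\<lambda>t. bump' \<epsilon> w (t *\<^sub>R h))) (at 0)"
    by (simp add: bump_deriv)
  moreover have "(\<lambda>t. bump' \<epsilon> w (t *\<^sub>R h)) = times (bump' \<epsilon> w h)" by (auto simp: bump'_def)
  ultimately show ?thesis by (simp add: has_field_derivative_def)
qed

text \<open>The weak gradient is tested with the bump centred at \<open>z\<close>, which is
  admissible because its support lies in a ball inside \<open>K'\<close> and so avoids the origin.
  Inside this ball the indicator of \<open>K'\<close> changes nothing. The minus sign of integration
  by parts cancels against the oddness of \<open>bump'\<close>, and linearity passes from basis
  vectors to \<open>h\<close>.\<close>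

lemma mollified_gradient:
  fixes u :: "'a::euclidean_space \<Rightarrow> real"
  assumes ug: "borel_weak_grad u g" and K': "compact K'" "0 \<notin> K'" and \<epsilon>: "0 < \<epsilon>" and sub: "cball z \<epsilon> \<subseteq> K'"
  shows "(\<integral>y. bump' \<epsilon> (z - y) h * (indicator K' y * u y) \<partial>lborel) = (\<integral>y. bump \<epsilon> (z - y) *\<^sub>R (indicator K' y *\<^sub>R g y) \<partial>lborel) \<bullet> h"
proof -
  let ?u = "\<lambda>y. indicator K' y * u y" and ?g = "\<lambda>y. indicator K' y *\<^sub>R g y"
  have iu: "integrable lborel ?u" and ig: "integrable lborel ?g"
    using ug K' unfolding borel_weak_grad_def set_integrable_def by auto
  have "0 \<notin> cball z \<epsilon>" using sub K'(2) by (rule contra_subsetD)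
  then have z: "\<epsilon> < norm z" by simp
  have inK: "y \<in> K'" if "norm (z - y) < \<epsilon>" for y
    using that subsetD[OF sub, of y] by (simp add: dist_norm)
  have bi: "(\<integral>y. bump' \<epsilon> (z - y) i * ?u y \<partial>lborel) = (\<integral>y. (g y \<bullet> i) * bump \<epsilon> (y - z) \<partial>lborel)" if i: "i \<in> Basis" for i
  proof -
    have "(\<integral>y. u y * frechet_derivative (\<lambda>y. bump \<epsilon> (y - z)) (at y) i \<partial>lborel) = - (\<integral>y. (g y \<bullet> i) * bump \<epsilon> (y - z) \<partial>lborel)"
      using ug test_fun_bump[OF \<epsilon> z] i unfolding borel_weak_grad_def by blast
    moreover have "u y * frechet_derivative (\<lambda>y. bump \<epsilon> (y - z)) (at y) i = - (bump' \<epsilon> (z - y) i * ?u y)" for y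
    proof (cases "norm (z - y) < \<epsilon>")
      case True
      have "bump' \<epsilon> (y - z) i = - bump' \<epsilon> (z - y) i" using bump'_uminus[of \<epsilon> "z - y" i] by simp
      then show ?thesis using inK[OF True] by (simp add: frechet_derivative_bump)
    next
      case False
      then show ?thesis
        using bump'_outside[OF \<epsilon>, of "z - y" i] bump'_outside[OF \<epsilon>, of "y - z" i]
        by (simp add: frechet_derivative_bump norm_minus_commute)
    qed
    ultimately show ?thesis by simp
  qed
  obtain B where B: "0 \<le> B" "\<And>w v::'a. \<bar>bump' \<epsilon> w v\<bar> \<le> B * norm v" using bump'_bounded[OF \<epsilon>] by blast
  have ibu: "integrable lborel (\<lambda>y. bump' \<epsilon> (z - y) i * ?u y)" for i
  proof (rule Bochner_Integration.integrable_bound[of _ "\<lambda>y. (B * norm i) * ?u y"])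
    show "AE y in lborel. norm (bump' \<epsilon> (z - y) i * ?u y) \<le> norm ((B * norm i) * ?u y)"
      using B by (intro AE_I2) (simp add: abs_mult mult_right_mono)
    show "(\<lambda>y. bump' \<epsilon> (z - y) i * ?u y) \<in> borel_measurable lborel" using iu by measurable
  qed (use iu in auto)
  have igb: "integrable lborel (\<lambda>y. bump \<epsilon> (z - y) *\<^sub>R ?g y)"
  proof (rule Bochner_Integration.integrable_bound[OF ig])
    show "AE y in lborel. norm (bump \<epsilon> (z - y) *\<^sub>R ?g y) \<le> norm (?g y)"
    proof (intro AE_I2)
      fix y
      have "norm (bump \<epsilon> (z - y) *\<^sub>R ?g y) = bump \<epsilon> (z - y) * norm (?g y)"
        by (simp only: norm_scaleR abs_of_nonneg[OF bump_nonneg])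
      also have "\<dots> \<le> 1 * norm (?g y)" by (intro mult_right_mono bump_le_1) auto
      finally show "norm (bump \<epsilon> (z - y) *\<^sub>R ?g y) \<le> norm (?g y)" by simp
    qed
    show "(\<lambda>y. bump \<epsilon> (z - y) *\<^sub>R ?g y) \<in> borel_measurable lborel" using ig by measurable
  qed
  have hb: "bump' \<epsilon> w h = (\<Sum>i\<in>Basis. (h \<bullet> i) * bump' \<epsilon> w i)" for w
  proof -
    have "w \<bullet> h = (\<Sum>i\<in>Basis. (h \<bullet> i) * (w \<bullet> i))"
      by (subst euclidean_inner) (simp add: mult.commute)
    then show ?thesis by (simp add: bump'_def sum_distrib_left mult_ac)
  qed
  have "(\<integral>y. bump' \<epsilon> (z - y) h * ?u y \<partial>lborel) = (\<integral>y. (\<Sum>i\<in>Basis. (h \<bullet> i) * (bump' \<epsilon> (z - y) i * ?u y)) \<partial>lborel)"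
    unfolding hb by (simp add: sum_distrib_right mult.assoc)
  also have "\<dots> = (\<Sum>i\<in>Basis. (h \<bullet> i) * (\<integral>y. bump' \<epsilon> (z - y) i * ?u y \<partial>lborel))"
    using ibu by (subst Bochner_Integration.integral_sum) auto
  also have "\<dots> = (\<Sum>i\<in>Basis. (h \<bullet> i) * ((\<integral>y. bump \<epsilon> (z - y) *\<^sub>R ?g y \<partial>lborel) \<bullet> i))"
  proof (intro sum.cong refl arg_cong2[where f=times])
    fix i :: 'a assume i: "i \<in> Basis"
    have "(\<integral>y. bump' \<epsilon> (z - y) i * ?u y \<partial>lborel) = (\<integral>y. (g y \<bullet> i) * bump \<epsilon> (y - z) \<partial>lborel)" by (rule bi[OF i])
    also have "\<dots> = (\<integral>y. (bump \<epsilon> (z - y) *\<^sub>R ?g y) \<bullet> i \<partial>lborel)"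
    proof (rule Bochner_Integration.integral_cong[OF refl])
      fix y
      show "(g y \<bullet> i) * bump \<epsilon> (y - z) = (bump \<epsilon> (z - y) *\<^sub>R ?g y) \<bullet> i"
      proof (cases "norm (z - y) < \<epsilon>")
        case True
        then show ?thesis using inK[OF True] by (simp add: bump_diff_commute[of \<epsilon> z y])
      next
        case False
        then show ?thesis using bump_outside[OF \<epsilon>, of "z - y"] by (simp add: bump_diff_commute[of \<epsilon> y z])
      qed
    qed
    also have "\<dots> = (\<integral>y. bump \<epsilon> (z - y) *\<^sub>R ?g y \<partial>lborel) \<bullet> i" using igb by (intro integral_inner_left) auto
    finally show "(\<integral>y. bump' \<epsilon> (z - y) i * ?u y \<partial>lborel) = (\<integral>y. bump \<epsilon> (z - y) *\<^sub>R ?g y \<partial>lborel) \<bullet> i" .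
  qed
  also have "\<dots> = (\<integral>y. bump \<epsilon> (z - y) *\<^sub>R ?g y \<partial>lborel) \<bullet> h"
    by (subst euclidean_inner[of _ h]) (simp add: mult.commute)
  finally show ?thesis .
qed

text \<open>The difference quotients of the kernel are dominated by its Lipschitz constant times
  \<open>norm h\<close>, so the derivative passes under the integral; the weak gradient then moves
  it from the kernel to \<open>u\<close>.\<close>

lemma dir_deriv_on_conv:
  fixes u :: "'a::euclidean_space \<Rightarrow> real"
  assumes ug: "borel_weak_grad u g" and K': "compact K'" "0 \<notin> K'" and \<epsilon>: "0 < \<epsilon>" and sub: "\<And>z. z \<in> K \<Longrightarrow> cball z \<epsilon> \<subseteq> K'"
  shows "dir_deriv_on K (conv \<epsilon> (\<lambda>y. indicator K' y * u y)) (conv \<epsilon> (\<lambda>y. indicator K' y *\<^sub>R g y))"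
proof -
  let ?u = "\<lambda>y. indicator K' y * u y" and ?g = "\<lambda>y. indicator K' y *\<^sub>R g y"
  let ?m = "\<integral>w. bump \<epsilon> (w::'a) \<partial>lborel"
  have iu: "integrable lborel ?u" and ig: "integrable lborel ?g"
    using ug K' unfolding borel_weak_grad_def set_integrable_def by auto
  have m: "0 < ?m" by (rule bump_mass_pos[OF \<epsilon>])
  obtain B where B: "0 \<le> B" "\<And>w w'::'a. \<bar>eta \<epsilon> w - eta \<epsilon> w'\<bar> \<le> B * norm (w - w')" using eta_lipschitz[OF \<epsilon>] by blast
  have "((\<lambda>t. conv \<epsilon> ?u (z + t *\<^sub>R h)) has_real_derivative conv \<epsilon> ?g z \<bullet> h) (at 0)" if z: "z \<in> K" for z h
  proof -
    have "((\<lambda>t. (conv \<epsilon> ?u (z + (0 + t) *\<^sub>R h) - conv \<epsilon> ?u (z + 0 *\<^sub>R h)) / t) \<longlongrightarrow> (\<integral>y. bump' \<epsilon> (z - y) h / ?m * ?u y \<partial>lborel)) (at 0)"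
      unfolding tendsto_at_iff_sequentially
    proof (intro allI impI)
      fix X :: "nat \<Rightarrow> real" assume X: "\<forall>i. X i \<in> UNIV - {0}" "X \<longlonglongrightarrow> 0"
      have eq: "((\<lambda>t. (conv \<epsilon> ?u (z + (0 + t) *\<^sub>R h) - conv \<epsilon> ?u (z + 0 *\<^sub>R h)) / t) \<circ> X) n
         = (\<integral>y. ((eta \<epsilon> ((z - y) + X n *\<^sub>R h) - eta \<epsilon> (z - y)) / X n) * ?u y \<partial>lborel)" for n
      proof -
        have "conv \<epsilon> ?u (z + X n *\<^sub>R h) - conv \<epsilon> ?u z = (\<integral>y. eta \<epsilon> (z + X n *\<^sub>R h - y) *\<^sub>R ?u y - eta \<epsilon> (z - y) *\<^sub>R ?u y \<partial>lborel)"
          unfolding conv_def by (intro Bochner_Integration.integral_diff[symmetric] integrable_conv_integrand \<epsilon> iu)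
        then have "(conv \<epsilon> ?u (z + X n *\<^sub>R h) - conv \<epsilon> ?u z) / X n = (\<integral>y. (eta \<epsilon> (z + X n *\<^sub>R h - y) *\<^sub>R ?u y - eta \<epsilon> (z - y) *\<^sub>R ?u y) / X n \<partial>lborel)"
          by simp
        also have "\<dots> = (\<integral>y. ((eta \<epsilon> ((z - y) + X n *\<^sub>R h) - eta \<epsilon> (z - y)) / X n) * ?u y \<partial>lborel)"
        proof (rule Bochner_Integration.integral_cong[OF refl])
          fix y
          have "z + X n *\<^sub>R h - y = (z - y) + X n *\<^sub>R h" by simp
          then show "(eta \<epsilon> (z + X n *\<^sub>R h - y) *\<^sub>R ?u y - eta \<epsilon> (z - y) *\<^sub>R ?u y) / X n = ((eta \<epsilon> ((z - y) + X n *\<^sub>R h) - eta \<epsilon> (z - y)) / X n) * ?u y"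
            by (simp only:) (simp add: left_diff_distrib)
        qed
        finally show ?thesis by simp
      qed
      have "(\<lambda>n. \<integral>y. ((eta \<epsilon> ((z - y) + X n *\<^sub>R h) - eta \<epsilon> (z - y)) / X n) * ?u y \<partial>lborel) \<longlonglongrightarrow> (\<integral>y. bump' \<epsilon> (z - y) h / ?m * ?u y \<partial>lborel)"
      proof (rule integral_dominated_convergence[where w="\<lambda>y. (B * norm h) * \<bar>?u y\<bar>"])
        show "(\<lambda>y. bump' \<epsilon> (z - y) h / ?m * ?u y) \<in> borel_measurable lborel" using iu by measurable
        show "(\<lambda>y. ((eta \<epsilon> ((z - y) + X n *\<^sub>R h) - eta \<epsilon> (z - y)) / X n) * ?u y) \<in> borel_measurable lborel" for n using iu by measurable
        show "integrable lborel (\<lambda>y. (B * norm h) * \<bar>?u y\<bar>)" using iu by auto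
        show "AE y in lborel. (\<lambda>n. ((eta \<epsilon> ((z - y) + X n *\<^sub>R h) - eta \<epsilon> (z - y)) / X n) * ?u y) \<longlonglongrightarrow> bump' \<epsilon> (z - y) h / ?m * ?u y"
        proof (intro AE_I2 tendsto_mult_right)
          fix y
          have "((\<lambda>t. eta \<epsilon> ((z - y) + t *\<^sub>R h)) has_real_derivative bump' \<epsilon> (z - y) h / ?m) (at 0)"
            unfolding eta_def by (rule DERIV_cdivide[OF bump_dir_deriv])
          then have "((\<lambda>t. (eta \<epsilon> ((z - y) + t *\<^sub>R h) - eta \<epsilon> (z - y)) / t) \<longlongrightarrow> bump' \<epsilon> (z - y) h / ?m) (at 0)"
            by (simp add: DERIV_def)
          then show "(\<lambda>n. (eta \<epsilon> ((z - y) + X n *\<^sub>R h) - eta \<epsilon> (z - y)) / X n) \<longlonglongrightarrow> bump' \<epsilon> (z - y) h / ?m"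
            using X unfolding tendsto_at_iff_sequentially o_def by blast
        qed
        show "AE y in lborel. norm (((eta \<epsilon> ((z - y) + X n *\<^sub>R h) - eta \<epsilon> (z - y)) / X n) * ?u y) \<le> (B * norm h) * \<bar>?u y\<bar>" for n
        proof (intro AE_I2)
          fix y
          have Xn: "X n \<noteq> 0" using X by auto
          have "\<bar>eta \<epsilon> ((z - y) + X n *\<^sub>R h) - eta \<epsilon> (z - y)\<bar> \<le> B * (\<bar>X n\<bar> * norm h)"
            using B(2)[of "(z - y) + X n *\<^sub>R h" "z - y"] by simp
          then have "\<bar>eta \<epsilon> ((z - y) + X n *\<^sub>R h) - eta \<epsilon> (z - y)\<bar> / \<bar>X n\<bar> \<le> B * norm h"
            using Xn by (simp add: divide_le_eq mult_ac)
          then have "\<bar>eta \<epsilon> ((z - y) + X n *\<^sub>R h) - eta \<epsilon> (z - y)\<bar> / \<bar>X n\<bar> * \<bar>?u y\<bar> \<le> (B * norm h) * \<bar>?u y\<bar>"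
            by (rule mult_right_mono) simp
          then show "norm (((eta \<epsilon> ((z - y) + X n *\<^sub>R h) - eta \<epsilon> (z - y)) / X n) * ?u y) \<le> (B * norm h) * \<bar>?u y\<bar>"
            unfolding real_norm_def abs_mult[of "_ / _"] abs_divide .
        qed
      qed
      then show "((\<lambda>t. (conv \<epsilon> ?u (z + (0 + t) *\<^sub>R h) - conv \<epsilon> ?u (z + 0 *\<^sub>R h)) / t) \<circ> X) \<longlonglongrightarrow> (\<integral>y. bump' \<epsilon> (z - y) h / ?m * ?u y \<partial>lborel)"
        unfolding eq[abs_def] o_def[symmetric] using eq by (simp add: o_def)
    qed
    moreover have "(\<integral>y. bump' \<epsilon> (z - y) h / ?m * ?u y \<partial>lborel) = conv \<epsilon> ?g z \<bullet> h"
    proof -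
      have "(\<integral>y. bump' \<epsilon> (z - y) h / ?m * ?u y \<partial>lborel) = (\<integral>y. bump' \<epsilon> (z - y) h * ?u y \<partial>lborel) / ?m"
        by (simp only: times_divide_eq_left Bochner_Integration.integral_divide_zero)
      also have "\<dots> = ((\<integral>y. bump \<epsilon> (z - y) *\<^sub>R ?g y \<partial>lborel) \<bullet> h) / ?m"
        by (simp only: mollified_gradient[OF ug K' \<epsilon> sub[OF z]])
      also have "\<dots> = ((1 / ?m) *\<^sub>R (\<integral>y. bump \<epsilon> (z - y) *\<^sub>R ?g y \<partial>lborel)) \<bullet> h" by simp
      also have "(1 / ?m) *\<^sub>R (\<integral>y. bump \<epsilon> (z - y) *\<^sub>R ?g y \<partial>lborel) = conv \<epsilon> ?g z"
        unfolding conv_def eta_def by (subst integral_scaleR_right[symmetric]) (simp_all add: mult.commute)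
      finally show ?thesis .
    qed
    ultimately show ?thesis unfolding DERIV_def by simp
  qed
  then show ?thesis unfolding dir_deriv_on_def using continuous_conv[OF \<epsilon> iu] continuous_conv[OF \<epsilon> ig] by blast
qed

section \<open>Passing to the limit in the local estimates\<close>

lemma integrable_unif:
  fixes f :: "'a::euclidean_space \<Rightarrow> real"
  assumes lu: "\<And>b. b \<in> Basis \<Longrightarrow> l \<bullet> b < u \<bullet> b" and f: "integrable lborel f"
  shows "integrable (unif l u) f"
proof -
  let ?m = "measure lborel (cbox l u)"
  have m: "0 < ?m" "emeasure lborel (cbox l u) = ennreal ?m" using measure_box[of l u] lu by blast+
  have "unif l u = density lborel (\<lambda>x. ennreal (indicator (cbox l u) x / ?m))"
    unfolding uniform_measure_def m(2) using m(1)
    by (intro density_cong) (auto simp: indicator_def divide_ennreal[symmetric])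
  moreover have "integrable lborel (\<lambda>x. (indicator (cbox l u) x / ?m) *\<^sub>R f x)"
  proof (rule Bochner_Integration.integrable_bound[of _ "\<lambda>x. f x / ?m"])
    show "AE x in lborel. norm ((indicator (cbox l u) x / ?m) *\<^sub>R f x) \<le> norm (f x / ?m)"
      using m(1) by (intro AE_I2) (auto simp: indicator_def)
    show "(\<lambda>x. (indicator (cbox l u) x / ?m) *\<^sub>R f x) \<in> borel_measurable lborel" using f by measurable
  qed (use f in auto)
  ultimately show ?thesis using f m(1) by (simp add: integrable_density)
qed

text \<open>The norm bounds are uniform in \<open>n\<close> and hold for all exponents at once.
  Convergence in \<open>L^1\<close> serves the means, convergence almost everywhere serves Fatou's
  lemma.\<close>

definition mollifies ::
  "'a::euclidean_space set \<Rightarrow> 'a set \<Rightarrow> ('a \<Rightarrow> real) \<Rightarrow> ('a \<Rightarrow> 'a) \<Rightarrow> (nat \<Rightarrow> 'a \<Rightarrow> real) \<Rightarrow> (nat \<Rightarrow> 'a \<Rightarrow> 'a) \<Rightarrow> bool" where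
  "mollifies K K' u g v G \<longleftrightarrow> (\<forall>n. dir_deriv_on K (v n) (G n)) \<and> (\<forall>n. integrable lborel (v n)) \<and>
    (\<forall>n q. 1 \<le> q \<longrightarrow> (\<integral>\<^sup>+x. ennreal (\<bar>v n x\<bar> powr q) \<partial>lborel) \<le> (\<integral>\<^sup>+x\<in>K'. ennreal (\<bar>u x\<bar> powr q) \<partial>lborel)) \<and>
    (\<forall>n p. 1 \<le> p \<longrightarrow> (\<integral>\<^sup>+x. ennreal (norm (G n x) powr p) \<partial>lborel) \<le> (\<integral>\<^sup>+x\<in>K'. ennreal (norm (g x) powr p) \<partial>lborel)) \<and>
    (\<lambda>n. \<integral>x. \<bar>v n x - indicator K' x * u x\<bar> \<partial>lborel) \<longlonglongrightarrow> 0 \<and>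
    (AE x in lborel. (\<lambda>n. v n x) \<longlonglongrightarrow> indicator K' x * u x)"

lemma mollify_sequence:
  fixes u :: "'a::euclidean_space \<Rightarrow> real"
  assumes ug: "borel_weak_grad u g" and K': "compact K'" "0 \<notin> K'" and \<epsilon>: "0 < \<epsilon>" and sub: "\<And>z. z \<in> K \<Longrightarrow> cball z \<epsilon> \<subseteq> K'"
  shows "\<exists>v G. mollifies K K' u g v G"
proof -
  let ?u = "\<lambda>y. indicator K' y * u y" and ?g = "\<lambda>y. indicator K' y *\<^sub>R g y"
  have iu: "integrable lborel ?u" and ig: "integrable lborel ?g"
    using ug K' unfolding borel_weak_grad_def set_integrable_def by auto
  define e where "e n = \<epsilon> / real (Suc n)" for n
  have e: "0 < e n" "e n \<le> \<epsilon>" for n using \<epsilon> by (auto simp: e_def field_simps)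
  have e0: "e \<longlonglongrightarrow> 0" unfolding e_def by (rule LIMSEQ_Suc[OF lim_const_over_n])
  have err: "(\<lambda>n. conv_error (e n) ?u) \<longlonglongrightarrow> 0" by (rule conv_error_tendsto[OF e(1) e0 iu])
  have ic: "integrable lborel (\<lambda>x. conv (e n) ?u x - ?u x)" for n
    using integrable_conv(1)[OF e(1) iu] iu by auto
  \<comment> \<open>Convergence in \<open>L^1\<close> yields convergence almost everywhere along a
    subsequence.\<close>
  obtain \<rho> :: "nat \<Rightarrow> nat" where \<rho>: "strict_mono \<rho>" "AE x in lborel. (\<lambda>n. conv (e (\<rho> n)) ?u x - ?u x) \<longlonglongrightarrow> 0"
    using tendsto_L1_AE_subseq[of lborel "\<lambda>n x. conv (e n) ?u x - ?u x"] ic err by auto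
  have "mollifies K K' u g (\<lambda>n. conv (e (\<rho> n)) ?u) (\<lambda>n. conv (e (\<rho> n)) ?g)"
    unfolding mollifies_def
  proof (intro conjI allI impI)
    fix n
    have "cball z (e (\<rho> n)) \<subseteq> K'" if "z \<in> K" for z
      using sub[OF that] subset_cball[OF e(2)] by (rule order_trans[rotated])
    then show "dir_deriv_on K (conv (e (\<rho> n)) ?u) (conv (e (\<rho> n)) ?g)"
      by (rule dir_deriv_on_conv[OF ug K' e(1)])
    show "integrable lborel (conv (e (\<rho> n)) ?u)" by (rule integrable_conv(1)[OF e(1) iu])
    show "(\<integral>\<^sup>+x. ennreal (\<bar>conv (e (\<rho> n)) ?u x\<bar> powr q) \<partial>lborel) \<le> (\<integral>\<^sup>+x\<in>K'. ennreal (\<bar>u x\<bar> powr q) \<partial>lborel)" if "1 \<le> q" for q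
    proof -
      have "(\<integral>\<^sup>+x. ennreal (\<bar>conv (e (\<rho> n)) ?u x\<bar> powr q) \<partial>lborel) \<le> (\<integral>\<^sup>+x. ennreal (norm (?u x) powr q) \<partial>lborel)"
        using conv_young[OF e(1) iu that] by simp
      also have "\<dots> = (\<integral>\<^sup>+x\<in>K'. ennreal (\<bar>u x\<bar> powr q) \<partial>lborel)"
        using that by (intro nn_integral_cong) (auto simp: indicator_def)
      finally show ?thesis .
    qed
    show "(\<integral>\<^sup>+x. ennreal (norm (conv (e (\<rho> n)) ?g x) powr p) \<partial>lborel) \<le> (\<integral>\<^sup>+x\<in>K'. ennreal (norm (g x) powr p) \<partial>lborel)" if "1 \<le> p" for p
    proof -
      have "(\<integral>\<^sup>+x. ennreal (norm (conv (e (\<rho> n)) ?g x) powr p) \<partial>lborel) \<le> (\<integral>\<^sup>+x. ennreal (norm (?g x) powr p) \<partial>lborel)"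
        by (rule conv_young[OF e(1) ig that])
      also have "\<dots> = (\<integral>\<^sup>+x\<in>K'. ennreal (norm (g x) powr p) \<partial>lborel)"
        using that by (intro nn_integral_cong) (auto simp: indicator_def)
      finally show ?thesis .
    qed
  next
    show "(\<lambda>n. conv_error (e (\<rho> n)) ?u) \<longlonglongrightarrow> 0"
      using LIMSEQ_subseq_LIMSEQ[OF err \<rho>(1)] by (simp only: o_def)
    show "AE x in lborel. (\<lambda>n. conv (e (\<rho> n)) ?u x) \<longlonglongrightarrow> ?u x"
      using \<rho>(2) by eventually_elim (rule LIM_zero_cancel)
  qed
  then show ?thesis by blast
qed

lemma mean_tendsto:
  fixes u :: "'a::euclidean_space \<Rightarrow> real"
  assumes lu: "\<And>b. b \<in> Basis \<Longrightarrow> l \<bullet> b < w \<bullet> b" and sub: "cbox l w \<subseteq> K'"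
    and u: "u \<in> borel_measurable borel" "K' \<in> sets borel" "integrable lborel (\<lambda>x. indicator K' x * u x)" and v: "\<And>n. integrable lborel (v n)"
    and lim: "(\<lambda>n. \<integral>x. \<bar>v n x - indicator K' x * u x\<bar> \<partial>lborel) \<longlonglongrightarrow> 0"
  shows "(\<lambda>n. \<integral>x. \<bar>v n x\<bar> \<partial>unif l w) \<longlonglongrightarrow> (\<integral>x. \<bar>u x\<bar> \<partial>unif l w)"
proof -
  let ?u = "\<lambda>y. indicator K' y * u y"
  let ?m = "measure lborel (cbox l w)"
  have m: "0 < ?m" using measure_box[of l w] lu by blast
  have [measurable]: "u \<in> borel_measurable borel" "K' \<in> sets borel" by (fact u)+
  have AEQ: "AE x in unif l w. x \<in> cbox l w" by (rule AE_unif) (rule lu)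
  have uu: "(\<integral>x. \<bar>u x\<bar> \<partial>unif l w) = (\<integral>x. \<bar>?u x\<bar> \<partial>unif l w)"
  proof (rule integral_cong_AE)
    show "AE x in unif l w. \<bar>u x\<bar> = \<bar>?u x\<bar>" using AEQ by eventually_elim (use sub in auto)
  qed (simp_all, measurable)
  have iu: "integrable (unif l w) (\<lambda>x. \<bar>?u x\<bar>)" and iv: "integrable (unif l w) (\<lambda>x. \<bar>v n x\<bar>)"
    and ivu: "integrable (unif l w) (\<lambda>x. \<bar>v n x - ?u x\<bar>)" for n
    using u(3) v[of n] by (auto intro!: integrable_unif[OF lu])
  have bd: "\<bar>(\<integral>x. \<bar>v n x\<bar> \<partial>unif l w) - (\<integral>x. \<bar>u x\<bar> \<partial>unif l w)\<bar> \<le> (\<integral>x. \<bar>v n x - ?u x\<bar> \<partial>lborel) / ?m" for n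
  proof -
    have mv: "(\<lambda>x. \<bar>v n x - ?u x\<bar>) \<in> borel_measurable borel" using v[of n] by measurable
    have "\<bar>(\<integral>x. \<bar>v n x\<bar> \<partial>unif l w) - (\<integral>x. \<bar>?u x\<bar> \<partial>unif l w)\<bar> = \<bar>\<integral>x. \<bar>v n x\<bar> - \<bar>?u x\<bar> \<partial>unif l w\<bar>"
      by (simp only: Bochner_Integration.integral_diff[OF iv iu])
    also have "\<dots> \<le> (\<integral>x. \<bar>\<bar>v n x\<bar> - \<bar>?u x\<bar>\<bar> \<partial>unif l w)" by (rule integral_abs_bound)
    also have "\<dots> \<le> (\<integral>x. \<bar>v n x - ?u x\<bar> \<partial>unif l w)"
    proof (rule integral_mono)
      show "integrable (unif l w) (\<lambda>x. \<bar>\<bar>v n x\<bar> - \<bar>?u x\<bar>\<bar>)" by (rule integrable_abs[OF Bochner_Integration.integrable_diff[OF iv iu]])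
    qed (use ivu abs_triangle_ineq3 in auto)
    also have "\<dots> = (LINT x:cbox l w|lborel. \<bar>v n x - ?u x\<bar>) / ?m" by (rule integral_unif[OF mv]) (rule lu)
    also have "\<dots> \<le> (\<integral>x. \<bar>v n x - ?u x\<bar> \<partial>lborel) / ?m"
    proof (intro divide_right_mono)
      have i: "integrable lborel (\<lambda>x. \<bar>v n x - ?u x\<bar>)" using u(3) v[of n] by auto
      show "(LINT x:cbox l w|lborel. \<bar>v n x - ?u x\<bar>) \<le> (\<integral>x. \<bar>v n x - ?u x\<bar> \<partial>lborel)"
        unfolding set_lebesgue_integral_def
      proof (rule integral_mono)
        show "integrable lborel (\<lambda>x. indicator (cbox l w) x *\<^sub>R \<bar>v n x - ?u x\<bar>)"
          using i by (intro integrable_mult_indicator) auto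
        show "indicator (cbox l w) x *\<^sub>R \<bar>v n x - ?u x\<bar> \<le> \<bar>v n x - ?u x\<bar>" for x by (auto simp: indicator_def)
      qed (rule i)
    qed (use m in auto)
    finally show ?thesis unfolding uu .
  qed
  have "(\<lambda>n. (\<integral>x. \<bar>v n x - ?u x\<bar> \<partial>lborel) / ?m) \<longlonglongrightarrow> 0 / ?m" using m by (intro tendsto_divide lim tendsto_const) auto
  then have lim0: "(\<lambda>n. (\<integral>x. \<bar>v n x - ?u x\<bar> \<partial>lborel) / ?m) \<longlonglongrightarrow> 0" by simp
  have "(\<lambda>n. (\<integral>x. \<bar>v n x\<bar> \<partial>unif l w) - (\<integral>x. \<bar>u x\<bar> \<partial>unif l w)) \<longlonglongrightarrow> 0"
    by (rule Lim_null_comparison[OF _ lim0]) (use bd in \<open>simp add: always_eventually\<close>)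
  then show ?thesis by (rule LIM_zero_cancel)
qed

lemma expectation_unif_le:
  fixes f :: "'a::euclidean_space \<Rightarrow> real"
  assumes lu: "\<And>b. b \<in> Basis \<Longrightarrow> l \<bullet> b < w \<bullet> b" and f: "f \<in> borel_measurable borel" "\<And>x. 0 \<le> f x"
    and le: "(\<integral>\<^sup>+x. ennreal (f x) \<partial>lborel) \<le> ennreal (measure lborel (cbox l w) * B)" and B: "0 \<le> B"
  shows "(\<integral>x. f x \<partial>unif l w) \<le> B"
proof -
  let ?m = "measure lborel (cbox l w)"
  have m: "0 < ?m" using measure_box[of l w] lu by blast
  have "ennreal (\<integral>x. f x \<partial>unif l w) \<le> (\<integral>\<^sup>+x. ennreal (f x) \<partial>unif l w)"
    using f by (intro ennreal_integral_le) auto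
  also have "\<dots> = ennreal (1 / ?m) * (\<integral>\<^sup>+x\<in>cbox l w. ennreal (f x) \<partial>lborel)"
    using f by (intro nn_integral_unif lu) auto
  also have "\<dots> \<le> ennreal (1 / ?m) * ennreal (?m * B)"
    by (intro mult_left_mono order_trans[OF nn_integral_mono le]) (auto simp: indicator_def)
  also have "\<dots> = ennreal B" using m B by (subst ennreal_mult[symmetric]) auto
  finally show ?thesis using B by (simp add: ennreal_le_iff)
qed

text \<open>The estimate on the box holds for every mollification with the same \<open>X\<close> and
  \<open>Y\<close>, because these bound norms over the larger set \<open>K'\<close>. The means
  converge, and Fatou's lemma handles the left side.\<close>

lemma interp_transfer:
  fixes u :: "'a::euclidean_space \<Rightarrow> real"
  assumes ug: "borel_weak_grad u g" and K': "compact K'" "0 \<notin> K'" and \<epsilon>: "0 < \<epsilon>" and sub: "\<And>z. z \<in> cbox l w \<Longrightarrow> cball z \<epsilon> \<subseteq> K'"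
    and lu: "\<And>b. b \<in> Basis \<Longrightarrow> l \<bullet> b < w \<bullet> b"
    and D: "\<And>x y. x \<in> cbox l w \<Longrightarrow> y \<in> cbox l w \<Longrightarrow> dist x y \<le> D"
    and p: "1 \<le> p" and s: "p \<le> s" "1 / p - 1 / s \<le> 1 / DIM('a)"
    and r: "0 < r" and q: "1 \<le> q" and \<theta>: "0 \<le> \<theta>" "\<theta> \<le> 1" "(1 - \<theta>) / q + \<theta> / s \<le> 1 / r"
    and X: "0 < X" "(\<integral>\<^sup>+x\<in>K'. ennreal (\<bar>u x\<bar> powr q) \<partial>lborel) \<le> ennreal (measure lborel (cbox l w) * X powr q)"
    and Y: "0 < Y" "(\<integral>\<^sup>+x\<in>K'. ennreal (norm (g x) powr p) \<partial>lborel) \<le> ennreal (measure lborel (cbox l w) * (Y powr p / D powr p))"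
  shows "(\<integral>\<^sup>+x\<in>cbox l w. ennreal (\<bar>u x\<bar> powr r) \<partial>lborel) \<le> ennreal (measure lborel (cbox l w) * (2 powr r * (
     ((2 powr (q + 1)) powr (r * (1 - \<theta>) / q) * (2 * (2 ^ DIM('a) + 1) powr (1 / p) + (1 + s * (1 - 1 / p))) powr (r * \<theta>)) * (X powr (1 - \<theta>) * Y powr \<theta>) powr r
     + (\<integral>x. \<bar>u x\<bar> \<partial>unif l w) powr r)))"
proof -
  let ?m = "measure lborel (cbox l w)"
  let ?C = "((2 powr (q + 1)) powr (r * (1 - \<theta>) / q) * (2 * (2 ^ DIM('a) + 1) powr (1 / p) + (1 + s * (1 - 1 / p))) powr (r * \<theta>)) * (X powr (1 - \<theta>) * Y powr \<theta>) powr r"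
  have m: "0 < ?m" using measure_box[of l w] lu by blast
  have um: "u \<in> borel_measurable borel" and iu: "integrable lborel (\<lambda>x. indicator K' x * u x)"
    using ug K' unfolding borel_weak_grad_def set_integrable_def by auto
  have Km: "K' \<in> sets borel" using K' by (simp add: compact_imp_closed)
  have Qsub: "cbox l w \<subseteq> K'" using sub \<epsilon> by (meson centre_in_cball less_imp_le subset_iff)
  obtain v G where "mollifies (cbox l w) K' u g v G" using mollify_sequence[OF ug K' \<epsilon> sub] by blast
  then have v: "\<And>n. dir_deriv_on (cbox l w) (v n) (G n)" "\<And>n. integrable lborel (v n)"
    "\<And>n q. 1 \<le> q \<Longrightarrow> (\<integral>\<^sup>+x. ennreal (\<bar>v n x\<bar> powr q) \<partial>lborel) \<le> (\<integral>\<^sup>+x\<in>K'. ennreal (\<bar>u x\<bar> powr q) \<partial>lborel)"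
    "\<And>n p. 1 \<le> p \<Longrightarrow> (\<integral>\<^sup>+x. ennreal (norm (G n x) powr p) \<partial>lborel) \<le> (\<integral>\<^sup>+x\<in>K'. ennreal (norm (g x) powr p) \<partial>lborel)"
    "(\<lambda>n. \<integral>x. \<bar>v n x - indicator K' x * u x\<bar> \<partial>lborel) \<longlonglongrightarrow> 0"
    "AE x in lborel. (\<lambda>n. v n x) \<longlonglongrightarrow> indicator K' x * u x"
    unfolding mollifies_def by blast+
  have cv: "continuous_on UNIV (v n)" and cG: "continuous_on UNIV (G n)" for n
    using v(1)[of n] by (auto simp: dir_deriv_on_def)
  have vm: "v n \<in> borel_measurable borel" and Gm: "G n \<in> borel_measurable borel" for n
    using cv[of n] cG[of n] by (auto intro: borel_measurable_continuous_onI)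
  have D0: "0 < D"
  proof -
    obtain b :: 'a where b: "b \<in> Basis" using nonempty_Basis by blast
    have "l \<noteq> w" using lu[OF b] by auto
    then have "0 < dist l w" by simp
    moreover have "l \<in> cbox l w" "w \<in> cbox l w" unfolding mem_box using lu by (auto intro: less_imp_le)
    ultimately show ?thesis using D[of l w] by linarith
  qed
  have mean: "(\<lambda>n. \<integral>x. \<bar>v n x\<bar> \<partial>unif l w) \<longlonglongrightarrow> (\<integral>x. \<bar>u x\<bar> \<partial>unif l w)"
    by (rule mean_tendsto[OF lu Qsub um Km iu v(2,5)])
  have each: "(\<integral>\<^sup>+x\<in>cbox l w. ennreal (\<bar>v n x\<bar> powr r) \<partial>lborel) \<le> ennreal (?m * (2 powr r * (?C + (\<integral>x. \<bar>v n x\<bar> \<partial>unif l w) powr r)))" for n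
  proof -
    have "(\<integral>x. \<bar>v n x\<bar> powr r \<partial>unif l w) \<le> 2 powr r * (?C + (\<integral>x. \<bar>v n x\<bar> \<partial>unif l w) powr r)"
    proof (rule local_interp[OF lu v(1) D p s r q \<theta> X(1) _ Y(1)])
      show "(\<integral>x. \<bar>v n x\<bar> powr q \<partial>unif l w) \<le> X powr q"
        using vm order_trans[OF v(3)[OF q] X(2)] by (intro expectation_unif_le[OF lu]) auto
      have "(\<integral>x. norm (G n x) powr p \<partial>unif l w) \<le> Y powr p / D powr p"
        using Gm order_trans[OF v(4)[OF p] Y(2)] by (intro expectation_unif_le[OF lu]) auto
      then show "D powr p * (\<integral>x. norm (G n x) powr p \<partial>unif l w) \<le> Y powr p"
        using D0 by (simp add: field_simps)
    qed
    then have "ennreal (?m * (\<integral>x. \<bar>v n x\<bar> powr r \<partial>unif l w)) \<le> ennreal (?m * (2 powr r * (?C + (\<integral>x. \<bar>v n x\<bar> \<partial>unif l w) powr r)))"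
      using m by (intro ennreal_leI mult_left_mono) auto
    moreover have "(\<integral>\<^sup>+x\<in>cbox l w. ennreal (\<bar>v n x\<bar> powr r) \<partial>lborel) = ennreal (?m * (\<integral>x. \<bar>v n x\<bar> powr r \<partial>unif l w))"
    proof -
      have "continuous_on UNIV (\<lambda>x. \<bar>v n x\<bar> powr r)"
        using r by (intro continuous_on_powr_const continuous_intros cv) auto
      then have "ennreal (\<integral>x. \<bar>v n x\<bar> powr r \<partial>unif l w) = (\<integral>\<^sup>+x. ennreal (\<bar>v n x\<bar> powr r) \<partial>unif l w)"
        by (intro nn_integral_eq_integral[symmetric] integrable_unif_continuous lu) auto
      also have "\<dots> = ennreal (1 / ?m) * (\<integral>\<^sup>+x\<in>cbox l w. ennreal (\<bar>v n x\<bar> powr r) \<partial>lborel)"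
        using vm by (intro nn_integral_unif lu) auto
      finally have "ennreal ?m * ennreal (\<integral>x. \<bar>v n x\<bar> powr r \<partial>unif l w) = (ennreal ?m * ennreal (1 / ?m)) * (\<integral>\<^sup>+x\<in>cbox l w. ennreal (\<bar>v n x\<bar> powr r) \<partial>lborel)"
        by (simp add: mult.assoc)
      also have "ennreal ?m * ennreal (1 / ?m) = 1" using m by (subst ennreal_mult[symmetric]) auto
      finally show ?thesis using m by (simp add: ennreal_mult)
    qed
    ultimately show ?thesis by simp
  qed
  have "(\<integral>\<^sup>+x\<in>cbox l w. ennreal (\<bar>u x\<bar> powr r) \<partial>lborel) = (\<integral>\<^sup>+x. liminf (\<lambda>n. ennreal (\<bar>v n x\<bar> powr r) * indicator (cbox l w) x) \<partial>lborel)"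
  proof (rule nn_integral_cong_AE)
    show "AE x in lborel. ennreal (\<bar>u x\<bar> powr r) * indicator (cbox l w) x = liminf (\<lambda>n. ennreal (\<bar>v n x\<bar> powr r) * indicator (cbox l w) x)"
      using v(6)
    proof eventually_elim
      case (elim x)
      show ?case
      proof (cases "x \<in> cbox l w")
        case True
        then have "(\<lambda>n. v n x) \<longlonglongrightarrow> u x" using elim Qsub by auto
        then have "(\<lambda>n. \<bar>v n x\<bar> powr r) \<longlonglongrightarrow> \<bar>u x\<bar> powr r"
          using r by (intro tendsto_powr' tendsto_intros) auto
        then have "(\<lambda>n. ennreal (\<bar>v n x\<bar> powr r)) \<longlonglongrightarrow> ennreal (\<bar>u x\<bar> powr r)" by (rule tendsto_ennrealI)
        then have "liminf (\<lambda>n. ennreal (\<bar>v n x\<bar> powr r)) = ennreal (\<bar>u x\<bar> powr r)" by (intro lim_imp_Liminf) auto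
        then show ?thesis using True by simp
      next
        case False
        have "liminf (\<lambda>n::nat. 0::ennreal) = 0" by (intro lim_imp_Liminf) auto
        then show ?thesis using False by simp
      qed
    qed
  qed
  also have "\<dots> \<le> liminf (\<lambda>n. \<integral>\<^sup>+x\<in>cbox l w. ennreal (\<bar>v n x\<bar> powr r) \<partial>lborel)"
  proof (rule nn_integral_liminf)
    fix n show "(\<lambda>x. ennreal (\<bar>v n x\<bar> powr r) * indicator (cbox l w) x) \<in> borel_measurable lborel"
      using vm[of n] by measurable
  qed
  also have "\<dots> \<le> liminf (\<lambda>n. ennreal (?m * (2 powr r * (?C + (\<integral>x. \<bar>v n x\<bar> \<partial>unif l w) powr r))))"
    by (intro Liminf_mono always_eventually allI each)
  also have "\<dots> = ennreal (?m * (2 powr r * (?C + (\<integral>x. \<bar>u x\<bar> \<partial>unif l w) powr r)))"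
  proof (intro lim_imp_Liminf tendsto_ennrealI tendsto_mult tendsto_add tendsto_const)
    show "(\<lambda>n. (\<integral>x. \<bar>v n x\<bar> \<partial>unif l w) powr r) \<longlonglongrightarrow> (\<integral>x. \<bar>u x\<bar> \<partial>unif l w) powr r"
      using r mean by (intro tendsto_powr' tendsto_const) (auto intro!: always_eventually Bochner_Integration.integral_nonneg)
  qed simp
  finally show ?thesis .
qed

text \<open>The means are taken of \<open>\<bar>u\<bar>\<close>, which leads to nonnegative
  sequences; as \<open>abs\<close> is 1-Lipschitz, they oscillate no more than \<open>u\<close>
  does. Jensen's inequality passes from the \<open>p\<close>-th power oscillation to the difference
  of the means.\<close>

lemma mean_transfer:
  fixes u :: "'a::euclidean_space \<Rightarrow> real"
  assumes ug: "borel_weak_grad u g" and K': "compact K'" "0 \<notin> K'" and \<epsilon>: "0 < \<epsilon>" and sub: "\<And>z. z \<in> K \<Longrightarrow> cball z \<epsilon> \<subseteq> K'"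
    and K: "convex K" "compact K" and D: "\<And>x y. x \<in> K \<Longrightarrow> y \<in> K \<Longrightarrow> dist x y \<le> D" and p: "1 \<le> p"
    and b1: "\<And>b. b \<in> Basis \<Longrightarrow> l1 \<bullet> b < u1 \<bullet> b" and b2: "\<And>b. b \<in> Basis \<Longrightarrow> l2 \<bullet> b < u2 \<bullet> b"
    and box_sub: "cbox l1 u1 \<subseteq> K" "cbox l2 u2 \<subseteq> K"
    and I: "(\<integral>\<^sup>+x\<in>K'. ennreal (norm (g x) powr p) \<partial>lborel) \<le> ennreal I" "0 \<le> I"
  shows "\<bar>(\<integral>x. \<bar>u x\<bar> \<partial>unif l1 u1) - (\<integral>x. \<bar>u x\<bar> \<partial>unif l2 u2)\<bar>
     \<le> (D powr p * 2 ^ DIM('a) * measure lborel K / (measure lborel (cbox l1 u1) * measure lborel (cbox l2 u2)) * I) powr (1 / p)"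
proof -
  let ?B = "D powr p * 2 ^ DIM('a) * measure lborel K / (measure lborel (cbox l1 u1) * measure lborel (cbox l2 u2)) * I"
  interpret U1: prob_space "unif l1 u1" using b1 by (rule prob_space_unif)
  have um: "u \<in> borel_measurable borel" and iu: "integrable lborel (\<lambda>x. indicator K' x * u x)"
    using ug K' unfolding borel_weak_grad_def set_integrable_def by auto
  have Km: "K' \<in> sets borel" using K' by (simp add: compact_imp_closed)
  have Ksub: "K \<subseteq> K'" using sub \<epsilon> by (meson centre_in_cball less_imp_le subset_iff)
  obtain v G where "mollifies K K' u g v G" using mollify_sequence[OF ug K' \<epsilon> sub] by blast
  then have v: "\<And>n. dir_deriv_on K (v n) (G n)" "\<And>n. integrable lborel (v n)"
    "\<And>n q. 1 \<le> q \<Longrightarrow> (\<integral>\<^sup>+x. ennreal (\<bar>v n x\<bar> powr q) \<partial>lborel) \<le> (\<integral>\<^sup>+x\<in>K'. ennreal (\<bar>u x\<bar> powr q) \<partial>lborel)"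
    "\<And>n p. 1 \<le> p \<Longrightarrow> (\<integral>\<^sup>+x. ennreal (norm (G n x) powr p) \<partial>lborel) \<le> (\<integral>\<^sup>+x\<in>K'. ennreal (norm (g x) powr p) \<partial>lborel)"
    "(\<lambda>n. \<integral>x. \<bar>v n x - indicator K' x * u x\<bar> \<partial>lborel) \<longlonglongrightarrow> 0"
    "AE x in lborel. (\<lambda>n. v n x) \<longlonglongrightarrow> indicator K' x * u x"
    unfolding mollifies_def by blast+
  have cv: "continuous_on UNIV (v n)" for n using v(1)[of n] by (auto simp: dir_deriv_on_def)
  have lim: "(\<lambda>n. \<bar>(\<integral>x. \<bar>v n x\<bar> \<partial>unif l1 u1) - (\<integral>x. \<bar>v n x\<bar> \<partial>unif l2 u2)\<bar>) \<longlonglongrightarrow> \<bar>(\<integral>x. \<bar>u x\<bar> \<partial>unif l1 u1) - (\<integral>x. \<bar>u x\<bar> \<partial>unif l2 u2)\<bar>"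
    by (intro tendsto_intros mean_tendsto[OF _ _ um Km iu v(2,5)] b1 b2 order_trans[OF _ Ksub] box_sub)
  have "\<bar>(\<integral>x. \<bar>v n x\<bar> \<partial>unif l1 u1) - (\<integral>x. \<bar>v n x\<bar> \<partial>unif l2 u2)\<bar> \<le> ?B powr (1 / p)" for n
  proof -
    let ?c = "\<integral>x. \<bar>v n x\<bar> \<partial>unif l2 u2"
    have cav: "continuous_on UNIV (\<lambda>x. \<bar>v n x\<bar>)" by (intro continuous_intros cv)
    have cad: "continuous_on UNIV (\<lambda>x. \<bar>\<bar>v n x\<bar> - ?c\<bar>)" by (intro continuous_intros cv)
    have cp: "continuous_on UNIV (\<lambda>x. \<bar>\<bar>v n x\<bar> - ?c\<bar> powr p)"
      using p by (intro continuous_on_powr_const cad) auto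
    note ii = integrable_unif_continuous[OF b1 cav] integrable_unif_continuous[OF b1 cad] integrable_unif_continuous[OF b1 cp]
    have osc: "(\<integral>x. \<bar>\<bar>v n x\<bar> - ?c\<bar> powr p \<partial>unif l1 u1) \<le> ?B"
    proof (rule mean_oscillation[OF v(1) K D p b1 b2 box_sub _ I(2), where \<phi>=abs])
      show "(\<integral>\<^sup>+x\<in>K. ennreal (norm (G n x) powr p) \<partial>lborel) \<le> ennreal I"
      proof -
        have "(\<integral>\<^sup>+x\<in>K. ennreal (norm (G n x) powr p) \<partial>lborel) \<le> (\<integral>\<^sup>+x. ennreal (norm (G n x) powr p) \<partial>lborel)"
          by (intro nn_integral_mono) (auto simp: indicator_def)
        then show ?thesis using v(4)[OF p, of n] I(1) by (meson order_trans)
      qed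
      show "continuous_on UNIV (abs :: real \<Rightarrow> real)" by (intro continuous_intros)
    qed (assumption | rule abs_triangle_ineq3)+
    have "\<bar>(\<integral>x. \<bar>v n x\<bar> \<partial>unif l1 u1) - ?c\<bar> = \<bar>\<integral>x. \<bar>v n x\<bar> - ?c \<partial>unif l1 u1\<bar>"
      using ii(1) U1.prob_space by simp
    also have "\<dots> \<le> (\<integral>x. \<bar>\<bar>v n x\<bar> - ?c\<bar> \<partial>unif l1 u1)" by (rule integral_abs_bound)
    finally have "\<bar>(\<integral>x. \<bar>v n x\<bar> \<partial>unif l1 u1) - ?c\<bar> powr p \<le> (\<integral>x. \<bar>\<bar>v n x\<bar> - ?c\<bar> \<partial>unif l1 u1) powr p"
      using p by (intro powr_mono2) auto
    also have "\<dots> \<le> (\<integral>x. \<bar>\<bar>v n x\<bar> - ?c\<bar> powr p \<partial>unif l1 u1)"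
      using p ii(3) by (intro U1.jensen_powr) auto
    also note osc
    finally have "(\<bar>(\<integral>x. \<bar>v n x\<bar> \<partial>unif l1 u1) - ?c\<bar> powr p) powr (1 / p) \<le> ?B powr (1 / p)"
      using p by (intro powr_mono2) auto
    then show ?thesis using p by (simp add: powr_powr)
  qed
  then show ?thesis by (intro LIMSEQ_le_const2[OF lim]) blast
qed

section \<open>Dyadic decomposition\<close>

text \<open>With \<open>R = 2 powr k\<close>, this contains the \<open>R / 2\<close>-neighbourhood
  of the box with parameters \<open>R\<close> and \<open>4 * R\<close>, which holds the boxes of
  scales \<open>k\<close> and \<open>k + 1\<close>. The margin is the room needed for
  mollification.\<close>

definition shell :: "int \<Rightarrow> 'a::euclidean_space set" where
  "shell k = {x. 2 powr of_int k / 2 \<le> norm x \<and> norm x \<le> 8 * DIM('a) * 2 powr of_int k}"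

lemma closed_shell: "closed (shell k)"
  unfolding shell_def by (intro closed_Collect_conj closed_Collect_le continuous_intros)

lemma compact_shell: "compact (shell k)"
proof -
  have "shell k \<subseteq> cball (0::'a) (8 * DIM('a) * 2 powr of_int k)" by (auto simp: shell_def)
  then have "bounded (shell k :: 'a set)" using bounded_cball bounded_subset by blast
  then show ?thesis using closed_shell by (simp add: compact_eq_bounded_closed)
qed

lemma zero_notin_shell: "0 \<notin> shell k" by (simp add: shell_def not_le)

lemma shell_measurable [measurable]: "shell k \<in> sets borel" by (rule borel_closed[OF closed_shell])

text \<open>Membership confines \<open>k\<close> to an interval of length
  \<open>log 2 (8 * N) + 1\<close>, with the crude bound \<open>log 2 (8 * N) <= 8 * N\<close>.
  Bounded overlap is what lets sums over shells be compared with integrals over the whole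
  space.\<close>

lemma card_shells:
  fixes x :: "'a::euclidean_space"
  assumes "finite F"
  shows "real (card {k\<in>F. x \<in> shell k}) \<le> 8 * real DIM('a) + 2"
proof (cases "x = 0")
  case True
  then show ?thesis by (simp add: zero_notin_shell)
next
  case False
  define y where "y = log 2 (norm x)"
  have n: "0 < norm x" using False by simp
  have sub: "{k\<in>F. x \<in> shell k} \<subseteq> {\<lceil>y - log 2 (8 * DIM('a))\<rceil>..\<lfloor>y + 1\<rfloor>}"
  proof
    fix k assume "k \<in> {k\<in>F. x \<in> shell k}"
    then have k: "2 powr of_int k / 2 \<le> norm x" "norm x \<le> 8 * DIM('a) * 2 powr of_int k" by (auto simp: shell_def)
    have "log 2 (2 powr of_int k) \<le> log 2 (2 * norm x)" using k n by (subst log_le_cancel_iff) auto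
    then have 1: "of_int k \<le> y + 1" using n by (simp add: y_def log_mult)
    have "log 2 (norm x) \<le> log 2 (8 * DIM('a) * 2 powr of_int k)" using k n by (subst log_le_cancel_iff) auto
    then have "y \<le> log 2 (8 * DIM('a)) + of_int k" unfolding y_def by (subst (asm) log_mult) auto
    then have "y - log 2 (8 * DIM('a)) \<le> of_int k" by simp
    with 1 show "k \<in> {\<lceil>y - log 2 (8 * DIM('a))\<rceil>..\<lfloor>y + 1\<rfloor>}"
      by (simp only: atLeastAtMost_iff ceiling_le_iff le_floor_iff)
  qed
  have lg: "log 2 (8 * DIM('a)) \<le> 8 * DIM('a)"
  proof -
    have "real (8 * DIM('a)) \<le> 2 powr (8 * DIM('a))"
      using of_nat_less_two_power[of "8 * DIM('a)", where 'a=real] by (simp add: powr_realpow[symmetric] less_imp_le)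
    then have "log 2 (8 * DIM('a)) \<le> log 2 (2 powr (8 * DIM('a)))" by (subst log_le_cancel_iff) auto
    then show ?thesis by simp
  qed
  have "card {k\<in>F. x \<in> shell k} \<le> card {\<lceil>y - log 2 (8 * DIM('a))\<rceil>..\<lfloor>y + 1\<rfloor>}"
    by (intro card_mono sub) auto
  also have "\<dots> = nat (\<lfloor>y + 1\<rfloor> + 1 - \<lceil>y - log 2 (8 * DIM('a))\<rceil>)" by simp
  finally have c: "card {k\<in>F. x \<in> shell k} \<le> nat (\<lfloor>y + 1\<rfloor> + 1 - \<lceil>y - log 2 (8 * DIM('a))\<rceil>)" .
  have "real_of_int (\<lfloor>y + 1\<rfloor> + 1 - \<lceil>y - log 2 (8 * DIM('a))\<rceil>) \<le> 8 * real DIM('a) + 2"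
    using lg of_int_floor_le[of "y + 1"] le_of_int_ceiling[of "y - log 2 (8 * DIM('a))"] by linarith
  then show ?thesis using c by linarith
qed

lemma sum_shells_le:
  fixes f :: "'a::euclidean_space \<Rightarrow> ennreal"
  assumes [measurable]: "f \<in> borel_measurable borel" and F: "finite F"
  shows "(\<Sum>k\<in>F. \<integral>\<^sup>+x\<in>shell k. f x \<partial>lborel) \<le> ennreal (8 * real DIM('a) + 2) * (\<integral>\<^sup>+x. f x \<partial>lborel)"
proof -
  have "(\<Sum>k\<in>F. \<integral>\<^sup>+x\<in>shell k. f x \<partial>lborel) = (\<integral>\<^sup>+x. (\<Sum>k\<in>F. f x * indicator (shell k) x) \<partial>lborel)"
    by (rule nn_integral_sum[symmetric]) measurable
  also have "\<dots> \<le> (\<integral>\<^sup>+x. ennreal (8 * real DIM('a) + 2) * f x \<partial>lborel)"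
  proof (rule nn_integral_mono)
    fix x :: 'a
    have "(\<Sum>k\<in>F. f x * indicator (shell k) x) = f x * (\<Sum>k\<in>F. indicator (shell k) x)" by (simp add: sum_distrib_left)
    also have "\<dots> \<le> f x * ennreal (8 * real DIM('a) + 2)"
    proof (rule mult_left_mono)
      have "(\<Sum>k\<in>F. indicator (shell k) x :: ennreal) = of_nat (card {k\<in>F. x \<in> shell k})"
        using F by (simp add: indicator_def of_bool_def sum.If_cases Int_def)
      also have "\<dots> \<le> ennreal (8 * real DIM('a) + 2)"
        unfolding ennreal_of_nat_eq_real_of_nat by (rule ennreal_leI[OF card_shells[OF F]])
      finally show "(\<Sum>k\<in>F. indicator (shell k) x) \<le> ennreal (8 * real DIM('a) + 2)" .
    qed simp
    finally show "(\<Sum>k\<in>F. f x * indicator (shell k) x) \<le> ennreal (8 * real DIM('a) + 2) * f x"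
      by (simp only: mult.commute)
  qed
  also have "\<dots> = ennreal (8 * real DIM('a) + 2) * (\<integral>\<^sup>+x. f x \<partial>lborel)" by (rule nn_integral_cmult) measurable
  finally show ?thesis .
qed

text \<open>The geometric summand makes all the numbers positive, which avoids the junk value
  \<open>0 powr 0 = 0\<close> in products \<open>\<alpha> powr (1 - \<theta>) * \<beta> powr \<theta>\<close>.\<close>

lemma shell_weights:
  fixes f :: "'a::euclidean_space \<Rightarrow> ennreal"
  assumes f: "f \<in> borel_measurable borel" and le: "(\<integral>\<^sup>+x. f x \<partial>lborel) \<le> 1" and t: "0 < t"
  shows "\<exists>\<alpha>::int \<Rightarrow> real. (\<forall>k. 0 < \<alpha> k) \<and> (\<forall>F. finite F \<longrightarrow> (\<Sum>k\<in>F. \<alpha> k powr t) \<le> 1) \<and>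
    (\<forall>k. (\<integral>\<^sup>+x\<in>shell k. f x \<partial>lborel) \<le> ennreal (2 * (8 * real DIM('a) + 2) * \<alpha> k powr t))"
proof -
  define n where "n = 8 * real DIM('a) + 2"
  have n: "0 < n" by (simp add: n_def)
  define a where "a k = enn2real (\<integral>\<^sup>+x\<in>shell k. f x \<partial>lborel)" for k
  have fin: "(\<integral>\<^sup>+x\<in>shell k. f x \<partial>lborel) \<le> 1" for k
    by (rule order_trans[OF nn_integral_mono le]) (auto simp: indicator_def)
  have ae: "ennreal (a k) = (\<integral>\<^sup>+x\<in>shell k. f x \<partial>lborel)" for k
    unfolding a_def using fin[of k] by (intro ennreal_enn2real) (auto intro: le_less_trans)
  have a0: "0 \<le> a k" for k by (simp add: a_def)
  have asum: "(\<Sum>k\<in>F. a k) \<le> n" if "finite F" for F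
  proof -
    have "ennreal (\<Sum>k\<in>F. a k) = (\<Sum>k\<in>F. \<integral>\<^sup>+x\<in>shell k. f x \<partial>lborel)"
      by (simp only: ae[symmetric] sum_ennreal[OF a0])
    also have "\<dots> \<le> ennreal n * (\<integral>\<^sup>+x. f x \<partial>lborel)"
      unfolding n_def by (rule sum_shells_le[OF f that])
    also have "\<dots> \<le> ennreal n * 1" by (rule mult_left_mono[OF le]) simp
    finally show ?thesis using n by simp
  qed
  \<comment> \<open>The powers sum to at most 4, so these terms use up at most \<open>1 / 2\<close>;
    the shell integrals divided by \<open>2 * n\<close> use up the other half.\<close>
  define \<epsilon> where "\<epsilon> k = 2 powr (- \<bar>real_of_int k\<bar>) / 8" for k :: int
  have \<epsilon>sum: "(\<Sum>k\<in>F. \<epsilon> k) \<le> 1 / 2" if F: "finite F" for F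
  proof -
    have 1: "(\<Sum>k\<in>F \<inter> {0..}. 2 powr (- \<bar>real_of_int k\<bar>)) \<le> 2"
    proof -
      have "(\<Sum>k\<in>F \<inter> {0..}. 2 powr (- \<bar>real_of_int k\<bar>)) = (\<Sum>k\<in>F \<inter> {0..}. 2 powr (of_int k * (- 1)))"
        by (intro sum.cong) auto
      also have "\<dots> \<le> 1 / (1 - 2 powr (- 1))" using F by (intro sum_powr2_nonneg_le) auto
      finally show ?thesis by (simp add: powr_minus)
    qed
    have 2: "(\<Sum>k\<in>F \<inter> {..<0}. 2 powr (- \<bar>real_of_int k\<bar>)) \<le> 2"
    proof -
      have "(\<Sum>k\<in>F \<inter> {..<0}. 2 powr (- \<bar>real_of_int k\<bar>)) = (\<Sum>k\<in>F \<inter> {..<0}. 2 powr (of_int k * 1))"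
        by (intro sum.cong) auto
      also have "\<dots> \<le> 1 / (1 - 2 powr (- 1))" using F by (intro sum_powr2_nonpos_le) auto
      finally show ?thesis by (simp add: powr_minus)
    qed
    have "(\<Sum>k\<in>F. 2 powr (- \<bar>real_of_int k\<bar>)) = (\<Sum>k\<in>F \<inter> {0..}. 2 powr (- \<bar>real_of_int k\<bar>)) + (\<Sum>k\<in>F \<inter> {..<0}. 2 powr (- \<bar>real_of_int k\<bar>))"
      using F by (subst sum.union_disjoint[symmetric]) (auto intro!: sum.cong)
    then show ?thesis using 1 2 unfolding \<epsilon>_def sum_divide_distrib[symmetric] by linarith
  qed
  have \<epsilon>0: "0 < \<epsilon> k" for k by (simp add: \<epsilon>_def)
  define z where "z k = a k / (2 * n) + \<epsilon> k" for k
  have z0: "0 < z k" for k unfolding z_def using a0[of k] \<epsilon>0[of k] n by (intro add_nonneg_pos) auto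
  define \<alpha> where "\<alpha> k = z k powr (1 / t)" for k
  have at: "\<alpha> k powr t = z k" for k using z0[of k] t by (simp add: \<alpha>_def powr_powr)
  have "(\<Sum>k\<in>F. \<alpha> k powr t) \<le> 1" if "finite F" for F
  proof -
    have "(\<Sum>k\<in>F. \<alpha> k powr t) = (\<Sum>k\<in>F. a k) / (2 * n) + (\<Sum>k\<in>F. \<epsilon> k)"
      by (simp add: at z_def sum.distrib sum_divide_distrib)
    also have "(\<Sum>k\<in>F. a k) / (2 * n) \<le> n / (2 * n)" using asum[OF that] n by (intro divide_right_mono) auto
    finally show ?thesis using \<epsilon>sum[OF that] n by simp
  qed
  moreover have "(\<integral>\<^sup>+x\<in>shell k. f x \<partial>lborel) \<le> ennreal (2 * (8 * real DIM('a) + 2) * \<alpha> k powr t)" for k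
  proof -
    have "a k \<le> 2 * n * z k" using n \<epsilon>0[of k] by (simp add: z_def distrib_left)
    then have "ennreal (a k) \<le> ennreal (2 * n * z k)" by (rule ennreal_leI)
    then show ?thesis unfolding ae at n_def by simp
  qed
  moreover have "0 < \<alpha> k" for k using z0[of k] by (simp add: \<alpha>_def)
  ultimately show ?thesis by blast
qed

text \<open>The weight is monotone in the norm, in a direction that depends on the sign of
  \<open>d\<close>; hence the smaller of the two values at the boundary of the rescaled
  shell.\<close>

definition shell_lo :: "'a::euclidean_space itself \<Rightarrow> real \<Rightarrow> real" where
  "shell_lo _ d = min ((1 / 2) powr d) ((8 * real DIM('a)) powr d)"

definition shell_hi :: "'a::euclidean_space itself \<Rightarrow> real \<Rightarrow> real" where
  "shell_hi _ d = max ((1 / 2) powr d) ((8 * real DIM('a)) powr d)"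

lemma shell_lo_pos: "0 < shell_lo TYPE('a::euclidean_space) d" by (simp add: shell_lo_def)

lemma shell_hi_pos: "0 < shell_hi TYPE('a::euclidean_space) d"
  unfolding shell_hi_def by (simp add: less_max_iff_disj)

lemma shell_norm_powr:
  fixes x :: "'a::euclidean_space"
  assumes "x \<in> shell k"
  shows "shell_lo TYPE('a) d * 2 powr (of_int k * d) \<le> norm x powr d"
    "norm x powr d \<le> shell_hi TYPE('a) d * 2 powr (of_int k * d)"
proof -
  define R where "R = 2 powr real_of_int k"
  define y where "y = norm x / R"
  have R: "0 < R" by (simp add: R_def)
  have y: "1 / 2 \<le> y" "y \<le> 8 * real DIM('a)"
    using assms R by (simp_all add: shell_def y_def field_simps flip: R_def)
  have y0: "0 < y" using y by linarith
  have Rd: "R powr d = 2 powr (of_int k * d)" by (simp add: R_def powr_powr)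
  have x: "norm x powr d = y powr d * R powr d"
    using R by (simp add: y_def flip: powr_mult)
  have b: "shell_lo TYPE('a) d \<le> y powr d" "y powr d \<le> shell_hi TYPE('a) d"
  proof -
    consider "0 \<le> d" | "d < 0" by linarith
    then have "shell_lo TYPE('a) d \<le> y powr d \<and> y powr d \<le> shell_hi TYPE('a) d"
    proof cases
      case 1
      have "(1 / 2) powr d \<le> y powr d" "y powr d \<le> (8 * real DIM('a)) powr d"
        using y y0 1 by (auto intro!: powr_mono2)
      then show ?thesis by (simp add: shell_lo_def shell_hi_def min_le_iff_disj le_max_iff_disj)
    next
      case 2
      have "y powr d \<le> (1 / 2) powr d" "(8 * real DIM('a)) powr d \<le> y powr d"
        using y y0 2 by (auto intro!: powr_mono2')
      then show ?thesis by (simp add: shell_lo_def shell_hi_def min_le_iff_disj le_max_iff_disj)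
    qed
    then show "shell_lo TYPE('a) d \<le> y powr d" "y powr d \<le> shell_hi TYPE('a) d" by auto
  qed
  show "shell_lo TYPE('a) d * 2 powr (of_int k * d) \<le> norm x powr d"
    "norm x powr d \<le> shell_hi TYPE('a) d * 2 powr (of_int k * d)"
    unfolding x Rd[symmetric] using b R by (auto intro!: mult_right_mono)
qed

text \<open>Lower corner of the box in which the coordinate along \<open>i\<close> ranges over
  \<open>[s, t]\<close>, or over \<open>[-t, -s]\<close> if \<open>\<sigma>\<close> is false, and
  all others over \<open>[-t, t]\<close>. Such boxes are convex products with sides comparable to
  their distance from the origin.\<close>

definition sector_lo :: "'a::euclidean_space \<Rightarrow> bool \<Rightarrow> real \<Rightarrow> real \<Rightarrow> 'a" where
  "sector_lo i \<sigma> s t = (\<Sum>j\<in>Basis. (if j = i \<and> \<sigma> then s else - t) *\<^sub>R j)"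

definition sector_hi :: "'a::euclidean_space \<Rightarrow> bool \<Rightarrow> real \<Rightarrow> real \<Rightarrow> 'a" where
  "sector_hi i \<sigma> s t = (\<Sum>j\<in>Basis. (if j = i \<and> \<not> \<sigma> then - s else t) *\<^sub>R j)"

abbreviation sector :: "'a::euclidean_space \<Rightarrow> bool \<Rightarrow> real \<Rightarrow> real \<Rightarrow> 'a set" where
  "sector i \<sigma> s t \<equiv> cbox (sector_lo i \<sigma> s t) (sector_hi i \<sigma> s t)"

lemma sector_inner:
  assumes "b \<in> Basis"
  shows "sector_lo i \<sigma> s t \<bullet> b = (if b = i \<and> \<sigma> then s else - t)" "sector_hi i \<sigma> s t \<bullet> b = (if b = i \<and> \<not> \<sigma> then - s else t)"
  using assms by (simp_all add: sector_lo_def sector_hi_def)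

lemma sector_less:
  assumes "0 < s" "s < t" "b \<in> Basis"
  shows "sector_lo i \<sigma> s t \<bullet> b < sector_hi i \<sigma> s t \<bullet> b"
  using assms by (auto simp: sector_inner)

lemma mem_sector:
  assumes "i \<in> Basis"
  shows "x \<in> sector i \<sigma> s t \<longleftrightarrow> (\<forall>b\<in>Basis. - t \<le> x \<bullet> b \<and> x \<bullet> b \<le> t \<or> b = i) \<and>
    (if \<sigma> then s \<le> x \<bullet> i \<and> x \<bullet> i \<le> t else - t \<le> x \<bullet> i \<and> x \<bullet> i \<le> - s)"
  using assms by (auto simp: mem_box sector_inner split: if_splits)

lemma sector_mono:
  assumes "i \<in> Basis" "s' \<le> s" "t \<le> t'"
  shows "sector i \<sigma> s t \<subseteq> sector i \<sigma> s' t'"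
  using assms by (force simp: mem_sector subset_iff)

lemma sector_norm:
  fixes x :: "'a::euclidean_space" and s t :: real
  assumes i: "i \<in> Basis" and st: "0 < s" "s < t" and x: "x \<in> sector i \<sigma> s t"
  shows "s \<le> norm x" "norm x \<le> DIM('a) * t"
proof -
  have "s \<le> \<bar>x \<bullet> i\<bar>" using x st unfolding mem_sector[OF i] by (auto split: if_splits)
  also have "\<dots> \<le> norm x" using i by (rule Basis_le_norm)
  finally show "s \<le> norm x" .
  have "\<bar>x \<bullet> b\<bar> \<le> t" if "b \<in> Basis" for b
    using x st that unfolding mem_sector[OF i] by (cases "b = i") (auto split: if_splits)
  then have "(\<Sum>b\<in>Basis. \<bar>x \<bullet> b\<bar>) \<le> (\<Sum>b\<in>(Basis::'a set). t)" by (intro sum_mono) auto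
  then show "norm x \<le> DIM('a) * t" using norm_le_l1[of x] by simp
qed

lemma sector_measure:
  assumes i: "(i::'a::euclidean_space) \<in> Basis" and st: "0 < s" "s < t"
  shows "(t - s) ^ DIM('a) \<le> measure lborel (sector i \<sigma> s t)" "measure lborel (sector i \<sigma> s t) \<le> (2 * t) ^ DIM('a)"
proof -
  have m: "measure lborel (sector i \<sigma> s t) = (\<Prod>b\<in>Basis. (sector_hi i \<sigma> s t - sector_lo i \<sigma> s t) \<bullet> b)"
    using sector_less[OF st, of _ i \<sigma>] by (subst measure_lborel_cbox_eq) (auto simp: less_imp_le)
  have "(\<Prod>b\<in>(Basis::'a set). t - s) \<le> (\<Prod>b\<in>Basis. (sector_hi i \<sigma> s t - sector_lo i \<sigma> s t) \<bullet> b)"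
    using st by (intro prod_mono) (auto simp: inner_diff_left sector_inner)
  then show "(t - s) ^ DIM('a) \<le> measure lborel (sector i \<sigma> s t)" unfolding m by simp
  have "(\<Prod>b\<in>Basis. (sector_hi i \<sigma> s t - sector_lo i \<sigma> s t) \<bullet> b) \<le> (\<Prod>b\<in>(Basis::'a set). 2 * t)"
    using st by (intro prod_mono) (auto simp: inner_diff_left sector_inner)
  then show "measure lborel (sector i \<sigma> s t) \<le> (2 * t) ^ DIM('a)" unfolding m by simp
qed

text \<open>The coordinate of largest absolute value determines the direction and the sign, the
  integer part of its binary logarithm the scale.\<close>

lemma sector_cover:
  fixes x :: "'a::euclidean_space"
  assumes "x \<noteq> 0"
  shows "\<exists>i\<in>Basis. \<exists>\<sigma> k. x \<in> sector i \<sigma> (2 powr of_int k) (2 * 2 powr of_int k)"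
proof -
  have fin: "finite ((\<lambda>b. \<bar>x \<bullet> b\<bar>) ` Basis)" "(\<lambda>b. \<bar>x \<bullet> b\<bar>) ` Basis \<noteq> {}" by auto
  from Max_in[OF fin] obtain i where i: "i \<in> Basis" "\<bar>x \<bullet> i\<bar> = Max ((\<lambda>b. \<bar>x \<bullet> b\<bar>) ` Basis)"
    by (elim imageE) metis
  have mx: "\<bar>x \<bullet> b\<bar> \<le> \<bar>x \<bullet> i\<bar>" if "b \<in> Basis" for b
    unfolding i(2) using that by (intro Max_ge) auto
  define M where "M = \<bar>x \<bullet> i\<bar>"
  have M: "0 < M"
  proof (rule ccontr)
    assume "\<not> 0 < M"
    then have "x \<bullet> b = 0" if "b \<in> Basis" for b using mx[OF that] by (simp add: M_def)
    then show False using assms euclidean_all_zero_iff by blast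
  qed
  define k where "k = \<lfloor>log 2 M\<rfloor>"
  have k: "2 powr of_int k \<le> M" "M < 2 powr (of_int k + 1)"
    using M floor_log_eq_powr_iff[of M 2 k] by (auto simp: k_def add.commute)
  then have "M \<le> 2 * 2 powr of_int k" by (simp add: powr_add)
  then have "x \<in> sector i (0 \<le> x \<bullet> i) (2 powr of_int k) (2 * 2 powr of_int k)"
    unfolding mem_sector[OF i(1)] using k mx by (force simp: M_def abs_le_iff)
  then show ?thesis using i(1) by blast
qed

text \<open>Hoelder's inequality on one box: \<open>t = 1\<close> will bound the mean,
  \<open>t = r\<close> gives the estimate that does not involve the gradient.\<close>

lemma power_mean_unif:
  fixes u :: "'a::euclidean_space \<Rightarrow> real"
  assumes lu: "\<And>b. b \<in> Basis \<Longrightarrow> l \<bullet> b < w \<bullet> b" and um: "u \<in> borel_measurable borel" and sub: "cbox l w \<subseteq> K'"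
    and X: "0 < X" "(\<integral>\<^sup>+x\<in>K'. ennreal (\<bar>u x\<bar> powr q) \<partial>lborel) \<le> ennreal (measure lborel (cbox l w) * X powr q)"
    and t: "0 < t" "t \<le> q"
  shows "(\<integral>x. \<bar>u x\<bar> powr t \<partial>unif l w) \<le> X powr t"
    "(\<integral>\<^sup>+x\<in>cbox l w. ennreal (\<bar>u x\<bar> powr t) \<partial>lborel) \<le> ennreal (measure lborel (cbox l w) * X powr t)"
proof -
  let ?m = "measure lborel (cbox l w)" and ?U = "unif l w"
  have m: "0 < ?m" using measure_box[of l w] lu by blast
  interpret prob_space ?U using lu by (rule prob_space_unif)
  have [measurable]: "u \<in> borel_measurable borel" by fact
  have one: "ennreal ?m * ennreal (1 / ?m) = 1" "ennreal (1 / ?m) * ennreal ?m = 1"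
    using m by (subst ennreal_mult[symmetric]; simp)+
  have nq: "(\<integral>\<^sup>+x. ennreal (\<bar>u x\<bar> powr q) \<partial>?U) \<le> ennreal (X powr q)"
  proof -
    have "(\<integral>\<^sup>+x. ennreal (\<bar>u x\<bar> powr q) \<partial>?U) = ennreal (1 / ?m) * (\<integral>\<^sup>+x\<in>cbox l w. ennreal (\<bar>u x\<bar> powr q) \<partial>lborel)"
      by (intro nn_integral_unif lu) auto
    also have "\<dots> \<le> ennreal (1 / ?m) * ennreal (?m * X powr q)"
      using sub by (intro mult_left_mono order_trans[OF nn_integral_mono X(2)]) (auto simp: indicator_def)
    also have "\<dots> = (ennreal (1 / ?m) * ennreal ?m) * ennreal (X powr q)"
      using m by (simp add: ennreal_mult mult.assoc)
    finally show ?thesis by (simp add: one)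
  qed
  have iq: "integrable ?U (\<lambda>x. \<bar>u x\<bar> powr q)"
    using nq by (intro integrableI_nonneg) (auto intro: le_less_trans)
  have q0: "0 < q" using t by linarith
  have Eq: "(\<integral>x. \<bar>u x\<bar> powr q \<partial>?U) \<le> X powr q"
    using nq by (subst (asm) nn_integral_eq_integral[OF iq]) auto
  have ei: "(\<bar>u x\<bar> powr q) powr (t / q) * 1 powr 0 = \<bar>u x\<bar> powr t" for x
    using q0 by (simp add: powr_powr)
  have "integrable ?U (\<lambda>x. (\<bar>u x\<bar> powr q) powr (t / q) * 1 powr 0)"
    using iq t q0 by (intro holder2(1)) auto
  then have it: "integrable ?U (\<lambda>x. \<bar>u x\<bar> powr t)" unfolding ei .
  have "(\<integral>x. (\<bar>u x\<bar> powr q) powr (t / q) * 1 powr 0 \<partial>?U) \<le> (\<integral>x. \<bar>u x\<bar> powr q \<partial>?U) powr (t / q) * (\<integral>x. 1 \<partial>?U) powr 0"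
    using iq t q0 by (intro holder2(2)) auto
  then have "(\<integral>x. \<bar>u x\<bar> powr t \<partial>?U) \<le> (\<integral>x. \<bar>u x\<bar> powr q \<partial>?U) powr (t / q)"
    unfolding ei using prob_space by simp
  also have "\<dots> \<le> (X powr q) powr (t / q)"
    using Eq t q0 by (intro powr_mono2 Bochner_Integration.integral_nonneg) auto
  also have "\<dots> = X powr t" using q0 by (simp add: powr_powr)
  finally show E: "(\<integral>x. \<bar>u x\<bar> powr t \<partial>?U) \<le> X powr t" .
  have "ennreal (1 / ?m) * (\<integral>\<^sup>+x\<in>cbox l w. ennreal (\<bar>u x\<bar> powr t) \<partial>lborel) = (\<integral>\<^sup>+x. ennreal (\<bar>u x\<bar> powr t) \<partial>?U)"
    by (intro nn_integral_unif[symmetric] lu) auto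
  also have "\<dots> = ennreal (\<integral>x. \<bar>u x\<bar> powr t \<partial>?U)" by (rule nn_integral_eq_integral[OF it]) auto
  also have "\<dots> \<le> ennreal (X powr t)" using E by (rule ennreal_leI)
  finally have "ennreal ?m * (ennreal (1 / ?m) * (\<integral>\<^sup>+x\<in>cbox l w. ennreal (\<bar>u x\<bar> powr t) \<partial>lborel)) \<le> ennreal ?m * ennreal (X powr t)"
    by (rule mult_left_mono) simp
  then show "(\<integral>\<^sup>+x\<in>cbox l w. ennreal (\<bar>u x\<bar> powr t) \<partial>lborel) \<le> ennreal (?m * X powr t)"
    using m by (simp add: ennreal_mult one flip: mult.assoc)
qed

lemma shell_unweight:
  fixes h :: "'a::euclidean_space \<Rightarrow> real"
  assumes h: "h \<in> borel_measurable borel" "\<And>x. 0 \<le> h x"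
    and W: "(\<integral>\<^sup>+x\<in>shell k. ennreal (norm x powr d * h x) \<partial>lborel) \<le> ennreal W" "0 \<le> W"
  shows "(\<integral>\<^sup>+x\<in>shell k. ennreal (h x) \<partial>lborel) \<le> ennreal (W / (shell_lo TYPE('a) d * 2 powr (of_int k * d)))"
proof -
  let ?c = "shell_lo TYPE('a) d * 2 powr (of_int k * d)"
  have c: "0 < ?c" using shell_lo_pos[of d, where 'a='a] by simp
  have [measurable]: "h \<in> borel_measurable borel" by fact
  have "(\<integral>\<^sup>+x\<in>shell k. ennreal (h x) \<partial>lborel) \<le> (\<integral>\<^sup>+x. ennreal (1 / ?c) * (ennreal (norm x powr d * h x) * indicator (shell k) x) \<partial>lborel)"
  proof (rule nn_integral_mono)
    fix x :: 'a
    show "ennreal (h x) * indicator (shell k) x \<le> ennreal (1 / ?c) * (ennreal (norm x powr d * h x) * indicator (shell k) x)"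
    proof (cases "x \<in> shell k")
      case True
      have "?c * h x \<le> norm x powr d * h x" by (intro mult_right_mono shell_norm_powr(1)[OF True] h)
      then have "h x \<le> (1 / ?c) * (norm x powr d * h x)" using c by (simp add: field_simps)
      then have "ennreal (h x) \<le> ennreal ((1 / ?c) * (norm x powr d * h x))" by (rule ennreal_leI)
      also have "\<dots> = ennreal (1 / ?c) * ennreal (norm x powr d * h x)" using c h(2)[of x] by (intro ennreal_mult) auto
      finally show ?thesis using True by simp
    qed simp
  qed
  also have "\<dots> = ennreal (1 / ?c) * (\<integral>\<^sup>+x\<in>shell k. ennreal (norm x powr d * h x) \<partial>lborel)"
    by (rule nn_integral_cmult) measurable
  also have "\<dots> \<le> ennreal (1 / ?c) * ennreal W" by (rule mult_left_mono[OF W(1)]) simp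
  also have "\<dots> = ennreal ((1 / ?c) * W)" using c W(2) by (intro ennreal_mult[symmetric]) auto
  finally show ?thesis by simp
qed

lemma shell_weight:
  fixes h :: "'a::euclidean_space \<Rightarrow> real"
  assumes h: "h \<in> borel_measurable borel" "\<And>x. 0 \<le> h x" and S: "S \<in> sets borel" "S \<subseteq> shell k"
    and W: "(\<integral>\<^sup>+x\<in>S. ennreal (h x) \<partial>lborel) \<le> ennreal W" "0 \<le> W"
  shows "(\<integral>\<^sup>+x\<in>S. ennreal (norm x powr d * h x) \<partial>lborel) \<le> ennreal (shell_hi TYPE('a) d * 2 powr (of_int k * d) * W)"
proof -
  let ?c = "shell_hi TYPE('a) d * 2 powr (of_int k * d)"
  have c: "0 < ?c" using shell_hi_pos[of d, where 'a='a] by simp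
  have [measurable]: "h \<in> borel_measurable borel" "S \<in> sets borel" by fact+
  have "(\<integral>\<^sup>+x\<in>S. ennreal (norm x powr d * h x) \<partial>lborel) \<le> (\<integral>\<^sup>+x. ennreal ?c * (ennreal (h x) * indicator S x) \<partial>lborel)"
  proof (rule nn_integral_mono)
    fix x :: 'a
    show "ennreal (norm x powr d * h x) * indicator S x \<le> ennreal ?c * (ennreal (h x) * indicator S x)"
    proof (cases "x \<in> S")
      case True
      then have "x \<in> shell k" using S by auto
      then have "norm x powr d * h x \<le> ?c * h x" by (intro mult_right_mono shell_norm_powr(2) h)
      then have "ennreal (norm x powr d * h x) \<le> ennreal (?c * h x)" by (rule ennreal_leI)
      also have "\<dots> = ennreal ?c * ennreal (h x)" using c h(2)[of x] by (intro ennreal_mult) auto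
      finally show ?thesis using True by simp
    qed simp
  qed
  also have "\<dots> = ennreal ?c * (\<integral>\<^sup>+x\<in>S. ennreal (h x) \<partial>lborel)" by (rule nn_integral_cmult) measurable
  also have "\<dots> \<le> ennreal ?c * ennreal W" by (rule mult_left_mono[OF W(1)]) simp
  also have "\<dots> = ennreal (?c * W)" using c W(2) by (intro ennreal_mult[symmetric]) auto
  finally show ?thesis .
qed

text \<open>For one direction, \<open>\<alpha>\<close> and \<open>\<beta>\<close> are the weighted
  norms of \<open>u\<close> and its gradient on the shells, up to constants and made positive;
  \<open>m\<close> and \<open>\<gamma>\<close> are the mean of \<open>\<bar>u\<bar>\<close> and the
  weighted target norm on the boxes. The exponents \<open>A\<close>, \<open>B\<close>,
  \<open>G\<close> are the scaling exponents of the three weighted norms. The constant is fixed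
  before \<open>u\<close>, direction and sign.\<close>

lemma sector_dyadic_ok:
  fixes a b c p q r \<theta> s :: real
  defines "N \<equiv> real DIM('a::euclidean_space)"
  defines "A \<equiv> (a + N) / q" and "B \<equiv> (b - p + N) / p" and "G \<equiv> (c + N) / r"
  defines "G' \<equiv> (1 - \<theta>) * A + \<theta> * B"
  assumes p: "1 \<le> p" and pr: "p < r" and rq: "r \<le> q" and \<theta>: "0 \<le> \<theta>" "\<theta> \<le> 1"
    and s: "p \<le> s" "1 / p - 1 / s \<le> 1 / N" "(1 - \<theta>) / q + \<theta> / s \<le> 1 / r"
  shows "\<exists>C\<ge>0. \<forall>(u::'a \<Rightarrow> real) g i \<sigma>. borel_weak_grad u g \<longrightarrow> i \<in> Basis \<longrightarrow>
    (\<integral>\<^sup>+x. ennreal (norm x powr a * \<bar>u x\<bar> powr q) \<partial>lborel) \<le> 1 \<longrightarrow>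
    (\<integral>\<^sup>+x. ennreal (norm x powr b * norm (g x) powr p) \<partial>lborel) \<le> 1 \<longrightarrow>
    (\<exists>\<alpha> \<beta> m \<gamma>. dyadic_ok p q A B G G' \<theta> C \<alpha> \<beta> \<beta> m \<gamma> \<and>
      (\<forall>k. (\<integral>\<^sup>+x\<in>sector i \<sigma> (2 powr of_int k) (2 * 2 powr of_int k). ennreal (norm x powr c * \<bar>u x\<bar> powr r) \<partial>lborel)
         = ennreal (\<gamma> k powr r)))"
proof -
  \<comment> \<open>\<open>Cq\<close> and \<open>Cp\<close> are the shell overlap divided by the
    lower bound of the weight; \<open>H\<close> is the upper bound of the weight times that of the
    normalised box volume. \<open>C1\<close> belongs to the interpolation on a box,
    \<open>K0\<close> and \<open>K1\<close> to its translation into \<open>\<alpha>\<close> and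
    \<open>\<beta>\<close>, \<open>K2\<close> to the change of the mean, \<open>K3\<close> to the
    separation of oscillation and mean. \<open>C\<close> dominates the constant of each required
    bound.\<close>
  define n where "n = 2 * (8 * N + 2)"
  define Cq where "Cq = n / shell_lo TYPE('a) a"
  define Cp where "Cp = n / shell_lo TYPE('a) b"
  define C1 where "C1 = (2 powr (q + 1)) powr (r * (1 - \<theta>) / q) * (2 * (2 ^ DIM('a) + 1) powr (1 / p) + (1 + s * (1 - 1 / p))) powr (r * \<theta>)"
  define H where "H = shell_hi TYPE('a) c * 4 ^ DIM('a)"
  define K0 where "K0 = Cq powr (1 / q)"
  define K1 where "K1 = K0 powr (1 - \<theta>) * (Cp powr (1 / p) * (8 * N)) powr \<theta>"
  define K2 where "K2 = ((8 * N) powr p * 16 ^ DIM('a) * Cp) powr (1 / p)"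
  define K3 where "K3 = (H * 2 powr r) powr (1 / r) * 2 powr (1 / r)"
  define C where "C = K0 + K2 + K3 * (C1 powr (1 / r) * K1 + 1) + H powr (1 / r) * K0"
  have pos: "0 < p" "0 < q" "0 < r" "0 < s" "1 \<le> q" "1 \<le> r" using p pr rq s by linarith+
  have N: "0 < N" "1 \<le> N" using DIM_positive[where 'a='a] unfolding N_def by (auto simp: Suc_le_eq)
  have n0: "0 < n" using N by (simp add: n_def)
  have Cq: "0 < Cq" and Cp: "0 < Cp" using n0 shell_lo_pos[where 'a='a] by (simp_all add: Cq_def Cp_def)
  have C1: "0 \<le> C1" by (simp add: C1_def)
  have H: "0 < H" using shell_hi_pos[where 'a='a] by (simp add: H_def)
  have K: "0 \<le> K0" "0 < K0" "0 \<le> K1" "0 \<le> K2" "0 \<le> K3" using Cq by (simp_all add: K0_def K1_def K2_def K3_def)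
  have C: "0 \<le> C" "K0 \<le> C" "K2 \<le> C" "K3 * (C1 powr (1 / r) * K1 + 1) \<le> C" "H powr (1 / r) * K0 \<le> C"
    unfolding C_def using K by (auto intro!: add_nonneg_nonneg mult_nonneg_nonneg simp: add_increasing add_increasing2)
  show ?thesis
  proof (intro exI[of _ C] conjI allI impI C(1))
    fix u :: "'a \<Rightarrow> real" and g and i :: 'a and \<sigma>
    assume ug: "borel_weak_grad u g" and i: "i \<in> Basis"
      and ua: "(\<integral>\<^sup>+x. ennreal (norm x powr a * \<bar>u x\<bar> powr q) \<partial>lborel) \<le> 1"
      and gb: "(\<integral>\<^sup>+x. ennreal (norm x powr b * norm (g x) powr p) \<partial>lborel) \<le> 1"
    have um[measurable]: "u \<in> borel_measurable borel" and gm[measurable]: "g \<in> borel_measurable borel"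
      using ug by (auto simp: borel_weak_grad_def)
    obtain \<alpha> where \<alpha>: "\<And>k. 0 < \<alpha> k" "\<forall>F. finite F \<longrightarrow> (\<Sum>k\<in>F. \<alpha> k powr q) \<le> 1"
      "\<And>k. (\<integral>\<^sup>+x\<in>shell k. ennreal (norm x powr a * \<bar>u x\<bar> powr q) \<partial>lborel) \<le> ennreal (n * \<alpha> k powr q)"
      using shell_weights[OF _ ua pos(2)] unfolding n_def N_def by (auto simp: mult.assoc)
    obtain \<beta> where \<beta>: "\<And>k. 0 < \<beta> k" "\<forall>F. finite F \<longrightarrow> (\<Sum>k\<in>F. \<beta> k powr p) \<le> 1"
      "\<And>k. (\<integral>\<^sup>+x\<in>shell k. ennreal (norm x powr b * norm (g x) powr p) \<partial>lborel) \<le> ennreal (n * \<beta> k powr p)"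
      using shell_weights[OF _ gb pos(1)] unfolding n_def N_def by (auto simp: mult.assoc)
    define R where "R k = 2 powr real_of_int k" for k
    have R0: "0 < R k" for k by (simp add: R_def)
    have Rp: "2 powr (of_int k * x) = R k powr x" for k x by (simp add: R_def powr_powr)
    define Q where "Q k = sector i \<sigma> (R k) (2 * R k)" for k
    define m where "m k = (\<integral>x. \<bar>u x\<bar> \<partial>unif (sector_lo i \<sigma> (R k) (2 * R k)) (sector_hi i \<sigma> (R k) (2 * R k)))" for k
    define mu where "mu k = measure lborel (Q k)" for k
    \<comment> \<open>Removing the weight costs \<open>R powr a\<close> and normalising the volume
      \<open>R powr N\<close>; the \<open>q\<close>-th root yields the exponent \<open>- A\<close>.
      Likewise for \<open>Y\<close>, which also absorbs the diameter \<open>D\<close>, hence the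
      factor \<open>8 * N\<close> and the exponent \<open>- B\<close>.\<close>
    define X where "X k = K0 * R k powr (- A) * \<alpha> k" for k
    define Y where "Y k = Cp powr (1 / p) * (8 * N) * R k powr (- B) * \<beta> k" for k
    define D where "D k = 8 * N * R k" for k
    have lt: "sector_lo i \<sigma> (R k) (2 * R k) \<bullet> bb < sector_hi i \<sigma> (R k) (2 * R k) \<bullet> bb" if "bb \<in> Basis" for k bb
      using R0[of k] that by (intro sector_less) auto
    have lt': "sector_lo i \<sigma> (2 * R k) (4 * R k) \<bullet> bb < sector_hi i \<sigma> (2 * R k) (4 * R k) \<bullet> bb" if "bb \<in> Basis" for k bb
      using R0[of k] that by (intro sector_less) auto
    have X0: "0 < X k" for k using K \<alpha>(1)[of k] R0[of k] by (simp add: X_def)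
    have Y0: "0 < Y k" for k using Cp N \<beta>(1)[of k] R0[of k] by (simp add: Y_def)
    have big_norm: "R k \<le> norm x" "norm x \<le> N * (4 * R k)" if "x \<in> sector i \<sigma> (R k) (4 * R k)" for k x
      using sector_norm[OF i _ _ that] R0[of k] by (auto simp: N_def)
    have QK: "Q k \<subseteq> sector i \<sigma> (R k) (4 * R k)" for k
      unfolding Q_def using R0[of k] by (intro sector_mono i) auto
    have QK': "sector i \<sigma> (2 * R k) (4 * R k) \<subseteq> sector i \<sigma> (R k) (4 * R k)" for k
      using R0[of k] by (intro sector_mono i) auto
    have ball_shell: "cball x (R k / 2) \<subseteq> shell k" if "x \<in> sector i \<sigma> (R k) (4 * R k)" for k x
    proof
      fix y assume y: "y \<in> cball x (R k / 2)"
      have d: "norm (x - y) \<le> R k / 2" using y by (simp add: dist_norm)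
      have "norm x \<le> norm (x - y) + norm y" using norm_triangle_ineq[of "x - y" y] by simp
      moreover have "norm y \<le> norm (x - y) + norm x" using norm_triangle_ineq[of "y - x" x] by (simp add: norm_minus_commute)
      moreover have "R k / 2 \<le> N * (4 * R k)" using N R0[of k] mult_right_mono[of 1 N "4 * R k"] by linarith
      ultimately have "R k / 2 \<le> norm y" "norm y \<le> 8 * N * R k" using big_norm[OF that] d by linarith+
      then show "y \<in> shell k" unfolding shell_def R_def[symmetric] N_def by simp
    qed
    have Qshell: "Q k \<subseteq> shell k" for k
    proof
      fix x assume "x \<in> Q k"
      then have "x \<in> cball x (R k / 2)" "x \<in> sector i \<sigma> (R k) (4 * R k)" using R0[of k] QK by auto
      then show "x \<in> shell k" using ball_shell by blast
    qed
    have diam: "dist x y \<le> D k" if "x \<in> sector i \<sigma> (R k) (4 * R k)" "y \<in> sector i \<sigma> (R k) (4 * R k)" for k x y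
    proof -
      have "dist x y \<le> norm x + norm y" unfolding dist_norm by (rule norm_triangle_ineq4)
      also have "\<dots> \<le> N * (4 * R k) + N * (4 * R k)" using big_norm[OF that(1)] big_norm[OF that(2)] by linarith
      finally show ?thesis by (simp add: D_def)
    qed
    have RN: "R k ^ DIM('a) = R k powr N" for k using R0[of k] by (simp add: N_def powr_realpow)
    have mu: "R k powr N \<le> mu k" "mu k \<le> 4 ^ DIM('a) * R k powr N" for k
    proof -
      have st: "0 < R k" "R k < 2 * R k" using R0[of k] by auto
      show "R k powr N \<le> mu k" using sector_measure(1)[OF i st, of \<sigma>] by (simp add: mu_def Q_def RN)
      show "mu k \<le> 4 ^ DIM('a) * R k powr N"
        using sector_measure(2)[OF i st, of \<sigma>] by (simp add: mu_def Q_def power_mult_distrib RN[symmetric])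
    qed
    have RNp: "0 < R k powr N" for k using R0[of k] by simp
    have mu0: "0 < mu k" for k using mu(1)[of k] RNp[of k] by linarith
    have fu: "(\<integral>\<^sup>+x\<in>shell k. ennreal (\<bar>u x\<bar> powr q) \<partial>lborel) \<le> ennreal (mu k * X k powr q)" for k
    proof -
      have "(\<integral>\<^sup>+x\<in>shell k. ennreal (\<bar>u x\<bar> powr q) \<partial>lborel) \<le> ennreal (n * \<alpha> k powr q / (shell_lo TYPE('a) a * 2 powr (of_int k * a)))"
        by (rule shell_unweight[OF _ _ \<alpha>(3)]) (use n0 in auto)
      also have "n * \<alpha> k powr q / (shell_lo TYPE('a) a * 2 powr (of_int k * a)) = R k powr N * X k powr q"
      proof -
        have "X k powr q = Cq * R k powr (- (a + N)) * \<alpha> k powr q"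
          using K \<alpha>(1)[of k] R0[of k] Cq pos by (simp add: X_def K0_def A_def powr_mult powr_powr)
        then have "R k powr N * X k powr q = Cq * (R k powr N * R k powr (- (a + N))) * \<alpha> k powr q" by simp
        also have "R k powr N * R k powr (- (a + N)) = R k powr (- a)" by (simp flip: powr_add)
        finally show ?thesis by (simp add: Cq_def Rp powr_minus_divide)
      qed
      also have "ennreal (R k powr N * X k powr q) \<le> ennreal (mu k * X k powr q)"
        using mu(1)[of k] by (intro ennreal_leI mult_right_mono) auto
      finally show ?thesis .
    qed
    have fg: "(\<integral>\<^sup>+x\<in>shell k. ennreal (norm (g x) powr p) \<partial>lborel) \<le> ennreal (Cp * R k powr (- b) * \<beta> k powr p)" for k
    proof -
      have "(\<integral>\<^sup>+x\<in>shell k. ennreal (norm (g x) powr p) \<partial>lborel) \<le> ennreal (n * \<beta> k powr p / (shell_lo TYPE('a) b * 2 powr (of_int k * b)))"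
        by (rule shell_unweight[OF _ _ \<beta>(3)]) (use n0 in auto)
      then show ?thesis by (simp add: Cp_def Rp powr_minus_divide)
    qed
    have fY: "Cp * R k powr (- b) * \<beta> k powr p \<le> mu k * (Y k powr p / D k powr p)" for k
    proof -
      have "Y k powr p = Cp * (8 * N) powr p * R k powr (p - b - N) * \<beta> k powr p"
      proof -
        have pB: "- (B * p) = p - b - N" using pos by (simp add: B_def)
        show ?thesis
          using Cp N \<beta>(1)[of k] R0[of k] pos by (simp add: Y_def powr_mult powr_powr pB)
      qed
      moreover have "D k powr p = (8 * N) powr p * R k powr p" using N R0[of k] by (simp add: D_def powr_mult)
      ultimately have "Y k powr p / D k powr p = Cp * (R k powr (p - b - N) / R k powr p) * \<beta> k powr p"
        using N by simp
      also have "R k powr (p - b - N) / R k powr p = R k powr (- b - N)" by (simp flip: powr_diff)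
      finally have "R k powr N * (Y k powr p / D k powr p) = Cp * (R k powr N * R k powr (- b - N)) * \<beta> k powr p" by simp
      also have "R k powr N * R k powr (- b - N) = R k powr (- b)" by (simp flip: powr_add)
      finally show ?thesis
        using mult_right_mono[OF mu(1)[of k], of "Y k powr p / D k powr p"] by simp
    qed
    have m0: "0 \<le> m k" for k unfolding m_def by (intro Bochner_Integration.integral_nonneg) auto
    have Qb: "Q k \<in> sets borel" for k by (simp add: Q_def)
    define \<gamma> where "\<gamma> k = enn2real (\<integral>\<^sup>+x\<in>Q k. ennreal (norm x powr c * \<bar>u x\<bar> powr r) \<partial>lborel) powr (1 / r)" for k
    \<comment> \<open>The weight contributes \<open>c\<close> and the volume \<open>N\<close>,
      together \<open>r * G\<close>.\<close>
    have H_le: "shell_hi TYPE('a) c * 2 powr (of_int k * c) * (mu k * Z) \<le> H * R k powr (r * G) * Z" if "0 \<le> Z" for k Z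
    proof -
      have "shell_hi TYPE('a) c * R k powr c * (mu k * Z) \<le> shell_hi TYPE('a) c * R k powr c * ((4 ^ DIM('a) * R k powr N) * Z)"
        using mu(2)[of k] that shell_hi_pos[of c, where 'a='a] by (intro mult_left_mono mult_right_mono) auto
      also have "\<dots> = H * (R k powr c * R k powr N) * Z" by (simp add: H_def)
      also have "R k powr c * R k powr N = R k powr (r * G)" using pos by (simp add: G_def flip: powr_add)
      finally show ?thesis by (simp add: Rp)
    qed
    have meanX: "m k \<le> X k" for k
    proof -
      have "(\<integral>x. \<bar>u x\<bar> powr 1 \<partial>unif (sector_lo i \<sigma> (R k) (2 * R k)) (sector_hi i \<sigma> (R k) (2 * R k))) \<le> X k powr 1"
        by (rule power_mean_unif(1)[OF lt um Qshell[unfolded Q_def] X0 fu[unfolded mu_def Q_def]]) (use pos in auto)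
      then show ?thesis using X0[of k] by (simp add: m_def)
    qed
    have w4: "(\<integral>\<^sup>+x\<in>Q k. ennreal (norm x powr c * \<bar>u x\<bar> powr r) \<partial>lborel) \<le> ennreal (H * R k powr (r * G) * X k powr r)" for k
    proof -
      have "(\<integral>\<^sup>+x\<in>Q k. ennreal (\<bar>u x\<bar> powr r) \<partial>lborel) \<le> ennreal (mu k * X k powr r)"
        unfolding mu_def Q_def
        by (rule power_mean_unif(2)[OF lt um Qshell[unfolded Q_def] X0 fu[unfolded mu_def Q_def]]) (use pos rq in auto)
      then have "(\<integral>\<^sup>+x\<in>Q k. ennreal (norm x powr c * \<bar>u x\<bar> powr r) \<partial>lborel) \<le> ennreal (shell_hi TYPE('a) c * 2 powr (of_int k * c) * (mu k * X k powr r))"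
        using mu0[of k] by (intro shell_weight Qb Qshell) auto
      also have "\<dots> \<le> ennreal (H * R k powr (r * G) * X k powr r)" by (intro ennreal_leI H_le) auto
      finally show ?thesis .
    qed
    have w1: "(\<integral>\<^sup>+x\<in>Q k. ennreal (norm x powr c * \<bar>u x\<bar> powr r) \<partial>lborel)
        \<le> ennreal (H * R k powr (r * G) * (2 powr r * (C1 * (X k powr (1 - \<theta>) * Y k powr \<theta>) powr r + m k powr r)))" for k
    proof -
      have "(\<integral>\<^sup>+x\<in>Q k. ennreal (\<bar>u x\<bar> powr r) \<partial>lborel) \<le> ennreal (mu k * (2 powr r * (C1 * (X k powr (1 - \<theta>) * Y k powr \<theta>) powr r + m k powr r)))"
        unfolding mu_def Q_def m_def C1_def
      proof (rule interp_transfer[OF ug compact_shell zero_notin_shell _ _ lt _ p s(1) s(2)[unfolded N_def] pos(3,5) \<theta> s(3) X0 _ Y0])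
        show "0 < R k / 2" using R0[of k] by simp
        show "cball z (R k / 2) \<subseteq> shell k" if "z \<in> sector i \<sigma> (R k) (2 * R k)" for z
          using that QK[of k] ball_shell unfolding Q_def by blast
        show "dist x y \<le> D k" if "x \<in> sector i \<sigma> (R k) (2 * R k)" "y \<in> sector i \<sigma> (R k) (2 * R k)" for x y
          using that QK[of k] diam unfolding Q_def by blast
        show "(\<integral>\<^sup>+x\<in>shell k. ennreal (\<bar>u x\<bar> powr q) \<partial>lborel) \<le> ennreal (measure lborel (sector i \<sigma> (R k) (2 * R k)) * X k powr q)"
          using fu[of k] unfolding mu_def Q_def .
        show "(\<integral>\<^sup>+x\<in>shell k. ennreal (norm (g x) powr p) \<partial>lborel) \<le> ennreal (measure lborel (sector i \<sigma> (R k) (2 * R k)) * (Y k powr p / D k powr p))"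
          using order_trans[OF fg[of k] ennreal_leI[OF fY[of k]]] unfolding mu_def Q_def .
      qed
      then have "(\<integral>\<^sup>+x\<in>Q k. ennreal (norm x powr c * \<bar>u x\<bar> powr r) \<partial>lborel) \<le> ennreal (shell_hi TYPE('a) c * 2 powr (of_int k * c) * (mu k * (2 powr r * (C1 * (X k powr (1 - \<theta>) * Y k powr \<theta>) powr r + m k powr r))))"
        using mu0[of k] C1 by (intro shell_weight Qb Qshell) auto
      also have "\<dots> \<le> ennreal (H * R k powr (r * G) * (2 powr r * (C1 * (X k powr (1 - \<theta>) * Y k powr \<theta>) powr r + m k powr r)))"
        using C1 by (intro ennreal_leI H_le) auto
      finally show ?thesis .
    qed
    have fin: "(\<integral>\<^sup>+x\<in>Q k. ennreal (norm x powr c * \<bar>u x\<bar> powr r) \<partial>lborel) < \<infinity>" for k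
      by (rule le_less_trans[OF w4]) simp
    have \<gamma>r: "(\<integral>\<^sup>+x\<in>Q k. ennreal (norm x powr c * \<bar>u x\<bar> powr r) \<partial>lborel) = ennreal (\<gamma> k powr r)" for k
      using fin[of k] pos by (simp add: \<gamma>_def powr_powr ennreal_enn2real)
    have \<gamma>_le: "\<gamma> k \<le> W powr (1 / r)" if "(\<integral>\<^sup>+x\<in>Q k. ennreal (norm x powr c * \<bar>u x\<bar> powr r) \<partial>lborel) \<le> ennreal W" "0 \<le> W" for k W
      unfolding \<gamma>_def using that pos by (intro powr_mono2 enn2real_leI) auto
    have \<gamma>4: "\<gamma> k \<le> C * 2 powr (of_int k * (G - A)) * \<alpha> k" for k
    proof -
      have "\<gamma> k \<le> (H * R k powr (r * G) * X k powr r) powr (1 / r)" using H by (intro \<gamma>_le w4) auto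
      also have "\<dots> = H powr (1 / r) * R k powr G * X k"
        using H X0[of k] pos by (simp add: powr_mult powr_powr)
      also have "\<dots> = H powr (1 / r) * K0 * (R k powr G * R k powr (- A)) * \<alpha> k" by (simp add: X_def)
      also have "R k powr G * R k powr (- A) = 2 powr (of_int k * (G - A))" by (simp add: Rp flip: powr_add)
      also have "H powr (1 / r) * K0 * 2 powr (of_int k * (G - A)) * \<alpha> k \<le> C * 2 powr (of_int k * (G - A)) * \<alpha> k"
        using C(5) \<alpha>(1)[of k] by (intro mult_right_mono) auto
      finally show ?thesis .
    qed
    have \<gamma>1: "\<gamma> k \<le> C * (2 powr (of_int k * (G - G')) * (\<alpha> k powr (1 - \<theta>) * \<beta> k powr \<theta>) + 2 powr (of_int k * G) * m k)" for k
    proof -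
      let ?Z = "X k powr (1 - \<theta>) * Y k powr \<theta>"
      have "\<gamma> k \<le> (H * R k powr (r * G) * (2 powr r * (C1 * ?Z powr r + m k powr r))) powr (1 / r)"
        using H C1 by (intro \<gamma>_le w1) auto
      also have "\<dots> = (H * 2 powr r) powr (1 / r) * R k powr G * (C1 * ?Z powr r + m k powr r) powr (1 / r)"
        using H C1 pos by (simp add: powr_mult powr_powr)
      also have "\<dots> \<le> (H * 2 powr r) powr (1 / r) * R k powr G * (2 powr (1 / r) * ((C1 * ?Z powr r) powr (1 / r) + (m k powr r) powr (1 / r)))"
        using C1 pos by (intro mult_left_mono powr_add_le) auto
      also have "\<dots> = K3 * R k powr G * (C1 powr (1 / r) * ?Z + m k)"
        using C1 m0[of k] pos by (simp add: K3_def powr_mult powr_powr)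
      also have "?Z = K1 * R k powr (- G') * (\<alpha> k powr (1 - \<theta>) * \<beta> k powr \<theta>)"
      proof -
        have "?Z = (K0 powr (1 - \<theta>) * (R k powr (- A)) powr (1 - \<theta>) * \<alpha> k powr (1 - \<theta>)) * ((Cp powr (1 / p) * (8 * N)) powr \<theta> * (R k powr (- B)) powr \<theta> * \<beta> k powr \<theta>)"
          unfolding X_def Y_def by (simp only: powr_mult)
        also have "\<dots> = K1 * ((R k powr (- A)) powr (1 - \<theta>) * (R k powr (- B)) powr \<theta>) * (\<alpha> k powr (1 - \<theta>) * \<beta> k powr \<theta>)"
          by (simp only: K1_def mult_ac)
        also have "(R k powr (- A)) powr (1 - \<theta>) * (R k powr (- B)) powr \<theta> = R k powr (- G')"
          unfolding powr_powr powr_add[symmetric] G'_def by (rule arg_cong[of _ _ "\<lambda>z. R k powr z"]) (simp add: algebra_simps)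
        finally show ?thesis .
      qed
      also have "K3 * R k powr G * (C1 powr (1 / r) * (K1 * R k powr (- G') * (\<alpha> k powr (1 - \<theta>) * \<beta> k powr \<theta>)) + m k)
         = K3 * ((C1 powr (1 / r) * K1) * ((R k powr G * R k powr (- G')) * (\<alpha> k powr (1 - \<theta>) * \<beta> k powr \<theta>)) + 1 * (R k powr G * m k))"
        by (simp add: algebra_simps)
      also have "\<dots> \<le> K3 * ((C1 powr (1 / r) * K1 + 1) * ((R k powr G * R k powr (- G')) * (\<alpha> k powr (1 - \<theta>) * \<beta> k powr \<theta>)) + (C1 powr (1 / r) * K1 + 1) * (R k powr G * m k))"
        using K m0[of k] by (intro mult_left_mono add_mono mult_right_mono) auto
      also have "\<dots> = (K3 * (C1 powr (1 / r) * K1 + 1)) * ((R k powr G * R k powr (- G')) * (\<alpha> k powr (1 - \<theta>) * \<beta> k powr \<theta>) + R k powr G * m k)"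
        by (simp add: algebra_simps)
      also have "\<dots> \<le> C * ((R k powr G * R k powr (- G')) * (\<alpha> k powr (1 - \<theta>) * \<beta> k powr \<theta>) + R k powr G * m k)"
        using C(4) m0[of k] by (intro mult_right_mono) auto
      also have "R k powr G * R k powr (- G') = 2 powr (of_int k * (G - G'))" by (simp add: Rp flip: powr_add)
      also have "R k powr G = 2 powr (of_int k * G)" by (simp add: Rp)
      finally show ?thesis .
    qed
    have m2: "\<bar>m (k + 1) - m k\<bar> \<le> C * 2 powr (- (of_int k * B)) * \<beta> k" for k
    proof -
      \<comment> \<open>The next box is thus the sector with parameters \<open>2 * R k\<close> and
        \<open>4 * R k\<close>; it and the box at \<open>k\<close> lie in the convex sector with
        parameters \<open>R k\<close> and \<open>4 * R k\<close>, on which the Poincare estimate is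
        used.\<close>
      have Rk1: "R (k + 1) = 2 * R k" by (simp add: R_def powr_add)
      let ?K = "sector i \<sigma> (R k) (4 * R k)"
      let ?I = "Cp * R k powr (- b) * \<beta> k powr p"
      have K_m: "measure lborel ?K \<le> 8 ^ DIM('a) * R k powr N"
        using sector_measure(2)[OF i, of "R k" "4 * R k" \<sigma>] R0[of k] by (simp add: power_mult_distrib RN[symmetric])
      have Q'_m: "R k powr N \<le> measure lborel (sector i \<sigma> (2 * R k) (4 * R k))"
      proof -
        have "R k ^ DIM('a) \<le> (4 * R k - 2 * R k) ^ DIM('a)" using R0[of k] by (intro power_mono) auto
        also have "\<dots> \<le> measure lborel (sector i \<sigma> (2 * R k) (4 * R k))" using R0[of k] by (intro sector_measure(1) i) auto
        finally show ?thesis by (simp add: RN)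
      qed
      have I0: "0 \<le> ?I" using Cp by simp
      have "\<bar>m k - m (k + 1)\<bar> \<le> (D k powr p * 2 ^ DIM('a) * measure lborel ?K / (mu k * measure lborel (sector i \<sigma> (2 * R k) (4 * R k))) * ?I) powr (1 / p)"
      proof -
        have "m (k + 1) = (\<integral>x. \<bar>u x\<bar> \<partial>unif (sector_lo i \<sigma> (2 * R k) (4 * R k)) (sector_hi i \<sigma> (2 * R k) (4 * R k)))"
          by (simp add: m_def Rk1)
        then show ?thesis
          unfolding m_def mu_def Q_def
          using mean_transfer[OF ug compact_shell zero_notin_shell _ ball_shell convex_box(1) compact_cbox diam p lt lt' QK[unfolded Q_def] QK' fg I0] R0[of k]
          by simp
      qed
      also have "\<dots> \<le> (D k powr p * 2 ^ DIM('a) * (8 ^ DIM('a) * R k powr N) / (R k powr N * R k powr N) * ?I) powr (1 / p)"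
      proof (rule powr_mono2)
        have D0: "0 \<le> D k powr p * 2 ^ DIM('a)" by simp
        have "R k powr N * R k powr N \<le> mu k * measure lborel (sector i \<sigma> (2 * R k) (4 * R k))"
          using mu(1)[of k] Q'_m RNp[of k] less_imp_le[OF mu0[of k]] by (intro mult_mono) simp_all
        moreover have "0 < R k powr N * R k powr N" using RNp[of k] by simp
        ultimately have "D k powr p * 2 ^ DIM('a) * measure lborel ?K / (mu k * measure lborel (sector i \<sigma> (2 * R k) (4 * R k)))
          \<le> D k powr p * 2 ^ DIM('a) * (8 ^ DIM('a) * R k powr N) / (R k powr N * R k powr N)"
          using D0 K_m by (intro frac_le mult_left_mono) simp_all
        then show "D k powr p * 2 ^ DIM('a) * measure lborel ?K / (mu k * measure lborel (sector i \<sigma> (2 * R k) (4 * R k))) * ?I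
          \<le> D k powr p * 2 ^ DIM('a) * (8 ^ DIM('a) * R k powr N) / (R k powr N * R k powr N) * ?I"
          by (rule mult_right_mono) (rule I0)
        show "0 \<le> D k powr p * 2 ^ DIM('a) * measure lborel ?K / (mu k * measure lborel (sector i \<sigma> (2 * R k) (4 * R k))) * ?I"
          by (rule mult_nonneg_nonneg[OF divide_nonneg_nonneg I0]) (simp_all add: less_imp_le[OF mu0[of k]])
      qed (use pos in simp)
      also have "D k powr p * 2 ^ DIM('a) * (8 ^ DIM('a) * R k powr N) / (R k powr N * R k powr N) * ?I
          = ((8 * N) powr p * 16 ^ DIM('a) * Cp) * (R k powr (p * (- B)) * \<beta> k powr p)"
      proof -
        have "D k powr p * 2 ^ DIM('a) * (8 ^ DIM('a) * R k powr N) / (R k powr N * R k powr N) * ?I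
          = ((8 * N) powr p * (2 ^ DIM('a) * 8 ^ DIM('a)) * Cp) * ((R k powr p / R k powr N * R k powr (- b)) * \<beta> k powr p)"
          using N R0[of k] by (simp add: D_def powr_mult)
        also have "(2::real) ^ DIM('a) * 8 ^ DIM('a) = 16 ^ DIM('a)" by (simp flip: power_mult_distrib)
        also have "R k powr p / R k powr N * R k powr (- b) = R k powr (p * (- B))"
        proof -
          have "p * (- B) = p - N + - b" using pos by (simp add: B_def)
          then show ?thesis by (simp only: powr_diff powr_add)
        qed
        finally show ?thesis .
      qed
      also have "(((8 * N) powr p * 16 ^ DIM('a) * Cp) * (R k powr (p * (- B)) * \<beta> k powr p)) powr (1 / p) = K2 * (R k powr (- B) * \<beta> k)"
        using pos \<beta>(1)[of k] by (simp add: K2_def powr_mult powr_powr)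
      also have "\<dots> \<le> C * (R k powr (- B) * \<beta> k)" using C(3) \<beta>(1)[of k] by (intro mult_right_mono) auto
      finally show ?thesis by (simp add: abs_minus_commute mult.assoc flip: Rp)
    qed
    have m3: "2 powr (of_int k * A) * m k \<le> C * \<alpha> k" for k
    proof -
      have "2 powr (of_int k * A) * m k \<le> 2 powr (of_int k * A) * X k" using meanX[of k] by (intro mult_left_mono) auto
      also have "\<dots> = K0 * (R k powr A * R k powr (- A)) * \<alpha> k" by (simp add: X_def Rp)
      also have "R k powr A * R k powr (- A) = 1" using R0[of k] by (simp flip: powr_add)
      also have "K0 * 1 * \<alpha> k \<le> C * \<alpha> k" using C(2) \<alpha>(1)[of k] by (simp add: mult_right_mono)
      finally show ?thesis .
    qed
    have \<gamma>0: "0 \<le> \<gamma> k" for k by (simp add: \<gamma>_def)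
    have "dyadic_ok p q A B G G' \<theta> C \<alpha> \<beta> \<beta> m \<gamma>"
      unfolding dyadic_ok_def dyadic_data_def
      by (intro conjI allI impI) (rule \<alpha>(1) \<beta>(1) less_imp_le[OF \<beta>(1)] m0 \<gamma>0 \<alpha>(2)[rule_format] \<beta>(2)[rule_format] m2 m3 \<gamma>1 \<gamma>4 | assumption)+
    then show "\<exists>\<alpha> \<beta> m \<gamma>. dyadic_ok p q A B G G' \<theta> C \<alpha> \<beta> \<beta> m \<gamma> \<and>
      (\<forall>k. (\<integral>\<^sup>+x\<in>sector i \<sigma> (2 powr of_int k) (2 * 2 powr of_int k). ennreal (norm x powr c * \<bar>u x\<bar> powr r) \<partial>lborel)
         = ennreal (\<gamma> k powr r))"
      using \<gamma>r unfolding Q_def R_def by blast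
  qed
qed

section \<open>The embedding\<close>

text \<open>Each direction and sign contributes at most \<open>S\<close> over any finite range of
  scales. The covering is exhausted by such ranges, and monotone convergence removes the
  restriction.\<close>

lemma borel_weak_grad_bound:
  fixes a b c p q r \<theta> s :: real
  defines "N \<equiv> real DIM('a::euclidean_space)"
  defines "A \<equiv> (a + N) / q" and "B \<equiv> (b - p + N) / p" and "G \<equiv> (c + N) / r"
  defines "G' \<equiv> (1 - \<theta>) * A + \<theta> * B"
  assumes p: "1 \<le> p" and pr: "p < r" and rq: "r \<le> q" and \<theta>: "0 \<le> \<theta>" "\<theta> \<le> 1"
    and s: "p \<le> s" "1 / p - 1 / s \<le> 1 / N" "(1 - \<theta>) / q + \<theta> / s \<le> 1 / r"
    and r\<theta>: "1 / r \<le> (1 - \<theta>) / q + \<theta> / p"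
    and cases: "(G < A \<and> B < G \<and> (0 < G \<or> A \<le> 0) \<and> G' \<le> G) \<or> (G = B \<and> G' = B \<and> A \<le> 0 \<and> B < 0)
      \<or> (A < G \<and> G < B \<and> (G < 0 \<or> 0 \<le> A) \<and> G \<le> G') \<or> (G = B \<and> G' = B \<and> 0 \<le> A \<and> 0 < B)"
  shows "\<exists>C\<ge>0. \<forall>(u::'a \<Rightarrow> real) g. borel_weak_grad u g \<longrightarrow>
    (\<integral>\<^sup>+x. ennreal (norm x powr a * \<bar>u x\<bar> powr q) \<partial>lborel) \<le> 1 \<longrightarrow>
    (\<integral>\<^sup>+x. ennreal (norm x powr b * norm (g x) powr p) \<partial>lborel) \<le> 1 \<longrightarrow>
    (\<integral>\<^sup>+x. ennreal (norm x powr c * \<bar>u x\<bar> powr r) \<partial>lborel) \<le> ennreal C"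
proof -
  from sector_dyadic_ok[where 'a='a, OF p pr rq \<theta> s(1) s(2)[unfolded N_def] s(3), of a b c]
  obtain C where C: "0 \<le> C" and ok: "\<And>(u::'a \<Rightarrow> real) g i \<sigma>. borel_weak_grad u g \<Longrightarrow> i \<in> Basis \<Longrightarrow>
    (\<integral>\<^sup>+x. ennreal (norm x powr a * \<bar>u x\<bar> powr q) \<partial>lborel) \<le> 1 \<Longrightarrow>
    (\<integral>\<^sup>+x. ennreal (norm x powr b * norm (g x) powr p) \<partial>lborel) \<le> 1 \<Longrightarrow>
    (\<exists>\<alpha> \<beta> m \<gamma>. dyadic_ok p q A B G G' \<theta> C \<alpha> \<beta> \<beta> m \<gamma> \<and>
      (\<forall>k. (\<integral>\<^sup>+x\<in>sector i \<sigma> (2 powr of_int k) (2 * 2 powr of_int k). ennreal (norm x powr c * \<bar>u x\<bar> powr r) \<partial>lborel)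
         = ennreal (\<gamma> k powr r)))"
    unfolding G'_def A_def B_def G_def N_def by blast
  from dyadic_sum[OF p pr rq \<theta> r\<theta> C cases] obtain S where
    S: "\<forall>\<alpha> \<beta> m \<gamma>. dyadic_ok p q A B G G' \<theta> C \<alpha> \<beta> \<beta> m \<gamma> \<longrightarrow> (\<forall>F. finite F \<longrightarrow> (\<Sum>k\<in>F. \<gamma> k powr r) \<le> S)" by (rule exE)
  show ?thesis
  \<comment> \<open>There are \<open>2 * N\<close> families of boxes, one for each basis vector and
    sign.\<close>
  proof (intro exI[of _ "2 * N * max S 0"] conjI allI impI)
    show "0 \<le> 2 * N * max S 0" by (simp add: N_def)
    fix u :: "'a \<Rightarrow> real" and g
    assume ug: "borel_weak_grad u g" and ua: "(\<integral>\<^sup>+x. ennreal (norm x powr a * \<bar>u x\<bar> powr q) \<partial>lborel) \<le> 1"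
      and gb: "(\<integral>\<^sup>+x. ennreal (norm x powr b * norm (g x) powr p) \<partial>lborel) \<le> 1"
    have [measurable]: "u \<in> borel_measurable borel" using ug by (simp add: borel_weak_grad_def)
    define f where "f x = ennreal (norm x powr c * \<bar>u x\<bar> powr r)" for x
    have [measurable]: "f \<in> borel_measurable borel" unfolding f_def by measurable
    define Q where "Q i \<sigma> k = sector i \<sigma> (2 powr of_int k) (2 * 2 powr of_int k)" for i :: 'a and \<sigma> and k :: int
    have [measurable]: "Q i \<sigma> k \<in> sets borel" for i \<sigma> k by (simp add: Q_def)
    have part: "(\<Sum>k\<in>F. \<integral>\<^sup>+x\<in>Q i \<sigma> k. f x \<partial>lborel) \<le> ennreal (max S 0)" if i: "i \<in> Basis" and F: "finite F" for i \<sigma> F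
    proof -
      from ok[OF ug i ua gb, of \<sigma>] obtain \<alpha> \<beta> m \<gamma> where
        1: "dyadic_ok p q A B G G' \<theta> C \<alpha> \<beta> \<beta> m \<gamma>" and
        2: "\<And>k. (\<integral>\<^sup>+x\<in>Q i \<sigma> k. f x \<partial>lborel) = ennreal (\<gamma> k powr r)"
        unfolding Q_def f_def by blast
      have "(\<Sum>k\<in>F. \<gamma> k powr r) \<le> S" using S[rule_format, OF 1 F] .
      then have "ennreal (\<Sum>k\<in>F. \<gamma> k powr r) \<le> ennreal (max S 0)" by (intro ennreal_leI) auto
      then show ?thesis unfolding 2 by (simp add: sum_ennreal)
    qed
    define E where "E n = (\<Union>i\<in>Basis. \<Union>\<sigma>. \<Union>k\<in>{- int n..int n}. Q i \<sigma> k)" for n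
    have [measurable]: "E n \<in> sets borel" for n
      unfolding E_def by (intro sets.finite_UN) (auto simp: Q_def)
    have En: "(\<integral>\<^sup>+x\<in>E n. f x \<partial>lborel) \<le> ennreal (2 * N * max S 0)" for n
    proof -
      let ?F = "{- int n..int n}"
      have "(\<integral>\<^sup>+x\<in>E n. f x \<partial>lborel) \<le> (\<integral>\<^sup>+x. (\<Sum>i\<in>Basis. \<Sum>\<sigma>\<in>UNIV. \<Sum>k\<in>?F. f x * indicator (Q i \<sigma> k) x) \<partial>lborel)"
      proof (rule nn_integral_mono)
        fix x :: 'a
        show "f x * indicator (E n) x \<le> (\<Sum>i\<in>Basis. \<Sum>\<sigma>\<in>UNIV. \<Sum>k\<in>?F. f x * indicator (Q i \<sigma> k) x)"
        proof (cases "x \<in> E n")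
          case True
          then obtain i \<sigma> k where ik: "i \<in> Basis" "k \<in> ?F" "x \<in> Q i \<sigma> k" unfolding E_def by blast
          have "f x * indicator (E n) x = f x * indicator (Q i \<sigma> k) x" using True ik by simp
          also have "\<dots> \<le> (\<Sum>k\<in>?F. f x * indicator (Q i \<sigma> k) x)" using ik by (intro member_le_sum) auto
          also have "\<dots> \<le> (\<Sum>\<sigma>\<in>UNIV. \<Sum>k\<in>?F. f x * indicator (Q i \<sigma> k) x)"
            by (rule member_le_sum[of \<sigma> UNIV "\<lambda>\<sigma>. \<Sum>k\<in>?F. f x * indicator (Q i \<sigma> k) x"]) auto
          also have "\<dots> \<le> (\<Sum>i\<in>Basis. \<Sum>\<sigma>\<in>UNIV. \<Sum>k\<in>?F. f x * indicator (Q i \<sigma> k) x)"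
            using ik by (intro member_le_sum[of i Basis "\<lambda>i. \<Sum>\<sigma>\<in>UNIV. \<Sum>k\<in>?F. f x * indicator (Q i \<sigma> k) x"]) auto
          finally show ?thesis .
        qed simp
      qed
      also have "\<dots> = (\<Sum>i\<in>Basis. \<Sum>\<sigma>\<in>UNIV. \<Sum>k\<in>?F. \<integral>\<^sup>+x\<in>Q i \<sigma> k. f x \<partial>lborel)"
        by (intro trans[OF nn_integral_sum] sum.cong refl) measurable
      also have "\<dots> \<le> (\<Sum>i\<in>(Basis::'a set). \<Sum>\<sigma>\<in>(UNIV::bool set). ennreal (max S 0))"
        by (intro sum_mono part) auto
      also have "\<dots> = ennreal (2 * N * max S 0)"
        by (simp add: N_def ennreal_mult ennreal_of_nat_eq_real_of_nat mult_ac)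
      finally show ?thesis .
    qed
    have inc: "incseq (\<lambda>n x. f x * indicator (E n) x)"
    proof (intro incseq_SucI le_funI)
      fix n and x :: 'a
      have "E n \<subseteq> E (Suc n)" unfolding E_def by (intro UN_mono subset_refl) auto
      then show "f x * indicator (E n) x \<le> f x * indicator (E (Suc n)) x" by (auto simp: indicator_def)
    qed
    have "(\<integral>\<^sup>+x. f x \<partial>lborel) \<le> (\<integral>\<^sup>+x. (SUP n. f x * indicator (E n) x) \<partial>lborel)"
    proof (rule nn_integral_mono)
      fix x :: 'a
      show "f x \<le> (SUP n. f x * indicator (E n) x)"
      \<comment> \<open>The boxes miss only the origin, where the integrand vanishes for every
        \<open>c\<close> because \<open>0 powr c = 0\<close>.\<close>
      proof (cases "x = 0")
        case False
        then obtain i \<sigma> k where ik: "i \<in> Basis" "x \<in> Q i \<sigma> k" using sector_cover[of x] unfolding Q_def by blast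
        have "k \<in> {- int (nat \<bar>k\<bar>)..int (nat \<bar>k\<bar>)}" by auto
        then have "x \<in> E (nat \<bar>k\<bar>)" unfolding E_def using ik by blast
        then have "f x = f x * indicator (E (nat \<bar>k\<bar>)) x" by simp
        also have "\<dots> \<le> (SUP n. f x * indicator (E n) x)" by (rule SUP_upper) simp
        finally show ?thesis .
      qed (simp add: f_def)
    qed
    also have "\<dots> = (SUP n. \<integral>\<^sup>+x\<in>E n. f x \<partial>lborel)"
      by (rule nn_integral_monotone_convergence_SUP[OF inc]) measurable
    also have "\<dots> \<le> ennreal (2 * N * max S 0)" by (rule SUP_least) (rule En)
    finally show "(\<integral>\<^sup>+x. ennreal (norm x powr c * \<bar>u x\<bar> powr r) \<partial>lborel) \<le> ennreal (2 * N * max S 0)"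
      unfolding f_def .
  qed
qed

section \<open>Homogeneity and the return to Lebesgue measurable functions\<close>

lemma borel_weak_grad_scale:
  assumes "borel_weak_grad u g"
  shows "borel_weak_grad (\<lambda>x. t * u x) (\<lambda>x. t *\<^sub>R g x)"
proof -
  have u: "u \<in> borel_measurable borel" and g: "g \<in> borel_measurable borel"
    and int: "\<And>K. compact K \<Longrightarrow> 0 \<notin> K \<Longrightarrow> set_integrable lborel K u \<and> set_integrable lborel K g"
    and W: "\<And>\<phi> i. test_fun \<phi> \<Longrightarrow> i \<in> Basis \<Longrightarrow>
      (\<integral>x. u x * frechet_derivative \<phi> (at x) i \<partial>lborel) = - (\<integral>x. (g x \<bullet> i) * \<phi> x \<partial>lborel)"
    using assms unfolding borel_weak_grad_def by blast+
  show ?thesis unfolding borel_weak_grad_def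
  proof (intro conjI allI impI ballI)
    show "(\<lambda>x. t * u x) \<in> borel_measurable borel" "(\<lambda>x. t *\<^sub>R g x) \<in> borel_measurable borel"
      using u g by measurable
    fix K :: "'a set" assume K: "compact K \<and> 0 \<notin> K"
    show "set_integrable lborel K (\<lambda>x. t * u x)" "set_integrable lborel K (\<lambda>x. t *\<^sub>R g x)"
      using int[of K] K by (auto intro: set_integrable_mult_right set_integrable_scaleR_right)
  next
    fix \<phi> :: "'a \<Rightarrow> real" and i :: 'a assume "test_fun \<phi>" "i \<in> Basis"
    from W[OF this] show "(\<integral>x. t * u x * frechet_derivative \<phi> (at x) i \<partial>lborel) = - (\<integral>x. (t *\<^sub>R g x \<bullet> i) * \<phi> x \<partial>lborel)"
      by (simp add: mult.assoc)
  qed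
qed

lemma wint_borel:
  fixes f f' :: "'a::euclidean_space \<Rightarrow> 'b::euclidean_space"
  assumes "f' \<in> borel_measurable borel" "AE x in lborel. f x = f' x"
  shows "wint d s f = (\<integral>\<^sup>+x. ennreal (norm x powr d * norm (f' x) powr s) \<partial>lborel)"
proof -
  have [measurable]: "f' \<in> borel_measurable borel" by fact
  have "AE x in lebesgue. f x = f' x" using assms(2) by (rule AE_completion)
  then have "wint d s f = (\<integral>\<^sup>+x. ennreal (norm x powr d * norm (f' x) powr s) \<partial>lebesgue)"
    unfolding wint_def by (intro nn_integral_cong_AE) (auto elim: eventually_mono)
  also have "\<dots> = (\<integral>\<^sup>+x. ennreal (norm x powr d * norm (f' x) powr s) \<partial>lborel)"
    by (intro nn_integral_completion) measurable
  finally show ?thesis .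
qed

lemma wint_eq_wnorm: "wint d s f < \<infinity> \<Longrightarrow> 0 < s \<Longrightarrow> wint d s f = ennreal (wnorm d s f powr s)"
  by (simp add: wnorm_def powr_powr)

lemma nn_integral_scaled:
  fixes f :: "'a::euclidean_space \<Rightarrow> 'b::euclidean_space"
  assumes [measurable]: "f \<in> borel_measurable borel" and "0 < t" "0 < s"
  shows "(\<integral>\<^sup>+x. ennreal (norm x powr d * norm (t *\<^sub>R f x) powr s) \<partial>lborel) = ennreal (t powr s) * (\<integral>\<^sup>+x. ennreal (norm x powr d * norm (f x) powr s) \<partial>lborel)"
proof -
  have "ennreal (norm x powr d * norm (t *\<^sub>R f x) powr s) = ennreal (t powr s) * ennreal (norm x powr d * norm (f x) powr s)" for x
    using assms(2) by (subst ennreal_mult[symmetric]) (auto simp: powr_mult mult_ac)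
  then show ?thesis by (simp add: nn_integral_cmult)
qed

text \<open>The pair is divided by the sum of its norms plus \<open>\<delta>\<close>; the positive
  \<open>\<delta>\<close> covers the case of vanishing norms and is sent to 0 at the end.\<close>

lemma embedding_of_normalized:
  assumes q: "0 < q" and p: "0 < p" and r: "0 < r"
    and C: "0 \<le> C" "\<forall>(u::'a::euclidean_space \<Rightarrow> real) g. borel_weak_grad u g \<longrightarrow>
    (\<integral>\<^sup>+x. ennreal (norm x powr a * \<bar>u x\<bar> powr q) \<partial>lborel) \<le> 1 \<longrightarrow>
    (\<integral>\<^sup>+x. ennreal (norm x powr b * norm (g x) powr p) \<partial>lborel) \<le> 1 \<longrightarrow>
    (\<integral>\<^sup>+x. ennreal (norm x powr c * \<bar>u x\<bar> powr r) \<partial>lborel) \<le> ennreal C"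
    and W: "in_W a b q p (u::'a \<Rightarrow> real) g"
  shows "wint c r u < \<infinity> \<and> wnorm c r u \<le> C powr (1 / r) * (wnorm a q u + wnorm b p g)"
proof -
  have wg: "weak_grad u g" and ua: "wint a q u < \<infinity>" and gb: "wint b p g < \<infinity>"
    using W by (auto simp: in_W_def)
  obtain u' g' where ug: "borel_weak_grad u' g'" and ae: "AE x in lborel. u x = u' x" "AE x in lborel. g x = g' x"
    using weak_grad_borel[OF wg] by blast
  have um: "u' \<in> borel_measurable borel" and gm: "g' \<in> borel_measurable borel" using ug by (auto simp: borel_weak_grad_def)
  note wu = wint_borel[OF um ae(1)] and wg' = wint_borel[OF gm ae(2)]
  have nn: "0 \<le> wnorm a q u" "0 \<le> wnorm b p g" "0 \<le> wnorm c r u" by (simp_all add: wnorm_def)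
  have key: "wint c r u \<le> ennreal (C * (wnorm a q u + wnorm b p g + \<delta>) powr r)" if \<delta>: "0 < \<delta>" for \<delta>
  proof -
    define t where "t = wnorm a q u + wnorm b p g + \<delta>"
    have t: "0 < t" "wnorm a q u \<le> t" "wnorm b p g \<le> t" using nn \<delta> by (auto simp: t_def)
    have le1: "ennreal ((1 / t) powr s) * ennreal (x powr s) \<le> 1" if "0 \<le> x" "x \<le> t" "0 < s" for x s
    proof -
      have "(1 / t) powr s * x powr s = (x / t) powr s" by (simp flip: powr_mult)
      also have "\<dots> \<le> 1" using that t by (intro powr_le1) auto
      finally show ?thesis by (simp flip: ennreal_mult' add: ennreal_le_1)
    qed
    have "(\<integral>\<^sup>+x. ennreal (norm x powr c * \<bar>(1 / t) * u' x\<bar> powr r) \<partial>lborel) \<le> ennreal C"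
    proof (rule C(2)[rule_format, OF borel_weak_grad_scale[OF ug, of "1 / t"]])
      have "(\<integral>\<^sup>+x. ennreal (norm x powr a * \<bar>1 / t * u' x\<bar> powr q) \<partial>lborel) = ennreal ((1 / t) powr q) * wint a q u"
        using nn_integral_scaled[OF um, of "1 / t" q a] t q unfolding wu by simp
      also have "\<dots> \<le> 1" unfolding wint_eq_wnorm[OF ua q] by (rule le1[OF nn(1) t(2) q])
      finally show "(\<integral>\<^sup>+x. ennreal (norm x powr a * \<bar>1 / t * u' x\<bar> powr q) \<partial>lborel) \<le> 1" .
      have "(\<integral>\<^sup>+x. ennreal (norm x powr b * norm ((1 / t) *\<^sub>R g' x) powr p) \<partial>lborel) = ennreal ((1 / t) powr p) * wint b p g"
        using nn_integral_scaled[OF gm, of "1 / t" p b] t p unfolding wg' by simp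
      also have "\<dots> \<le> 1" unfolding wint_eq_wnorm[OF gb p] by (rule le1[OF nn(2) t(3) p])
      finally show "(\<integral>\<^sup>+x. ennreal (norm x powr b * norm ((1 / t) *\<^sub>R g' x) powr p) \<partial>lborel) \<le> 1" .
    qed
    then have "ennreal ((1 / t) powr r) * wint c r u \<le> ennreal C"
      using nn_integral_scaled[OF um, of "1 / t" r c] t r unfolding wu by simp
    then have "ennreal (t powr r) * (ennreal ((1 / t) powr r) * wint c r u) \<le> ennreal (t powr r) * ennreal C"
      by (rule mult_left_mono) simp
    moreover have "ennreal (t powr r) * ennreal ((1 / t) powr r) = 1"
      using t by (simp flip: ennreal_mult powr_mult)
    ultimately have "wint c r u \<le> ennreal (t powr r) * ennreal C" by (simp only: mult.assoc[symmetric] mult_1_left)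
    also have "\<dots> = ennreal (C * t powr r)" using C(1) by (subst mult.commute) (simp add: ennreal_mult)
    finally show ?thesis unfolding t_def .
  qed
  have fin: "wint c r u < \<infinity>" by (rule le_less_trans[OF key[of 1]]) auto
  let ?P = "wnorm a q u + wnorm b p g"
  let ?D = "C powr (1 / r)"
  have bd: "wnorm c r u \<le> ?D * (?P + \<delta>)" if \<delta>: "0 < \<delta>" for \<delta>
  proof -
    have "enn2real (wint c r u) \<le> C * (?P + \<delta>) powr r"
      using key[OF \<delta>] C(1) by (intro enn2real_leI) auto
    then have "wnorm c r u \<le> (C * (?P + \<delta>) powr r) powr (1 / r)"
      unfolding wnorm_def using r by (intro powr_mono2) auto
    also have "\<dots> = ?D * (?P + \<delta>)" using C(1) nn \<delta> r by (simp add: powr_mult powr_powr)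
    finally show ?thesis .
  qed
  have "wnorm c r u \<le> ?D * ?P"
  proof (rule field_le_epsilon)
    fix e :: real assume e: "0 < e"
    have D0: "0 \<le> ?D" by simp
    \<comment> \<open>Dividing by \<open>?D + 1\<close> instead of \<open>?D\<close> allows
      \<open>?D = 0\<close>.\<close>
    have "wnorm c r u \<le> ?D * (?P + e / (?D + 1))" using e D0 by (intro bd divide_pos_pos) linarith+
    also have "\<dots> = ?D * ?P + ?D / (?D + 1) * e" by (simp add: distrib_left)
    also have "?D / (?D + 1) * e \<le> 1 * e" using D0 e by (intro mult_right_mono) (auto simp: divide_le_eq_1_pos add_nonneg_pos)
    finally show "wnorm c r u \<le> ?D * ?P + e" by simp
  qed
  then show ?thesis using fin by simp
qed

text \<open>In terms of \<open>\<sigma> = 1 / s\<close> the task is to find a positive number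
  between \<open>1 / p - 1 / N\<close> and \<open>1 / p\<close> with
  \<open>\<theta> * \<sigma> <= t\<close>, where \<open>t = 1 / r - (1 - \<theta>) / q\<close>. For
  \<open>\<theta> > 0\<close> the hypothesis says that \<open>1 / p - 1 / N <= t / \<theta>\<close>,
  and \<open>t > 0\<close>; the maximum and minimum select such a value even if
  \<open>1 / p - 1 / N\<close> is negative. For \<open>\<theta> = 0\<close> the choice
  \<open>s = p\<close> works.\<close>

lemma sobolev_exponent_exists:
  fixes p q r \<theta> N :: real
  assumes p: "1 \<le> p" and q: "0 < q" and N: "0 < N" and rq: "0 < r" "r \<le> q" and \<theta>: "0 \<le> \<theta>" "\<theta> \<le> 1"
    and le: "\<theta> * (1 / p - 1 / N - 1 / q) \<le> 1 / r - 1 / q"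
  shows "\<exists>s. p \<le> s \<and> 1 / p - 1 / s \<le> 1 / N \<and> (1 - \<theta>) / q + \<theta> / s \<le> 1 / r"
proof (cases "\<theta> = 0")
  case True
  have "1 / q \<le> 1 / r" using rq by (simp add: frac_le)
  then show ?thesis using True N p by (intro exI[of _ p]) auto
next
  case False
  then have \<theta>0: "0 < \<theta>" using \<theta> by simp
  define t where "t = 1 / r - (1 - \<theta>) / q"
  have qr: "1 / q \<le> 1 / r" using rq by (simp add: frac_le)
  have t_eq: "t = 1 / r - 1 / q + \<theta> / q" by (simp add: t_def diff_divide_distrib)
  have t0: "0 < t" unfolding t_eq using qr \<theta>0 q by (intro add_nonneg_pos) auto
  define \<sigma> where "\<sigma> = max (1 / p - 1 / N) (min (1 / p) (t / \<theta>))"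
  have \<sigma>0: "0 < \<sigma>" unfolding \<sigma>_def using t0 \<theta>0 p by (simp add: less_max_iff_disj)
  have \<sigma>p: "\<sigma> \<le> 1 / p" unfolding \<sigma>_def using N by simp
  have \<sigma>N: "1 / p - \<sigma> \<le> 1 / N" unfolding \<sigma>_def by linarith
  have "\<theta> * (1 / p - 1 / N) \<le> t" using le unfolding t_eq by (simp add: right_diff_distrib)
  then have "1 / p - 1 / N \<le> t / \<theta>" using \<theta>0 by (simp add: field_simps)
  then have "\<sigma> \<le> t / \<theta>" unfolding \<sigma>_def by simp
  then have "\<theta> * \<sigma> \<le> t" using \<theta>0 by (simp add: field_simps)
  moreover have "p \<le> 1 / \<sigma>" using \<sigma>p \<sigma>0 p by (simp add: field_simps)
  ultimately show ?thesis using \<sigma>N \<sigma>0 unfolding t_def by (intro exI[of _ "1 / \<sigma>"]) simp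
qed

text \<open>Finiteness of \<open>wint\<close> is asserted separately because \<open>wnorm\<close>
  assigns 0 to an infinite integral. The gradient part of the norm of the smaller target space
  already occurs in the source norm, so the estimate of \<open>u\<close> contains both embeddings.
  In terms of \<open>A\<close>, \<open>B\<close>, \<open>G\<close> the endpoints \<open>c0\<close>,
  \<open>c1\<close> and \<open>-N\<close> become \<open>A\<close>, \<open>B\<close> and 0, so the
  conditions on the weights turn into orderings of four numbers.\<close>

theorem theorem7p1:
  fixes a b c p q r :: real
  defines "N \<equiv> real DIM('a::euclidean_space)"
  defines "c0 \<equiv> r * (a + N) / q - N"
  defines "c1 \<equiv> r * (b - p + N) / p - N"
  defines "\<theta> \<equiv> (c - c0) / (c1 - c0)"
  assumes hp: "1 \<le> p" and hpr: "p < r" and hrq: "r \<le> q"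
  assumes cases:
    "((((a \<le> -N \<and> b - p \<le> -N) \<or> (a \<ge> -N \<and> b - p \<ge> -N))
        \<and> (a + N) / q \<noteq> (b - p + N) / p
        \<and> min c0 c1 < c \<and> c < max c0 c1
        \<and> \<theta> * (1/p - 1/N - 1/q) \<le> 1/r - 1/q)
     \<or> (((a < -N \<and> b - p > -N) \<or> (a > -N \<and> b - p < -N))
        \<and> min c0 (-N) < c \<and> c < max c0 (-N)
        \<and> \<theta> * (1/p - 1/N - 1/q) \<le> 1/r - 1/q)
     \<or> (r = q \<and> c = a)
     \<or> ((p \<ge> N \<or> r \<le> N * p / (N - p))
        \<and> ((a \<le> -N \<and> b - p < -N) \<or> (a \<ge> -N \<and> b - p > -N))
        \<and> c = c1)
     \<or> ((a + N) / q = (b - p + N) / p \<and> (b - p + N) / p \<noteq> 0 \<and> c = c1))"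
  shows "\<exists>C. \<forall>(u::'a \<Rightarrow> real) g. in_W a b q p u g \<longrightarrow>
            wint c r u < \<infinity> \<and> wnorm c r u \<le> C * (wnorm a q u + wnorm b p g)"
proof (cases "r = q \<and> c = a")
  case True
  then show ?thesis by (intro exI[of _ 1]) (auto simp: in_W_def wnorm_def)
next
  case False
  have pos: "0 < p" "0 < q" "0 < r" using hp hpr hrq by linarith+
  have N: "0 < N" by (simp add: N_def)
  define A B G where "A = (a + N) / q" and "B = (b - p + N) / p" and "G = (c + N) / r"
  have c0: "c0 = r * A - N" and c1: "c1 = r * B - N" and c: "c = r * G - N"
    using pos by (simp_all add: c0_def c1_def A_def B_def G_def)
  have sgnA: "A \<le> 0 \<longleftrightarrow> a \<le> - N" "0 \<le> A \<longleftrightarrow> - N \<le> a" "A < 0 \<longleftrightarrow> a < - N" "0 < A \<longleftrightarrow> - N < a"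
    using pos by (auto simp: A_def divide_le_0_iff zero_le_divide_iff divide_less_0_iff zero_less_divide_iff)
  have sgnB: "B \<le> 0 \<longleftrightarrow> b - p \<le> - N" "0 \<le> B \<longleftrightarrow> - N \<le> b - p" "B < 0 \<longleftrightarrow> b - p < - N" "0 < B \<longleftrightarrow> - N < b - p"
    using pos by (auto simp: B_def divide_le_0_iff zero_le_divide_iff divide_less_0_iff zero_less_divide_iff)
  have cmp: "c0 < c \<longleftrightarrow> A < G" "c < c0 \<longleftrightarrow> G < A" "c1 < c \<longleftrightarrow> B < G" "c < c1 \<longleftrightarrow> G < B" "c < - N \<longleftrightarrow> G < 0" "- N < c \<longleftrightarrow> 0 < G" "c = c1 \<longleftrightarrow> G = B"
    using pos unfolding c0 c1 c by (auto simp: mult_less_0_iff zero_less_mult_iff)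
  have \<theta>_eq: "\<theta> = (G - A) / (B - A)"
    using pos unfolding \<theta>_def c0 c1 c by (simp flip: right_diff_distrib)
  have inv: "1 / q \<le> 1 / r" "1 / r < 1 / p" using pos hpr hrq by (auto simp: frac_le frac_less2)
  \<comment> \<open>The solution of \<open>1 / r = (1 - \<theta>0) / q + \<theta>0 / p\<close>,
    hence the least parameter for which the summability condition on the exponents holds. It always
    satisfies the Sobolev condition, with \<open>\<theta>0 / N\<close> to spare.\<close>
  define \<theta>0 where "\<theta>0 = (1 / r - 1 / q) / (1 / p - 1 / q)"
  have \<theta>0: "0 \<le> \<theta>0" "\<theta>0 \<le> 1" using inv by (auto simp: \<theta>0_def divide_le_eq_1)
  have \<theta>0_eq: "\<theta>0 * (1 / p - 1 / q) = 1 / r - 1 / q"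
    unfolding \<theta>0_def times_divide_eq_left by (rule nonzero_mult_div_cancel_right) (use inv in linarith)
  have \<theta>0_le: "\<theta>0 * (1 / p - 1 / N - 1 / q) \<le> 1 / r - 1 / q"
  proof -
    have "\<theta>0 * (1 / p - 1 / N - 1 / q) = \<theta>0 * (1 / p - 1 / q) - \<theta>0 / N" by (simp add: algebra_simps)
    then show ?thesis using \<theta>0 N unfolding \<theta>0_eq by simp
  qed
  have \<theta>0_ge: "1 / r \<le> (1 - \<theta>') / q + \<theta>' / p" if "\<theta>0 \<le> \<theta>'" for \<theta>'
  proof -
    have "\<theta>0 * (1 / p - 1 / q) \<le> \<theta>' * (1 / p - 1 / q)" using that inv by (intro mult_right_mono) auto
    then show ?thesis unfolding \<theta>0_eq by (simp add: algebra_simps diff_divide_distrib)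
  qed
  have main: ?thesis
    if \<theta>': "0 \<le> \<theta>'" "\<theta>' \<le> 1" "\<theta>' * (1 / p - 1 / N - 1 / q) \<le> 1 / r - 1 / q" "1 / r \<le> (1 - \<theta>') / q + \<theta>' / p"
      and cs: "(G < A \<and> B < G \<and> (0 < G \<or> A \<le> 0) \<and> (1 - \<theta>') * A + \<theta>' * B \<le> G) \<or> (G = B \<and> (1 - \<theta>') * A + \<theta>' * B = B \<and> A \<le> 0 \<and> B < 0)
      \<or> (A < G \<and> G < B \<and> (G < 0 \<or> 0 \<le> A) \<and> G \<le> (1 - \<theta>') * A + \<theta>' * B) \<or> (G = B \<and> (1 - \<theta>') * A + \<theta>' * B = B \<and> 0 \<le> A \<and> 0 < B)"
    for \<theta>'
  proof -
    obtain s where s: "p \<le> s" "1 / p - 1 / s \<le> 1 / N" "(1 - \<theta>') / q + \<theta>' / s \<le> 1 / r"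
      using sobolev_exponent_exists[OF hp pos(2) N pos(3) hrq \<theta>'(1,2,3)] by blast
    from borel_weak_grad_bound[where 'a='a, OF hp hpr hrq \<theta>'(1,2) s[unfolded N_def] \<theta>'(4) cs[unfolded A_def B_def G_def N_def]]
    obtain C where C: "0 \<le> C" "\<forall>(u::'a \<Rightarrow> real) g. borel_weak_grad u g \<longrightarrow>
      (\<integral>\<^sup>+x. ennreal (norm x powr a * \<bar>u x\<bar> powr q) \<partial>lborel) \<le> 1 \<longrightarrow>
      (\<integral>\<^sup>+x. ennreal (norm x powr b * norm (g x) powr p) \<partial>lborel) \<le> 1 \<longrightarrow>
      (\<integral>\<^sup>+x. ennreal (norm x powr c * \<bar>u x\<bar> powr r) \<partial>lborel) \<le> ennreal C" by (elim exE conjE)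
    from embedding_of_normalized[OF pos(2,1,3) C] show ?thesis by (intro exI allI impI)
  qed
  have interp: ?thesis
    if btw: "(G < A \<and> B < G \<and> (0 < G \<or> A \<le> 0)) \<or> (A < G \<and> G < B \<and> (G < 0 \<or> 0 \<le> A))"
      and le: "\<theta> * (1 / p - 1 / N - 1 / q) \<le> 1 / r - 1 / q"
  proof -
    have \<theta>: "0 \<le> \<theta>" "\<theta> \<le> 1" "G = A + \<theta> * (B - A)"
      using btw unfolding \<theta>_eq by (auto simp: divide_le_eq_1 zero_le_divide_iff)
    \<comment> \<open>Both candidates satisfy the Sobolev condition, hence so does the larger.
      Raising \<open>\<theta>\<close> moves \<open>A + \<theta> * (B - A)\<close> from
      \<open>G\<close> towards \<open>B\<close>, the direction in which the sums tolerate
      it.\<close>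
    define \<theta>' where "\<theta>' = max \<theta> \<theta>0"
    have G': "(1 - \<theta>') * A + \<theta>' * B = A + \<theta>' * (B - A)" by (simp add: algebra_simps)
    show ?thesis
    proof (rule main)
      show "0 \<le> \<theta>'" "\<theta>' \<le> 1" using \<theta> \<theta>0 by (auto simp: \<theta>'_def)
      show "\<theta>' * (1 / p - 1 / N - 1 / q) \<le> 1 / r - 1 / q" using le \<theta>0_le by (simp add: \<theta>'_def max_def)
      show "1 / r \<le> (1 - \<theta>') / q + \<theta>' / p" by (rule \<theta>0_ge) (simp add: \<theta>'_def)
      have "\<theta>' * (B - A) \<le> \<theta> * (B - A)" if "B < A" using that by (intro mult_right_mono_neg) (auto simp: \<theta>'_def)
      moreover have "\<theta> * (B - A) \<le> \<theta>' * (B - A)" if "A < B" using that by (intro mult_right_mono) (auto simp: \<theta>'_def)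
      ultimately show "(G < A \<and> B < G \<and> (0 < G \<or> A \<le> 0) \<and> (1 - \<theta>') * A + \<theta>' * B \<le> G) \<or> (G = B \<and> (1 - \<theta>') * A + \<theta>' * B = B \<and> A \<le> 0 \<and> B < 0)
        \<or> (A < G \<and> G < B \<and> (G < 0 \<or> 0 \<le> A) \<and> G \<le> (1 - \<theta>') * A + \<theta>' * B) \<or> (G = B \<and> (1 - \<theta>') * A + \<theta>' * B = B \<and> 0 \<le> A \<and> 0 < B)"
        using btw \<theta>(3) unfolding G' by (metis add_left_mono order.strict_trans)
    qed
  qed
  consider
      (i) "(A \<le> 0 \<and> B \<le> 0) \<or> (0 \<le> A \<and> 0 \<le> B)" "min c0 c1 < c" "c < max c0 c1" "\<theta> * (1/p - 1/N - 1/q) \<le> 1/r - 1/q"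
    | (ii) "(A < 0 \<and> 0 < B) \<or> (0 < A \<and> B < 0)" "min c0 (-N) < c" "c < max c0 (-N)" "\<theta> * (1/p - 1/N - 1/q) \<le> 1/r - 1/q"
    | (iv) "p \<ge> N \<or> r \<le> N * p / (N - p)" "(A \<le> 0 \<and> B < 0) \<or> (0 \<le> A \<and> 0 < B)" "G = B"
    | (v) "A = B" "B \<noteq> 0" "G = B"
    using cases False unfolding sgnA[symmetric] sgnB[symmetric] cmp(7) A_def[symmetric] B_def[symmetric]
    by (elim disjE) blast+
  then show ?thesis
  proof cases
    case i
    \<comment> \<open>The sign condition is then automatic: \<open>B < G\<close> gives
      \<open>0 < G\<close> if \<open>A\<close> and \<open>B\<close> are nonnegative, and
      \<open>G < B\<close> gives \<open>G < 0\<close> if they are nonpositive.\<close>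
    have "(A < G \<and> G < B) \<or> (B < G \<and> G < A)" using i(2,3) cmp by (auto simp: min_def max_def split: if_splits)
    then show ?thesis using i(1,4) by (intro interp) auto
  next
    case ii
    \<comment> \<open>The endpoint \<open>-N\<close> means that \<open>G\<close> keeps the sign of
      \<open>A\<close>; as \<open>B\<close> has the opposite sign, \<open>G\<close> lies between
      \<open>A\<close> and \<open>B\<close>.\<close>
    have "(A < G \<and> G < 0) \<or> (0 < G \<and> G < A)" using ii(2,3) cmp by (auto simp: min_def max_def split: if_splits)
    then show ?thesis using ii(1,4) by (intro interp) auto
  next
    case iv
    \<comment> \<open>This follows from \<open>r <= p^*\<close> and is the Sobolev condition for
      \<open>\<theta>' = 1\<close>, where the \<open>L^q\<close> norm drops out of the
      interpolation.\<close>
    have "1 / p - 1 / N \<le> 1 / r"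
    proof (cases "N \<le> p")
      case True
      then have "1 / p \<le> 1 / N" using N by (simp add: frac_le)
      then show ?thesis using pos(3) by (smt (verit) zero_less_divide_1_iff)
    next
      case False
      then have r: "r \<le> N * p / (N - p)" using iv(1) by simp
      have "1 / (N * p / (N - p)) \<le> 1 / r" using r pos by (intro frac_le) auto
      moreover have "1 / (N * p / (N - p)) = 1 / p - 1 / N" using False N pos by (simp add: field_simps)
      ultimately show ?thesis by simp
    qed
    then show ?thesis using iv(2,3) inv by (intro main[of 1]) auto
  next
    case v
    \<comment> \<open>Here \<open>\<theta>\<close> would be a quotient by 0. Every convex
      combination of \<open>A\<close> and \<open>B\<close> equals \<open>B\<close>, so
      \<open>\<theta>0\<close> can be taken, which meets both conditions on the exponents.\<close>
    then have "(1 - \<theta>0) * A + \<theta>0 * B = B" by (simp add: algebra_simps)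
    then show ?thesis using v \<theta>0 \<theta>0_le \<theta>0_ge by (intro main[of \<theta>0]) auto
  qed
qed

end
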